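(* Let $N\ge 1$, let $\Omega\subset\mathbb{R}^N$ be a bounded domain, and let $1<q<p<\infty$. Let $m,a,f\in L^\gamma(\Omega)$, where $\gamma>N/p$ (for some such $\gamma$) if $N\ge p$ and $\gamma=1$ if $N<p$, with $m_+\not\equiv 0$, $a\not\equiv 0$, $f\not\equiv 0$. Assume that $a,f\ge 0$ a.e. in $\Omega$. Then for any $\lambda\ge\lambda_1(m)$ there exists $\hat\eta_\lambda\le 0$ such that the problem $$-\Delta_p u=\lambda\,m(x)|u|^{p-2}u+\eta\,a(x)|u|^{q-2}u+f(x)\ \text{ in }\Omega,\qquad u=0\ \text{ on }\partial\Omega,$$ has no nonnegative solutions provided $\eta\ge\hat\eta_\lambda$. Moreover, if $\lambda>\lambda_1(m)$, then $\hat\eta_\lambda<0$ (i.e., $\hat\eta_\lambda$ can be chosen negative).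
   Context: Notation: $w_\pm=\max\{\pm w,0\}$; $\Delta_p u=\mathrm{div}(|\nabla u|^{p-2}\nabla u)$. A solution is a function $u\in W_0^{1,p}(\Omega)$ with $\int_\Omega|\nabla u|^{p-2}\nabla u\cdot\nabla\xi\,dx=\lambda\int_\Omega m|u|^{p-2}u\xi\,dx+\eta\int_\Omega a|u|^{q-2}u\xi\,dx+\int_\Omega f\xi\,dx$ for all $\xi\in W_0^{1,p}(\Omega)$. The first positive eigenvalue is $$\lambda_1(m)=\inf\left\{\frac{\int_\Omega|\nabla u|^p\,dx}{\int_\Omega m|u|^p\,dx}:\ u\in W_0^{1,p}(\Omega),\ \int_\Omega m|u|^p\,dx>0\right\}.$$ *)

theory Defs
  imports "HOL-Analysis.Analysis"
begin

text \<open>Functions on \<open>\<Omega>\<close> are represented by total functions; only their values on \<open>\<Omega>\<close> matter, and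
  functions equal almost everywhere on \<open>\<Omega>\<close> are not identified.  All Lebesgue integrals over
  \<open>\<Omega>\<close> are Bochner integrals with respect to \<open>lebesgue_on \<Omega>\<close>.\<close>

definition Lp :: "'a::euclidean_space set \<Rightarrow> real \<Rightarrow> ('a \<Rightarrow> 'b::euclidean_space) set" where
  "Lp \<Omega> r = {u. u \<in> borel_measurable (lebesgue_on \<Omega>) \<and>
                 integrable (lebesgue_on \<Omega>) (\<lambda>x. norm (u x) powr r)}"

fun continuously_differentiable :: "nat \<Rightarrow> ('a::euclidean_space \<Rightarrow> real) \<Rightarrow> bool" where
  "continuously_differentiable 0 \<phi> \<longleftrightarrow> continuous_on UNIV \<phi>"
| "continuously_differentiable (Suc k) \<phi> \<longleftrightarrow>
     (\<forall>x. \<phi> differentiable (at x)) \<and>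
     (\<forall>i\<in>Basis. continuously_differentiable k (\<lambda>x. frechet_derivative \<phi> (at x) i))"

definition gradient :: "('a::euclidean_space \<Rightarrow> real) \<Rightarrow> 'a \<Rightarrow> 'a" where
  "gradient \<phi> x = (\<Sum>i\<in>Basis. frechet_derivative \<phi> (at x) i *\<^sub>R i)"

text \<open>The space \<open>C\<^sub>c\<^sup>\<infinity>(\<Omega>)\<close>, each element being extended by zero to the whole space.\<close>

definition test_functions :: "'a::euclidean_space set \<Rightarrow> ('a \<Rightarrow> real) set" where
  "test_functions \<Omega> = {\<phi>. (\<forall>k. continuously_differentiable k \<phi>) \<and>
     compact (closure {x. \<phi> x \<noteq> 0}) \<and> closure {x. \<phi> x \<noteq> 0} \<subseteq> \<Omega>}"

definition has_weak_gradient ::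
    "'a::euclidean_space set \<Rightarrow> ('a \<Rightarrow> real) \<Rightarrow> ('a \<Rightarrow> 'a) \<Rightarrow> bool" where
  "has_weak_gradient \<Omega> u g \<longleftrightarrow>
     (\<forall>K. compact K \<and> K \<subseteq> \<Omega> \<longrightarrow> u absolutely_integrable_on K \<and> g absolutely_integrable_on K) \<and>
     (\<forall>\<phi>\<in>test_functions \<Omega>.
        (LINT x|lebesgue_on \<Omega>. u x *\<^sub>R gradient \<phi> x) = - (LINT x|lebesgue_on \<Omega>. \<phi> x *\<^sub>R g x))"

text \<open>For open \<open>\<Omega>\<close> a weak gradient is unique up to a null subset of \<open>\<Omega>\<close>, so the representative
  chosen here does not affect any of the integrals below.\<close>

definition weak_gradient :: "'a::euclidean_space set \<Rightarrow> ('a \<Rightarrow> real) \<Rightarrow> 'a \<Rightarrow> 'a" where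
  "weak_gradient \<Omega> u = (SOME g. has_weak_gradient \<Omega> u g)"

definition W1p :: "'a::euclidean_space set \<Rightarrow> real \<Rightarrow> ('a \<Rightarrow> real) set" where
  "W1p \<Omega> p = {u. u \<in> Lp \<Omega> p \<and> (\<exists>g. has_weak_gradient \<Omega> u g \<and> g \<in> Lp \<Omega> p)}"

text \<open>\<open>W\<^sub>0\<^sup>1\<^sup>,\<^sup>p(\<Omega>)\<close> is the closure of \<open>C\<^sub>c\<^sup>\<infinity>(\<Omega>)\<close> in \<open>W\<^sup>1\<^sup>,\<^sup>p(\<Omega>)\<close>.\<close>

definition W01p :: "'a::euclidean_space set \<Rightarrow> real \<Rightarrow> ('a \<Rightarrow> real) set" where
  "W01p \<Omega> p = {u \<in> W1p \<Omega> p. \<exists>\<phi>. (\<forall>n. \<phi> n \<in> test_functions \<Omega>) \<and>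
     (\<lambda>n::nat. LINT x|lebesgue_on \<Omega>. \<bar>\<phi> n x - u x\<bar> powr p) \<longlonglongrightarrow> 0 \<and>
     (\<lambda>n. LINT x|lebesgue_on \<Omega>. norm (gradient (\<phi> n) x - weak_gradient \<Omega> u x) powr p) \<longlonglongrightarrow> 0}"

text \<open>A non-integrable function has integral \<open>0\<close>, so the condition below includes the
  integrability of \<open>m |u|\<^sup>p\<close>.\<close>

definition lambda1 :: "'a::euclidean_space set \<Rightarrow> real \<Rightarrow> ('a \<Rightarrow> real) \<Rightarrow> real" where
  "lambda1 \<Omega> p m =
     Inf {(LINT x|lebesgue_on \<Omega>. norm (weak_gradient \<Omega> u x) powr p) /
          (LINT x|lebesgue_on \<Omega>. m x * \<bar>u x\<bar> powr p) | u.
          u \<in> W01p \<Omega> p \<and> (LINT x|lebesgue_on \<Omega>. m x * \<bar>u x\<bar> powr p) > 0}"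

text \<open>Since \<open>0 powr r = 0\<close> in HOL, \<open>|s|\<^sup>r\<^sup>-\<^sup>2 s\<close> vanishes at \<open>s = 0\<close>, also for \<open>r < 2\<close>.
  If \<open>\<Omega>\<close> is bounded and open, \<open>1 < q < p\<close>, and \<open>m\<close>, \<open>a\<close>, \<open>f\<close> lie in \<open>L\<^sup>\<gamma>(\<Omega>)\<close> with \<open>\<gamma> > N/p\<close> for
  \<open>N \<ge> p\<close> and \<open>\<gamma> = 1\<close> for \<open>N < p\<close>, all integrands are integrable by the Sobolev embedding.\<close>

definition is_solution ::
    "'a::euclidean_space set \<Rightarrow> real \<Rightarrow> real \<Rightarrow> ('a \<Rightarrow> real) \<Rightarrow> ('a \<Rightarrow> real) \<Rightarrow> ('a \<Rightarrow> real)
      \<Rightarrow> real \<Rightarrow> real \<Rightarrow> ('a \<Rightarrow> real) \<Rightarrow> bool" where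
  "is_solution \<Omega> p q m a f lam \<eta> u \<longleftrightarrow> u \<in> W01p \<Omega> p \<and>
     (\<forall>\<xi>\<in>W01p \<Omega> p.
        (LINT x|lebesgue_on \<Omega>. norm (weak_gradient \<Omega> u x) powr (p - 2) *
             (weak_gradient \<Omega> u x \<bullet> weak_gradient \<Omega> \<xi> x)) =
        lam * (LINT x|lebesgue_on \<Omega>. m x * \<bar>u x\<bar> powr (p - 2) * u x * \<xi> x)
        + \<eta> * (LINT x|lebesgue_on \<Omega>. a x * \<bar>u x\<bar> powr (q - 2) * u x * \<xi> x)
        + (LINT x|lebesgue_on \<Omega>. f x * \<xi> x))"

end

theory Submission
  imports Defs
begin

text \<open>
  Let \<open>u \<ge> 0\<close> be a solution and \<open>\<epsilon> > 0\<close>.  Testing the equation with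
  \<open>|\<phi>|\<^sup>p (u + \<epsilon>)\<^sup>1\<^sup>-\<^sup>p\<close> and applying Picone's inequality gives, for every compactly supported
  \<open>C\<^sup>1\<close> function \<open>\<phi>\<close>,

  \<open>\<lambda> \<integral> m (u/(u + \<epsilon>))\<^sup>p\<^sup>-\<^sup>1 |\<phi>|\<^sup>p + \<eta> \<integral> a u\<^sup>q\<^sup>-\<^sup>1 (u + \<epsilon>)\<^sup>1\<^sup>-\<^sup>p |\<phi>|\<^sup>p + \<integral> f (u + \<epsilon>)\<^sup>1\<^sup>-\<^sup>p |\<phi>|\<^sup>p \<le> \<integral> |\<nabla>\<phi>|\<^sup>p\<close>.

  If \<open>\<eta> \<ge> 0\<close> and \<open>u > 0\<close> almost everywhere, then \<open>\<epsilon> \<rightarrow> 0\<close> leaves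
  \<open>\<lambda> \<integral> m |\<phi>|\<^sup>p \<le> \<integral> |\<nabla>\<phi>|\<^sup>p\<close> for all \<open>\<phi>\<close>, which is impossible for \<open>\<lambda> > \<lambda>\<^sub>1(m)\<close>.  Two things
  remain: to do without the strong maximum principle, which may fail for \<open>\<eta> < 0\<close>, and to treat
  \<open>\<lambda> = \<lambda>\<^sub>1(m)\<close>.

  For \<open>\<lambda> > \<lambda>\<^sub>1(m)\<close> suppose that no negative threshold exists.  Then there are nonnegative
  solutions \<open>u\<^sub>n\<close> for parameters \<open>\<eta>\<^sub>n \<ge> - \<epsilon>\<^sub>n\<^sup>p\<^sup>-\<^sup>q\<^sup>+\<^sup>1\<close> with \<open>\<epsilon>\<^sub>n \<rightarrow> 0\<close>.  Since
  \<open>u\<^sup>q\<^sup>-\<^sup>1 (u + \<epsilon>)\<^sup>1\<^sup>-\<^sup>p \<le> \<epsilon>\<^sup>q\<^sup>-\<^sup>p\<close>, the second term above, taken with \<open>\<epsilon> = \<epsilon>\<^sub>n\<close>, is at least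
  \<open>- const \<cdot> \<epsilon>\<^sub>n\<close>.  A version of the inequality with a loss on the right (\<open>log_estimate\<close>) bounds
  \<open>\<nabla> log (u\<^sub>n + \<epsilon>\<^sub>n)\<close> locally in \<open>L\<^sup>p\<close> and also bounds \<open>\<integral> f (u\<^sub>n + \<epsilon>\<^sub>n)\<^sup>1\<^sup>-\<^sup>p |\<phi>|\<^sup>p\<close>.  The second bound keeps
  \<open>u\<^sub>n\<close> away from \<open>0\<close> on a fixed amount of the set where \<open>f\<close> is positive (\<open>log_ratio_start\<close>); by
  the first one and Poincare's inequality on balls, \<open>log (1 + u\<^sub>n/\<epsilon>\<^sub>n)\<close> cannot be huge on one part of
  a ball and moderate on another, and by connectedness it tends to infinity in measure on every
  compact set (\<open>mass_spreads\<close>).  So \<open>u\<^sub>n/(u\<^sub>n + \<epsilon>\<^sub>n) \<rightarrow> 1\<close> in measure, which replaces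
  the strong maximum principle: the limit is again \<open>\<lambda> \<integral> m |\<phi>|\<^sup>p \<le> \<integral> |\<nabla>\<phi>|\<^sup>p\<close>
  (\<open>Picone_limit\<close>).

  For \<open>\<lambda> = \<lambda>\<^sub>1(m)\<close> and \<open>\<eta> \<ge> 0\<close> the same limit, taken along a constant sequence of solutions,
  retains the source: \<open>\<lambda> \<integral> m |\<phi>|\<^sup>p + \<integral> f (u + 1)\<^sup>1\<^sup>-\<^sup>p |\<phi>|\<^sup>p \<le> \<integral> |\<nabla>\<phi>|\<^sup>p\<close>.  Along a minimizing sequence
  \<open>\<phi>\<^sub>k\<close>, normalised by \<open>\<integral> m |\<phi>\<^sub>k|\<^sup>p = 1\<close>, the source term tends to \<open>0\<close>, so \<open>\<phi>\<^sub>k\<close>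
  becomes small on a part of \<open>\<Omega>\<close>.  Near-minimizers also satisfy a logarithmic estimate, because
  comparing \<open>\<phi>\<^sub>k\<close> with \<open>(|\<phi>\<^sub>k|\<^sup>p + \<tau> |\<psi>|\<^sup>p)\<^sup>1\<^sup>/\<^sup>p\<close> would otherwise lower the energy too much
  (\<open>near_minimizer_log_estimate\<close>, by hidden convexity of the energy).  The spreading argument
  then shows \<open>\<phi>\<^sub>k \<rightarrow> 0\<close> in measure, and the inequality
  \<open>\<integral> |m| |\<phi>|\<^sup>p \<le> C \<parallel>m\<parallel>\<^sub>\<gamma> \<integral> |\<nabla>\<phi>|\<^sup>p\<close> (\<open>trace_inequality\<close>) forces \<open>\<integral> m |\<phi>\<^sub>k|\<^sup>p\<close> to become
  small, which contradicts the normalisation.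
\<close>

section \<open>Continuously differentiable functions\<close>

definition C1 :: "('a::euclidean_space \<Rightarrow> real) \<Rightarrow> bool" where
  "C1 \<phi> \<longleftrightarrow> (\<forall>x. \<phi> differentiable (at x)) \<and> continuous_on UNIV (gradient \<phi>)"

text \<open>
  Test functions of class \<open>C\<^sup>1\<close> rather than smooth ones: this class is stable under \<open>\<phi> \<mapsto> |\<phi>|\<^sup>p\<close> and
  under composition with \<open>C\<^sup>1\<close> functions vanishing at \<open>0\<close>.
\<close>

definition C1c :: "'a::euclidean_space set \<Rightarrow> ('a \<Rightarrow> real) set" where
  "C1c \<Omega> = {\<phi>. C1 \<phi> \<and> (\<exists>K. compact K \<and> K \<subseteq> \<Omega> \<and> (\<forall>x. x \<notin> K \<longrightarrow> \<phi> x = 0))}"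

lemma gradient_eqI:
  assumes "(\<phi> has_derivative (\<lambda>h. g \<bullet> h)) (at x)"
  shows "gradient \<phi> x = g"
proof -
  have "frechet_derivative \<phi> (at x) = (\<lambda>h. g \<bullet> h)"
    using frechet_derivative_at[OF assms] by simp
  then show ?thesis
    by (simp add: gradient_def euclidean_representation)
qed

lemma inner_gradient:
  assumes "\<phi> differentiable (at x)"
  shows "gradient \<phi> x \<bullet> h = frechet_derivative \<phi> (at x) h"
proof -
  have lin: "linear (frechet_derivative \<phi> (at x))"
    using assms linear_frechet_derivative by blast
  have "gradient \<phi> x \<bullet> h = (\<Sum>i\<in>Basis. frechet_derivative \<phi> (at x) i * (i \<bullet> h))"
    by (simp add: gradient_def inner_sum_left)
  also have "\<dots> = frechet_derivative \<phi> (at x) (\<Sum>i\<in>Basis. (h \<bullet> i) *\<^sub>R i)"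
    by (simp add: linear_sum[OF lin] linear_scale[OF lin] inner_commute mult.commute)
  finally show ?thesis by (simp add: euclidean_representation)
qed

lemma has_derivative_gradient:
  assumes "\<phi> differentiable (at x)"
  shows "(\<phi> has_derivative (\<lambda>h. gradient \<phi> x \<bullet> h)) (at x)"
  using assms inner_gradient[OF assms]
  by (simp add: frechet_derivative_works)

lemma C1I:
  assumes "\<And>x. (\<phi> has_derivative (\<lambda>h. G x \<bullet> h)) (at x)" "continuous_on UNIV G"
  shows "C1 \<phi>" "gradient \<phi> = G"
proof -
  show "gradient \<phi> = G" using gradient_eqI[OF assms(1)] by auto
  then show "C1 \<phi>" using assms unfolding C1_def differentiable_def by auto
qed

lemma C1_has_derivative: "C1 \<phi> \<Longrightarrow> (\<phi> has_derivative (\<lambda>h. gradient \<phi> x \<bullet> h)) (at x)"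
  by (simp add: C1_def has_derivative_gradient)

lemma C1_continuous_gradient: "C1 \<phi> \<Longrightarrow> continuous_on A (gradient \<phi>)"
  unfolding C1_def using continuous_on_subset by blast

lemma C1_continuous: "C1 \<phi> \<Longrightarrow> continuous_on A \<phi>"
  unfolding C1_def
  by (meson differentiable_imp_continuous_within continuous_at_imp_continuous_on)

lemma C1_mult:
  assumes "C1 \<phi>" "C1 \<psi>"
  shows "C1 (\<lambda>x. \<phi> x * \<psi> x)"
    and "gradient (\<lambda>x. \<phi> x * \<psi> x) = (\<lambda>x. \<phi> x *\<^sub>R gradient \<psi> x + \<psi> x *\<^sub>R gradient \<phi> x)"
proof -
  have 1: "((\<lambda>x. \<phi> x * \<psi> x) has_derivative
      (\<lambda>h. (\<phi> x *\<^sub>R gradient \<psi> x + \<psi> x *\<^sub>R gradient \<phi> x) \<bullet> h)) (at x)" for x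
    by (rule has_derivative_eq_rhs[OF has_derivative_mult[OF C1_has_derivative[OF assms(1)] C1_has_derivative[OF assms(2)]]])
       (auto simp: inner_add_left)
  have 2: "continuous_on UNIV (\<lambda>x. \<phi> x *\<^sub>R gradient \<psi> x + \<psi> x *\<^sub>R gradient \<phi> x)"
    using assms by (intro continuous_intros C1_continuous C1_continuous_gradient)
  show "C1 (\<lambda>x. \<phi> x * \<psi> x)" by (rule C1I(1)[OF 1 2])
  show "gradient (\<lambda>x. \<phi> x * \<psi> x) = (\<lambda>x. \<phi> x *\<^sub>R gradient \<psi> x + \<psi> x *\<^sub>R gradient \<phi> x)"
    by (rule C1I(2)[OF 1 2])
qed

lemma C1_add:
  assumes "C1 \<phi>" "C1 \<psi>"
  shows "C1 (\<lambda>x. \<phi> x + \<psi> x)"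
    and "gradient (\<lambda>x. \<phi> x + \<psi> x) = (\<lambda>x. gradient \<phi> x + gradient \<psi> x)"
proof -
  have 1: "((\<lambda>x. \<phi> x + \<psi> x) has_derivative
      (\<lambda>h. (gradient \<phi> x + gradient \<psi> x) \<bullet> h)) (at x)" for x
    by (rule has_derivative_eq_rhs[OF has_derivative_add[OF C1_has_derivative[OF assms(1)] C1_has_derivative[OF assms(2)]]])
       (auto simp: inner_add_left)
  have 2: "continuous_on UNIV (\<lambda>x. gradient \<phi> x + gradient \<psi> x)"
    using assms by (intro continuous_intros C1_continuous C1_continuous_gradient)
  show "C1 (\<lambda>x. \<phi> x + \<psi> x)" by (rule C1I(1)[OF 1 2])
  show "gradient (\<lambda>x. \<phi> x + \<psi> x) = (\<lambda>x. gradient \<phi> x + gradient \<psi> x)"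
    by (rule C1I(2)[OF 1 2])
qed

lemma C1_compose:
  assumes "C1 \<phi>" and g: "\<And>x. (g has_real_derivative g' (\<phi> x)) (at (\<phi> x))"
    and c: "continuous_on (range \<phi>) g'"
  shows "C1 (\<lambda>x. g (\<phi> x))"
    and "gradient (\<lambda>x. g (\<phi> x)) = (\<lambda>x. g' (\<phi> x) *\<^sub>R gradient \<phi> x)"
proof -
  have 1: "((\<lambda>x. g (\<phi> x)) has_derivative (\<lambda>h. (g' (\<phi> x) *\<^sub>R gradient \<phi> x) \<bullet> h)) (at x)" for x
    by (rule has_derivative_eq_rhs[OF has_derivative_compose[OF C1_has_derivative[OF assms(1)] g[unfolded has_field_derivative_def]]])
       auto
  have 2: "continuous_on UNIV (\<lambda>x. g' (\<phi> x) *\<^sub>R gradient \<phi> x)"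
    using assms by (intro continuous_intros C1_continuous_gradient continuous_on_compose2[OF c] C1_continuous) auto
  show "C1 (\<lambda>x. g (\<phi> x))" by (rule C1I(1)[OF 1 2])
  show "gradient (\<lambda>x. g (\<phi> x)) = (\<lambda>x. g' (\<phi> x) *\<^sub>R gradient \<phi> x)"
    by (rule C1I(2)[OF 1 2])
qed

lemma C1c_imp_C1: "\<phi> \<in> C1c \<Omega> \<Longrightarrow> C1 \<phi>"
  by (simp add: C1c_def)

lemma gradient_zero_off_compact:
  assumes "closed K" "\<And>x. x \<notin> K \<Longrightarrow> \<phi> x = 0" "x \<notin> K"
  shows "gradient \<phi> x = 0"
proof (rule gradient_eqI)
  have "((\<lambda>x. 0) has_derivative (\<lambda>h. 0 \<bullet> h)) (at x)" by simp
  then show "(\<phi> has_derivative (\<lambda>h. 0 \<bullet> h)) (at x)"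
    by (rule has_derivative_transform_within_open[where s="-K"]) (use assms in auto)
qed

lemma C1c_support:
  assumes "\<phi> \<in> C1c \<Omega>"
  obtains K where "compact K" "K \<subseteq> \<Omega>" "\<And>x. x \<notin> K \<Longrightarrow> \<phi> x = 0" "\<And>x. x \<notin> K \<Longrightarrow> gradient \<phi> x = 0"
proof -
  obtain K where K: "compact K" "K \<subseteq> \<Omega>" "\<And>x. x \<notin> K \<Longrightarrow> \<phi> x = 0"
    using assms unfolding C1c_def by auto
  show ?thesis
    by (rule that[OF K gradient_zero_off_compact[OF compact_imp_closed[OF K(1)] K(3)]])
qed

lemma C1c_mult_left: 
  assumes "\<phi> \<in> C1c \<Omega>" "C1 \<psi>"
  shows "(\<lambda>x. \<phi> x * \<psi> x) \<in> C1c \<Omega>"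
  using assms C1_mult(1) unfolding C1c_def by auto

lemma C1c_add: 
  assumes "\<phi> \<in> C1c \<Omega>" "\<psi> \<in> C1c \<Omega>"
  shows "(\<lambda>x. \<phi> x + \<psi> x) \<in> C1c \<Omega>"
proof -
  obtain K where K: "compact K" "K \<subseteq> \<Omega>" "\<And>x. x \<notin> K \<Longrightarrow> \<phi> x = 0" using assms(1) C1c_support by metis
  obtain L where L: "compact L" "L \<subseteq> \<Omega>" "\<And>x. x \<notin> L \<Longrightarrow> \<psi> x = 0" using assms(2) C1c_support by metis
  have "compact (K \<union> L)" "K \<union> L \<subseteq> \<Omega>" "\<forall>x. x \<notin> K \<union> L \<longrightarrow> \<phi> x + \<psi> x = 0"
    using K L by auto
  then show ?thesis unfolding C1c_def
    using C1_add(1)[OF C1c_imp_C1[OF assms(1)] C1c_imp_C1[OF assms(2)]] by blast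
qed

lemma C1c_compose:
  assumes "\<phi> \<in> C1c \<Omega>" and g: "\<And>x. (g has_real_derivative g' (\<phi> x)) (at (\<phi> x))"
    and c: "continuous_on (range \<phi>) g'" and "g 0 = 0"
  shows "(\<lambda>x. g (\<phi> x)) \<in> C1c \<Omega>"
  using C1_compose(1)[OF C1c_imp_C1[OF assms(1)] g c] assms(1,4) unfolding C1c_def by auto

lemma continuously_differentiable_lower:
  "continuously_differentiable (Suc k) \<phi> \<Longrightarrow> continuously_differentiable k \<phi>"
proof (induction k arbitrary: \<phi>)
  case 0
  then show ?case
    by (auto intro!: continuous_at_imp_continuous_on differentiable_imp_continuous_within)
next
  case (Suc k)
  then show ?case unfolding continuously_differentiable.simps(2)[of "Suc k"] continuously_differentiable.simps(2)[of k]
    using Suc.IH by auto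
qed

lemma continuously_differentiable_add:
  "continuously_differentiable k \<phi> \<Longrightarrow> continuously_differentiable k \<psi> \<Longrightarrow>
     continuously_differentiable k (\<lambda>x. \<phi> x + \<psi> x)"
proof (induction k arbitrary: \<phi> \<psi>)
  case 0
  then show ?case by (auto intro: continuous_intros)
next
  case (Suc k)
  have "frechet_derivative (\<lambda>x. \<phi> x + \<psi> x) (at x) =
      (\<lambda>h. frechet_derivative \<phi> (at x) h + frechet_derivative \<psi> (at x) h)" for x
    using Suc.prems
    by (intro frechet_derivative_at[symmetric] has_derivative_add) (auto simp: frechet_derivative_works[symmetric])
  then show ?case using Suc by auto
qed

lemma continuously_differentiable_mult:
  "continuously_differentiable k \<phi> \<Longrightarrow> continuously_differentiable k \<psi> \<Longrightarrow>
     continuously_differentiable k (\<lambda>x. \<phi> x * \<psi> x)"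
proof (induction k arbitrary: \<phi> \<psi>)
  case 0
  then show ?case by (auto intro: continuous_intros)
next
  case (Suc k)
  have "frechet_derivative (\<lambda>x. \<phi> x * \<psi> x) (at x) =
      (\<lambda>h. \<phi> x * frechet_derivative \<psi> (at x) h + frechet_derivative \<phi> (at x) h * \<psi> x)" for x
    using Suc.prems
    by (intro frechet_derivative_at[symmetric] has_derivative_mult) (auto simp: frechet_derivative_works[symmetric])
  then show ?case using Suc continuously_differentiable_lower[of k \<phi>] continuously_differentiable_lower[of k \<psi>]
    by (auto intro!: continuously_differentiable_add)
qed

lemma continuously_differentiable_const:
  "continuously_differentiable k (\<lambda>x::'a::euclidean_space. c)"
proof (induction k arbitrary: c)
  case (Suc k)
  have "frechet_derivative (\<lambda>x. c) (at x) = (\<lambda>h. 0)" for x :: 'a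
    by (rule frechet_derivative_const)
  then show ?case using Suc by simp
qed simp

lemma continuously_differentiable_inner: "continuously_differentiable k (\<lambda>x. (x - b) \<bullet> i)"
proof (cases k)
  case 0
  then show ?thesis by (auto intro!: continuous_intros)
next
  case (Suc n)
  have d: "((\<lambda>x. (x - b) \<bullet> i) has_derivative (\<lambda>h. h \<bullet> i)) (at x)" for x
    by (auto intro!: derivative_eq_intros)
  then have "frechet_derivative (\<lambda>x. (x - b) \<bullet> i) (at x) = (\<lambda>h. h \<bullet> i)" for x
    using frechet_derivative_at[OF d] by simp
  then show ?thesis using Suc d continuously_differentiable_const by (auto simp: differentiable_def)
qed

lemma test_functions_C1c: "test_functions \<Omega> \<subseteq> C1c \<Omega>"
proof
  fix \<phi> :: "'a \<Rightarrow> real" assume p: "\<phi> \<in> test_functions \<Omega>"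
  then have "continuously_differentiable (Suc 0) \<phi>" by (simp add: test_functions_def del: continuously_differentiable.simps)
  then have d: "\<forall>x. \<phi> differentiable (at x)" and c: "\<And>i. i \<in> Basis \<Longrightarrow> continuous_on UNIV (\<lambda>x. frechet_derivative \<phi> (at x) i)"
    by auto
  have "continuous_on UNIV (gradient \<phi>)" unfolding gradient_def
    by (intro continuous_intros c)
  moreover have "x \<notin> closure {x. \<phi> x \<noteq> 0} \<Longrightarrow> \<phi> x = 0" for x
    using closure_subset[of "{x. \<phi> x \<noteq> 0}"] by auto
  ultimately show "\<phi> \<in> C1c \<Omega>" using p d unfolding C1c_def C1_def test_functions_def by blast
qed

lemma test_functionsI:
  assumes "\<And>k. continuously_differentiable k \<phi>" "compact K" "K \<subseteq> \<Omega>" "\<And>x. x \<notin> K \<Longrightarrow> \<phi> x = 0"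
  shows "\<phi> \<in> test_functions \<Omega>"
proof -
  have "closure {x. \<phi> x \<noteq> 0} \<subseteq> K"
    using assms by (intro closure_minimal compact_imp_closed) auto
  moreover have "compact (closure {x. \<phi> x \<noteq> 0})"
    using bounded_subset[OF compact_imp_bounded[OF assms(2)], of "{x. \<phi> x \<noteq> 0}"] assms(4) by (auto simp: compact_closure)
  ultimately show ?thesis using assms by (auto simp: test_functions_def)
qed

section \<open>A smooth bump function\<close>

text \<open>
  The family \<open>P(1/t) exp(-1/t)\<close>, extended by \<open>0\<close> to \<open>t \<le> 0\<close>, is closed under differentiation;
  the polynomial \<open>P\<close> is a parameter so that smoothness can be proved by induction.
\<close>

definition flat_exp :: "real poly \<Rightarrow> real \<Rightarrow> real" where
  "flat_exp P t = (if t > 0 then poly P (1/t) * exp (-(1/t)) else 0)"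

lemma poly_times_exp_minus_tendsto_0: "((\<lambda>s. poly P s * exp (-s)) \<longlongrightarrow> 0) (at_top :: real filter)"
proof -
  have 1: "((\<lambda>s::real. s ^ k * exp (- s)) \<longlongrightarrow> 0) at_top" for k
    using tendsto_power_div_exp_0[of k] by (simp add: exp_minus divide_inverse)
  have "((\<lambda>s. \<Sum>i\<le>degree P. coeff P i * (s^i * exp(-s))) \<longlongrightarrow> (\<Sum>i\<le>degree P. coeff P i * 0)) at_top"
    by (intro tendsto_intros 1)
  then show ?thesis by (simp add: poly_altdef sum_distrib_right mult.assoc)
qed

lemma flat_exp_at_right_0: "(flat_exp P \<longlongrightarrow> 0) (at_right 0)"
proof -
  have "((\<lambda>t::real. poly P (1/t) * exp (-(1/t))) \<longlongrightarrow> 0) (at_right 0)"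
    using filterlim_compose[OF poly_times_exp_minus_tendsto_0 filterlim_inverse_at_top_right]
    by (simp add: inverse_eq_divide)
  then show ?thesis
    by (rule Lim_transform_eventually) (auto simp: flat_exp_def eventually_at_right_field intro!: exI[of _ 1])
qed

text \<open>
  For \<open>t > 0\<close> the chain rule turns \<open>P\<close> into \<open>X\<^sup>2 (P - P')\<close>.  At \<open>t = 0\<close> the right difference
  quotient is the member of the family with polynomial \<open>X P\<close>, which tends to \<open>0\<close>.
\<close>

lemma flat_exp_has_derivative:
  "(flat_exp P has_real_derivative flat_exp ([:0,0,1:] * (P - pderiv P)) t) (at t)"
proof -
  consider "t > 0" | "t < 0" | "t = 0" by linarith
  then show ?thesis
  proof cases
    case 1
    have i: "((\<lambda>t. 1/t) has_real_derivative - (1/t^2)) (at t)"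
      using 1 by (auto intro!: derivative_eq_intros simp: power2_eq_square)
    have "((\<lambda>t. poly P (1/t) * exp (-(1/t))) has_real_derivative
        poly P (1/t) * (exp (-(1/t)) * - (- (1/t^2))) + (poly (pderiv P) (1/t) * - (1/t^2)) * exp (-(1/t))) (at t)"
      by (rule DERIV_mult'[OF DERIV_chain2[OF poly_DERIV i] DERIV_chain2[OF DERIV_exp DERIV_minus[OF i]]])
    then have "((\<lambda>t. poly P (1/t) * exp (-(1/t))) has_real_derivative flat_exp ([:0,0,1:] * (P - pderiv P)) t) (at t)"
      by (rule DERIV_cong) (use 1 in \<open>simp add: flat_exp_def algebra_simps power2_eq_square\<close>)
    then show ?thesis
      by (rule has_field_derivative_transform_within_open[where S="{0<..}"]) (use 1 in \<open>auto simp: flat_exp_def\<close>)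
  next
    case 2
    have "((\<lambda>t. 0) has_real_derivative flat_exp ([:0,0,1:] * (P - pderiv P)) t) (at t)"
      using 2 by (auto simp: flat_exp_def)
    then show ?thesis
      by (rule has_field_derivative_transform_within_open[where S="{..<0}"]) (use 2 in \<open>auto simp: flat_exp_def\<close>)
  next
    case 3
    have 1: "((\<lambda>y. (flat_exp P y - flat_exp P 0) / (y - 0)) \<longlongrightarrow> 0) (at_right 0)"
      using flat_exp_at_right_0[of "[:0,1:] * P"]
      by (rule Lim_transform_eventually) (auto simp: flat_exp_def eventually_at_right_field intro!: exI[of _ 1])
    have 2: "((\<lambda>y. (flat_exp P y - flat_exp P 0) / (y - 0)) \<longlongrightarrow> 0) (at_left 0)"
      by (rule Lim_transform_eventually[OF tendsto_const]) (auto simp: flat_exp_def eventually_at_left_field intro!: exI[of _ "-1"])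
    have "(flat_exp P has_real_derivative 0) (at 0)"
      using filterlim_split_at[OF 2 1] by (simp add: has_field_derivative_iff)
    then show ?thesis using 3 by (simp add: flat_exp_def)
  qed
qed

definition bump :: "real \<Rightarrow> 'a::euclidean_space \<Rightarrow> real" where
  "bump r x = flat_exp 1 (r^2 - x \<bullet> x)"

lemma continuously_differentiable_flat_exp:
  fixes P :: "real poly"
  shows "continuously_differentiable k (\<lambda>x::'a::euclidean_space. flat_exp P (r^2 - x \<bullet> x))"
proof (induction k arbitrary: P)
  case 0
  have "continuous_on UNIV (flat_exp P)"
    by (intro continuous_at_imp_continuous_on ballI DERIV_isCont[OF flat_exp_has_derivative])
  then show ?case by (auto intro!: continuous_intros elim!: continuous_on_compose2)
next
  case (Suc k)
  define Q where "Q = [:0,0,1:] * (P - pderiv P)"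
  have d: "((\<lambda>x::'a. flat_exp P (r^2 - x \<bullet> x)) has_derivative (\<lambda>h. flat_exp Q (r^2 - x \<bullet> x) * ((-2) * ((x - 0) \<bullet> h)))) (at x)" for x
    unfolding Q_def
    by (rule has_derivative_eq_rhs[OF has_derivative_compose[OF _ flat_exp_has_derivative[unfolded has_field_derivative_def]]])
       (auto intro!: derivative_eq_intros simp: inner_commute)
  have e: "frechet_derivative (\<lambda>x::'a. flat_exp P (r^2 - x \<bullet> x)) (at x) = (\<lambda>h. flat_exp Q (r^2 - x \<bullet> x) * ((-2) * ((x - 0) \<bullet> h)))" for x
    using frechet_derivative_at[OF d] by simp
  show ?case unfolding continuously_differentiable.simps e
    by (intro conjI allI ballI continuously_differentiable_mult Suc continuously_differentiable_const continuously_differentiable_inner)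
       (use d differentiable_def in blast)
qed

lemma bump_smooth: "continuously_differentiable k (bump r :: 'a::euclidean_space \<Rightarrow> real)"
  using continuously_differentiable_flat_exp[of k 1 r] by (simp add: bump_def[abs_def])

lemma bump_nonneg: "bump r x \<ge> 0"
  by (simp add: bump_def flat_exp_def)

lemma bump_pos_iff: assumes "r > 0" shows "bump r x > 0 \<longleftrightarrow> norm x < r"
proof -
  have "norm x < r \<longleftrightarrow> (norm x)\<^sup>2 < r\<^sup>2"
    using assms by (smt (verit) norm_ge_zero power2_less_imp_less power_strict_mono zero_less_numeral)
  then show ?thesis
    by (simp add: bump_def flat_exp_def dot_square_norm)
qed

section \<open>Integration by parts and mollification\<close>

lemma integrable_continuous_compact_support:
  fixes f :: "'a::euclidean_space \<Rightarrow> 'b::{banach, second_countable_topology}"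
  assumes "continuous_on UNIV f" "compact K" "\<And>x. x \<notin> K \<Longrightarrow> f x = 0"
  shows "integrable lborel f"
proof -
  have "integrable lborel (\<lambda>x. indicator K x *\<^sub>R f x)"
    by (rule borel_integrable_compact[OF assms(2) continuous_on_subset[OF assms(1)]]) simp
  also have "(\<lambda>x. indicator K x *\<^sub>R f x) = f"
    using assms(3) by (auto simp: indicator_def)
  finally show ?thesis .
qed

lemma bounded_continuous_compact_support:
  fixes f :: "'a::euclidean_space \<Rightarrow> 'b::real_normed_vector"
  assumes "continuous_on UNIV f" "compact K" "\<And>x. x \<notin> K \<Longrightarrow> f x = 0"
  obtains B where "B > 0" "\<And>x. norm (f x) \<le> B"
proof -
  have "bounded (f ` K)"
    by (intro compact_imp_bounded compact_continuous_image continuous_on_subset[OF assms(1)] assms(2)) simp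
  then obtain B where B: "B > 0" "\<And>y. y \<in> f ` K \<Longrightarrow> norm y \<le> B"
    using bounded_pos by metis
  have "norm (f x) \<le> B" for x
    using B assms(3)[of x] by (cases "x \<in> K") auto
  then show ?thesis using that B(1) by blast
qed

lemma lborel_integral_translate:
  fixes f :: "'a::euclidean_space \<Rightarrow> 'b::{banach, second_countable_topology}"
  assumes [measurable]: "f \<in> borel_measurable borel"
  shows "(LINT x|lborel. f (h + x)) = (LINT x|lborel. f x)"
  by (subst (2) lborel_distr_plus[of h, symmetric]) (simp add: integral_distr)

lemma lebesgue_on_integral_eq_lborel:
  fixes f :: "'a::euclidean_space \<Rightarrow> 'b::{banach, second_countable_topology}"
  assumes O: "\<Omega> \<in> sets lebesgue" and f: "f \<in> borel_measurable borel" and z: "\<And>x. x \<notin> \<Omega> \<Longrightarrow> f x = 0"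
  shows "(LINT x|lebesgue_on \<Omega>. f x) = (LINT x|lborel. f x)"
    and "integrable (lebesgue_on \<Omega>) f \<longleftrightarrow> integrable lborel f"
proof -
  have 1: "(\<lambda>x. indicator \<Omega> x *\<^sub>R f x) = f" using z by (auto simp: indicator_def)
  show "(LINT x|lebesgue_on \<Omega>. f x) = (LINT x|lborel. f x)"
    using O f by (subst integral_restrict_space) (auto simp: 1 integral_completion)
  show "integrable (lebesgue_on \<Omega>) f \<longleftrightarrow> integrable lborel f"
    using O f by (subst integrable_restrict_space) (auto simp: 1 integrable_completion)
qed

lemma C1_lipschitz:
  assumes "C1 \<phi>" "\<And>x. norm (gradient \<phi> x) \<le> B"
  shows "\<bar>\<phi> x - \<phi> y\<bar> \<le> B * norm (x - y)"
proof -
  have "onorm ((\<bullet>) (gradient \<phi> z)) \<le> B" for z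
  proof (rule onorm_le)
    show "norm (gradient \<phi> z \<bullet> h) \<le> B * norm h" for h
      using Cauchy_Schwarz_ineq2[of "gradient \<phi> z" h] assms(2)[of z]
      by (smt (verit) mult_right_mono norm_ge_zero real_norm_def)
  qed
  then have "norm (\<phi> x - \<phi> y) \<le> B * norm (x - y)"
    by (intro differentiable_bound[where S=UNIV and f'="\<lambda>z. (\<bullet>) (gradient \<phi> z)"])
       (auto intro: C1_has_derivative[OF assms(1)])
  then show ?thesis by simp
qed

lemma C1c_gradient_bounded:
  assumes "\<phi> \<in> C1c \<Omega>"
  obtains B where "B > 0" "\<And>x. norm (gradient \<phi> x) \<le> B"
proof -
  obtain K where K: "compact K" "\<And>x. x \<notin> K \<Longrightarrow> gradient \<phi> x = 0"
    using C1c_support[OF assms] by metis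
  show ?thesis
    by (rule bounded_continuous_compact_support[OF C1_continuous_gradient[OF C1c_imp_C1[OF assms]] K that])
qed

lemma C1c_bounded:
  assumes "\<phi> \<in> C1c \<Omega>"
  obtains B where "B > 0" "\<And>x. \<bar>\<phi> x\<bar> \<le> B"
proof -
  obtain K where K: "compact K" "\<And>x. x \<notin> K \<Longrightarrow> \<phi> x = 0"
    using C1c_support[OF assms] by metis
  show ?thesis
    by (rule bounded_continuous_compact_support[OF C1_continuous[OF C1c_imp_C1[OF assms]] K]) (auto intro: that)
qed

lemma C1c_integrable:
  assumes "\<phi> \<in> C1c \<Omega>"
  shows "integrable lborel \<phi>" "integrable lborel (gradient \<phi>)"
proof -
  obtain K where K: "compact K" "K \<subseteq> \<Omega>" "\<And>x. x \<notin> K \<Longrightarrow> \<phi> x = 0" "\<And>x. x \<notin> K \<Longrightarrow> gradient \<phi> x = 0"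
    using C1c_support[OF assms] by metis
  note C = C1c_imp_C1[OF assms]
  show "integrable lborel \<phi>"
    by (rule integrable_continuous_compact_support[OF C1_continuous[OF C] K(1,3)])
  show "integrable lborel (gradient \<phi>)"
    by (rule integrable_continuous_compact_support[OF C1_continuous_gradient[OF C] K(1,4)])
qed

text \<open>
  Lebesgue measure is translation invariant, so the difference quotients of \<open>F\<close> have integral
  \<open>0\<close>; they converge dominatedly to the partial derivatives.
\<close>

lemma integral_gradient_eq_0:
  assumes F: "F \<in> C1c \<Omega>"
  shows "(LINT x|lborel. gradient F x) = 0"
proof (rule euclidean_eqI)
  fix i :: 'a assume i: "i \<in> Basis"
  obtain K where K: "compact K" "\<And>x. x \<notin> K \<Longrightarrow> F x = 0" using C1c_support[OF F] by metis
  obtain r where r: "\<And>x. x \<in> K \<Longrightarrow> norm x \<le> r" using compact_imp_bounded[OF K(1)] bounded_iff by metis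
  obtain B where B: "B > 0" "\<And>x. norm (gradient F x) \<le> B" using C1c_gradient_bounded[OF F] by metis
  note C = C1c_imp_C1[OF F]
  have Fm[measurable]: "F \<in> borel_measurable borel"
    by (rule borel_measurable_continuous_onI[OF C1_continuous[OF C]])
  have gm[measurable]: "gradient F \<in> borel_measurable borel"
    by (rule borel_measurable_continuous_onI[OF C1_continuous_gradient[OF C]])
  define t :: "nat \<Rightarrow> real" where "t n = inverse (real (Suc n))" for n
  have t: "t n > 0" "t n \<le> 1" for n by (auto simp: t_def field_simps)
  have t0: "t \<longlonglongrightarrow> 0" unfolding t_def by (rule LIMSEQ_inverse_real_of_nat)
  define D where "D n x = (F (t n *\<^sub>R i + x) - F x) / t n" for n x
  have "(LINT x|lborel. D n x) = 0" for n
  proof -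
    have "(LINT x|lborel. D n x) = ((LINT x|lborel. F (t n *\<^sub>R i + x)) - (LINT x|lborel. F x)) / t n"
      unfolding D_def
      using C1c_integrable(1)[OF F] integrable_distr_eq[of "(+) (t n *\<^sub>R i)" lborel borel F]
      by (simp add: lborel_distr_plus)
    then show ?thesis by (simp add: lborel_integral_translate)
  qed
  \<comment> \<open>The support of \<open>F\<close> lies in the ball of radius \<open>r\<close> and the step is at most \<open>1\<close>, so the difference
    quotients vanish off the ball of radius \<open>r + 1\<close>.\<close>
  moreover have "(\<lambda>n. LINT x|lborel. D n x) \<longlonglongrightarrow> (LINT x|lborel. gradient F x \<bullet> i)"
  proof (rule integral_dominated_convergence[where w="\<lambda>x. B * indicator (cball 0 (r+1)) x"])
    show "D n \<in> borel_measurable lborel" for n unfolding D_def by measurable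
    show "integrable lborel (\<lambda>x::'a. B * indicator (cball 0 (r + 1)) x :: real)"
      using emeasure_bounded_finite[OF bounded_cball[of "0::'a" "r+1"]]
      by (intro integrable_mult_right integrable_real_indicator) auto
    show "AE x in lborel. (\<lambda>n. D n x) \<longlonglongrightarrow> gradient F x \<bullet> i"
    proof (rule AE_I2)
      fix x
      have "((\<lambda>s. F (x + s *\<^sub>R i)) has_derivative (\<lambda>h. gradient F (x + 0 *\<^sub>R i) \<bullet> (h *\<^sub>R i))) (at 0)"
        by (rule has_derivative_compose[OF _ C1_has_derivative[OF C]]) (auto intro!: derivative_eq_intros)
      then have "((\<lambda>s. F (x + s *\<^sub>R i)) has_real_derivative (gradient F x \<bullet> i)) (at 0)"
        by (simp add: has_field_derivative_def mult.commute[of _ "gradient F x \<bullet> i"])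
      then have "((\<lambda>s. (F (x + s *\<^sub>R i) - F x) / s) \<longlongrightarrow> gradient F x \<bullet> i) (at 0)"
        by (simp add: has_field_derivative_iff)
      moreover have "filterlim t (at 0) sequentially"
        using t0 t(1) by (auto simp: filterlim_at intro!: always_eventually) (metis less_numeral_extra(3))
      ultimately show "(\<lambda>n. D n x) \<longlonglongrightarrow> gradient F x \<bullet> i"
        unfolding D_def add.commute[of "_ *\<^sub>R i"] by (rule filterlim_compose)
    qed
    show "AE x in lborel. norm (D n x) \<le> B * indicator (cball 0 (r + 1)) x" for n
    proof (rule AE_I2)
      fix x
      show "norm (D n x) \<le> B * indicator (cball 0 (r + 1)) x"
      proof (cases "x \<in> cball 0 (r+1)")
        case True
        have "\<bar>F (t n *\<^sub>R i + x) - F x\<bar> \<le> B * norm (t n *\<^sub>R i + x - x)"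
          by (rule C1_lipschitz[OF C B(2)])
        then show ?thesis using t[of n] i True by (simp add: D_def field_simps)
      next
        case False
        then have "norm x > r + 1" by simp
        moreover have "norm x \<le> norm (t n *\<^sub>R i + x) + norm (t n *\<^sub>R i)"
          by (metis add.commute add_diff_cancel_right' norm_triangle_ineq4)
        ultimately have "norm (t n *\<^sub>R i + x) > r" using t[of n] i by simp
        then have "F (t n *\<^sub>R i + x) = 0" "F x = 0" using K(2) r \<open>norm x > r + 1\<close> by force+
        then show ?thesis using False by (simp add: D_def)
      qed
    qed
  qed (measurable)
  ultimately have "(LINT x|lborel. gradient F x \<bullet> i) = 0"
    by (simp add: LIMSEQ_const_iff)
  then show "(LINT x|lborel. gradient F x) \<bullet> i = 0 \<bullet> i"
    using C1c_integrable(2)[OF F] by simp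
qed

lemma integration_by_parts:
  assumes "C1 \<phi>" "\<psi> \<in> C1c \<Omega>"
  shows "(LINT x|lborel. \<phi> x *\<^sub>R gradient \<psi> x) = - (LINT x|lborel. \<psi> x *\<^sub>R gradient \<phi> x)"
proof -
  note C = assms(1) C1c_imp_C1[OF assms(2)]
  obtain K where K: "compact K" "K \<subseteq> \<Omega>" "\<And>x. x \<notin> K \<Longrightarrow> \<psi> x = 0" "\<And>x. x \<notin> K \<Longrightarrow> gradient \<psi> x = 0"
    using C1c_support[OF assms(2)] by metis
  have i1: "integrable lborel (\<lambda>x. \<phi> x *\<^sub>R gradient \<psi> x)"
    by (rule integrable_continuous_compact_support[OF _ K(1)])
       (auto intro!: continuous_intros C1_continuous C1_continuous_gradient C simp: K)
  have i2: "integrable lborel (\<lambda>x. \<psi> x *\<^sub>R gradient \<phi> x)"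
    by (rule integrable_continuous_compact_support[OF _ K(1)])
       (auto intro!: continuous_intros C1_continuous C1_continuous_gradient C simp: K)
  have "(LINT x|lborel. gradient (\<lambda>x. \<psi> x * \<phi> x) x) = 0"
    by (rule integral_gradient_eq_0[OF C1c_mult_left[OF assms(2,1)]])
  then have "(LINT x|lborel. \<psi> x *\<^sub>R gradient \<phi> x + \<phi> x *\<^sub>R gradient \<psi> x) = 0"
    by (simp add: C1_mult(2)[OF C(2,1)])
  then show ?thesis using i1 i2 by (simp add: eq_neg_iff_add_eq_0 add.commute)
qed

text \<open>
  Differentiation under the integral sign.  The integral is first rewritten over a box that
  contains the support of \<open>\<phi>\<close>, where the Leibniz rule applies.
\<close>

lemma has_derivative_convolution:
  fixes \<phi> \<rho> :: "'a::euclidean_space \<Rightarrow> real"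
  assumes \<phi>: "continuous_on UNIV \<phi>" "compact K" "\<And>x. x \<notin> K \<Longrightarrow> \<phi> x = 0" and \<rho>: "C1 \<rho>"
  shows "((\<lambda>x. LINT y|lborel. \<phi> y * \<rho> (x - y)) has_derivative
     (\<lambda>h. (LINT y|lborel. \<phi> y *\<^sub>R gradient \<rho> (x - y)) \<bullet> h)) (at x)"
proof -
  obtain a where ab: "K \<subseteq> cbox (-a) a" using bounded_subset_cbox_symmetric[OF compact_imp_bounded[OF assms(2)]] by blast
  have eq: "(LINT y|lborel. \<phi> y *\<^sub>R f y) = integral (cbox (-a) a) (\<lambda>y. \<phi> y *\<^sub>R f y)"
    if "continuous_on UNIV f" for f :: "'a \<Rightarrow> 'b::euclidean_space"
  proof -
    have i: "integrable lborel (\<lambda>y. \<phi> y *\<^sub>R f y)"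
      by (rule integrable_continuous_compact_support[OF _ assms(2)])
         (auto intro!: continuous_intros assms that)
    have 1: "(\<lambda>y. indicator (cbox (-a) a) y *\<^sub>R (\<phi> y *\<^sub>R f y)) = (\<lambda>y. \<phi> y *\<^sub>R f y)"
      using ab assms(3) by (auto simp: indicator_def fun_eq_iff)
    have "set_integrable lborel (cbox (-a) a) (\<lambda>y. \<phi> y *\<^sub>R f y)"
      using i unfolding set_integrable_def 1 .
    from set_borel_integral_eq_integral(2)[OF this] show ?thesis
      unfolding set_lebesgue_integral_def 1 .
  qed
  have c\<rho>: "continuous_on UNIV (\<lambda>y. \<rho> (x - y))" for x
    by (rule continuous_on_compose2[OF C1_continuous[OF \<rho>, of UNIV]]) (auto intro!: continuous_intros)
  have cg: "continuous_on UNIV (\<lambda>y. gradient \<rho> (x - y))" for x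
    by (rule continuous_on_compose2[OF C1_continuous_gradient[OF \<rho>, of UNIV]]) (auto intro!: continuous_intros)
  define fx where "fx x y = blinfun_inner_left (\<phi> y *\<^sub>R gradient \<rho> (x - y))" for x y
  have cfx: "continuous_on (UNIV \<times> cbox (-a) a) (\<lambda>(x, t). fx x t)"
    unfolding fx_def split_beta
    by (intro bounded_linear.continuous_on[OF bounded_linear_blinfun_inner_left] continuous_intros
         continuous_on_compose2[OF assms(1)] continuous_on_compose2[OF C1_continuous_gradient[OF \<rho>, of UNIV]]) auto
  have "((\<lambda>x. integral (cbox (-a) a) (\<lambda>y. \<phi> y * \<rho> (x - y))) has_derivative
      blinfun_apply (integral (cbox (-a) a) (fx x))) (at x within UNIV)"
  proof (rule leibniz_rule[OF _ _ cfx])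
    show "((\<lambda>x. \<phi> t * \<rho> (x - t)) has_derivative blinfun_apply (fx x t)) (at x within UNIV)" for x t
      unfolding fx_def blinfun_inner_left.rep_eq
      by (rule has_derivative_eq_rhs[OF has_derivative_mult_right[OF has_derivative_compose[OF _ C1_has_derivative[OF \<rho>]]]])
         (auto intro!: derivative_eq_intros simp: inner_commute)
    show "(\<lambda>y. \<phi> y * \<rho> (x - y)) integrable_on cbox (-a) a" for x
      by (intro integrable_continuous continuous_intros continuous_on_subset[OF assms(1)] continuous_on_subset[OF c\<rho>]) auto
  qed auto
  moreover have bl: "blinfun_apply (integral (cbox (-a) a) (fx x)) h = integral (cbox (-a) a) (\<lambda>y. \<phi> y *\<^sub>R gradient \<rho> (x - y)) \<bullet> h" for h
  proof -
    have i: "(\<lambda>y. \<phi> y *\<^sub>R gradient \<rho> (x - y)) integrable_on cbox (-a) a"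
      by (intro integrable_continuous continuous_intros continuous_on_subset[OF assms(1)] continuous_on_subset[OF cg]) auto
    have "integral (cbox (-a) a) (fx x) = blinfun_inner_left (integral (cbox (-a) a) (\<lambda>y. \<phi> y *\<^sub>R gradient \<rho> (x - y)))"
      unfolding fx_def[abs_def] using integral_linear[OF i bounded_linear_blinfun_inner_left] by (simp add: o_def)
    then show ?thesis by (simp add: inner_commute)
  qed
  ultimately show ?thesis
    unfolding real_scaleR_def[symmetric] eq[OF c\<rho>] eq[OF cg] bl[THEN ext, symmetric] by simp
qed

text \<open>
  All derivatives fall on the smooth factor.
\<close>

lemma continuously_differentiable_convolution:
  fixes \<phi> \<rho> :: "'a::euclidean_space \<Rightarrow> real"
  assumes \<phi>: "continuous_on UNIV \<phi>" "compact K" "\<And>x. x \<notin> K \<Longrightarrow> \<phi> x = 0"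
    and \<rho>: "\<And>k. continuously_differentiable k \<rho>"
  shows "continuously_differentiable k (\<lambda>x. LINT y|lborel. \<phi> y * \<rho> (x - y))"
  using \<rho>
proof (induction k arbitrary: \<rho>)
  have C: "C1 \<rho>" if "\<And>k. continuously_differentiable k \<rho>" for \<rho> :: "'a \<Rightarrow> real"
  proof -
    have "continuously_differentiable (Suc 0) \<rho>" by (rule that)
    then show ?thesis unfolding C1_def gradient_def by (auto intro!: continuous_intros)
  qed
  {
    case 0
    then show ?case
      using has_derivative_convolution[OF \<phi> C[OF 0]]
      by (auto intro!: continuous_at_imp_continuous_on dest: has_derivative_continuous)
  next
    case (Suc k)
    note d = has_derivative_convolution[OF \<phi> C[OF Suc(2)]]
    have "continuously_differentiable k (\<lambda>x. frechet_derivative (\<lambda>x. LINT y|lborel. \<phi> y * \<rho> (x - y)) (at x) i)"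
      if i: "i \<in> Basis" for i
    proof -
      have "frechet_derivative (\<lambda>x. LINT y|lborel. \<phi> y * \<rho> (x - y)) (at x) i =
          (LINT y|lborel. \<phi> y * frechet_derivative \<rho> (at (x - y)) i)" for x
      proof -
        have "integrable lborel (\<lambda>y. \<phi> y *\<^sub>R gradient \<rho> (x - y))"
          by (rule integrable_continuous_compact_support[OF _ \<phi>(2)])
             (auto intro!: continuous_intros \<phi> continuous_on_compose2[OF C1_continuous_gradient[OF C[OF Suc(2)], of UNIV]])
        then have "(LINT y|lborel. \<phi> y *\<^sub>R gradient \<rho> (x - y)) \<bullet> i = (LINT y|lborel. (\<phi> y *\<^sub>R gradient \<rho> (x - y)) \<bullet> i)"
          by (rule integral_inner_left[symmetric])
        also have "\<dots> = (LINT y|lborel. \<phi> y * frechet_derivative \<rho> (at (x - y)) i)"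
          using C[OF Suc(2)] by (simp add: inner_gradient C1_def)
        finally show ?thesis using frechet_derivative_at[OF d, of x, symmetric] by simp
      qed
      moreover have "continuously_differentiable k (\<lambda>x. frechet_derivative \<rho> (at x) i)" for k
        using Suc(2)[of "Suc k"] i by simp
      ultimately show ?thesis using Suc(1)[of "\<lambda>x. frechet_derivative \<rho> (at x) i"] by simp
    qed
    then show ?case using d by (auto simp: differentiable_def)
  }
qed


definition mollifier :: "real \<Rightarrow> 'a::euclidean_space \<Rightarrow> real" where
  "mollifier \<epsilon> x = bump \<epsilon> x / (LINT y|lborel. bump \<epsilon> (y::'a))"

lemma C1_bump: "C1 (bump \<epsilon>)"
  using bump_smooth[of "Suc 0" \<epsilon>] unfolding C1_def gradient_def by (auto intro!: continuous_intros)

lemma bump_zero: "\<epsilon> > 0 \<Longrightarrow> x \<notin> cball 0 \<epsilon> \<Longrightarrow> bump \<epsilon> x = 0"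
  using bump_pos_iff[of \<epsilon> x] bump_nonneg[of \<epsilon> x] by auto

lemma bump_integral_pos:
  assumes "\<epsilon> > 0"
  shows "(LINT y|lborel. bump \<epsilon> (y::'a::euclidean_space)) > 0"
proof (rule ccontr)
  assume "\<not> ?thesis"
  then have "(LINT y|lborel. bump \<epsilon> (y::'a)) = 0"
    using Bochner_Integration.integral_nonneg[of lborel "bump \<epsilon>"] bump_nonneg by (metis less_eq_real_def)
  moreover have "integrable lborel (bump \<epsilon> :: 'a \<Rightarrow> real)"
    by (rule integrable_continuous_compact_support[OF C1_continuous[OF C1_bump] compact_cball bump_zero[OF assms]])
  ultimately have "AE y in lborel. bump \<epsilon> (y::'a) = 0"
    using integral_nonneg_eq_0_iff_AE[of lborel "bump \<epsilon> :: 'a \<Rightarrow> real"] bump_nonneg by auto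
  then have "AE y in lborel. y \<notin> ball (0::'a) \<epsilon>"
    by eventually_elim (use bump_pos_iff[OF assms] in force)
  then have "emeasure lborel (ball (0::'a) \<epsilon>) = 0"
    by (subst (asm) AE_iff_measurable[where N="ball 0 \<epsilon>"]) auto
  then have "measure lborel (ball (0::'a) \<epsilon>) = 0" by (simp add: measure_def)
  then show False using content_ball_pos[OF assms, of "0::'a"] by (simp only:)
qed

lemma mollifier_nonneg: "\<epsilon> > 0 \<Longrightarrow> mollifier \<epsilon> x \<ge> 0"
  unfolding mollifier_def by (intro divide_nonneg_pos bump_nonneg bump_integral_pos)

lemma mollifier_smooth: "continuously_differentiable k (mollifier \<epsilon>)"
  unfolding mollifier_def[abs_def] divide_inverse
  by (intro continuously_differentiable_mult continuously_differentiable_const bump_smooth)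

lemma C1_mollifier: "C1 (mollifier \<epsilon>)"
  using mollifier_smooth[of "Suc 0" \<epsilon>] unfolding C1_def gradient_def by (auto intro!: continuous_intros)

lemma mollifier_zero: "\<epsilon> > 0 \<Longrightarrow> x \<notin> cball 0 \<epsilon> \<Longrightarrow> mollifier \<epsilon> x = 0"
  unfolding mollifier_def by (simp add: bump_zero)

lemma mollifier_minus: "mollifier \<epsilon> (x - y) = mollifier \<epsilon> (y - x)"
  unfolding mollifier_def bump_def by (simp add: inner_diff inner_commute algebra_simps)

lemma mollifier_integral:
  fixes x :: "'a::euclidean_space"
  assumes "\<epsilon> > 0"
  shows "(LINT y|lborel. mollifier \<epsilon> (x - y)) = 1"
proof -
  have m: "mollifier \<epsilon> \<in> borel_measurable (borel :: 'a measure)"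
    by (rule borel_measurable_continuous_onI[OF C1_continuous[OF C1_mollifier]])
  have "(LINT y|lborel. mollifier \<epsilon> (x - y)) = (LINT y|lborel. mollifier \<epsilon> (- x + y))"
    by (simp add: mollifier_minus[of \<epsilon> x])
  also have "\<dots> = (LINT y|lborel. mollifier \<epsilon> (y::'a))"
    by (rule lborel_integral_translate[OF m])
  also have "\<dots> = 1"
    using bump_integral_pos[OF assms, where 'a='a] by (simp add: mollifier_def)
  finally show ?thesis .
qed

lemma mollifier_integrable:
  assumes "\<epsilon> > 0" "continuous_on UNIV G"
  shows "integrable lborel (\<lambda>y. mollifier \<epsilon> (x - y) *\<^sub>R (G y :: 'b::euclidean_space))"
proof (rule integrable_continuous_compact_support[of _ "cball x \<epsilon>"])
  show "continuous_on UNIV (\<lambda>y. mollifier \<epsilon> (x - y) *\<^sub>R G y)"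
    by (intro continuous_intros assms continuous_on_compose2[OF C1_continuous[OF C1_mollifier, of UNIV]]) auto
  show "mollifier \<epsilon> (x - y) *\<^sub>R G y = 0" if "y \<notin> cball x \<epsilon>" for y
  proof -
    have "x - y \<notin> cball 0 \<epsilon>" using that by (metis dist_norm mem_cball mem_cball_0)
    from mollifier_zero[OF assms(1) this] show ?thesis by simp
  qed
qed auto

lemma mollifier_bound:
  fixes G :: "'a::euclidean_space \<Rightarrow> 'b::euclidean_space"
  assumes "\<epsilon> > 0" "continuous_on UNIV G" "\<And>y. norm (y - x) \<le> \<epsilon> \<Longrightarrow> norm (G y - c) \<le> e"
  shows "norm ((LINT y|lborel. mollifier \<epsilon> (x - y) *\<^sub>R G y) - c) \<le> e"
proof -
  note i = mollifier_integrable[OF assms(1)]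
  have ic: "integrable lborel (\<lambda>y. mollifier \<epsilon> (x - y) *\<^sub>R c)" by (rule i) simp
  have i1: "integrable lborel (\<lambda>y. mollifier \<epsilon> (x - y))"
    using i[of "\<lambda>_. 1::real" x] by simp
  have "(LINT y|lborel. mollifier \<epsilon> (x - y) *\<^sub>R c) = c"
    using i1 by (simp add: mollifier_integral[OF assms(1)])
  then have "(LINT y|lborel. mollifier \<epsilon> (x - y) *\<^sub>R G y) - c = (LINT y|lborel. mollifier \<epsilon> (x - y) *\<^sub>R (G y - c))"
    using i[OF assms(2)] ic by (simp add: scaleR_diff_right)
  also have "norm \<dots> \<le> (LINT y|lborel. mollifier \<epsilon> (x - y) * e)"
  proof (rule Bochner_Integration.integral_norm_bound_integral)
    show "integrable lborel (\<lambda>y. mollifier \<epsilon> (x - y) *\<^sub>R (G y - c))"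
      by (intro i continuous_intros assms)
    show "norm (mollifier \<epsilon> (x - y) *\<^sub>R (G y - c)) \<le> mollifier \<epsilon> (x - y) * e" for y
    proof (cases "norm (y - x) \<le> \<epsilon>")
      case True
      then show ?thesis using assms(3)[OF True] mollifier_nonneg[OF assms(1), of "x - y"]
        by (simp add: mult_left_mono)
    next
      case False
      then have "mollifier \<epsilon> (x - y) = 0"
        using mollifier_zero[OF assms(1), of "x - y"] norm_minus_commute[of y x] by (metis mem_cball_0)
      then show ?thesis by simp
    qed
  qed (use i1 in simp)
  also have "\<dots> = e" using i1 by (simp add: mollifier_integral[OF assms(1)])
  finally show ?thesis .
qed

lemma compact_support_uniformly_continuous:
  fixes G :: "'a::euclidean_space \<Rightarrow> 'b::euclidean_space"
  assumes "continuous_on UNIV G" "compact K" "\<And>x. x \<notin> K \<Longrightarrow> G x = 0" "e > 0"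
  obtains d where "d > 0" "\<And>x y. norm (y - x) \<le> d \<Longrightarrow> norm (G y - G x) \<le> e"
proof -
  obtain r where r: "\<And>x. x \<in> K \<Longrightarrow> norm x \<le> r" using compact_imp_bounded[OF assms(2)] bounded_iff by metis
  have "uniformly_continuous_on (cball 0 (r+1)) G"
    by (intro compact_uniformly_continuous continuous_on_subset[OF assms(1)]) auto
  then obtain d where d: "d > 0" "\<And>x y. x \<in> cball 0 (r+1) \<Longrightarrow> y \<in> cball 0 (r+1) \<Longrightarrow> dist y x < d \<Longrightarrow> dist (G y) (G x) < e"
    unfolding uniformly_continuous_on_def using assms(4) by metis
  have "norm (G y - G x) \<le> e" if yx: "norm (y - x) \<le> min 1 (d/2)" for x y
  proof (cases "x \<in> cball 0 (r+1) \<and> y \<in> cball 0 (r+1)")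
    case True
    then show ?thesis using d(2)[of x y] yx d(1) by (auto simp: dist_norm)
  next
    case False
    have "norm y \<le> norm x + 1" "norm x \<le> norm y + 1"
      using yx norm_triangle_sub[of y x] norm_triangle_sub[of x y] by (auto simp: norm_minus_commute)
    then have "x \<notin> K" "y \<notin> K" using False r[of x] r[of y] by auto
    then show ?thesis using assms(3,4) by simp
  qed
  moreover have "min 1 (d/2) > 0" using d by simp
  ultimately show ?thesis using that by blast
qed

lemma mollifier_converges_uniformly:
  fixes G :: "'a::euclidean_space \<Rightarrow> 'b::euclidean_space"
  assumes "continuous_on UNIV G" "compact K" "\<And>x. x \<notin> K \<Longrightarrow> G x = 0"
    and \<epsilon>: "\<And>n. \<epsilon> n > 0" "\<epsilon> \<longlonglongrightarrow> 0"
  shows "uniform_limit UNIV (\<lambda>n x. LINT y|lborel. mollifier (\<epsilon> n) (x - y) *\<^sub>R G y) G sequentially"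
proof (rule uniform_limitI)
  fix e :: real assume e: "e > 0"
  obtain d where d: "d > 0" "\<And>x y. norm (y - x) \<le> d \<Longrightarrow> norm (G y - G x) \<le> e/2"
    using compact_support_uniformly_continuous[OF assms(1-3), of "e/2"] e by auto
  have "\<forall>\<^sub>F n in sequentially. \<epsilon> n < d" using \<epsilon>(2) d(1) by (rule order_tendstoD)
  then show "\<forall>\<^sub>F n in sequentially. \<forall>x\<in>UNIV. dist (LINT y|lborel. mollifier (\<epsilon> n) (x - y) *\<^sub>R G y) (G x) < e"
  proof eventually_elim
    case (elim n)
    have "norm ((LINT y|lborel. mollifier (\<epsilon> n) (x - y) *\<^sub>R G y) - G x) \<le> e/2" for x
      by (rule mollifier_bound[OF \<epsilon>(1) assms(1)]) (use elim d in auto)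
    then have "norm ((LINT y|lborel. mollifier (\<epsilon> n) (x - y) *\<^sub>R G y) - G x) < e" for x
      by (rule le_less_trans) (use e in simp)
    then show ?case by (simp add: dist_norm)
  qed
qed

text \<open>
  Convolution with mollifiers.  Its derivative falls on the mollifier, and if \<open>\<phi>\<close> is \<open>C\<^sup>1\<close> then
  integration by parts moves it to \<open>\<phi>\<close>, so that the gradients are themselves mollified.
\<close>

theorem mollification:
  fixes \<phi> :: "'a::euclidean_space \<Rightarrow> real"
  assumes "open \<Omega>" "continuous_on UNIV \<phi>" and K: "compact K" "K \<subseteq> \<Omega>" "\<And>x. x \<notin> K \<Longrightarrow> \<phi> x = 0"
  obtains \<zeta> where "\<And>n. \<zeta> n \<in> test_functions \<Omega>"
    "\<And>B n x. (\<And>y. \<bar>\<phi> y\<bar> \<le> B) \<Longrightarrow> \<bar>\<zeta> n x\<bar> \<le> B"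
    "uniform_limit UNIV \<zeta> \<phi> sequentially"
    "C1 \<phi> \<Longrightarrow> uniform_limit UNIV (\<lambda>n. gradient (\<zeta> n)) (gradient \<phi>) sequentially"
proof -
  obtain d where d: "d > 0" "(\<Union>x\<in>K. cball x d) \<subseteq> \<Omega>"
    using compact_subset_open_imp_cball_epsilon_subset[OF K(1) assms(1) K(2)] by auto
  define K' where "K' = (\<Union>x\<in>K. \<Union>y\<in>cball 0 d. {x + y})"
  have K': "compact K'" "K' \<subseteq> \<Omega>"
  proof -
    show "compact K'" unfolding K'_def by (rule compact_sums'[OF K(1) compact_cball])
    have "x + y \<in> (\<Union>x\<in>K. cball x d)" if "x \<in> K" "norm y \<le> d" for x y
      using that by (intro UN_I[of x]) (auto simp: dist_norm)
    then show "K' \<subseteq> \<Omega>" using d(2) by (auto simp: K'_def)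
  qed
  define \<epsilon> where "\<epsilon> n = d / real (Suc n)" for n
  have \<epsilon>: "\<epsilon> n > 0" "\<epsilon> n \<le> d" for n using d(1) by (auto simp: \<epsilon>_def field_simps)
  have \<epsilon>0: "\<epsilon> \<longlonglongrightarrow> 0" unfolding \<epsilon>_def using LIMSEQ_Suc[OF lim_const_over_n[of d]] by simp
  define \<zeta> where "\<zeta> n x = (LINT y|lborel. \<phi> y * mollifier (\<epsilon> n) (x - y))" for n x
  have \<zeta>': "\<zeta> n x = (LINT y|lborel. mollifier (\<epsilon> n) (x - y) *\<^sub>R \<phi> y)" for n x
    unfolding \<zeta>_def by (simp add: mult.commute)
  have z: "\<zeta> n x = 0" if "x \<notin> K'" for n x
  proof -
    have "\<phi> y * mollifier (\<epsilon> n) (x - y) = 0" for y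
    proof (cases "y \<in> K")
      case True
      then have "x - y \<notin> cball 0 d" using that unfolding K'_def by force
      then show ?thesis using mollifier_zero[OF \<epsilon>(1), of "x - y" n] \<epsilon>(2)[of n] by auto
    qed (use K in simp)
    then show ?thesis unfolding \<zeta>_def by (simp only: Bochner_Integration.integral_zero)
  qed
  have r1: "\<zeta> n \<in> test_functions \<Omega>" for n
  proof (rule test_functionsI[OF _ K' z])
    show "continuously_differentiable k (\<zeta> n)" for k
      unfolding \<zeta>_def[abs_def]
      by (rule continuously_differentiable_convolution[OF assms(2) K(1,3) mollifier_smooth])
  qed
  have r2: "\<bar>\<zeta> n x\<bar> \<le> B" if "\<And>y. \<bar>\<phi> y\<bar> \<le> B" for B n x
    using mollifier_bound[OF \<epsilon>(1) assms(2), of x n 0 B] that by (simp add: \<zeta>')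
  have r3: "uniform_limit UNIV \<zeta> \<phi> sequentially"
    using mollifier_converges_uniformly[OF assms(2) K(1,3) \<epsilon>(1) \<epsilon>0] by (simp add: \<zeta>'[abs_def])
  have r4: "uniform_limit UNIV (\<lambda>n. gradient (\<zeta> n)) (gradient \<phi>) sequentially" if C: "C1 \<phi>"
  proof -
    have \<phi>c: "\<phi> \<in> C1c \<Omega>" using C K unfolding C1c_def by auto
    have "gradient (\<zeta> n) x = (LINT y|lborel. mollifier (\<epsilon> n) (x - y) *\<^sub>R gradient \<phi> y)" for n x
    proof -
      have "gradient (\<zeta> n) x = (LINT y|lborel. \<phi> y *\<^sub>R gradient (mollifier (\<epsilon> n)) (x - y))"
        unfolding \<zeta>_def[abs_def]
        by (rule gradient_eqI[OF has_derivative_convolution[OF assms(2) K(1,3) C1_mollifier]])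
      moreover
      have 1: "((\<lambda>y. mollifier (\<epsilon> n) (x - y)) has_derivative (\<lambda>h. (- gradient (mollifier (\<epsilon> n)) (x - y)) \<bullet> h)) (at y)" for y
        by (rule has_derivative_eq_rhs[OF has_derivative_compose[OF _ C1_has_derivative[OF C1_mollifier]]])
           (auto intro!: derivative_eq_intros)
      have 2: "continuous_on UNIV (\<lambda>y. - gradient (mollifier (\<epsilon> n)) (x - y))"
        by (intro continuous_intros continuous_on_compose2[OF C1_continuous_gradient[OF C1_mollifier, of UNIV]]) auto
      have "(LINT y|lborel. mollifier (\<epsilon> n) (x - y) *\<^sub>R gradient \<phi> y) =
         - (LINT y|lborel. \<phi> y *\<^sub>R - gradient (mollifier (\<epsilon> n)) (x - y))"
        using integration_by_parts[OF C1I(1)[OF 1 2] \<phi>c] unfolding C1I(2)[OF 1 2] .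
      ultimately show ?thesis by simp
    qed
    moreover obtain L where L: "compact L" "\<And>x. x \<notin> L \<Longrightarrow> gradient \<phi> x = 0" using C1c_support[OF \<phi>c] by metis
    ultimately show ?thesis
      using mollifier_converges_uniformly[OF C1_continuous_gradient[OF C] L \<epsilon>(1) \<epsilon>0] by presburger
  qed
  show ?thesis by (rule that[OF r1 r2 r3 r4])
qed

section \<open>Approximation of indicator functions\<close>

lemma powr_add_le:
  fixes a b p :: real
  assumes "a \<ge> 0" "b \<ge> 0" "p > 0"
  shows "(a + b) powr p \<le> 2 powr p * (a powr p + b powr p)"
proof -
  have "(a + b) powr p \<le> (2 * max a b) powr p"
    using assms by (intro powr_mono2) auto
  also have "\<dots> = 2 powr p * (max a b) powr p"
    using assms by (simp add: powr_mult)
  also have "\<dots> \<le> 2 powr p * (a powr p + b powr p)"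
    by (intro mult_left_mono) (auto simp: max_def)
  finally show ?thesis .
qed

text \<open>
  Integrated, with a suitable \<open>\<delta>\<close>, this elementary bound does the work of Hoelder's inequality
  throughout.
\<close>

lemma le_delta_powr:
  fixes t :: real
  assumes "t \<ge> 0" "\<delta> > 0" "r \<ge> 1"
  shows "t \<le> \<delta> + \<delta> powr (1 - r) * t powr r"
proof (cases "t \<le> \<delta>")
  case True
  then show ?thesis by (smt (verit) mult_nonneg_nonneg powr_ge_zero)
next
  case False
  have "t = t powr (1 - r) * t powr r" using False assms by (simp add: powr_add[symmetric])
  also have "\<dots> \<le> \<delta> powr (1 - r) * t powr r"
    using False assms by (intro mult_right_mono powr_mono2') auto
  finally show ?thesis using assms by simp
qed

lemma infdist_neighbourhood:
  fixes K \<Omega> :: "'a::euclidean_space set"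
  assumes "compact K" "open \<Omega>" "K \<subseteq> \<Omega>" "K \<noteq> {}"
  obtains e where "e > 0" "{x. infdist x K \<le> e} \<subseteq> \<Omega>"
proof -
    obtain e where e: "e > 0" "(\<Union>x\<in>K. cball x e) \<subseteq> \<Omega>"
      using compact_subset_open_imp_cball_epsilon_subset[OF assms(1,2,3)] by auto
    have "{x. infdist x K \<le> e} \<subseteq> (\<Union>x\<in>K. cball x e)"
    proof
      fix x assume "x \<in> {x. infdist x K \<le> e}"
      moreover obtain y where "y \<in> K" "infdist x K = dist x y"
        using infdist_attains_inf[OF compact_imp_closed[OF assms(1)] assms(4)] by metis
      ultimately show "x \<in> (\<Union>x\<in>K. cball x e)" by (auto simp: dist_commute)
    qed
    then show ?thesis using e that by blast
qed

text \<open>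
  The cut-offs \<open>max 0 (1 - n dist(x,K))\<close>, suitably scaled, decrease to the indicator of \<open>K\<close>.  They
  are mollified up to an error \<open>1/n\<close>; the common bound and the common support are there for
  dominated convergence.
\<close>

lemma indicator_approximation:
  fixes K \<Omega> :: "'a::euclidean_space set"
  assumes "compact K" "open \<Omega>" "K \<subseteq> \<Omega>"
  obtains \<zeta> K' where "\<And>n. \<zeta> n \<in> test_functions \<Omega>" "compact K'" "K' \<subseteq> \<Omega>"
    "\<And>n x. x \<notin> K' \<Longrightarrow> \<zeta> n x = 0" "\<And>n x. \<bar>\<zeta> n x\<bar> \<le> 1"
    "\<And>x. (\<lambda>n::nat. \<zeta> n x) \<longlonglongrightarrow> indicator K x"
proof (cases "K = {}")
  case True
  have "(\<lambda>x. 0) \<in> test_functions \<Omega>"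
    by (rule test_functionsI[of _ "{}"]) (auto simp: continuously_differentiable_const)
  then show ?thesis using True by (intro that[of "\<lambda>_ _. 0" "{}"]) auto
next
  case False
  obtain e where e: "e > 0" "{x. infdist x K \<le> e} \<subseteq> \<Omega>"
    using infdist_neighbourhood[OF assms False] by metis
  define K' where "K' = {x. infdist x K \<le> e}"
  define U where "U = {x. infdist x K < e}"
  have K': "compact K'" unfolding K'_def by (rule compact_infdist_le[OF False assms(1) e(1)])
  have U: "open U" unfolding U_def by (intro open_Collect_less continuous_intros)
  define \<psi> where "\<psi> n x = max 0 (1 - real (Suc n) * (2/e) * infdist x K)" for n x
  have z: "\<exists>\<zeta>. \<zeta> \<in> test_functions U \<and> (\<forall>x. \<bar>\<zeta> x\<bar> \<le> 1) \<and> (\<forall>x. \<bar>\<zeta> x - \<psi> n x\<bar> \<le> 1 / real (Suc n))" for n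
  proof -
    have c: "continuous_on UNIV (\<psi> n)" unfolding \<psi>_def by (intro continuous_intros)
    have k: "compact {x. infdist x K \<le> e/2}" by (rule compact_infdist_le[OF False assms(1)]) (use e in simp)
    have ku: "{x. infdist x K \<le> e/2} \<subseteq> U" using e by (auto simp: U_def)
    have s: "\<psi> n x = 0" if "x \<notin> {x. infdist x K \<le> e/2}" for x
    proof -
      have "1 \<le> (2/e) * infdist x K" using that e(1) by (simp add: field_simps)
      also have "\<dots> \<le> real (Suc n) * ((2/e) * infdist x K)"
        using infdist_nonneg[of x K] e(1) mult_right_mono[of 1 "real (Suc n)" "(2/e) * infdist x K"] by simp
      finally show ?thesis unfolding \<psi>_def mult.assoc by linarith
    qed
    have b: "\<bar>\<psi> n y\<bar> \<le> 1" for y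
      using infdist_nonneg[of y K] e(1) by (simp add: \<psi>_def)
    obtain \<zeta> where \<zeta>: "\<And>n. \<zeta> n \<in> test_functions U" "\<And>B j x. (\<And>y. \<bar>\<psi> n y\<bar> \<le> B) \<Longrightarrow> \<bar>\<zeta> j x\<bar> \<le> B"
        "uniform_limit UNIV \<zeta> (\<psi> n) sequentially"
      using mollification[OF U c k ku s] by metis
    have "\<forall>\<^sub>F j in sequentially. \<forall>x\<in>UNIV. dist (\<zeta> j x) (\<psi> n x) < 1 / real (Suc n)"
      by (rule uniform_limitD[OF \<zeta>(3)]) simp
    then obtain j where "\<And>x. \<bar>\<zeta> j x - \<psi> n x\<bar> < 1 / real (Suc n)"
      by (auto simp: eventually_sequentially dist_real_def)
    then show ?thesis using \<zeta>(1,2) b by (intro exI[of _ "\<zeta> j"]) (auto intro: less_imp_le)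
  qed
  then obtain \<zeta> where \<zeta>: "\<And>n. \<zeta> n \<in> test_functions U" "\<And>n x. \<bar>\<zeta> n x\<bar> \<le> 1"
    "\<And>n x. \<bar>\<zeta> n x - \<psi> n x\<bar> \<le> 1 / real (Suc n)" by metis
  have sup: "closure {x. \<zeta> n x \<noteq> 0} \<subseteq> U" for n using \<zeta>(1) by (simp add: test_functions_def)
  have UK: "U \<subseteq> K'" by (auto simp: U_def K'_def)
  have "\<zeta> n \<in> test_functions \<Omega>" for n
    using \<zeta>(1)[of n] UK e(2) by (auto simp: test_functions_def K'_def)
  moreover have "\<zeta> n x = 0" if "x \<notin> K'" for n x
    using sup[of n] UK that closure_subset[of "{x. \<zeta> n x \<noteq> 0}"] by blast
  moreover have "(\<lambda>n. \<zeta> n x) \<longlonglongrightarrow> indicator K x" for x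
  proof -
    have "(\<lambda>n. \<psi> n x) \<longlonglongrightarrow> indicator K x"
    proof (cases "x \<in> K")
      case False
      then have pos: "infdist x K > 0"
        using \<open>K \<noteq> {}\<close> assms(1) by (meson compact_imp_closed infdist_pos_not_in_closed)
      have "filterlim (\<lambda>n. real (Suc n) * ((2/e) * infdist x K)) at_top sequentially"
        by (rule filterlim_at_top_mult_tendsto_pos[OF tendsto_const _ filterlim_compose[OF filterlim_real_sequentially filterlim_Suc]])
           (use pos e(1) in simp)
      then have "\<forall>\<^sub>F n in sequentially. real (Suc n) * ((2/e) * infdist x K) \<ge> 1"
        by (simp add: filterlim_at_top)
      then have "\<forall>\<^sub>F n in sequentially. \<psi> n x = 0"
        unfolding \<psi>_def mult.assoc by eventually_elim linarith
      then show ?thesis using False by (simp add: tendsto_eventually)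
    qed (simp add: \<psi>_def)
    moreover have "(\<lambda>n. \<zeta> n x - \<psi> n x) \<longlonglongrightarrow> 0"
      by (rule Lim_null_comparison[OF _ LIMSEQ_Suc[OF lim_const_over_n[of 1]]]) (use \<zeta>(3) in auto)
    ultimately show ?thesis using tendsto_add by force
  qed
  ultimately show ?thesis using that[of \<zeta> K'] K' \<zeta>(2) e(2) K'_def by blast
qed

text \<open>
  Mollify a continuous cut-off that is \<open>1\<close> on the \<open>\<delta>\<close>-neighbourhood of \<open>K\<close>, with a mollifier
  supported in the \<open>\<delta>\<close>-ball.
\<close>

lemma cutoff_function:
  fixes K \<Omega> :: "'a::euclidean_space set"
  assumes "compact K" "open \<Omega>" "K \<subseteq> \<Omega>"
  obtains \<psi> where "\<psi> \<in> test_functions \<Omega>" "\<And>x. x \<in> K \<Longrightarrow> \<psi> x = 1"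
proof (cases "K = {}")
  case True
  have "(\<lambda>x. 0) \<in> test_functions \<Omega>"
    by (rule test_functionsI[of _ "{}"]) (auto simp: continuously_differentiable_const)
  then show ?thesis using True by (intro that) auto
next
  case False
  obtain e where e: "e > 0" "{x. infdist x K \<le> e} \<subseteq> \<Omega>"
    using infdist_neighbourhood[OF assms False] by metis
  define \<delta> where "\<delta> = e / 3"
  have \<delta>: "\<delta> > 0" using e by (simp add: \<delta>_def)
  define \<phi> where "\<phi> x = max 0 (min 1 (2 - infdist x K / \<delta>))" for x
  have c: "continuous_on UNIV \<phi>" unfolding \<phi>_def by (intro continuous_intros) (use \<delta> in auto)
  have k: "compact {x. infdist x K \<le> 2 * \<delta>}" by (rule compact_infdist_le[OF False assms(1)]) (use \<delta> in simp)
  have z: "\<phi> x = 0" if "x \<notin> {x. infdist x K \<le> 2 * \<delta>}" for x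
  proof -
    have "infdist x K / \<delta> \<ge> 2" using that \<delta> by (simp add: field_simps)
    then show ?thesis unfolding \<phi>_def by linarith
  qed
  define \<psi> where "\<psi> x = (LINT y|lborel. \<phi> y * mollifier \<delta> (x - y))" for x
  have \<psi>': "\<psi> x = (LINT y|lborel. mollifier \<delta> (x - y) *\<^sub>R \<phi> y)" for x
    unfolding \<psi>_def by (simp add: mult.commute)
  have near: "infdist x K \<le> infdist y K + \<delta>" if "norm (y - x) \<le> \<delta>" for x y
    using infdist_triangle[of x K y] that by (simp add: dist_norm norm_minus_commute)
  have "\<psi> \<in> test_functions \<Omega>"
  proof (rule test_functionsI[OF _ _ e(2)])
    show "continuously_differentiable k \<psi>" for k
      unfolding \<psi>_def[abs_def] by (rule continuously_differentiable_convolution[OF c k z mollifier_smooth])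
    show "compact {x. infdist x K \<le> e}" by (rule compact_infdist_le[OF False assms(1) e(1)])
    fix x assume x: "x \<notin> {x. infdist x K \<le> e}"
    have "norm ((LINT y|lborel. mollifier \<delta> (x - y) *\<^sub>R \<phi> y) - 0) \<le> 0"
    proof (rule mollifier_bound[OF \<delta> c])
      fix y assume "norm (y - x) \<le> \<delta>"
      from near[OF this] show "norm (\<phi> y - 0) \<le> 0" using x z[of y] by (auto simp: \<delta>_def)
    qed
    then show "\<psi> x = 0" by (simp add: \<psi>')
  qed
  moreover have "\<psi> x = 1" if "x \<in> K" for x
  proof -
    have "norm ((LINT y|lborel. mollifier \<delta> (x - y) *\<^sub>R \<phi> y) - 1) \<le> 0"
    proof (rule mollifier_bound[OF \<delta> c])
      fix y assume "norm (y - x) \<le> \<delta>"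
      then have "infdist y K \<le> \<delta>" using near[of x y] that by (simp add: norm_minus_commute)
      then have "infdist y K / \<delta> \<le> 1" using \<delta> by simp
      then have "\<phi> y = 1" unfolding \<phi>_def by linarith
      then show "norm (\<phi> y - 1) \<le> 0" by simp
    qed
    then show ?thesis by (simp add: \<psi>')
  qed
  ultimately show ?thesis using that by blast
qed

section \<open>Convergence in the mean of order p\<close>

locale bounded_open_set =
  fixes \<Omega> :: "'a::euclidean_space set" and p :: real
  assumes open_domain: "open \<Omega>" and bounded_domain: "bounded \<Omega>" and p_gt_1: "1 < p"
begin

abbreviation M where "M \<equiv> lebesgue_on \<Omega>"

abbreviation energy :: "('a \<Rightarrow> real) \<Rightarrow> real" where
  "energy \<phi> \<equiv> (LINT x|M. norm (gradient \<phi> x) powr p)"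

abbreviation mass :: "('a \<Rightarrow> real) \<Rightarrow> ('a \<Rightarrow> real) \<Rightarrow> real" where
  "mass h \<phi> \<equiv> (LINT x|M. h x * \<bar>\<phi> x\<bar> powr p)"

lemma sets_domain [measurable, simp]: "\<Omega> \<in> sets lebesgue"
  using open_domain by simp

lemma emeasure_domain: "emeasure lebesgue \<Omega> < \<infinity>"
  using emeasure_bounded_finite[OF bounded_domain] open_domain by simp

sublocale finite_measure M
  by (rule finite_measureI) (use emeasure_domain in \<open>simp add: emeasure_restrict_space\<close>)

lemma borel_measurable_M: "f \<in> borel_measurable borel \<Longrightarrow> f \<in> borel_measurable M"
  by (simp add: measurable_completion measurable_restrict_space1)

lemma continuous_measurable_M: 
  fixes f :: "'a \<Rightarrow> 'b::euclidean_space" 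
  shows "continuous_on UNIV f \<Longrightarrow> f \<in> borel_measurable M"
  by (intro borel_measurable_M borel_measurable_continuous_onI)

lemma C1c_measurable:
  assumes "\<phi> \<in> C1c \<Omega>"
  shows "\<phi> \<in> borel_measurable M" "gradient \<phi> \<in> borel_measurable M"
  by (intro continuous_measurable_M C1_continuous C1_continuous_gradient C1c_imp_C1[OF assms])+

lemma sets_M_subset: "B \<in> sets lebesgue \<Longrightarrow> B \<subseteq> \<Omega> \<Longrightarrow> B \<in> sets M"
  by (auto simp: sets_restrict_space_iff)

lemma compact_sets_M: "compact K \<Longrightarrow> K \<subseteq> \<Omega> \<Longrightarrow> K \<in> sets M"
  by (intro sets_M_subset) (auto intro: lmeasurable_compact fmeasurableD)

lemma ball_sets_M: "ball z r \<subseteq> \<Omega> \<Longrightarrow> ball z r \<in> sets M"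
  by (rule sets_M_subset) auto

lemma sets_M_Collect:
  assumes "B \<in> sets M" and P: "Measurable.pred M P"
  shows "{x\<in>B. P x} \<in> sets M"
proof -
  have "{x\<in>B. P x} = B \<inter> {x\<in>space M. P x}"
    using sets.sets_into_space[OF assms(1)] by auto
  then show ?thesis using sets.Int[OF assms(1) predE[OF P]] by (simp only:)
qed

lemma LpD:
  assumes "f \<in> Lp \<Omega> r"
  shows "f \<in> borel_measurable M" "integrable M (\<lambda>x. norm (f x) powr r)"
  using assms by (auto simp: Lp_def)

lemma Lp_dominated:
  fixes f :: "'a \<Rightarrow> 'b::euclidean_space" and g :: "'a \<Rightarrow> 'c::euclidean_space"
  assumes "g \<in> Lp \<Omega> p" "f \<in> borel_measurable M" "AE x in M. norm (f x) \<le> C * norm (g x)"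
  shows "f \<in> Lp \<Omega> p"
proof -
  have m: "(\<lambda>x. norm (f x) powr p) \<in> borel_measurable M" using assms(2) by measurable
  have "integrable M (\<lambda>x. norm (f x) powr p)"
  proof (rule Bochner_Integration.integrable_bound[OF _ m])
    show "integrable M (\<lambda>x. \<bar>C\<bar> powr p * norm (g x) powr p)" using LpD(2)[OF assms(1)] by simp
    show "AE x in M. norm (norm (f x) powr p) \<le> norm (\<bar>C\<bar> powr p * norm (g x) powr p)"
      using assms(3)
    proof eventually_elim
      case (elim x)
      have "norm (f x) \<le> \<bar>C\<bar> * norm (g x)"
        using elim by (meson abs_ge_self mult_right_mono norm_ge_zero order_trans)
      then have "norm (f x) powr p \<le> (\<bar>C\<bar> * norm (g x)) powr p"
        using p_gt_1 by (intro powr_mono2) auto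
      then show ?case by (simp add: powr_mult)
    qed
  qed
  then show ?thesis using assms(2) by (simp add: Lp_def)
qed

lemma Lp_add:
  fixes f g :: "'a \<Rightarrow> 'b::euclidean_space"
  assumes "f \<in> Lp \<Omega> p" "g \<in> Lp \<Omega> p"
  shows "(\<lambda>x. f x + g x) \<in> Lp \<Omega> p"
proof -
  note [measurable] = LpD(1)[OF assms(1)] LpD(1)[OF assms(2)]
  have "integrable M (\<lambda>x. norm (f x + g x) powr p)"
  proof (rule Bochner_Integration.integrable_bound)
    show "integrable M (\<lambda>x. 2 powr p * (norm (f x) powr p + norm (g x) powr p))"
      using LpD(2)[OF assms(1)] LpD(2)[OF assms(2)] by simp
    show "AE x in M. norm (norm (f x + g x) powr p) \<le> norm (2 powr p * (norm (f x) powr p + norm (g x) powr p))"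
    proof (rule AE_I2)
      fix x
      have "norm (f x + g x) powr p \<le> (norm (f x) + norm (g x)) powr p"
        using p_gt_1 by (intro powr_mono2 norm_triangle_ineq) auto
      also have "\<dots> \<le> 2 powr p * (norm (f x) powr p + norm (g x) powr p)"
        using p_gt_1 by (intro powr_add_le) auto
      finally show "norm (norm (f x + g x) powr p) \<le> norm (2 powr p * (norm (f x) powr p + norm (g x) powr p))"
        by (simp add: add_nonneg_nonneg)
    qed
  qed measurable
  then show ?thesis by (simp add: Lp_def)
qed

lemma Lp_diff:
  fixes f g :: "'a \<Rightarrow> 'b::euclidean_space"
  assumes "f \<in> Lp \<Omega> p" "g \<in> Lp \<Omega> p"
  shows "(\<lambda>x. f x - g x) \<in> Lp \<Omega> p"
proof -
  have "(\<lambda>x. - g x) \<in> Lp \<Omega> p"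
    by (rule Lp_dominated[OF assms(2), of _ 1]) (use LpD(1)[OF assms(2)] in auto)
  from Lp_add[OF assms(1) this] show ?thesis by simp
qed

lemma Lp_bounded:
  fixes f :: "'a \<Rightarrow> 'b::euclidean_space"
  assumes "f \<in> borel_measurable M" "AE x in M. norm (f x) \<le> B"
  shows "f \<in> Lp \<Omega> p"
proof -
  have "(\<lambda>x. 1::real) \<in> Lp \<Omega> p" by (simp add: Lp_def)
  then show ?thesis by (rule Lp_dominated[of _ f B]) (use assms in auto)
qed

lemma Lp_scaleR_bounded:
  fixes f :: "'a \<Rightarrow> 'b::euclidean_space" and b :: "'a \<Rightarrow> real"
  assumes "f \<in> Lp \<Omega> p" "b \<in> borel_measurable M" "AE x in M. \<bar>b x\<bar> \<le> B"
  shows "(\<lambda>x. b x *\<^sub>R f x) \<in> Lp \<Omega> p"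
  by (rule Lp_dominated[OF assms(1), of _ B]) 
    (use assms LpD(1)[OF assms(1)] in \<open>auto elim!: eventually_mono intro!: mult_right_mono\<close>)

lemma powr_integrable_imp_integrable:
  fixes f :: "'a \<Rightarrow> 'b::euclidean_space"
  assumes "f \<in> Lp \<Omega> r" "r \<ge> 1"
  shows "integrable M f"
proof (rule Bochner_Integration.integrable_bound)
  show "integrable M (\<lambda>x. 1 + norm (f x) powr r)" using LpD(2)[OF assms(1)] by simp
  show "AE x in M. norm (f x) \<le> norm (1 + norm (f x) powr r)"
    using le_delta_powr[of "norm (f _)" 1 r] assms(2) by (auto intro!: AE_I2)
qed (rule LpD(1)[OF assms(1)])

lemma Lp_integrable:
  fixes f :: "'a \<Rightarrow> 'b::euclidean_space"
  shows "f \<in> Lp \<Omega> p \<Longrightarrow> integrable M f"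
  using powr_integrable_imp_integrable[of f p] p_gt_1 by simp

text \<open>
  Membership of all functions in the space is part of the definition, since the integral of a
  function that is not integrable has the value \<open>0\<close>.
\<close>

definition Lp_limit :: "(nat \<Rightarrow> 'a \<Rightarrow> 'b::euclidean_space) \<Rightarrow> ('a \<Rightarrow> 'b) \<Rightarrow> bool" where
  "Lp_limit f g \<longleftrightarrow> (\<forall>n. f n \<in> Lp \<Omega> p) \<and> g \<in> Lp \<Omega> p \<and>
     (\<lambda>n. LINT x|M. norm (f n x - g x) powr p) \<longlonglongrightarrow> 0"

lemma Lp_limitD:
  assumes "Lp_limit f g"
  shows "f n \<in> Lp \<Omega> p" "g \<in> Lp \<Omega> p" "(\<lambda>n. LINT x|M. norm (f n x - g x) powr p) \<longlonglongrightarrow> 0"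
  using assms by (auto simp: Lp_limit_def)

lemma Lp_limit_subseq: "Lp_limit f g \<Longrightarrow> strict_mono r \<Longrightarrow> Lp_limit (\<lambda>n. f (r n)) g"
  unfolding Lp_limit_def by (auto dest: LIMSEQ_subseq_LIMSEQ simp: o_def)

lemma Lp_limit_const: "g \<in> Lp \<Omega> p \<Longrightarrow> Lp_limit (\<lambda>n. g) g"
  unfolding Lp_limit_def using p_gt_1 by simp

lemma Lp_limit_L1:
  assumes "Lp_limit f g"
  shows "(\<lambda>n. LINT x|M. norm (f n x - g x)) \<longlonglongrightarrow> 0"
proof (rule LIMSEQ_I)
  fix e :: real assume e: "e > 0"
  define D where "D = measure M (space M)"
  have D: "D \<ge> 0" by (simp add: D_def)
  \<comment> \<open>By \<open>le_delta_powr\<close> the \<open>L\<^sup>1\<close> distance is at most \<open>\<delta> D\<close> plus a multiple of the \<open>p\<close>-th power integral.\<close>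
  define \<delta> where "\<delta> = e / (2 * (D + 1))"
  have \<delta>: "\<delta> > 0" using e D by (simp add: \<delta>_def)
  have \<delta>D: "\<delta> * D < e / 2" using e D by (simp add: \<delta>_def field_simps)
  define C where "C = \<delta> powr (1 - p)"
  have "(\<lambda>n. C * (LINT x|M. norm (f n x - g x) powr p)) \<longlonglongrightarrow> C * 0"
    by (intro tendsto_intros Lp_limitD(3)[OF assms])
  then have "\<forall>\<^sub>F n in sequentially. C * (LINT x|M. norm (f n x - g x) powr p) < e/2"
    using e by (intro order_tendstoD) auto
  then obtain N where N: "\<And>n. n \<ge> N \<Longrightarrow> C * (LINT x|M. norm (f n x - g x) powr p) < e/2"
    by (auto simp: eventually_sequentially)
  show "\<exists>N. \<forall>n\<ge>N. norm ((LINT x|M. norm (f n x - g x)) - 0) < e"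
  proof (intro exI allI impI)
    fix n assume n: "n \<ge> N"
    have d: "(\<lambda>x. f n x - g x) \<in> Lp \<Omega> p" using Lp_diff Lp_limitD[OF assms] by blast
    note i = LpD(2)[OF d]
    have "(LINT x|M. norm (f n x - g x)) \<le> (LINT x|M. \<delta> + C * norm (f n x - g x) powr p)"
      using i Lp_integrable[OF d] \<delta> p_gt_1 unfolding C_def
      by (intro integral_mono le_delta_powr) auto
    also have "\<dots> = \<delta> * D + C * (LINT x|M. norm (f n x - g x) powr p)"
      using i by (simp add: D_def)
    also have "\<dots> < e" using \<delta>D N[OF n] by simp
    finally show "norm ((LINT x|M. norm (f n x - g x)) - 0) < e" by simp
  qed
qed

lemma Lp_limit_AE_subseq:
  assumes "Lp_limit f g"
  obtains r where "strict_mono r" "AE x in M. (\<lambda>n. f (r n) x) \<longlonglongrightarrow> g x"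
proof -
  have "integrable M (\<lambda>x. f n x - g x)" for n
    using Lp_integrable Lp_diff Lp_limitD[OF assms] by blast
  from tendsto_L1_AE_subseq[OF this Lp_limit_L1[OF assms]]
  obtain r where r: "strict_mono r" "AE x in M. (\<lambda>n. f (r n) x - g x) \<longlonglongrightarrow> 0" by auto
  from r(2) have "AE x in M. (\<lambda>n. f (r n) x) \<longlonglongrightarrow> g x"
    by eventually_elim (rule LIM_zero_cancel)
  then show ?thesis using that r(1) by blast
qed

text \<open>
  A transfer principle: it covers Lipschitz images, bounded multiples and changes on null sets.
\<close>

lemma Lp_limit_le:
  fixes F :: "nat \<Rightarrow> 'a \<Rightarrow> 'b::euclidean_space" and f :: "nat \<Rightarrow> 'a \<Rightarrow> 'c::euclidean_space"
  assumes "Lp_limit f g" "\<And>n. F n \<in> borel_measurable M" "G \<in> Lp \<Omega> p"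
    and le: "\<And>n. AE x in M. norm (F n x - G x) \<le> C * norm (f n x - g x)"
  shows "Lp_limit F G"
proof -
  have d: "(\<lambda>x. f n x - g x) \<in> Lp \<Omega> p" for n using Lp_diff Lp_limitD[OF assms(1)] by blast
  have D: "(\<lambda>x. F n x - G x) \<in> Lp \<Omega> p" for n
    by (rule Lp_dominated[OF d _ le]) (use assms(2) LpD(1)[OF assms(3)] in measurable)
  have FL: "F n \<in> Lp \<Omega> p" for n using Lp_add[OF D assms(3)] by simp
  have b: "(LINT x|M. norm (F n x - G x) powr p) \<le> \<bar>C\<bar> powr p * (LINT x|M. norm (f n x - g x) powr p)" for n
  proof -
    have "(LINT x|M. norm (F n x - G x) powr p) \<le> (LINT x|M. \<bar>C\<bar> powr p * norm (f n x - g x) powr p)"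
    proof (rule integral_mono_AE)
      show "AE x in M. norm (F n x - G x) powr p \<le> \<bar>C\<bar> powr p * norm (f n x - g x) powr p"
        using le[of n]
      proof eventually_elim
        case (elim x)
        have "norm (F n x - G x) \<le> \<bar>C\<bar> * norm (f n x - g x)"
          using elim by (meson abs_ge_self mult_right_mono norm_ge_zero order_trans)
        then have "norm (F n x - G x) powr p \<le> (\<bar>C\<bar> * norm (f n x - g x)) powr p"
          using p_gt_1 by (intro powr_mono2) auto
        then show ?case by (simp add: powr_mult)
      qed
    qed (use LpD(2)[OF D] LpD(2)[OF d] in auto)
    then show ?thesis by simp
  qed
  have "(\<lambda>n. LINT x|M. norm (F n x - G x) powr p) \<longlonglongrightarrow> 0"
  proof (rule tendsto_sandwich[OF _ _ tendsto_const])
    show "(\<lambda>n. \<bar>C\<bar> powr p * (LINT x|M. norm (f n x - g x) powr p)) \<longlonglongrightarrow> 0"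
      using tendsto_mult_right_zero[OF Lp_limitD(3)[OF assms(1)]] .
  qed (use b in auto)
  then show ?thesis using FL assms(3) by (simp add: Lp_limit_def)
qed

lemma Lp_limit_add:
  assumes "Lp_limit f g" "Lp_limit f' g'"
  shows "Lp_limit (\<lambda>n x. f n x + f' n x) (\<lambda>x. g x + g' x)"
proof -
  have d: "(\<lambda>x. f n x - g x) \<in> Lp \<Omega> p" for n using Lp_diff Lp_limitD[OF assms(1)] by blast
  have d': "(\<lambda>x. f' n x - g' x) \<in> Lp \<Omega> p" for n using Lp_diff Lp_limitD[OF assms(2)] by blast
  have D: "(\<lambda>x. f n x + f' n x - (g x + g' x)) \<in> Lp \<Omega> p" for n
    using Lp_add[OF d d'] by (simp add: algebra_simps)
  have b: "(LINT x|M. norm (f n x + f' n x - (g x + g' x)) powr p) \<le>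
     2 powr p * ((LINT x|M. norm (f n x - g x) powr p) + (LINT x|M. norm (f' n x - g' x) powr p))" for n
  proof -
    have "(LINT x|M. norm (f n x + f' n x - (g x + g' x)) powr p) \<le>
      (LINT x|M. 2 powr p * (norm (f n x - g x) powr p + norm (f' n x - g' x) powr p))"
    proof (rule integral_mono)
      fix x
      have "norm (f n x + f' n x - (g x + g' x)) \<le> norm (f n x - g x) + norm (f' n x - g' x)"
        by (rule norm_diff_triangle_ineq)
      then have "norm (f n x + f' n x - (g x + g' x)) powr p \<le> (norm (f n x - g x) + norm (f' n x - g' x)) powr p"
        using p_gt_1 by (intro powr_mono2) auto
      also have "\<dots> \<le> 2 powr p * (norm (f n x - g x) powr p + norm (f' n x - g' x) powr p)"
        using p_gt_1 by (intro powr_add_le) auto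
      finally show "norm (f n x + f' n x - (g x + g' x)) powr p \<le> 2 powr p * (norm (f n x - g x) powr p + norm (f' n x - g' x) powr p)" .
    qed (use LpD(2)[OF D] LpD(2)[OF d] LpD(2)[OF d'] in auto)
    then show ?thesis using LpD(2)[OF d] LpD(2)[OF d'] by simp
  qed
  have "(\<lambda>n. LINT x|M. norm (f n x + f' n x - (g x + g' x)) powr p) \<longlonglongrightarrow> 0"
  proof (rule tendsto_sandwich[OF _ _ tendsto_const])
    show "(\<lambda>n. 2 powr p * ((LINT x|M. norm (f n x - g x) powr p) + (LINT x|M. norm (f' n x - g' x) powr p))) \<longlonglongrightarrow> 0"
      using tendsto_mult_right_zero[OF tendsto_add_zero[OF Lp_limitD(3)[OF assms(1)] Lp_limitD(3)[OF assms(2)]]] .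
  qed (use b in auto)
  then show ?thesis using Lp_add Lp_limitD[OF assms(1)] Lp_limitD[OF assms(2)] by (auto simp: Lp_limit_def)
qed

lemma Lp_limit_dominated:
  fixes F :: "nat \<Rightarrow> 'a \<Rightarrow> 'b::euclidean_space" and h :: "'a \<Rightarrow> 'c::euclidean_space"
  assumes m: "\<And>n. F n \<in> borel_measurable M" "G \<in> borel_measurable M" and h: "h \<in> Lp \<Omega> p"
    and b: "\<And>n. AE x in M. norm (F n x) \<le> norm (h x)" and lim: "AE x in M. (\<lambda>n. F n x) \<longlonglongrightarrow> G x"
  shows "Lp_limit F G"
proof -
  have "AE x in M. \<forall>n. norm (F n x) \<le> norm (h x)" using b by (simp add: AE_all_countable)
  with lim have bG: "AE x in M. norm (G x) \<le> norm (h x)"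
  proof eventually_elim
    case (elim x)
    then show ?case using Lim_bounded[OF tendsto_norm[OF elim(1)], of 0] by auto
  qed
  have FL: "F n \<in> Lp \<Omega> p" for n by (rule Lp_dominated[OF h m(1), of n 1]) (use b[of n] in simp)
  have GL: "G \<in> Lp \<Omega> p" by (rule Lp_dominated[OF h m(2), of 1]) (use bG in simp)
  have "(\<lambda>n. LINT x|M. norm (F n x - G x) powr p) \<longlonglongrightarrow> (LINT x|M. 0)"
  proof (rule integral_dominated_convergence)
    show "integrable M (\<lambda>x. 2 powr p * norm (h x) powr p)" using LpD(2)[OF h] by simp
    show "AE x in M. (\<lambda>n. norm (F n x - G x) powr p) \<longlonglongrightarrow> 0"
      using lim
    proof eventually_elim
      case (elim x)
      have "(\<lambda>n. norm (F n x - G x)) \<longlonglongrightarrow> 0"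
        using elim by (simp add: LIM_zero tendsto_norm_zero)
      then have "(\<lambda>n. norm (F n x - G x) powr p) \<longlonglongrightarrow> 0 powr p"
        using p_gt_1 by (intro tendsto_powr2 tendsto_const) auto
      then show ?case using p_gt_1 by simp
    qed
    show "AE x in M. norm (norm (F n x - G x) powr p) \<le> 2 powr p * norm (h x) powr p" for n
      using b[of n] bG
    proof eventually_elim
      case (elim x)
      have "norm (F n x - G x) \<le> 2 * norm (h x)"
        using elim norm_triangle_ineq4[of "F n x" "G x"] by linarith
      then have "norm (F n x - G x) powr p \<le> (2 * norm (h x)) powr p"
        using p_gt_1 by (intro powr_mono2) auto
      then show ?case by (simp add: powr_mult)
    qed
  qed (use m in measurable)
  then show ?thesis using FL GL by (simp add: Lp_limit_def)
qed

text \<open>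
  Split \<open>b\<^sub>n f\<^sub>n - c g\<close> into \<open>b\<^sub>n (f\<^sub>n - g)\<close>, bounded by a multiple of \<open>|f\<^sub>n - g|\<close>, and
  \<open>(b\<^sub>n - c) g\<close>, which converges dominatedly.
\<close>

lemma Lp_limit_scaleR:
  fixes f :: "nat \<Rightarrow> 'a \<Rightarrow> 'b::euclidean_space" and b :: "nat \<Rightarrow> 'a \<Rightarrow> real"
  assumes f: "Lp_limit f g" and m: "\<And>n. b n \<in> borel_measurable M" "c \<in> borel_measurable M"
    and B: "\<And>n. AE x in M. \<bar>b n x\<bar> \<le> B" and lim: "AE x in M. (\<lambda>n. b n x) \<longlonglongrightarrow> c x"
  shows "Lp_limit (\<lambda>n x. b n x *\<^sub>R f n x) (\<lambda>x. c x *\<^sub>R g x)"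
proof -
  note [measurable] = m LpD(1)[OF Lp_limitD(1)[OF f]] LpD(1)[OF Lp_limitD(2)[OF f]]
  have 1: "Lp_limit (\<lambda>n x. b n x *\<^sub>R (f n x - g x)) (\<lambda>x. 0)"
  proof (rule Lp_limit_le[OF f])
    show "AE x in M. norm (b n x *\<^sub>R (f n x - g x) - 0) \<le> B * norm (f n x - g x)" for n
      using B[of n] by (auto elim!: eventually_mono intro!: mult_right_mono)
    show "(\<lambda>x. 0) \<in> Lp \<Omega> p" by (simp add: Lp_def)
  qed measurable
  have 2: "Lp_limit (\<lambda>n x. b n x *\<^sub>R g x) (\<lambda>x. c x *\<^sub>R g x)"
  proof (rule Lp_limit_dominated)
    show "(\<lambda>x. \<bar>B\<bar> *\<^sub>R g x) \<in> Lp \<Omega> p"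
      by (rule Lp_scaleR_bounded[OF Lp_limitD(2)[OF f]]) auto
    show "AE x in M. norm (b n x *\<^sub>R g x) \<le> norm (\<bar>B\<bar> *\<^sub>R g x)" for n
      using B[of n] by (auto elim!: eventually_mono intro!: mult_right_mono)
    show "AE x in M. (\<lambda>n. b n x *\<^sub>R g x) \<longlonglongrightarrow> c x *\<^sub>R g x"
      using lim by eventually_elim (intro tendsto_intros)
  qed measurable
  from Lp_limit_add[OF 1 2] show ?thesis by (simp add: scaleR_diff_right)
qed

section \<open>The Sobolev space\<close>

lemma AE_M_iff: "(AE x in M. P x) \<longleftrightarrow> (AE x in lebesgue. x \<in> \<Omega> \<longrightarrow> P x)"
  by (subst AE_restrict_space_iff) auto

lemma integrable_M_imp_absolutely_integrable_on:
  fixes f :: "'a \<Rightarrow> 'b::euclidean_space"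
  assumes "integrable M f" "compact K" "K \<subseteq> \<Omega>"
  shows "f absolutely_integrable_on K"
proof -
  have "set_integrable lebesgue \<Omega> f"
    using assms(1) by (simp add: set_integrable_def integrable_restrict_space)
  then show ?thesis
    by (rule set_integrable_subset) (use assms in \<open>auto intro: lmeasurable_compact fmeasurableD\<close>)
qed

lemma integrable_M_test_function:
  fixes g :: "'a \<Rightarrow> 'b::euclidean_space"
  assumes K: "compact K" "K \<subseteq> \<Omega>" and g: "g absolutely_integrable_on K"
    and \<phi>: "continuous_on UNIV \<phi>" "\<And>x. x \<notin> K \<Longrightarrow> \<phi> x = (0::real)" "\<And>x. \<bar>\<phi> x\<bar> \<le> B"
  shows "integrable M (\<lambda>x. \<phi> x *\<^sub>R g x)"
    and "(LINT x|M. \<phi> x *\<^sub>R g x) = (LINT x|lebesgue. \<phi> x *\<^sub>R (indicator K x *\<^sub>R g x))"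
proof -
  have eq: "indicator \<Omega> x *\<^sub>R (\<phi> x *\<^sub>R g x) = \<phi> x *\<^sub>R (indicator K x *\<^sub>R g x)" for x
    using K(2) \<phi>(2)[of x] by (auto simp: indicator_def)
  have [measurable]: "\<phi> \<in> borel_measurable lebesgue"
    by (intro measurable_completion) (simp add: borel_measurable_continuous_onI \<phi>(1))
  have gi: "integrable lebesgue (\<lambda>x. indicator K x *\<^sub>R g x)" using g by (simp add: set_integrable_def)
  have "integrable lebesgue (\<lambda>x. \<phi> x *\<^sub>R (indicator K x *\<^sub>R g x))"
  proof (rule Bochner_Integration.integrable_bound)
    show "integrable lebesgue (\<lambda>x. B * norm (indicator K x *\<^sub>R g x))"
      by (intro integrable_mult_right integrable_norm gi)
    show "AE x in lebesgue. norm (\<phi> x *\<^sub>R (indicator K x *\<^sub>R g x)) \<le> norm (B * norm (indicator K x *\<^sub>R g x))"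
    proof (rule AE_I2)
      fix x
      have "\<bar>\<phi> x\<bar> \<le> \<bar>B\<bar>" using \<phi>(3)[of x] by linarith
      then show "norm (\<phi> x *\<^sub>R (indicator K x *\<^sub>R g x)) \<le> norm (B * norm (indicator K x *\<^sub>R g x))"
        by (simp add: abs_mult mult.assoc mult_right_mono)
    qed
  qed (use borel_measurable_integrable[OF gi] in measurable)
  then show "integrable M (\<lambda>x. \<phi> x *\<^sub>R g x)"
    by (subst integrable_restrict_space) (auto simp only: eq sets_domain Int_UNIV_right space_completion space_lborel space_borel)
  show "(LINT x|M. \<phi> x *\<^sub>R g x) = (LINT x|lebesgue. \<phi> x *\<^sub>R (indicator K x *\<^sub>R g x))"
    by (subst integral_restrict_space) (auto simp only: eq sets_domain Int_UNIV_right space_completion space_lborel space_borel)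
qed

text \<open>
  By inner regularity the set where \<open>k > 0\<close> is, up to a null set, a countable union of compact sets,
  and each of them is null because the integral of \<open>k\<close> over it vanishes.
\<close>

lemma AE_nonpos_of_compact_integrals:
  fixes k :: "'a \<Rightarrow> real"
  assumes K: "compact K" "K \<subseteq> \<Omega>" and k: "k absolutely_integrable_on K"
    and z: "\<And>C. compact C \<Longrightarrow> C \<subseteq> \<Omega> \<Longrightarrow> (LINT x|lebesgue. indicator C x * k x) = 0"
  shows "AE x in lebesgue. x \<in> K \<longrightarrow> k x \<le> 0"
proof -
  have ki: "integrable lebesgue (\<lambda>x. indicator K x *\<^sub>R k x)" using k by (simp add: set_integrable_def)
  note [measurable] = borel_measurable_integrable[OF ki]
  define S where "S = {x. indicator K x *\<^sub>R k x > 0}"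
  have "S = {x\<in>space lebesgue. indicator K x *\<^sub>R k x > 0}" by (simp add: S_def)
  also have "\<dots> \<in> sets lebesgue" by measurable
  finally have S: "S \<in> sets lebesgue" .
  obtain N C where NC: "negligible N" "\<And>n::nat. compact (C n)" "S = (\<Union>n. C n) \<union> N"
    using lebesgue_regular_inner[OF S] by metis
  have CS: "C n \<subseteq> S" for n using NC by auto
  have SK: "S \<subseteq> K" by (auto simp: S_def indicator_def split: if_splits)
  have "AE x in lebesgue. x \<notin> C n" for n
  proof -
    have CK: "C n \<subseteq> K" using CS SK by blast
    have i: "integrable lebesgue (\<lambda>x. indicator (C n) x * k x)"
      using set_integrable_subset[OF k _ CK] NC(2)[of n] by (simp add: set_integrable_def lmeasurable_compact fmeasurableD)
    have nn: "indicator (C n) x * k x \<ge> 0" for x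
    proof (cases "x \<in> C n")
      case True
      then have "x \<in> S" using CS by blast
      then have "x \<in> K" "k x > 0" using SK by (auto simp: S_def)
      then show ?thesis by simp
    qed simp
    have "(LINT x|lebesgue. indicator (C n) x * k x) = 0"
      by (rule z) (use NC(2) CK K in auto)
    then have "AE x in lebesgue. indicator (C n) x * k x = 0"
      using integral_nonneg_eq_0_iff_AE[OF i] nn by simp
    then show ?thesis
      by eventually_elim (use CS[of n] in \<open>auto simp: S_def indicator_def split: if_splits\<close>)
  qed
  then have "AE x in lebesgue. \<forall>n. x \<notin> C n" by (simp add: AE_all_countable)
  moreover have "AE x in lebesgue. x \<notin> N"
    using NC(1) AE_not_in[of N lebesgue] by (simp add: negligible_iff_null_sets)
  ultimately show ?thesis
  proof eventually_elim
    case (elim x)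
    then have "x \<notin> S" using NC(3) by blast
    then show ?case by (auto simp: S_def not_less)
  qed
qed

lemma AE_zero_of_compact_integrals:
  fixes h :: "'a \<Rightarrow> 'b::euclidean_space"
  assumes h: "\<And>K. compact K \<Longrightarrow> K \<subseteq> \<Omega> \<Longrightarrow> h absolutely_integrable_on K"
    and z: "\<And>K. compact K \<Longrightarrow> K \<subseteq> \<Omega> \<Longrightarrow> (LINT x|lebesgue. indicator K x *\<^sub>R h x) = 0"
  shows "AE x in M. h x = 0"
proof -
  obtain C where C: "\<And>n::nat. compact (C n)" "\<And>n. C n \<subseteq> \<Omega>" "\<Union>(range C) = \<Omega>"
    using open_Union_compact_subsets[OF open_domain] by metis
  have nonpos: "AE x in lebesgue. x \<in> C n \<longrightarrow> h x \<bullet> i \<le> 0" for i n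
  proof (rule AE_nonpos_of_compact_integrals[OF C(1,2)])
    have hi: "(\<lambda>x. h x \<bullet> i) absolutely_integrable_on K" if "compact K" "K \<subseteq> \<Omega>" for K
      using integrable_inner_left[of i lebesgue, OF h[OF that, unfolded set_integrable_def]]
      by (simp add: set_integrable_def)
    then show "(\<lambda>x. h x \<bullet> i) absolutely_integrable_on C n" using C by blast
    show "(LINT x|lebesgue. indicator K x * (h x \<bullet> i)) = 0" if K: "compact K" "K \<subseteq> \<Omega>" for K
      using integral_inner_left[of i lebesgue, OF h[OF K, unfolded set_integrable_def]] z[OF K] by simp
  qed
  have "finite (Basis \<union> uminus ` Basis :: 'b set)" by simp
  then have 1: "AE x in lebesgue. \<forall>i\<in>Basis \<union> uminus ` Basis. \<forall>n. x \<in> C n \<longrightarrow> h x \<bullet> i \<le> 0"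
  proof (rule AE_finite_allI)
    fix i :: 'b assume "i \<in> Basis \<union> uminus ` Basis"
    then show "AE x in lebesgue. \<forall>n. x \<in> C n \<longrightarrow> h x \<bullet> i \<le> 0"
      unfolding AE_all_countable using nonpos by blast
  qed
  show ?thesis unfolding AE_M_iff
    using 1
  proof eventually_elim
    case (elim x)
    show ?case
    proof
      assume "x \<in> \<Omega>"
      then obtain n where "x \<in> C n" using C(3) by blast
      then have "h x \<bullet> i \<le> 0" "h x \<bullet> (- i) \<le> 0" if "i \<in> Basis" for i using elim that by blast+
      then have "h x \<bullet> i = 0 \<bullet> i" if "i \<in> Basis" for i
        using that by (simp add: order_antisym)
      then show "h x = 0" by (rule euclidean_eqI)
    qed
  qed
qed

text \<open>
  The difference of two weak gradients integrates to \<open>0\<close> against test functions, hence, by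
  bounded approximation of indicators, over compact sets.
\<close>

lemma weak_gradient_unique:
  assumes "has_weak_gradient \<Omega> u g" "has_weak_gradient \<Omega> u g'"
  shows "AE x in M. g x = g' x"
proof -
  have g: "g absolutely_integrable_on K" "g' absolutely_integrable_on K" if "compact K" "K \<subseteq> \<Omega>" for K
    using assms that by (auto simp: has_weak_gradient_def)
  have h: "(\<lambda>x. g x - g' x) absolutely_integrable_on K" if "compact K" "K \<subseteq> \<Omega>" for K
    by (intro set_integral_diff g that)
  have "(LINT x|lebesgue. indicator K x *\<^sub>R (g x - g' x)) = 0" if K: "compact K" "K \<subseteq> \<Omega>" for K
  proof -
    obtain \<zeta> K' where \<zeta>: "\<And>n. \<zeta> n \<in> test_functions \<Omega>" "compact K'" "K' \<subseteq> \<Omega>"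
      "\<And>n x. x \<notin> K' \<Longrightarrow> \<zeta> n x = 0" "\<And>n x. \<bar>\<zeta> n x\<bar> \<le> 1"
      "\<And>x. (\<lambda>n::nat. \<zeta> n x) \<longlonglongrightarrow> indicator K x"
      using indicator_approximation[OF K(1) open_domain K(2)] by blast
    have c: "continuous_on UNIV (\<zeta> n)" for n
      using \<zeta>(1)[of n] test_functions_C1c C1c_imp_C1 C1_continuous by blast
    have m[measurable]: "\<zeta> n \<in> borel_measurable lebesgue" for n
      by (intro measurable_completion) (simp add: borel_measurable_continuous_onI c)
    define H where "H x = indicator K' x *\<^sub>R (g x - g' x)" for x
    have H: "integrable lebesgue H" using h[OF \<zeta>(2,3)] by (simp add: set_integrable_def H_def[abs_def])
    note [measurable] = borel_measurable_integrable[OF H]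
    have "(LINT x|lebesgue. \<zeta> n x *\<^sub>R H x) = 0" for n
    proof -
      note t = integrable_M_test_function[OF \<zeta>(2,3) _ c \<zeta>(4) \<zeta>(5)]
      have "(LINT x|lebesgue. \<zeta> n x *\<^sub>R H x) = (LINT x|M. \<zeta> n x *\<^sub>R (g x - g' x))"
        unfolding H_def by (rule t(2)[OF h[OF \<zeta>(2,3)], symmetric])
      also have "\<dots> = (LINT x|M. \<zeta> n x *\<^sub>R g x) - (LINT x|M. \<zeta> n x *\<^sub>R g' x)"
        using t(1)[OF g(1)[OF \<zeta>(2,3)]] t(1)[OF g(2)[OF \<zeta>(2,3)]] by (simp add: scaleR_diff_right)
      also have "(LINT x|M. \<zeta> n x *\<^sub>R g x) = (LINT x|M. \<zeta> n x *\<^sub>R g' x)"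
        using assms \<zeta>(1)[of n] by (simp add: has_weak_gradient_def)
      finally show ?thesis by simp
    qed
    moreover have "(\<lambda>n. LINT x|lebesgue. \<zeta> n x *\<^sub>R H x) \<longlonglongrightarrow> (LINT x|lebesgue. indicator K x *\<^sub>R H x)"
    proof (rule integral_dominated_convergence)
      show "integrable lebesgue (\<lambda>x. norm (H x))" using H by simp
      show "AE x in lebesgue. (\<lambda>n. \<zeta> n x *\<^sub>R H x) \<longlonglongrightarrow> indicator K x *\<^sub>R H x"
        by (intro AE_I2 tendsto_intros \<zeta>(6))
      show "AE x in lebesgue. norm (\<zeta> n x *\<^sub>R H x) \<le> norm (H x)" for n
        using \<zeta>(5) by (auto intro!: AE_I2 mult_left_le_one_le)
    qed (use lmeasurable_compact[OF K(1)] in \<open>auto simp: fmeasurableD\<close>)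
    ultimately have "(LINT x|lebesgue. indicator K x *\<^sub>R H x) = 0" by (simp add: LIMSEQ_const_iff)
    moreover have "K \<subseteq> K'"
    proof
      fix x assume "x \<in> K"
      show "x \<in> K'"
      proof (rule ccontr)
        assume "x \<notin> K'"
        then have "(\<lambda>n. 0) \<longlonglongrightarrow> (1::real)" using \<zeta>(6)[of x] \<zeta>(4) \<open>x \<in> K\<close> by simp
        then show False by (simp add: LIMSEQ_const_iff)
      qed
    qed
    then have "indicator K x *\<^sub>R H x = indicator K x *\<^sub>R (g x - g' x)" for x
      by (auto simp: H_def indicator_def)
    ultimately show ?thesis by simp
  qed
  from AE_zero_of_compact_integrals[OF h this] show ?thesis by simp
qed

lemma borel_measurable_M_AE:
  fixes f :: "'a \<Rightarrow> 'b::euclidean_space"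
  assumes "f \<in> borel_measurable M" "AE x in M. f x = g x"
  shows "g \<in> borel_measurable M"
proof -
  have "(\<lambda>x. if x \<in> \<Omega> then f x else 0) \<in> borel_measurable lebesgue"
    by (rule borel_measurable_if_I[OF assms(1)]) simp
  then have "(\<lambda>x. if x \<in> \<Omega> then g x else 0) \<in> borel_measurable lebesgue"
    by (rule borel_measurable_AE) (use assms(2) in \<open>auto simp: AE_M_iff elim!: eventually_mono\<close>)
  then show ?thesis by (rule borel_measurable_if_D)
qed

lemma Lp_AE:
  fixes f :: "'a \<Rightarrow> 'b::euclidean_space"
  assumes "f \<in> Lp \<Omega> p" "AE x in M. f x = g x"
  shows "g \<in> Lp \<Omega> p"
  by (rule Lp_dominated[OF assms(1), of _ 1])
    (use borel_measurable_M_AE[OF LpD(1)[OF assms(1)] assms(2)] assms(2) in \<open>auto elim!: eventually_mono\<close>)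

lemma Lp_limit_AE:
  assumes "Lp_limit f g" "AE x in M. g x = g' x"
  shows "Lp_limit f g'"
  by (rule Lp_limit_le[OF assms(1), of _ _ 1])
    (use assms Lp_AE[OF Lp_limitD(2)[OF assms(1)]] LpD(1)[OF Lp_limitD(1)[OF assms(1)]] in auto)

lemma C1c_Lp:
  assumes "\<phi> \<in> C1c \<Omega>"
  shows "\<phi> \<in> Lp \<Omega> p" "gradient \<phi> \<in> Lp \<Omega> p"
proof -
  note C = C1c_imp_C1[OF assms]
  obtain B where "\<And>x. \<bar>\<phi> x\<bar> \<le> B" using C1c_bounded[OF assms] by metis
  then show "\<phi> \<in> Lp \<Omega> p"
    by (intro Lp_bounded[of _ B] continuous_measurable_M C1_continuous[OF C]) auto
  obtain B where "\<And>x. norm (gradient \<phi> x) \<le> B" using C1c_gradient_bounded[OF assms] by metis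
  then show "gradient \<phi> \<in> Lp \<Omega> p"
    by (intro Lp_bounded[of _ B] continuous_measurable_M C1_continuous_gradient[OF C]) auto
qed

lemma has_weak_gradient_C1c:
  assumes "\<phi> \<in> C1c \<Omega>"
  shows "has_weak_gradient \<Omega> \<phi> (gradient \<phi>)"
  unfolding has_weak_gradient_def
proof (intro conjI allI impI ballI)
  show "\<phi> absolutely_integrable_on K" "gradient \<phi> absolutely_integrable_on K" if "compact K \<and> K \<subseteq> \<Omega>" for K
    using that by (auto intro!: integrable_M_imp_absolutely_integrable_on Lp_integrable C1c_Lp assms)
  fix \<psi> assume "\<psi> \<in> test_functions \<Omega>"
  then have \<psi>: "\<psi> \<in> C1c \<Omega>" using test_functions_C1c by blast
  note C = C1c_imp_C1[OF assms] C1c_imp_C1[OF \<psi>]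
  obtain K where K: "compact K" "K \<subseteq> \<Omega>" "\<And>x. x \<notin> K \<Longrightarrow> \<psi> x = 0" "\<And>x. x \<notin> K \<Longrightarrow> gradient \<psi> x = 0"
    using C1c_support[OF \<psi>] by metis
  have "(LINT x|M. \<phi> x *\<^sub>R gradient \<psi> x) = (LINT x|lborel. \<phi> x *\<^sub>R gradient \<psi> x)"
    by (rule lebesgue_on_integral_eq_lborel)
       (use K in \<open>auto intro!: borel_measurable_continuous_onI continuous_intros C1_continuous C1_continuous_gradient C\<close>)
  also have "\<dots> = - (LINT x|lborel. \<psi> x *\<^sub>R gradient \<phi> x)"
    by (rule integration_by_parts[OF C(1) \<psi>])
  also have "(LINT x|lborel. \<psi> x *\<^sub>R gradient \<phi> x) = (LINT x|M. \<psi> x *\<^sub>R gradient \<phi> x)"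
    by (rule lebesgue_on_integral_eq_lborel[symmetric])
       (use K in \<open>auto intro!: borel_measurable_continuous_onI continuous_intros C1_continuous C1_continuous_gradient C\<close>)
  finally show "(LINT x|M. \<phi> x *\<^sub>R gradient \<psi> x) = - (LINT x|M. \<psi> x *\<^sub>R gradient \<phi> x)" .
qed

lemma weak_gradient_eq:
  assumes "has_weak_gradient \<Omega> u g"
  shows "AE x in M. g x = weak_gradient \<Omega> u x"
  unfolding weak_gradient_def
  by (rule weak_gradient_unique[OF assms someI[of "has_weak_gradient \<Omega> u", OF assms]])

lemma W01p_Lp:
  assumes "u \<in> W01p \<Omega> p"
  shows "u \<in> Lp \<Omega> p" "weak_gradient \<Omega> u \<in> Lp \<Omega> p"
proof -
  show "u \<in> Lp \<Omega> p" using assms by (simp add: W01p_def W1p_def)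
  obtain g where "has_weak_gradient \<Omega> u g" "g \<in> Lp \<Omega> p" using assms by (auto simp: W01p_def W1p_def)
  then show "weak_gradient \<Omega> u \<in> Lp \<Omega> p" using Lp_AE weak_gradient_eq by blast
qed

text \<open>
  Both sides of the defining identity are continuous under convergence in \<open>L\<^sup>1\<close>, because test
  functions and their gradients are bounded.
\<close>

lemma has_weak_gradient_limit:
  assumes \<zeta>: "\<And>n. \<zeta> n \<in> C1c \<Omega>" and u: "Lp_limit \<zeta> u" and g: "Lp_limit (\<lambda>n. gradient (\<zeta> n)) g"
  shows "has_weak_gradient \<Omega> u g"
  unfolding has_weak_gradient_def
proof (intro conjI allI impI ballI)
  note ui = Lp_integrable[OF Lp_limitD(2)[OF u]]
  note gi = Lp_integrable[OF Lp_limitD(2)[OF g]]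
  show "u absolutely_integrable_on K" "g absolutely_integrable_on K" if "compact K \<and> K \<subseteq> \<Omega>" for K
    using that ui gi by (auto intro!: integrable_M_imp_absolutely_integrable_on)
  fix \<phi> assume t: "\<phi> \<in> test_functions \<Omega>"
  then have \<phi>: "\<phi> \<in> C1c \<Omega>" using test_functions_C1c by blast
  note C = C1c_imp_C1[OF \<phi>]
  \<comment> \<open>\<open>T\<close> is scalar multiplication, in this order or flipped, so one limit covers both sides.\<close>
  have lim: "(\<lambda>n. LINT x|M. T (b x) (f n x)) \<longlonglongrightarrow> (LINT x|M. T (b x) (h x))"
    if "Lp_limit f h" and b: "b \<in> borel_measurable M" "\<And>x. norm (b x) \<le> B" and T: "bounded_bilinear T"
      and N: "\<And>x y. norm (T x y) \<le> norm x * norm y"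
    for f :: "nat \<Rightarrow> 'a \<Rightarrow> 'x::euclidean_space" and h and b :: "'a \<Rightarrow> 'y::euclidean_space" and B
      and T :: "'y \<Rightarrow> 'x \<Rightarrow> 'a"
  proof -
    note f = that(1)
    have Ti: "integrable M (\<lambda>x. T (b x) (k x))" if k: "k \<in> Lp \<Omega> p" for k
    proof (rule Bochner_Integration.integrable_bound)
      show "integrable M (\<lambda>x. B * norm (k x))" using Lp_integrable[OF k] by simp
      have "continuous_on UNIV (\<lambda>z. T (fst z) (snd z))"
        by (intro bounded_bilinear.continuous_on[OF T] continuous_intros)
      then show "(\<lambda>x. T (b x) (k x)) \<in> borel_measurable M"
        using b(1) LpD(1)[OF k] borel_measurable_continuous_Pair[of b M k T] by (simp add: split_beta)
      show "AE x in M. norm (T (b x) (k x)) \<le> norm (B * norm (k x))"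
      proof (rule AE_I2)
        fix x
        have "norm (T (b x) (k x)) \<le> norm (b x) * norm (k x)" by (rule N)
        also have "\<dots> \<le> B * norm (k x)" by (intro mult_right_mono b) simp
        finally show "norm (T (b x) (k x)) \<le> norm (B * norm (k x))" by simp
      qed
    qed
    have "(\<lambda>n. (LINT x|M. T (b x) (f n x)) - (LINT x|M. T (b x) (h x))) \<longlonglongrightarrow> 0"
    proof (rule Lim_null_comparison)
      show "(\<lambda>n. B * (LINT x|M. norm (f n x - h x))) \<longlonglongrightarrow> 0"
        using tendsto_mult_right_zero[OF Lp_limit_L1[OF f]] .
      show "\<forall>\<^sub>F n in sequentially. norm ((LINT x|M. T (b x) (f n x)) - (LINT x|M. T (b x) (h x))) \<le> B * (LINT x|M. norm (f n x - h x))"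
      proof (rule always_eventually, rule allI)
        fix n
        have fn: "f n \<in> Lp \<Omega> p" "h \<in> Lp \<Omega> p" using Lp_limitD[OF f] by auto
        have d: "(\<lambda>x. f n x - h x) \<in> Lp \<Omega> p" by (rule Lp_diff[OF fn])
        have "(LINT x|M. T (b x) (f n x)) - (LINT x|M. T (b x) (h x)) = (LINT x|M. T (b x) (f n x - h x))"
          using Ti[OF fn(1)] Ti[OF fn(2)] by (simp add: bounded_bilinear.diff_right[OF T])
        also have "norm \<dots> \<le> (LINT x|M. B * norm (f n x - h x))"
        proof (rule Bochner_Integration.integral_norm_bound_integral[OF Ti[OF d]])
          show "integrable M (\<lambda>x. B * norm (f n x - h x))" using Lp_integrable[OF d] by simp
          fix x
          have "norm (T (b x) (f n x - h x)) \<le> norm (b x) * norm (f n x - h x)" by (rule N)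
          also have "\<dots> \<le> B * norm (f n x - h x)" by (intro mult_right_mono b) simp
          finally show "norm (T (b x) (f n x - h x)) \<le> B * norm (f n x - h x)" .
        qed
        finally show "norm ((LINT x|M. T (b x) (f n x)) - (LINT x|M. T (b x) (h x))) \<le> B * (LINT x|M. norm (f n x - h x))"
          by simp
      qed
    qed
    then show ?thesis by (rule LIM_zero_cancel)
  qed
  obtain B where B: "\<And>x. \<bar>\<phi> x\<bar> \<le> B" using C1c_bounded[OF \<phi>] by metis
  obtain B' where B': "\<And>x. norm (gradient \<phi> x) \<le> B'" using C1c_gradient_bounded[OF \<phi>] by metis
  have 1: "(\<lambda>n. LINT x|M. \<zeta> n x *\<^sub>R gradient \<phi> x) \<longlonglongrightarrow> (LINT x|M. u x *\<^sub>R gradient \<phi> x)"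
    using lim[OF u continuous_measurable_M[OF C1_continuous_gradient[OF C]] B', of "\<lambda>x y. y *\<^sub>R x"]
      bounded_bilinear.flip[OF bounded_bilinear_scaleR] by (simp add: mult.commute)
  have 2: "(\<lambda>n. LINT x|M. \<phi> x *\<^sub>R gradient (\<zeta> n) x) \<longlonglongrightarrow> (LINT x|M. \<phi> x *\<^sub>R g x)"
    using lim[OF g continuous_measurable_M[OF C1_continuous[OF C]], of B "(*\<^sub>R)"] B bounded_bilinear_scaleR by simp
  have "(LINT x|M. \<zeta> n x *\<^sub>R gradient \<phi> x) = - (LINT x|M. \<phi> x *\<^sub>R gradient (\<zeta> n) x)" for n
    using has_weak_gradient_C1c[OF \<zeta>[of n]] t by (simp add: has_weak_gradient_def)
  then show "(LINT x|M. u x *\<^sub>R gradient \<phi> x) = - (LINT x|M. \<phi> x *\<^sub>R g x)"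
    using LIMSEQ_unique[OF 1] tendsto_minus[OF 2] by simp
qed

lemma C1c_approx_test_function:
  assumes "\<phi> \<in> C1c \<Omega>" "e > 0"
  obtains \<zeta> where "\<zeta> \<in> test_functions \<Omega>" "\<And>x. \<bar>\<zeta> x - \<phi> x\<bar> \<le> e" "\<And>x. norm (gradient \<zeta> x - gradient \<phi> x) \<le> e"
proof -
  note C = C1c_imp_C1[OF assms(1)]
  obtain K where K: "compact K" "K \<subseteq> \<Omega>" "\<And>x. x \<notin> K \<Longrightarrow> \<phi> x = 0"
    using C1c_support[OF assms(1)] by metis
  obtain \<zeta> where \<zeta>: "\<And>n. \<zeta> n \<in> test_functions \<Omega>" "uniform_limit UNIV \<zeta> \<phi> sequentially"
    "C1 \<phi> \<Longrightarrow> uniform_limit UNIV (\<lambda>n. gradient (\<zeta> n)) (gradient \<phi>) sequentially"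
    using mollification[OF open_domain C1_continuous[OF C] K] by metis
  note \<zeta> = \<zeta>(1,2) \<zeta>(3)[OF C]
  have "\<forall>\<^sub>F n in sequentially. (\<forall>x\<in>UNIV. dist (\<zeta> n x) (\<phi> x) < e) \<and> (\<forall>x\<in>UNIV. dist (gradient (\<zeta> n) x) (gradient \<phi> x) < e)"
    by (intro eventually_conj uniform_limitD \<zeta> assms)
  then obtain n where "(\<forall>x\<in>UNIV. dist (\<zeta> n x) (\<phi> x) < e) \<and> (\<forall>x\<in>UNIV. dist (gradient (\<zeta> n) x) (gradient \<phi> x) < e)"
    by (auto simp: eventually_sequentially)
  then show ?thesis using that[OF \<zeta>(1)[of n]] by (auto simp: dist_norm less_imp_le)
qed

lemma Lp_limit_uniformly_close:
  fixes f F :: "nat \<Rightarrow> 'a \<Rightarrow> 'b::euclidean_space"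
  assumes "Lp_limit f g" "\<And>n. F n \<in> borel_measurable M" "\<And>n x. norm (F n x - f n x) \<le> 1 / real (Suc n)"
  shows "Lp_limit F g"
proof -
  have [measurable]: "f n \<in> borel_measurable M" for n using LpD(1) Lp_limitD(1)[OF assms(1)] by blast
  have "Lp_limit (\<lambda>n x. F n x - f n x) (\<lambda>x. 0)"
  proof (rule Lp_limit_dominated[where h="\<lambda>x. 1::real"])
    show "AE x in M. norm (F n x - f n x) \<le> norm (1::real)" for n
    proof (rule AE_I2)
      have 1: "1 / real (Suc n) \<le> 1" by simp
      show "norm (F n x - f n x) \<le> norm (1::real)" for x using order_trans[OF assms(3)[of n x] 1] by simp
    qed
    show "AE x in M. (\<lambda>n. F n x - f n x) \<longlonglongrightarrow> 0"
      by (intro AE_I2 Lim_null_comparison[OF _ LIMSEQ_Suc[OF lim_const_over_n[of 1]]]) (use assms(3) in auto)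
  qed (use assms(2) in \<open>auto intro!: Lp_bounded[of _ 1]\<close>)
  from Lp_limit_add[OF this assms(1)] show ?thesis by simp
qed

text \<open>
  Limits of \<open>C\<^sup>1\<close> functions, and not just of smooth ones, lie in \<open>W\<^sub>0\<^sup>1\<^sup>,\<^sup>p\<close>: a diagonal argument with
  uniformly close test functions.
\<close>

theorem W01pI:
  assumes \<zeta>: "\<And>n. \<zeta> n \<in> C1c \<Omega>" and u: "Lp_limit \<zeta> u" and g: "Lp_limit (\<lambda>n. gradient (\<zeta> n)) g"
  shows "u \<in> W01p \<Omega> p" "AE x in M. weak_gradient \<Omega> u x = g x"
proof -
  note w = has_weak_gradient_limit[OF assms]
  note e = weak_gradient_eq[OF w]
  from e show "AE x in M. weak_gradient \<Omega> u x = g x" by (auto elim: eventually_mono)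
  have "\<exists>\<tau>. \<tau> \<in> test_functions \<Omega> \<and> (\<forall>x. \<bar>\<tau> x - \<zeta> n x\<bar> \<le> 1 / real (Suc n)) \<and>
      (\<forall>x. norm (gradient \<tau> x - gradient (\<zeta> n) x) \<le> 1 / real (Suc n))" for n
  proof -
    have "1 / real (Suc n) > 0" by simp
    from C1c_approx_test_function[OF \<zeta>[of n] this] show ?thesis by metis
  qed
  then obtain \<tau> where \<tau>: "\<And>n. \<tau> n \<in> test_functions \<Omega>" "\<And>n x. \<bar>\<tau> n x - \<zeta> n x\<bar> \<le> 1 / real (Suc n)"
      "\<And>n x. norm (gradient (\<tau> n) x - gradient (\<zeta> n) x) \<le> 1 / real (Suc n)" by metis
  have C: "C1 (\<tau> n)" for n using \<tau>(1) test_functions_C1c C1c_imp_C1 by blast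
  have 1: "Lp_limit \<tau> u"
    by (rule Lp_limit_uniformly_close[OF u]) (use \<tau>(2) in \<open>auto intro!: continuous_measurable_M C1_continuous C\<close>)
  have 2: "Lp_limit (\<lambda>n. gradient (\<tau> n)) (weak_gradient \<Omega> u)"
    by (rule Lp_limit_AE[OF Lp_limit_uniformly_close[OF g] e])
      (use \<tau>(3) in \<open>auto intro!: continuous_measurable_M C1_continuous_gradient C\<close>)
  have "u \<in> W1p \<Omega> p" using w Lp_limitD(2)[OF u] Lp_limitD(2)[OF g] by (auto simp: W1p_def)
  then show "u \<in> W01p \<Omega> p"
    using \<tau>(1) Lp_limitD(3)[OF 1] Lp_limitD(3)[OF 2] unfolding W01p_def
    by (auto intro!: exI[of _ \<tau>])
qed

text \<open>
  The converse of \<open>W01pI\<close>; passing to a subsequence adds convergence almost everywhere, which is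
  what nonlinear functions of \<open>u\<close> need.
\<close>

theorem W01pE:
  assumes "u \<in> W01p \<Omega> p"
  obtains \<zeta> where "\<And>n. \<zeta> n \<in> C1c \<Omega>" "Lp_limit \<zeta> u" "Lp_limit (\<lambda>n. gradient (\<zeta> n)) (weak_gradient \<Omega> u)"
    "AE x in M. (\<lambda>n. \<zeta> n x) \<longlonglongrightarrow> u x"
proof -
  obtain \<phi> where \<phi>: "\<And>n. \<phi> n \<in> test_functions \<Omega>"
     "(\<lambda>n::nat. LINT x|lebesgue_on \<Omega>. \<bar>\<phi> n x - u x\<bar> powr p) \<longlonglongrightarrow> 0"
     "(\<lambda>n. LINT x|lebesgue_on \<Omega>. norm (gradient (\<phi> n) x - weak_gradient \<Omega> u x) powr p) \<longlonglongrightarrow> 0"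
    using assms unfolding W01p_def by auto
  have C: "\<phi> n \<in> C1c \<Omega>" for n using \<phi>(1) test_functions_C1c by blast
  have 1: "Lp_limit \<phi> u" "Lp_limit (\<lambda>n. gradient (\<phi> n)) (weak_gradient \<Omega> u)"
    using \<phi> W01p_Lp[OF assms] C1c_Lp[OF C] by (auto simp: Lp_limit_def)
  obtain r where r: "strict_mono r" "AE x in M. (\<lambda>n. \<phi> (r n) x) \<longlonglongrightarrow> u x"
    using Lp_limit_AE_subseq[OF 1(1)] by metis
  show ?thesis
    by (rule that[OF C Lp_limit_subseq[OF 1(1) r(1)] Lp_limit_subseq[OF 1(2) r(1)] r(2)])
qed

lemma C1c_cutoff:
  assumes "cball z r \<subseteq> \<Omega>"
  obtains \<psi> where "\<psi> \<in> C1c \<Omega>" "\<And>x. x \<in> cball z r \<Longrightarrow> \<psi> x = 1"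
  using cutoff_function[OF compact_cball open_domain assms] test_functions_C1c by blast

corollary C1c_W01p:
  assumes "\<phi> \<in> C1c \<Omega>"
  shows "\<phi> \<in> W01p \<Omega> p" "AE x in M. weak_gradient \<Omega> \<phi> x = gradient \<phi> x"
  by (rule W01pI[of "\<lambda>_. \<phi>", OF assms Lp_limit_const Lp_limit_const]; rule C1c_Lp[OF assms])+

text \<open>
  The product and chain rules hold for the approximating \<open>C\<^sup>1\<close> functions.  Since \<open>g\<close> is Lipschitz, the
  values \<open>g(\<zeta>\<^sub>n)\<close> converge in \<open>L\<^sup>p\<close>; the factors \<open>g'(\<zeta>\<^sub>n)\<close> are bounded and converge almost
  everywhere.
\<close>

theorem W01p_chain_rule:
  assumes u: "u \<in> W01p \<Omega> p" and \<psi>: "\<psi> \<in> C1c \<Omega>"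
    and g: "\<And>s. (g has_real_derivative g' s) (at s)" "continuous_on UNIV g'" "\<And>s. \<bar>g' s\<bar> \<le> L"
  shows "(\<lambda>x. \<psi> x * g (u x)) \<in> W01p \<Omega> p"
    "AE x in M. weak_gradient \<Omega> (\<lambda>x. \<psi> x * g (u x)) x =
        g (u x) *\<^sub>R gradient \<psi> x + (\<psi> x * g' (u x)) *\<^sub>R weak_gradient \<Omega> u x"
proof -
  obtain \<zeta> where \<zeta>: "\<And>n. \<zeta> n \<in> C1c \<Omega>" "Lp_limit \<zeta> u" "Lp_limit (\<lambda>n. gradient (\<zeta> n)) (weak_gradient \<Omega> u)"
    "AE x in M. (\<lambda>n. \<zeta> n x) \<longlonglongrightarrow> u x"
    by (rule W01pE[OF u]) (rule that)
  have gc: "continuous_on UNIV g"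
    by (intro continuous_at_imp_continuous_on ballI DERIV_isCont[OF g(1)])
  have gm[measurable]: "g \<in> borel_measurable borel" "g' \<in> borel_measurable borel"
    by (auto intro!: borel_measurable_continuous_onI gc g)
  note C = C1c_imp_C1[OF \<zeta>(1)] C1c_imp_C1[OF \<psi>]
  have cg: "C1 (\<lambda>x. g (\<zeta> n x))" "gradient (\<lambda>x. g (\<zeta> n x)) = (\<lambda>x. g' (\<zeta> n x) *\<^sub>R gradient (\<zeta> n) x)" for n
    by (rule C1_compose[OF C(1) g(1) continuous_on_subset[OF g(2)]], simp)+
  define \<xi> where "\<xi> n x = \<psi> x * g (\<zeta> n x)" for n x
  have \<xi>: "\<xi> n \<in> C1c \<Omega>" for n unfolding \<xi>_def by (rule C1c_mult_left[OF \<psi> cg(1)])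
  have g\<xi>: "gradient (\<xi> n) x = g (\<zeta> n x) *\<^sub>R gradient \<psi> x + (\<psi> x * g' (\<zeta> n x)) *\<^sub>R gradient (\<zeta> n) x" for n x
    unfolding \<xi>_def C1_mult(2)[OF C(2) cg(1)] cg(2) by (simp add: add.commute)
  have lip: "\<bar>g s - g t\<bar> \<le> L * \<bar>s - t\<bar>" for s t
    using field_differentiable_bound[of UNIV g g' L s t] g by auto
  have glin: "\<bar>g s\<bar> \<le> \<bar>g 0\<bar> + L * \<bar>s\<bar>" for s using lip[of s 0] by simp
  note um[measurable] = LpD(1)[OF W01p_Lp(1)[OF u]]
  note \<psi>m[measurable] = continuous_measurable_M[OF C1_continuous[OF C(2)]] continuous_measurable_M[OF C1_continuous_gradient[OF C(2)]]
  have \<zeta>m[measurable]: "\<zeta> n \<in> borel_measurable M" for n by (intro continuous_measurable_M C1_continuous C)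
  have guL: "(\<lambda>x. g (u x)) \<in> Lp \<Omega> p"
  proof (rule Lp_dominated[of "\<lambda>x. \<bar>g 0\<bar> + L * \<bar>u x\<bar>" _ 1])
    have "(\<lambda>x. L * \<bar>u x\<bar>) \<in> Lp \<Omega> p"
      by (rule Lp_dominated[OF W01p_Lp(1)[OF u], of _ "\<bar>L\<bar>"]) (auto simp: abs_mult)
    then show "(\<lambda>x. \<bar>g 0\<bar> + L * \<bar>u x\<bar>) \<in> Lp \<Omega> p"
      by (rule Lp_add[rotated]) (auto intro: Lp_bounded[of _ "\<bar>g 0\<bar>"])
    show "AE x in M. norm (g (u x)) \<le> 1 * norm (\<bar>g 0\<bar> + L * \<bar>u x\<bar>)"
      using glin by (intro AE_I2) (simp add: order_trans[OF glin])
  qed measurable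
  have gl: "Lp_limit (\<lambda>n x. g (\<zeta> n x)) (\<lambda>x. g (u x))"
    by (rule Lp_limit_le[OF \<zeta>(2) _ guL, of _ L]) (use lip in auto)
  obtain B where B: "\<And>x. \<bar>\<psi> x\<bar> \<le> B" using C1c_bounded[OF \<psi>] by metis
  obtain B' where B': "\<And>x. norm (gradient \<psi> x) \<le> B'" using C1c_gradient_bounded[OF \<psi>] by metis
  have 1: "Lp_limit \<xi> (\<lambda>x. \<psi> x * g (u x))"
    using Lp_limit_scaleR[OF gl, of "\<lambda>_. \<psi>" \<psi> B] B unfolding \<xi>_def by simp
  have 2: "Lp_limit (\<lambda>n x. g (\<zeta> n x) *\<^sub>R gradient \<psi> x) (\<lambda>x. g (u x) *\<^sub>R gradient \<psi> x)"
  proof (rule Lp_limit_le[OF gl])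
    show "(\<lambda>x. g (u x) *\<^sub>R gradient \<psi> x) \<in> Lp \<Omega> p"
      by (rule Lp_dominated[OF guL, of _ B']) (use B' in \<open>auto simp: mult.commute[of B'] intro!: AE_I2 mult_left_mono\<close>)
    show "AE x in M. norm (g (\<zeta> n x) *\<^sub>R gradient \<psi> x - g (u x) *\<^sub>R gradient \<psi> x) \<le> B' * norm (g (\<zeta> n x) - g (u x))" for n
      using B' by (auto simp: scaleR_diff_left[symmetric] mult.commute[of B'] intro!: AE_I2 mult_left_mono)
  qed measurable
  have 3: "Lp_limit (\<lambda>n x. (\<psi> x * g' (\<zeta> n x)) *\<^sub>R gradient (\<zeta> n) x) (\<lambda>x. (\<psi> x * g' (u x)) *\<^sub>R weak_gradient \<Omega> u x)"
  proof (rule Lp_limit_scaleR[OF \<zeta>(3)])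
    show "AE x in M. \<bar>\<psi> x * g' (\<zeta> n x)\<bar> \<le> B * L" for n
      using B g(3) by (intro AE_I2) (auto simp: abs_mult intro!: mult_mono order_trans[OF _ B])
    show "AE x in M. (\<lambda>n. \<psi> x * g' (\<zeta> n x)) \<longlonglongrightarrow> \<psi> x * g' (u x)"
      using \<zeta>(4) by eventually_elim (intro tendsto_intros continuous_on_tendsto_compose[OF g(2)], auto)
  qed measurable
  have 4: "Lp_limit (\<lambda>n. gradient (\<xi> n)) (\<lambda>x. g (u x) *\<^sub>R gradient \<psi> x + (\<psi> x * g' (u x)) *\<^sub>R weak_gradient \<Omega> u x)"
    using Lp_limit_add[OF 2 3] by (simp add: g\<xi>[abs_def, symmetric])
  show "(\<lambda>x. \<psi> x * g (u x)) \<in> W01p \<Omega> p" by (rule W01pI(1)[OF \<xi> 1 4])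
  show "AE x in M. weak_gradient \<Omega> (\<lambda>x. \<psi> x * g (u x)) x =
        g (u x) *\<^sub>R gradient \<psi> x + (\<psi> x * g' (u x)) *\<^sub>R weak_gradient \<Omega> u x"
    by (rule W01pI(2)[OF \<xi> 1 4])
qed

end

section \<open>Poincare's inequality on balls\<close>

lemma nn_integral_lborel_affine:
  fixes f :: "'a::euclidean_space \<Rightarrow> ennreal" and c :: real
  assumes [measurable]: "f \<in> borel_measurable borel" and c: "c \<noteq> 0"
  shows "(\<integral>\<^sup>+x. f (a + c *\<^sub>R x) \<partial>lborel) = ennreal (1 / \<bar>c\<bar> ^ DIM('a)) * (\<integral>\<^sup>+x. f x \<partial>lborel)"
proof -
  have "(\<integral>\<^sup>+x. f x \<partial>lborel) = ennreal (\<bar>c\<bar> ^ DIM('a)) * (\<integral>\<^sup>+x. f (a + c *\<^sub>R x) \<partial>lborel)"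
    by (subst lborel_affine[OF c, of a])
       (simp add: nn_integral_density nn_integral_distr nn_integral_cmult)
  then have "ennreal (1 / \<bar>c\<bar> ^ DIM('a)) * (\<integral>\<^sup>+x. f x \<partial>lborel)
     = (ennreal (1 / \<bar>c\<bar> ^ DIM('a)) * ennreal (\<bar>c\<bar> ^ DIM('a))) * (\<integral>\<^sup>+x. f (a + c *\<^sub>R x) \<partial>lborel)"
    by (simp add: mult.assoc)
  also have "ennreal (1 / \<bar>c\<bar> ^ DIM('a)) * ennreal (\<bar>c\<bar> ^ DIM('a)) = 1"
    using c by (simp add: ennreal_mult[symmetric])
  finally show ?thesis by simp
qed

lemma C1_increment_le:
  assumes w: "C1 w" and R: "R \<ge> 0"
  shows "ennreal \<bar>w (x + R *\<^sub>R v) - w x\<bar> \<le>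
    (\<integral>\<^sup>+t. indicator {0..R} t * ennreal (norm (gradient w (x + t *\<^sub>R v)) * norm v) \<partial>lborel)"
proof -
  define f where "f t = gradient w (x + t *\<^sub>R v) \<bullet> v" for t
  have der: "((\<lambda>t. w (x + t *\<^sub>R v)) has_vector_derivative f t) (at t within {0..R})" for t
  proof -
    have "((\<lambda>t. w (x + t *\<^sub>R v)) has_derivative (\<lambda>h. gradient w (x + t *\<^sub>R v) \<bullet> (h *\<^sub>R v))) (at t within {0..R})"
      by (rule has_derivative_compose[OF _ C1_has_derivative[OF w]]) (auto intro!: derivative_eq_intros)
    then show ?thesis by (simp add: has_vector_derivative_def f_def)
  qed
  have c: "continuous_on {0..R} f" unfolding f_def
    by (intro continuous_intros continuous_on_compose2[OF C1_continuous_gradient[OF w, of UNIV]]) auto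
  have "integrable lborel (\<lambda>t. indicator {0..R} t *\<^sub>R f t)"
    by (rule borel_integrable_compact[OF compact_Icc c])
  then have "ennreal (norm (LINT t|lborel. indicator {0..R} t *\<^sub>R f t)) \<le> (\<integral>\<^sup>+t. norm (indicator {0..R} t *\<^sub>R f t) \<partial>lborel)"
    by (rule integral_norm_bound_ennreal)
  also have "(LINT t|lborel. indicator {0..R} t *\<^sub>R f t) = w (x + R *\<^sub>R v) - w x"
    using integral_FTC_Icc[OF R der c] by simp
  also have "(\<integral>\<^sup>+t. norm (indicator {0..R} t *\<^sub>R f t) \<partial>lborel) \<le>
     (\<integral>\<^sup>+t. indicator {0..R} t * ennreal (norm (gradient w (x + t *\<^sub>R v)) * norm v) \<partial>lborel)"
    by (intro nn_integral_mono)
       (auto simp: f_def indicator_def intro!: ennreal_leI Cauchy_Schwarz_ineq2)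
  finally show ?thesis by simp
qed

text \<open>
  Bound \<open>|w(x) - w(y)|\<close> by the integral of \<open>|\<nabla>w|\<close> over the segment from \<open>x\<close> to \<open>y\<close>, which stays
  in the ball, and integrate over \<open>x\<close> and \<open>y\<close>.  For a fixed position \<open>t\<close> on the segment the point
  \<open>x + t (y - x)\<close> is substituted for \<open>y\<close> if \<open>t \<ge> 1/2\<close> and for \<open>x\<close> if \<open>t < 1/2\<close>, so that the
  Jacobian never exceeds \<open>2\<^sup>N\<close>.
\<close>

lemma Poincare_ball:
  fixes z :: "'a::euclidean_space"
  assumes w: "C1 w" and r: "r > 0"
  shows "(\<integral>\<^sup>+x. indicator (ball z r) x * (\<integral>\<^sup>+y. indicator (ball z r) y * ennreal \<bar>w x - w y\<bar> \<partial>lborel) \<partial>lborel)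
    \<le> ennreal (2 * r * 2 ^ DIM('a) * measure lborel (ball z r)) * (\<integral>\<^sup>+x. indicator (ball z r) x * ennreal (norm (gradient w x)) \<partial>lborel)"
proof -
  define B where "B = ball z r"
  have [measurable]: "B \<in> sets borel" by (simp add: B_def)
  have gm[measurable]: "gradient w \<in> borel_measurable borel"
    by (rule borel_measurable_continuous_onI[OF C1_continuous_gradient[OF w]])
  define H where "H x = (indicator B x * ennreal (norm (gradient w x)) :: ennreal)" for x
  have [measurable]: "H \<in> borel_measurable borel" unfolding H_def by measurable
  define k where "k t x y = indicator B x * (indicator B y * H (x + t *\<^sub>R (y - x)))" for t x y
  have conv: "x + t *\<^sub>R (y - x) \<in> B" if "x \<in> B" "y \<in> B" "0 \<le> t" "t \<le> 1" for x y t
  proof -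
    have "(1 - t) *\<^sub>R x + t *\<^sub>R y \<in> B"
      using convexD_alt[OF convex_ball[of z r], of x y t] that by (simp add: B_def)
    then show ?thesis by (simp add: algebra_simps)
  qed
  have pw: "indicator B x * (indicator B y * ennreal \<bar>w x - w y\<bar>) \<le>
      ennreal (2 * r) * (\<integral>\<^sup>+t. indicator {0..1} t * k t x y \<partial>lborel)" for x y
  proof (cases "x \<in> B \<and> y \<in> B")
    case True
    have n: "norm (y - x) \<le> 2 * r"
    proof -
      have "dist y x \<le> dist y z + dist x z" by (metis dist_commute dist_triangle)
      then show ?thesis using True by (simp add: B_def dist_norm[symmetric] dist_commute)
    qed
    have "ennreal \<bar>w x - w y\<bar> = ennreal \<bar>w (x + 1 *\<^sub>R (y - x)) - w x\<bar>" by (simp add: abs_minus_commute)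
    also have "\<dots> \<le> (\<integral>\<^sup>+t. indicator {0..1} t * ennreal (norm (gradient w (x + t *\<^sub>R (y - x))) * norm (y - x)) \<partial>lborel)"
      by (rule C1_increment_le[OF w]) simp
    also have "\<dots> \<le> (\<integral>\<^sup>+t. ennreal (2 * r) * (indicator {0..1} t * k t x y) \<partial>lborel)"
    proof (rule nn_integral_mono)
      fix t :: real
      show "indicator {0..1} t * ennreal (norm (gradient w (x + t *\<^sub>R (y - x))) * norm (y - x)) \<le> ennreal (2 * r) * (indicator {0..1} t * k t x y)"
      proof (cases "t \<in> {0..1}")
        case t: True
        have "k t x y = ennreal (norm (gradient w (x + t *\<^sub>R (y - x))))"
          using True conv[of x y t] t by (simp add: k_def H_def)
        moreover have "ennreal (norm (gradient w (x + t *\<^sub>R (y - x))) * norm (y - x)) \<le> ennreal (2 * r * norm (gradient w (x + t *\<^sub>R (y - x))))"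
          by (intro ennreal_leI) (subst mult.commute, intro mult_right_mono n norm_ge_zero)
        ultimately show ?thesis using t r by (simp add: ennreal_mult)
      qed simp
    qed
    also have "\<dots> = ennreal (2 * r) * (\<integral>\<^sup>+t. indicator {0..1} t * k t x y \<partial>lborel)"
      unfolding k_def by (rule nn_integral_cmult) measurable
    finally show ?thesis using True by simp
  qed auto
  define I where "I = (\<integral>\<^sup>+x. H x \<partial>lborel)"
  define V where "V = emeasure lborel B"
  have fixt: "(\<integral>\<^sup>+x. \<integral>\<^sup>+y. k t x y \<partial>lborel \<partial>lborel) \<le> ennreal (2 ^ DIM('a)) * V * I" if t: "0 \<le> t" "t \<le> 1" for t
  proof -
    have pow: "ennreal (1 / \<bar>s\<bar> ^ DIM('a)) \<le> ennreal (2 ^ DIM('a))" if "1/2 \<le> s" for s :: real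
    proof (rule ennreal_leI)
      have "(1/2) ^ DIM('a) \<le> s ^ DIM('a)" using that by (intro power_mono) auto
      then show "1 / \<bar>s\<bar> ^ DIM('a) \<le> 2 ^ DIM('a)" using that by (simp add: field_simps)
    qed
    \<comment> \<open>Substitute for \<open>y\<close> if \<open>t \<ge> 1/2\<close>, and for \<open>x\<close>, with factor \<open>1 - t \<ge> 1/2\<close>, otherwise.\<close>
    show ?thesis
    proof (cases "1/2 \<le> t")
      case True
      have "(\<integral>\<^sup>+y. k t x y \<partial>lborel) \<le> indicator B x * (ennreal (2 ^ DIM('a)) * I)" for x
      proof -
        have "(\<integral>\<^sup>+y. k t x y \<partial>lborel) \<le> (\<integral>\<^sup>+y. indicator B x * H ((x - t *\<^sub>R x) + t *\<^sub>R y) \<partial>lborel)"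
          unfolding k_def by (intro nn_integral_mono mult_left_mono) (auto simp: algebra_simps indicator_def)
        also have "\<dots> = indicator B x * (ennreal (1 / \<bar>t\<bar> ^ DIM('a)) * I)"
          unfolding I_def using True by (subst nn_integral_cmult) (auto simp: nn_integral_lborel_affine)
        also have "\<dots> \<le> indicator B x * (ennreal (2 ^ DIM('a)) * I)"
          by (intro mult_left_mono mult_right_mono pow True) auto
        finally show ?thesis .
      qed
      then have "(\<integral>\<^sup>+x. \<integral>\<^sup>+y. k t x y \<partial>lborel \<partial>lborel) \<le> (\<integral>\<^sup>+x. indicator B x * (ennreal (2 ^ DIM('a)) * I) \<partial>lborel)"
        by (intro nn_integral_mono)
      also have "\<dots> = V * (ennreal (2 ^ DIM('a)) * I)"
        by (subst nn_integral_multc) (auto simp: V_def)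
      finally show ?thesis by (simp add: mult_ac)
    next
      case False
      have "(\<integral>\<^sup>+x. k t x y \<partial>lborel) \<le> indicator B y * (ennreal (2 ^ DIM('a)) * I)" for y
      proof -
        have "(\<integral>\<^sup>+x. k t x y \<partial>lborel) \<le> (\<integral>\<^sup>+x. indicator B y * H (t *\<^sub>R y + (1 - t) *\<^sub>R x) \<partial>lborel)"
          unfolding k_def by (intro nn_integral_mono) (auto simp: algebra_simps indicator_def)
        also have "\<dots> = indicator B y * (ennreal (1 / \<bar>1 - t\<bar> ^ DIM('a)) * I)"
          unfolding I_def using False by (subst nn_integral_cmult) (auto simp: nn_integral_lborel_affine)
        also have "\<dots> \<le> indicator B y * (ennreal (2 ^ DIM('a)) * I)"
          using False by (intro mult_left_mono mult_right_mono pow) auto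
        finally show ?thesis .
      qed
      then have "(\<integral>\<^sup>+y. \<integral>\<^sup>+x. k t x y \<partial>lborel \<partial>lborel) \<le> (\<integral>\<^sup>+y. indicator B y * (ennreal (2 ^ DIM('a)) * I) \<partial>lborel)"
        by (intro nn_integral_mono)
      also have "\<dots> = V * (ennreal (2 ^ DIM('a)) * I)"
        by (subst nn_integral_multc) (auto simp: V_def)
      also have "(\<integral>\<^sup>+y. \<integral>\<^sup>+x. k t x y \<partial>lborel \<partial>lborel) = (\<integral>\<^sup>+x. \<integral>\<^sup>+y. k t x y \<partial>lborel \<partial>lborel)"
        unfolding k_def by (rule lborel_pair.Fubini') measurable
      finally show ?thesis by (simp add: mult_ac)
    qed
  qed
  have "(\<integral>\<^sup>+x. indicator B x * (\<integral>\<^sup>+y. indicator B y * ennreal \<bar>w x - w y\<bar> \<partial>lborel) \<partial>lborel)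
     = (\<integral>\<^sup>+x. \<integral>\<^sup>+y. indicator B x * (indicator B y * ennreal \<bar>w x - w y\<bar>) \<partial>lborel \<partial>lborel)"
    by (intro nn_integral_cong nn_integral_cmult[symmetric])
       (use borel_measurable_continuous_onI[OF C1_continuous[OF w]] in measurable)
  also have "\<dots> \<le> (\<integral>\<^sup>+x. \<integral>\<^sup>+y. ennreal (2 * r) * (\<integral>\<^sup>+t. indicator {0..1} t * k t x y \<partial>lborel) \<partial>lborel \<partial>lborel)"
    by (intro nn_integral_mono pw)
  also have "\<dots> = ennreal (2 * r) * (\<integral>\<^sup>+x. \<integral>\<^sup>+y. \<integral>\<^sup>+t. indicator {0..1::real} t * k t x y \<partial>lborel \<partial>lborel \<partial>lborel)"
    unfolding k_def by (subst nn_integral_cmult, measurable)+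
  also have "(\<integral>\<^sup>+x. \<integral>\<^sup>+y. \<integral>\<^sup>+t. indicator {0..1::real} t * k t x y \<partial>lborel \<partial>lborel \<partial>lborel)
     = (\<integral>\<^sup>+x. \<integral>\<^sup>+t. \<integral>\<^sup>+y. indicator {0..1::real} t * k t x y \<partial>lborel \<partial>lborel \<partial>lborel)"
    unfolding k_def by (intro nn_integral_cong lborel_pair.Fubini') measurable
  also have "\<dots> = (\<integral>\<^sup>+t. \<integral>\<^sup>+x. \<integral>\<^sup>+y. indicator {0..1::real} t * k t x y \<partial>lborel \<partial>lborel \<partial>lborel)"
    unfolding k_def by (intro lborel_pair.Fubini') measurable
  also have "\<dots> \<le> (\<integral>\<^sup>+t. indicator {0..1::real} t * (ennreal (2 ^ DIM('a)) * V * I) \<partial>lborel)"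
  proof (rule nn_integral_mono)
    fix t :: real
    show "(\<integral>\<^sup>+x. \<integral>\<^sup>+y. indicator {0..1::real} t * k t x y \<partial>lborel \<partial>lborel) \<le> indicator {0..1} t * (ennreal (2 ^ DIM('a)) * V * I)"
      using fixt[of t] by (cases "t \<in> {0..1}") auto
  qed
  also have "\<dots> = ennreal (2 ^ DIM('a)) * V * I"
    by (subst nn_integral_multc) auto
  also have "V = ennreal (measure lborel B)"
    unfolding V_def B_def by (rule emeasure_eq_ennreal_measure) (use emeasure_lborel_ball_finite[of z r] in auto)
  finally have "(\<integral>\<^sup>+x. indicator B x * (\<integral>\<^sup>+y. indicator B y * ennreal \<bar>w x - w y\<bar> \<partial>lborel) \<partial>lborel)
     \<le> ennreal (2 * r) * (ennreal (2 ^ DIM('a)) * ennreal (measure lborel B) * I)"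
    by (simp only: mult_left_mono zero_le)
  then show ?thesis using r unfolding B_def[symmetric] I_def H_def
    by (simp add: ennreal_mult mult_ac)
qed

section \<open>A weighted inequality for the energy\<close>

text \<open>
  Hoelder's inequality with the weight \<open>t\<^sup>-\<^sup>\<alpha>\<close>, up to the factor \<open>2\<^sup>p\<close>.  It follows from
  \<open>le_delta_powr\<close> with \<open>\<delta> = s t\<^sup>-\<^sup>\<alpha>\<close>, where \<open>s\<close> is such that the first summand contributes
  \<open>L/2\<close> and can be absorbed.
\<close>

lemma powr_le_of_le_nn_integral:
  fixes h :: "real \<Rightarrow> real" and \<alpha> p K c L :: real
  assumes h: "\<And>t. h t \<ge> 0" "h \<in> borel_measurable borel" and p: "p > 1"
    and \<alpha>: "K > 0" "(\<integral>\<^sup>+t. indicator {0..R} t * ennreal (t powr (- \<alpha>)) \<partial>lborel) \<le> ennreal K"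
    and L: "L \<ge> 0" "ennreal L \<le> ennreal c * (\<integral>\<^sup>+t. indicator {0..R} t * ennreal (h t) \<partial>lborel)" and c: "c > 0"
  shows "ennreal (L powr p) \<le> ennreal ((2 * c) powr p * K powr (p - 1)) *
     (\<integral>\<^sup>+t. indicator {0..R} t * ennreal (t powr (\<alpha> * (p - 1)) * h t powr p) \<partial>lborel)"
proof (cases "L = 0")
  case False
  then have L0: "L > 0" using L by simp
  note [measurable] = h(2)
  define J where "J = (\<integral>\<^sup>+t. indicator {0..R} t * ennreal (t powr (\<alpha> * (p - 1)) * h t powr p) \<partial>lborel)"
  define s where "s = L / (2 * c * K)"
  have s: "s > 0" using L0 c \<alpha> by (simp add: s_def)
  have "(\<integral>\<^sup>+t. indicator {0..R} t * ennreal (h t) \<partial>lborel) \<le>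
     (\<integral>\<^sup>+t. ennreal s * (indicator {0..R} t * ennreal (t powr (- \<alpha>))) +
        ennreal (s powr (1 - p)) * (indicator {0..R} t * ennreal (t powr (\<alpha> * (p - 1)) * h t powr p)) \<partial>lborel)"
  proof (rule nn_integral_mono_AE)
    show "AE t in lborel. indicator {0..R} t * ennreal (h t) \<le>
      ennreal s * (indicator {0..R} t * ennreal (t powr (- \<alpha>))) +
        ennreal (s powr (1 - p)) * (indicator {0..R} t * ennreal (t powr (\<alpha> * (p - 1)) * h t powr p))"
      using AE_lborel_singleton[of "0::real"]
    proof eventually_elim
      case (elim t)
      show ?case
      proof (cases "t \<in> {0..R}")
        case True
        then have t: "t > 0" using elim by simp
        have "h t \<le> s * t powr (-\<alpha>) + (s * t powr (-\<alpha>)) powr (1 - p) * h t powr p"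
          using h(1) s t p by (intro le_delta_powr) auto
        also have "(s * t powr (-\<alpha>)) powr (1 - p) = s powr (1 - p) * t powr (\<alpha> * (p - 1))"
          using s t by (simp add: powr_mult powr_powr algebra_simps)
        finally have "ennreal (h t) \<le> ennreal (s * t powr (-\<alpha>) + s powr (1 - p) * (t powr (\<alpha> * (p - 1)) * h t powr p))"
          by (intro ennreal_leI) (simp add: mult.assoc)
        then show ?thesis using True s by (simp add: ennreal_mult)
      qed simp
    qed
  qed
  also have "\<dots> = ennreal s * (\<integral>\<^sup>+t. indicator {0..R} t * ennreal (t powr (- \<alpha>)) \<partial>lborel) + ennreal (s powr (1 - p)) * J"
    unfolding J_def by (subst nn_integral_add) (auto simp: nn_integral_cmult)
  also have "\<dots> \<le> ennreal s * ennreal K + ennreal (s powr (1 - p)) * J"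
    by (intro add_mono mult_left_mono \<alpha>) auto
  finally have "ennreal c * (\<integral>\<^sup>+t. indicator {0..R} t * ennreal (h t) \<partial>lborel) \<le> ennreal c * (ennreal s * ennreal K + ennreal (s powr (1 - p)) * J)"
    by (rule mult_left_mono) simp
  with L(2) have "ennreal L \<le> ennreal c * (ennreal s * ennreal K + ennreal (s powr (1 - p)) * J)" by (rule order_trans)
  also have "\<dots> = ennreal (L / 2) + ennreal (c * s powr (1 - p)) * J"
    using c s \<alpha>(1) by (simp add: distrib_left ennreal_mult[symmetric] mult.assoc[symmetric]) (simp add: s_def)
  finally have "ennreal (L / 2) + ennreal (L / 2) \<le> ennreal (L / 2) + ennreal (c * s powr (1 - p)) * J"
    using L0 by (simp add: ennreal_plus[symmetric] del: ennreal_plus)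
  then have le: "ennreal (L / 2) \<le> ennreal (c * s powr (1 - p)) * J"
    using ennreal_add_left_cancel_le[THEN iffD1] by fastforce
  have "L powr p = (2 * c) powr p * K powr (p - 1) * (L / 2 / (c * s powr (1 - p)))"
  proof -
    have "s powr (1 - p) = L powr (1 - p) / ((2 * c) powr (1 - p) * K powr (1 - p))"
      using L0 c \<alpha>(1) by (simp add: s_def powr_divide powr_mult)
    then have "L / 2 / (c * s powr (1 - p)) = L * (2 * c) powr (1 - p) * K powr (1 - p) / (2 * c * L powr (1 - p))"
      by simp
    also have "\<dots> = (L powr 1 / L powr (1 - p)) * ((2 * c) powr (1 - p) / (2 * c) powr 1) * K powr (1 - p)"
      using L0 c by simp
    also have "\<dots> = L powr p * (2 * c) powr (- p) * K powr (1 - p)"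
      using L0 c by (simp only: powr_diff[symmetric]) simp
    finally have e: "L / 2 / (c * s powr (1 - p)) = L powr p * (2 * c) powr (- p) * K powr (1 - p)" .
    have "(2 * c) powr p * (2 * c) powr (- p) = 1" "K powr (p - 1) * K powr (1 - p) = 1"
      using c \<alpha>(1) by (simp_all add: powr_add[symmetric])
    then show ?thesis unfolding e by (metis (no_types, lifting) mult.assoc mult.commute mult.right_neutral)
  qed
  then have "ennreal (L powr p) = ennreal ((2 * c) powr p * K powr (p - 1) / (c * s powr (1 - p))) * ennreal (L / 2)"
    using L0 c s by (simp add: ennreal_mult[symmetric])
  also have "\<dots> \<le> ennreal ((2 * c) powr p * K powr (p - 1) / (c * s powr (1 - p))) * (ennreal (c * s powr (1 - p)) * J)"
    by (rule mult_left_mono[OF le]) simp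
  also have "\<dots> = ennreal ((2 * c) powr p * K powr (p - 1)) * J"
    using c s by (simp add: mult.assoc[symmetric] ennreal_mult[symmetric])
  finally show ?thesis unfolding J_def .
qed (use p in simp)

lemma nn_integral_powr_finite:
  assumes "a > -1" "R \<ge> 0"
  obtains K where "K > 0" "(\<integral>\<^sup>+t. indicator {0..R} t * ennreal (t powr a) \<partial>lborel) \<le> ennreal K"
proof -
  have "(\<integral>\<^sup>+t. ennreal (t powr a) * indicator {0..R} t \<partial>lborel) = ennreal (R powr (a+1) / (a+1))"
    by (rule nn_integral_has_integral_lebesgue'[OF _ has_integral_powr_from_0[OF assms]]) simp
  then have "(\<integral>\<^sup>+t. indicator {0..R} t * ennreal (t powr a) \<partial>lborel) \<le> ennreal (R powr (a+1) / (a+1) + 1)"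
    using assms by (simp add: mult.commute ennreal_leI)
  moreover have "R powr (a+1) / (a+1) + 1 > 0" using assms by (intro add_nonneg_pos) auto
  ultimately show ?thesis using that by blast
qed

text \<open>
  Directions \<open>y\<close> range over a unit ball \<open>A\<close> with \<open>1 \<le> |y| \<le> 3\<close>.  Every ray \<open>x + t y\<close> leaves \<open>\<Omega>\<close>
  before \<open>t = R\<close>, so \<open>|\<phi>(x)| \<le> 3 \<integral>\<^sub>0\<^sup>R |\<nabla>\<phi>(x + t y)| dt\<close>.  Raise this to the power \<open>p\<close> with the
  weight \<open>t\<^sup>-\<^sup>\<alpha>\<close>, multiply by \<open>w(x)\<close>, integrate over \<open>x\<close> and over \<open>y \<in> A\<close>, and substitute
  \<open>z = x + t y\<close>.  What multiplies \<open>|\<nabla>\<phi>(z)|\<^sup>p\<close> is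
  \<open>\<integral>\<^sub>0\<^sup>R t\<^sup>\<alpha>\<^sup>(\<^sup>p\<^sup>-\<^sup>1\<^sup>) (\<integral>\<^sub>A w(z - t y) dy) dt\<close>, whose inner integral is \<open>O(\<kappa> t\<^sup>-\<^sup>N\<^sup>/\<^sup>\<gamma>)\<close> by Hoelder's
  inequality.  This is finite for some \<open>\<alpha> < 1\<close> exactly because \<open>N/\<gamma> < p\<close>.
\<close>

theorem trace_inequality:
  fixes \<Omega> :: "'a::euclidean_space set" and p \<gamma> :: real
  assumes \<Omega>: "bounded \<Omega>" and p: "p > 1" and \<gamma>: "\<gamma> \<ge> 1" "\<gamma> > DIM('a) / p"
  obtains C where "C > 0"
    "\<And>\<phi> w \<kappa>. \<phi> \<in> C1c \<Omega> \<Longrightarrow> w \<in> borel_measurable borel \<Longrightarrow> (\<And>x. w x \<ge> 0) \<Longrightarrow> \<kappa> > 0 \<Longrightarrow>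
       (\<integral>\<^sup>+x. ennreal (w x powr \<gamma>) \<partial>lborel) \<le> ennreal (\<kappa> powr \<gamma>) \<Longrightarrow>
       (\<integral>\<^sup>+x. ennreal (w x * \<bar>\<phi> x\<bar> powr p) \<partial>lborel) \<le> ennreal (C * \<kappa>) * (\<integral>\<^sup>+x. ennreal (norm (gradient \<phi> x) powr p) \<partial>lborel)"
proof -
  obtain D where D: "D > 0" "\<And>x. x \<in> \<Omega> \<Longrightarrow> norm x \<le> D" using \<Omega> bounded_pos by metis
  define R where "R = 2 * D + 1"
  have R: "R > 0" using D by (simp add: R_def)
  obtain b :: 'a where b: "b \<in> Basis" using nonempty_Basis by blast
  define A where "A = ball (2 *\<^sub>R b) 1"
  have A: "1 \<le> norm y" "norm y \<le> 3" if "y \<in> A" for y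
  proof -
    have "norm (2 *\<^sub>R b - y) < 1" using that by (simp add: A_def dist_norm)
    moreover have "norm (2 *\<^sub>R b) = 2" using b by simp
    ultimately show "1 \<le> norm y" "norm y \<le> 3"
      using norm_triangle_ineq3[of "2 *\<^sub>R b" y] by linarith+
  qed
  have [measurable]: "A \<in> sets borel" by (simp add: A_def)
  define V where "V = measure lborel A"
  have V: "V > 0" unfolding V_def A_def by (rule content_ball_pos) simp
  have VA: "emeasure lborel A = ennreal V"
    unfolding V_def A_def using emeasure_lborel_ball_finite[of "2 *\<^sub>R b" 1] by (intro emeasure_eq_ennreal_measure) auto
  define N where "N = real DIM('a)"
  \<comment> \<open>The exponent \<open>\<alpha> < 1\<close> makes \<open>t\<^sup>-\<^sup>\<alpha>\<close> integrable at \<open>0\<close>, and \<open>\<alpha> > r\<close> is equivalent to \<open>\<alpha> (p - 1) - N/\<gamma> > -1\<close>.\<close>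
  define r where "r = (N/\<gamma> - 1)/(p - 1)"
  define \<alpha> where "\<alpha> = (max 0 r + 1) / 2"
  have "N < p * \<gamma>" using \<gamma> p by (simp add: N_def field_simps)
  then have "N/\<gamma> < p" using \<gamma>(1) by (simp add: field_simps)
  then have "r < 1" using p by (simp add: r_def)
  then have \<alpha>: "0 < \<alpha>" "\<alpha> < 1" "r < \<alpha>" by (auto simp: \<alpha>_def max_def)
  define \<sigma> where "\<sigma> = \<alpha> * (p - 1)"
  have \<sigma>: "\<sigma> - N/\<gamma> > -1" using \<alpha>(3) p by (simp add: \<sigma>_def r_def divide_less_eq)
  obtain K1 where K1: "K1 > 0" "(\<integral>\<^sup>+t. indicator {0..R} t * ennreal (t powr (- \<alpha>)) \<partial>lborel) \<le> ennreal K1"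
    using nn_integral_powr_finite[of "-\<alpha>" R] \<alpha> R by auto
  obtain K2 where K2: "K2 > 0" "(\<integral>\<^sup>+t. indicator {0..R} t * ennreal (t powr (\<sigma> - N/\<gamma>)) \<partial>lborel) \<le> ennreal K2"
    using nn_integral_powr_finite[OF \<sigma>, of R] R by auto
  define C1 where "C1 = (2 * 3) powr p * K1 powr (p - 1)"
  have C1: "C1 > 0" using K1 by (simp add: C1_def)
  define C where "C = C1 * (V + 1) * K2 / V"
  show ?thesis
  proof (rule that[of C])
    show "C > 0" using C1 K2 V by (simp add: C_def)
    fix \<phi> w :: "'a \<Rightarrow> real" and \<kappa> :: real
    assume \<phi>: "\<phi> \<in> C1c \<Omega>" and w[measurable]: "w \<in> borel_measurable borel" and w0: "\<And>x. w x \<ge> 0" and \<kappa>: "\<kappa> > 0"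
      and wk: "(\<integral>\<^sup>+x. ennreal (w x powr \<gamma>) \<partial>lborel) \<le> ennreal (\<kappa> powr \<gamma>)"
    note C = C1c_imp_C1[OF \<phi>]
    have [measurable]: "gradient \<phi> \<in> borel_measurable borel" "\<phi> \<in> borel_measurable borel"
      by (auto intro!: borel_measurable_continuous_onI C1_continuous_gradient C1_continuous C)
    have off: "\<phi> x = 0" if "x \<notin> \<Omega>" for x using \<phi> that unfolding C1c_def by blast
    define h where "h x = norm (gradient \<phi> x)" for x
    have [measurable]: "h \<in> borel_measurable borel" unfolding h_def by measurable
    define g where "g x = ennreal (h x powr p)" for x
    have [measurable]: "g \<in> borel_measurable borel" unfolding g_def by measurable
    have pw: "ennreal (\<bar>\<phi> x\<bar> powr p) \<le> ennreal C1 * (\<integral>\<^sup>+t. indicator {0..R} t * (ennreal (t powr \<sigma>) * g (x + t *\<^sub>R y)) \<partial>lborel)"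
      if y: "y \<in> A" for x y
    proof (cases "x \<in> \<Omega>")
      case True
      have "R * 1 \<le> R * norm y" using A(1)[OF y] R by (intro mult_left_mono) auto
      then have "norm (R *\<^sub>R y) \<ge> R" using R by simp
      moreover have "norm (R *\<^sub>R y) - norm x \<le> norm (x + R *\<^sub>R y)"
        by (metis add.commute norm_diff_ineq)
      ultimately have "norm (x + R *\<^sub>R y) > D" using D(2)[OF True] D(1) R_def by linarith
      then have z: "\<phi> (x + R *\<^sub>R y) = 0" using off D(2) by force
      have "ennreal \<bar>\<phi> x\<bar> \<le> (\<integral>\<^sup>+t. indicator {0..R} t * ennreal (norm (gradient \<phi> (x + t *\<^sub>R y)) * norm y) \<partial>lborel)"
        using C1_increment_le[OF C, of R x y] R z by simp
      also have "\<dots> \<le> (\<integral>\<^sup>+t. ennreal 3 * (indicator {0..R} t * ennreal (h (x + t *\<^sub>R y))) \<partial>lborel)"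
      proof (rule nn_integral_mono)
        fix t :: real
        have "h (x + t *\<^sub>R y) * norm y \<le> 3 * h (x + t *\<^sub>R y)"
          using mult_left_mono[OF A(2)[OF y], of "h (x + t *\<^sub>R y)"] by (simp add: h_def)
        then have "ennreal (h (x + t *\<^sub>R y) * norm y) \<le> ennreal 3 * ennreal (h (x + t *\<^sub>R y))"
          by (subst ennreal_mult[symmetric]) (auto simp: h_def intro: ennreal_leI)
        then show "indicator {0..R} t * ennreal (norm (gradient \<phi> (x + t *\<^sub>R y)) * norm y) \<le>
            ennreal 3 * (indicator {0..R} t * ennreal (h (x + t *\<^sub>R y)))"
          by (simp add: h_def indicator_def)
      qed
      also have "\<dots> = ennreal 3 * (\<integral>\<^sup>+t. indicator {0..R} t * ennreal (h (x + t *\<^sub>R y)) \<partial>lborel)"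
        by (rule nn_integral_cmult) measurable
      finally have "ennreal \<bar>\<phi> x\<bar> \<le> \<dots>" .
      from powr_le_of_le_nn_integral[OF _ _ p K1 _ this]
      show ?thesis by (simp add: C1_def \<sigma>_def g_def h_def ennreal_mult)
    qed (use off p in simp)
    have S: "(\<integral>\<^sup>+y. indicator A y * ennreal (w (z - t *\<^sub>R y)) \<partial>lborel) \<le> ennreal ((V + 1) * \<kappa> * t powr (- (N/\<gamma>)))"
      if t: "t > 0" for t z
    proof -
      \<comment> \<open>With this \<open>s\<close> the two summands of \<open>le_delta_powr\<close> are of the same order after integration.\<close>
      define s where "s = \<kappa> * t powr (- (N/\<gamma>))"
      have s: "s > 0" using \<kappa> t by (simp add: s_def)
      have "(\<integral>\<^sup>+y. indicator A y * ennreal (w (z - t *\<^sub>R y)) \<partial>lborel) \<le>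
        (\<integral>\<^sup>+y. ennreal s * indicator A y + ennreal (s powr (1 - \<gamma>)) * ennreal (w (z + (- t) *\<^sub>R y) powr \<gamma>) \<partial>lborel)"
      proof (rule nn_integral_mono)
        fix y
        have "w (z - t *\<^sub>R y) \<le> s + s powr (1 - \<gamma>) * w (z - t *\<^sub>R y) powr \<gamma>"
          by (rule le_delta_powr[OF w0 s \<gamma>(1)])
        then have "ennreal (w (z - t *\<^sub>R y)) \<le> ennreal (s + s powr (1 - \<gamma>) * w (z - t *\<^sub>R y) powr \<gamma>)"
          by (rule ennreal_leI)
        also have "\<dots> = ennreal s + ennreal (s powr (1 - \<gamma>)) * ennreal (w (z + (- t) *\<^sub>R y) powr \<gamma>)"
          using s by (simp add: ennreal_mult)
        finally show "indicator A y * ennreal (w (z - t *\<^sub>R y)) \<le> ennreal s * indicator A y + ennreal (s powr (1 - \<gamma>)) * ennreal (w (z + (- t) *\<^sub>R y) powr \<gamma>)"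
          by (simp add: indicator_def)
      qed
      also have "\<dots> = ennreal s * ennreal V + ennreal (s powr (1 - \<gamma>)) * (ennreal (1 / \<bar>-t\<bar> ^ DIM('a)) * (\<integral>\<^sup>+y. ennreal (w y powr \<gamma>) \<partial>lborel))"
        using t by (subst nn_integral_add) (auto simp: nn_integral_cmult VA nn_integral_lborel_affine[where f="\<lambda>y. ennreal (w y powr \<gamma>)" and c="-t", simplified])
      also have "\<dots> \<le> ennreal s * ennreal V + ennreal (s powr (1 - \<gamma>)) * (ennreal (1 / \<bar>-t\<bar> ^ DIM('a)) * ennreal (\<kappa> powr \<gamma>))"
        by (intro add_left_mono mult_left_mono wk) auto
      also have "\<dots> = ennreal (s * V + s powr (1 - \<gamma>) * (1 / t ^ DIM('a) * \<kappa> powr \<gamma>))"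
        using s V t by (simp add: ennreal_mult[symmetric] ennreal_plus[symmetric] del: ennreal_plus)
      also have "s powr (1 - \<gamma>) * (1 / t ^ DIM('a) * \<kappa> powr \<gamma>) = s"
      proof -
        have "s powr (1 - \<gamma>) = \<kappa> powr (1 - \<gamma>) * t powr (N - N/\<gamma>)"
        proof -
          have e: "- (N/\<gamma>) * (1 - \<gamma>) = N - N/\<gamma>" using \<gamma>(1) by (simp add: field_simps)
          have "s powr (1 - \<gamma>) = \<kappa> powr (1 - \<gamma>) * (t powr (- (N/\<gamma>))) powr (1 - \<gamma>)"
            unfolding s_def by (rule powr_mult)
          then show ?thesis by (simp only: powr_powr e)
        qed
        moreover have "1 / t ^ DIM('a) = t powr (- N)"
          using t by (simp add: N_def powr_minus powr_realpow divide_inverse)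
        ultimately have "s powr (1 - \<gamma>) * (1 / t ^ DIM('a) * \<kappa> powr \<gamma>) = (\<kappa> powr (1 - \<gamma>) * \<kappa> powr \<gamma>) * (t powr (N - N/\<gamma>) * t powr (- N))"
          by simp
        also have "\<dots> = s" using \<kappa> t by (simp add: powr_add[symmetric] s_def)
        finally show ?thesis .
      qed
      also have "s * V + s = (V + 1) * \<kappa> * t powr (- (N/\<gamma>))" by (simp add: s_def algebra_simps)
      finally show ?thesis .
    qed
    define G where "G = (\<integral>\<^sup>+z. g z \<partial>lborel)"
    define W where "W = (\<integral>\<^sup>+x. ennreal (w x * \<bar>\<phi> x\<bar> powr p) \<partial>lborel)"
    define k where "k t y x = ennreal (w x) * (indicator A y * (indicator {0..R} t * (ennreal (t powr \<sigma>) * g (x + t *\<^sub>R y))))" for t y x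
    \<comment> \<open>\<open>V W\<close> is the integral over all directions \<open>y \<in> A\<close>; the order of integration is changed until \<open>y\<close>
      is innermost.\<close>
    have "ennreal V * W = (\<integral>\<^sup>+x. \<integral>\<^sup>+y. indicator A y * ennreal (w x * \<bar>\<phi> x\<bar> powr p) \<partial>lborel \<partial>lborel)"
      unfolding W_def by (subst nn_integral_cmult[symmetric]) (auto simp: nn_integral_multc VA)
    also have "\<dots> \<le> (\<integral>\<^sup>+x. \<integral>\<^sup>+y. ennreal C1 * (\<integral>\<^sup>+t. k t y x \<partial>lborel) \<partial>lborel \<partial>lborel)"
    proof (intro nn_integral_mono)
      fix x y
      show "indicator A y * ennreal (w x * \<bar>\<phi> x\<bar> powr p) \<le> ennreal C1 * (\<integral>\<^sup>+t. k t y x \<partial>lborel)"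
      proof (cases "y \<in> A")
        case True
        have "(\<integral>\<^sup>+t. k t y x \<partial>lborel) = ennreal (w x) * (\<integral>\<^sup>+t. indicator {0..R} t * (ennreal (t powr \<sigma>) * g (x + t *\<^sub>R y)) \<partial>lborel)"
          unfolding k_def using True by (simp add: nn_integral_cmult)
        moreover have "ennreal (w x) * ennreal (\<bar>\<phi> x\<bar> powr p) \<le> ennreal (w x) * (ennreal C1 * (\<integral>\<^sup>+t. indicator {0..R} t * (ennreal (t powr \<sigma>) * g (x + t *\<^sub>R y)) \<partial>lborel))"
          by (intro mult_left_mono pw True) simp
        ultimately show ?thesis using True w0[of x] by (simp add: ennreal_mult mult_ac)
      qed simp
    qed
    also have "\<dots> = ennreal C1 * (\<integral>\<^sup>+x. \<integral>\<^sup>+y. \<integral>\<^sup>+t. k t y x \<partial>lborel \<partial>lborel \<partial>lborel)"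
      unfolding k_def by (subst nn_integral_cmult, measurable)+
    also have "(\<integral>\<^sup>+x. \<integral>\<^sup>+y. \<integral>\<^sup>+t. k t y x \<partial>lborel \<partial>lborel \<partial>lborel) = (\<integral>\<^sup>+y. \<integral>\<^sup>+x. \<integral>\<^sup>+t. k t y x \<partial>lborel \<partial>lborel \<partial>lborel)"
      unfolding k_def by (intro lborel_pair.Fubini') measurable
    also have "\<dots> = (\<integral>\<^sup>+y. \<integral>\<^sup>+t. \<integral>\<^sup>+x. k t y x \<partial>lborel \<partial>lborel \<partial>lborel)"
      unfolding k_def by (intro nn_integral_cong lborel_pair.Fubini') measurable
    also have "\<dots> = (\<integral>\<^sup>+y. \<integral>\<^sup>+t. \<integral>\<^sup>+z. k t y (- (t *\<^sub>R y) + 1 *\<^sub>R z) \<partial>lborel \<partial>lborel \<partial>lborel)"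
    proof (rule nn_integral_cong, rule nn_integral_cong)
      fix y :: 'a and t :: real
      have "k t y \<in> borel_measurable borel" unfolding k_def by measurable
      from nn_integral_lborel_affine[OF this, of 1 "- (t *\<^sub>R y)"]
      show "(\<integral>\<^sup>+x. k t y x \<partial>lborel) = (\<integral>\<^sup>+z. k t y (- (t *\<^sub>R y) + 1 *\<^sub>R z) \<partial>lborel)" by simp
    qed
    also have "\<dots> = (\<integral>\<^sup>+t. \<integral>\<^sup>+y. \<integral>\<^sup>+z. k t y (- (t *\<^sub>R y) + 1 *\<^sub>R z) \<partial>lborel \<partial>lborel \<partial>lborel)"
      unfolding k_def by (intro lborel_pair.Fubini') measurable
    also have "\<dots> = (\<integral>\<^sup>+t. \<integral>\<^sup>+z. \<integral>\<^sup>+y. k t y (- (t *\<^sub>R y) + 1 *\<^sub>R z) \<partial>lborel \<partial>lborel \<partial>lborel)"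
      unfolding k_def by (intro nn_integral_cong lborel_pair.Fubini') measurable
    also have "\<dots> \<le> (\<integral>\<^sup>+t. \<integral>\<^sup>+z. indicator {0..R} t * (ennreal ((V + 1) * \<kappa>) * (ennreal (t powr (\<sigma> - N/\<gamma>)) * g z)) \<partial>lborel \<partial>lborel)"
    proof (rule nn_integral_mono_AE)
      show "AE t in lborel. (\<integral>\<^sup>+z. \<integral>\<^sup>+y. k t y (- (t *\<^sub>R y) + 1 *\<^sub>R z) \<partial>lborel \<partial>lborel) \<le>
         (\<integral>\<^sup>+z. indicator {0..R} t * (ennreal ((V + 1) * \<kappa>) * (ennreal (t powr (\<sigma> - N/\<gamma>)) * g z)) \<partial>lborel)"
        using AE_lborel_singleton[of "0::real"]
      proof eventually_elim
        case (elim t)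
        show ?case
        proof (rule nn_integral_mono)
          fix z
          show "(\<integral>\<^sup>+y. k t y (- (t *\<^sub>R y) + 1 *\<^sub>R z) \<partial>lborel) \<le>
            indicator {0..R} t * (ennreal ((V + 1) * \<kappa>) * (ennreal (t powr (\<sigma> - N/\<gamma>)) * g z))"
          proof (cases "t \<in> {0..R}")
            case True
            then have t: "t > 0" using elim by simp
            have "(\<integral>\<^sup>+y. k t y (- (t *\<^sub>R y) + 1 *\<^sub>R z) \<partial>lborel) = (\<integral>\<^sup>+y. (ennreal (t powr \<sigma>) * g z) * (indicator A y * ennreal (w (z - t *\<^sub>R y))) \<partial>lborel)"
              unfolding k_def using True by (intro nn_integral_cong) (simp add: mult_ac)
            also have "\<dots> = (ennreal (t powr \<sigma>) * g z) * (\<integral>\<^sup>+y. indicator A y * ennreal (w (z - t *\<^sub>R y)) \<partial>lborel)"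
              by (rule nn_integral_cmult) measurable
            also have "\<dots> \<le> (ennreal (t powr \<sigma>) * g z) * ennreal ((V + 1) * \<kappa> * t powr (- (N/\<gamma>)))"
              by (intro mult_left_mono S t) simp
            also have "\<dots> = (ennreal (t powr \<sigma>) * ennreal ((V + 1) * \<kappa> * t powr (- (N/\<gamma>)))) * g z"
              by (simp add: mult_ac)
            also have "ennreal (t powr \<sigma>) * ennreal ((V + 1) * \<kappa> * t powr (- (N/\<gamma>))) = ennreal ((V + 1) * \<kappa>) * ennreal (t powr (\<sigma> - N/\<gamma>))"
              using V \<kappa> t by (simp add: ennreal_mult[symmetric] powr_diff powr_minus divide_inverse mult_ac)
            finally show ?thesis using True by (simp add: mult.assoc)
          qed (simp add: k_def)
        qed
      qed
    qed
    also have "\<dots> = (\<integral>\<^sup>+t. indicator {0..R} t * ennreal (t powr (\<sigma> - N/\<gamma>)) * (ennreal ((V + 1) * \<kappa>) * G) \<partial>lborel)"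
      unfolding G_def by (intro nn_integral_cong) (simp add: nn_integral_cmult nn_integral_multc mult_ac)
    also have "\<dots> = (\<integral>\<^sup>+t. indicator {0..R} t * ennreal (t powr (\<sigma> - N/\<gamma>)) \<partial>lborel) * (ennreal ((V + 1) * \<kappa>) * G)"
      by (rule nn_integral_multc) measurable
    also have "\<dots> \<le> ennreal K2 * (ennreal ((V + 1) * \<kappa>) * G)"
      by (intro mult_right_mono K2) simp
    finally have VW: "ennreal V * W \<le> ennreal C1 * (ennreal K2 * (ennreal ((V + 1) * \<kappa>) * G))"
      by (simp add: mult_left_mono)
    have "W = ennreal (1 / V) * (ennreal V * W)"
      using V by (simp add: mult.assoc[symmetric] ennreal_mult[symmetric])
    also have "\<dots> \<le> ennreal (1 / V) * (ennreal C1 * (ennreal K2 * (ennreal ((V + 1) * \<kappa>) * G)))"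
      by (rule mult_left_mono[OF VW]) simp
    also have "\<dots> = ennreal (C * \<kappa>) * G"
      using V C1 K2 \<kappa> by (simp add: C_def mult.assoc[symmetric] ennreal_mult[symmetric]) (simp add: field_simps)
    finally show "(\<integral>\<^sup>+x. ennreal (w x * \<bar>\<phi> x\<bar> powr p) \<partial>lborel) \<le> ennreal (C * \<kappa>) * (\<integral>\<^sup>+x. ennreal (norm (gradient \<phi> x) powr p) \<partial>lborel)"
      unfolding W_def G_def g_def h_def .
  qed
qed

section \<open>Spreading of large values\<close>

lemma borel_measurable_mean_oscillation:
  fixes k :: "'a::euclidean_space \<Rightarrow> real"
  assumes [measurable]: "k \<in> borel_measurable borel"
  shows "(\<lambda>x. \<integral>\<^sup>+y. indicator (ball z r) y * ennreal \<bar>k x - k y\<bar> \<partial>lborel) \<in> borel_measurable borel"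
proof -
  have [measurable]: "ball z r \<in> sets borel" by simp
  have "(\<lambda>x. \<integral>\<^sup>+y. indicator (ball z r) y * ennreal \<bar>k x - k y\<bar> \<partial>lborel) \<in> borel_measurable lborel"
    by measurable
  then show ?thesis by simp
qed

context bounded_open_set begin

lemma nn_integral_M_eq_lborel:
  assumes "\<And>x. x \<notin> \<Omega> \<Longrightarrow> f x = 0"
  shows "(\<integral>\<^sup>+x. f x \<partial>M) = (\<integral>\<^sup>+x. f x \<partial>lborel)"
proof -
  have "f x * indicator \<Omega> x = f x" for x using assms by (auto simp: indicator_def)
  then show ?thesis
    by (subst nn_integral_restrict_space) (auto simp: nn_integral_completion)
qed

text \<open>
  A double integral rather than the deviation from the mean, because it is lower semicontinuous
  under convergence almost everywhere and directly bounds products of measures of level sets.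
\<close>

definition oscillation :: "'a \<Rightarrow> real \<Rightarrow> ('a \<Rightarrow> real) \<Rightarrow> ennreal" where
  "oscillation z r w = (\<integral>\<^sup>+x. indicator (ball z r) x * (\<integral>\<^sup>+y. indicator (ball z r) y * ennreal \<bar>w x - w y\<bar> \<partial>M) \<partial>M)"

definition Poincare_const :: "real \<Rightarrow> real" where
  "Poincare_const r = 2 * r * 2 ^ DIM('a) * measure lborel (ball (0::'a) r)"

lemma oscillation_C1:
  assumes w: "C1 w" and r: "r > 0" "ball z r \<subseteq> \<Omega>"
  shows "oscillation z r w \<le> ennreal (Poincare_const r) * (\<integral>\<^sup>+x. indicator (ball z r) x * ennreal (norm (gradient w x)) \<partial>M)"
proof -
  have o: "oscillation z r w = (\<integral>\<^sup>+x. indicator (ball z r) x * (\<integral>\<^sup>+y. indicator (ball z r) y * ennreal \<bar>w x - w y\<bar> \<partial>lborel) \<partial>lborel)"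
    unfolding oscillation_def using r(2)
    by (subst nn_integral_M_eq_lborel) (auto simp: indicator_def intro!: nn_integral_cong nn_integral_M_eq_lborel)
  have e: "(\<integral>\<^sup>+x. indicator (ball z r) x * ennreal (norm (gradient w x)) \<partial>M) = (\<integral>\<^sup>+x. indicator (ball z r) x * ennreal (norm (gradient w x)) \<partial>lborel)"
    using r(2) by (intro nn_integral_M_eq_lborel) (auto simp: indicator_def)
  have "measure lborel (ball z r) = measure lborel (ball (0::'a) r)"
    using content_ball_conv_unit_ball[of r z] content_ball_conv_unit_ball[of r "0::'a"] r by simp
  then show ?thesis unfolding o e Poincare_const_def using Poincare_ball[OF w r(1), of z] by simp
qed

text \<open>
  Poincare's inequality for the approximating \<open>C\<^sup>1\<close> functions, then Fatou's lemma, in both variables,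
  on the left and convergence in \<open>L\<^sup>1\<close> of the gradients on the right.
\<close>

lemma oscillation_W01p:
  assumes u: "u \<in> W01p \<Omega> p" and r: "r > 0" "ball z r \<subseteq> \<Omega>"
    and G: "\<And>s. (G has_real_derivative G' s) (at s)" "continuous_on UNIV G'" "\<And>s. \<bar>G' s\<bar> \<le> L"
  shows "oscillation z r (\<lambda>x. G (u x)) \<le> ennreal (Poincare_const r) *
    (\<integral>\<^sup>+x. indicator (ball z r) x * ennreal (\<bar>G' (u x)\<bar> * norm (weak_gradient \<Omega> u x)) \<partial>M)"
proof -
  let ?B = "ball z r"
  obtain \<zeta> where \<zeta>: "\<And>n. \<zeta> n \<in> C1c \<Omega>" "Lp_limit \<zeta> u" "Lp_limit (\<lambda>n. gradient (\<zeta> n)) (weak_gradient \<Omega> u)"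
    "AE x in M. (\<lambda>n. \<zeta> n x) \<longlonglongrightarrow> u x"
    by (rule W01pE[OF u]) (rule that)
  note C = C1c_imp_C1[OF \<zeta>(1)]
  have Gc: "continuous_on UNIV G"
    by (intro continuous_at_imp_continuous_on ballI DERIV_isCont[OF G(1)])
  have [measurable]: "G \<in> borel_measurable borel" "G' \<in> borel_measurable borel"
    by (auto intro!: borel_measurable_continuous_onI Gc G)
  note [measurable] = LpD(1)[OF W01p_Lp(1)[OF u]] LpD(1)[OF W01p_Lp(2)[OF u]]
  have \<zeta>m[measurable]: "\<zeta> n \<in> borel_measurable M" "gradient (\<zeta> n) \<in> borel_measurable M" for n
    by (intro continuous_measurable_M C1_continuous C1_continuous_gradient C)+
  have cg: "C1 (\<lambda>x. G (\<zeta> n x))" "gradient (\<lambda>x. G (\<zeta> n x)) = (\<lambda>x. G' (\<zeta> n x) *\<^sub>R gradient (\<zeta> n) x)" for n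
    by (rule C1_compose[OF C G(1) continuous_on_subset[OF G(2)]], simp)+
  have lim: "Lp_limit (\<lambda>n x. G' (\<zeta> n x) *\<^sub>R gradient (\<zeta> n) x) (\<lambda>x. G' (u x) *\<^sub>R weak_gradient \<Omega> u x)"
  proof (rule Lp_limit_scaleR[OF \<zeta>(3)])
    show "AE x in M. \<bar>G' (\<zeta> n x)\<bar> \<le> L" for n using G(3) by simp
    show "AE x in M. (\<lambda>n. G' (\<zeta> n x)) \<longlonglongrightarrow> G' (u x)"
      using \<zeta>(4) by eventually_elim (intro continuous_on_tendsto_compose[OF G(2)], auto)
  qed measurable
  define V where "V n x = G' (\<zeta> n x) *\<^sub>R gradient (\<zeta> n) x" for n x
  define V0 where "V0 x = G' (u x) *\<^sub>R weak_gradient \<Omega> u x" for x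
  have [measurable]: "V n \<in> borel_measurable M" "V0 \<in> borel_measurable M" for n
    unfolding V_def V0_def by measurable
  have L1: "(\<lambda>n. LINT x|M. norm (V n x - V0 x)) \<longlonglongrightarrow> 0"
    using Lp_limit_L1[OF lim] by (simp add: V_def V0_def)
  have di: "integrable M (\<lambda>x. norm (V n x - V0 x))" for n
    using Lp_integrable[OF Lp_diff[OF Lp_limitD(1)[OF lim, of n] Lp_limitD(2)[OF lim]]] by (simp add: V_def V0_def)
  define I where "I n = (\<integral>\<^sup>+x. indicator ?B x * ennreal (norm (V n x)) \<partial>M)" for n
  define I0 where "I0 = (\<integral>\<^sup>+x. indicator ?B x * ennreal (norm (V0 x)) \<partial>M)"
  have [measurable]: "?B \<in> sets M" by (rule ball_sets_M[OF r(2)])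
  have In: "I n \<le> I0 + ennreal (LINT x|M. norm (V n x - V0 x))" for n
  proof -
    have "I n \<le> (\<integral>\<^sup>+x. indicator ?B x * ennreal (norm (V0 x)) + ennreal (norm (V n x - V0 x)) \<partial>M)"
      unfolding I_def
    proof (rule nn_integral_mono)
      fix x
      have "norm (V n x) \<le> norm (V0 x) + norm (V n x - V0 x)" using norm_triangle_sub by blast
      then have "ennreal (norm (V n x)) \<le> ennreal (norm (V0 x)) + ennreal (norm (V n x - V0 x))"
        by (simp add: ennreal_leI ennreal_plus[symmetric] del: ennreal_plus)
      then show "indicator ?B x * ennreal (norm (V n x)) \<le> indicator ?B x * ennreal (norm (V0 x)) + ennreal (norm (V n x - V0 x))"
        by (simp add: indicator_def)
    qed
    also have "\<dots> = I0 + (\<integral>\<^sup>+x. ennreal (norm (V n x - V0 x)) \<partial>M)"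
      unfolding I0_def by (rule nn_integral_add) measurable
    also have "(\<integral>\<^sup>+x. ennreal (norm (V n x - V0 x)) \<partial>M) = ennreal (LINT x|M. norm (V n x - V0 x))"
      by (rule nn_integral_eq_integral[OF di]) simp
    finally show ?thesis .
  qed
  have liminf_le: "liminf (\<lambda>n. ennreal (Poincare_const r) * I n) \<le> ennreal (Poincare_const r) * I0"
  proof -
    let ?b = "\<lambda>n. ennreal (Poincare_const r) * (I0 + ennreal (LINT x|M. norm (V n x - V0 x)))"
    have "?b \<longlonglongrightarrow> ennreal (Poincare_const r) * (I0 + ennreal 0)"
      by (intro ennreal_tendsto_cmult tendsto_add tendsto_const tendsto_ennrealI L1) simp
    then have "liminf ?b = ennreal (Poincare_const r) * I0"
      using lim_imp_Liminf[OF sequentially_bot] by fastforce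
    moreover have "liminf (\<lambda>n. ennreal (Poincare_const r) * I n) \<le> liminf ?b"
      by (intro Liminf_mono always_eventually allI mult_left_mono In) simp
    ultimately show ?thesis by simp
  qed
  have AEc: "AE x in M. (\<lambda>n. G (\<zeta> n x)) \<longlonglongrightarrow> G (u x)"
    using \<zeta>(4) by eventually_elim (intro continuous_on_tendsto_compose[OF Gc], auto)
  have inner: "(\<integral>\<^sup>+y. indicator ?B y * ennreal \<bar>G (u x) - G (u y)\<bar> \<partial>M) \<le>
     liminf (\<lambda>n. \<integral>\<^sup>+y. indicator ?B y * ennreal \<bar>G (\<zeta> n x) - G (\<zeta> n y)\<bar> \<partial>M)"
    if x: "(\<lambda>n. G (\<zeta> n x)) \<longlonglongrightarrow> G (u x)" for x
  proof -
    have "(\<integral>\<^sup>+y. indicator ?B y * ennreal \<bar>G (u x) - G (u y)\<bar> \<partial>M) \<le>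
       (\<integral>\<^sup>+y. liminf (\<lambda>n. indicator ?B y * ennreal \<bar>G (\<zeta> n x) - G (\<zeta> n y)\<bar>) \<partial>M)"
    proof (rule nn_integral_mono_AE)
      show "AE y in M. indicator ?B y * ennreal \<bar>G (u x) - G (u y)\<bar> \<le> liminf (\<lambda>n. indicator ?B y * ennreal \<bar>G (\<zeta> n x) - G (\<zeta> n y)\<bar>)"
        using AEc
      proof eventually_elim
        case (elim y)
        have "(\<lambda>n. ennreal \<bar>G (\<zeta> n x) - G (\<zeta> n y)\<bar>) \<longlonglongrightarrow> ennreal \<bar>G (u x) - G (u y)\<bar>"
          by (intro tendsto_ennrealI tendsto_rabs tendsto_diff x elim)
        then have "(\<lambda>n. indicator ?B y * ennreal \<bar>G (\<zeta> n x) - G (\<zeta> n y)\<bar>) \<longlonglongrightarrow> indicator ?B y * ennreal \<bar>G (u x) - G (u y)\<bar>"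
          by (cases "y \<in> ?B") auto
        then have "liminf (\<lambda>n. indicator ?B y * ennreal \<bar>G (\<zeta> n x) - G (\<zeta> n y)\<bar>) = indicator ?B y * ennreal \<bar>G (u x) - G (u y)\<bar>"
          by (rule lim_imp_Liminf[OF sequentially_bot])
        then show ?case by simp
      qed
    qed
    also have "\<dots> \<le> liminf (\<lambda>n. \<integral>\<^sup>+y. indicator ?B y * ennreal \<bar>G (\<zeta> n x) - G (\<zeta> n y)\<bar> \<partial>M)"
      by (rule nn_integral_liminf) measurable
    finally show ?thesis .
  qed
  define J where "J n x = (\<integral>\<^sup>+y. indicator ?B y * ennreal \<bar>G (\<zeta> n x) - G (\<zeta> n y)\<bar> \<partial>M)" for n x
  have J_lb: "J n x = (\<integral>\<^sup>+y. indicator ?B y * ennreal \<bar>G (\<zeta> n x) - G (\<zeta> n y)\<bar> \<partial>lborel)" for n x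
    unfolding J_def using r(2) by (intro nn_integral_M_eq_lborel) (auto simp: indicator_def)
  have Gz: "(\<lambda>x. G (\<zeta> n x)) \<in> borel_measurable borel" for n
    by (intro borel_measurable_continuous_onI C1_continuous cg)
  have "J n \<in> borel_measurable borel" for n
    unfolding J_lb[abs_def] by (rule borel_measurable_mean_oscillation[OF Gz])
  then have [measurable]: "J n \<in> borel_measurable M" for n
    by (rule borel_measurable_M)
  have "oscillation z r (\<lambda>x. G (u x)) \<le> (\<integral>\<^sup>+x. liminf (\<lambda>n. indicator ?B x * J n x) \<partial>M)"
    unfolding oscillation_def
  proof (rule nn_integral_mono_AE)
    show "AE x in M. indicator ?B x * (\<integral>\<^sup>+y. indicator ?B y * ennreal \<bar>G (u x) - G (u y)\<bar> \<partial>M) \<le> liminf (\<lambda>n. indicator ?B x * J n x)"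
      using AEc
    proof eventually_elim
      case (elim x)
      then show ?case using inner[OF elim] by (cases "x \<in> ?B") (auto simp: J_def)
    qed
  qed
  also have "\<dots> \<le> liminf (\<lambda>n. \<integral>\<^sup>+x. indicator ?B x * J n x \<partial>M)"
    by (rule nn_integral_liminf) measurable
  also have "\<dots> \<le> liminf (\<lambda>n. ennreal (Poincare_const r) * I n)"
  proof (rule Liminf_mono, rule always_eventually, rule allI)
    fix n
    show "(\<integral>\<^sup>+x. indicator ?B x * J n x \<partial>M) \<le> ennreal (Poincare_const r) * I n"
      using oscillation_C1[OF cg(1)[of n] r] unfolding oscillation_def J_def I_def V_def cg(2) .
  qed
  also note liminf_le
  finally show ?thesis by (simp add: I0_def V0_def)
qed

text \<open>
  Where \<open>w(x) \<ge> L\<close> and \<open>w(y) \<le> T\<close> the integrand is at least \<open>L - T\<close>.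
\<close>

lemma oscillation_level_sets:
  assumes [measurable]: "w \<in> borel_measurable M" and r: "ball z r \<subseteq> \<Omega>" and o: "oscillation z r w \<le> ennreal C" and TL: "T < L" and C: "C \<ge> 0"
  shows "(L - T) * measure M {x\<in>ball z r. w x \<ge> L} * measure M {x\<in>ball z r. w x \<le> T} \<le> C"
proof -
  let ?B = "ball z r"
  let ?P = "{x\<in>?B. w x \<ge> L}" and ?Q = "{x\<in>?B. w x \<le> T}"
  have PQ: "?P \<in> sets M" "?Q \<in> sets M"
    by (intro sets_M_Collect[OF ball_sets_M[OF r]]; measurable)+
  have "ennreal ((L - T) * measure M ?P * measure M ?Q) = ennreal (L - T) * emeasure M ?Q * emeasure M ?P"
    using TL by (simp add: emeasure_eq_measure ennreal_mult mult_ac)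
  also have "\<dots> = (\<integral>\<^sup>+x. (\<integral>\<^sup>+y. ennreal (L - T) * indicator ?Q y \<partial>M) * indicator ?P x \<partial>M)"
    using PQ by (simp add: nn_integral_cmult_indicator)
  also have "\<dots> \<le> oscillation z r w"
    unfolding oscillation_def
  proof (rule nn_integral_mono)
    fix x
    show "(\<integral>\<^sup>+y. ennreal (L - T) * indicator ?Q y \<partial>M) * indicator ?P x \<le> indicator ?B x * (\<integral>\<^sup>+y. indicator ?B y * ennreal \<bar>w x - w y\<bar> \<partial>M)"
    proof (cases "x \<in> ?P")
      case True
      have "(\<integral>\<^sup>+y. ennreal (L - T) * indicator ?Q y \<partial>M) \<le> (\<integral>\<^sup>+y. indicator ?B y * ennreal \<bar>w x - w y\<bar> \<partial>M)"
        using True by (intro nn_integral_mono) (auto simp: indicator_def intro!: ennreal_leI)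
      then show ?thesis using True by simp
    qed simp
  qed
  also note o
  finally show ?thesis using C by simp
qed

text \<open>
  Call a ball good if \<open>w\<^sub>n\<close> tends to infinity in measure on it.  With bounded oscillation, if the set
  \<open>w\<^sub>n \<ge> L\<close> keeps a fixed amount of measure in a ball for every \<open>L\<close>, then the set \<open>w\<^sub>n \<le> T\<close> must
  vanish, because the product of the two measures is at most \<open>C/(L - T)\<close>; so the ball is good.  A
  ball that meets a good one contains such an amount, so good and bad balls never meet, and
  connectedness leaves only good ones.
\<close>

theorem mass_spreads:
  assumes conn: "connected \<Omega>" and [measurable]: "\<And>n. w n \<in> borel_measurable M"
    and osc: "\<And>z r. r > 0 \<Longrightarrow> cball z r \<subseteq> \<Omega> \<Longrightarrow> \<exists>C. \<forall>n. oscillation z r (w n) \<le> ennreal C"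
    and start: "cball z0 r0 \<subseteq> \<Omega>" "r0 > 0" "c0 > 0" "\<And>T. \<forall>\<^sub>F n in sequentially. c0 \<le> measure M {x\<in>ball z0 r0. w n x \<ge> T}"
    and K: "compact K" "K \<subseteq> \<Omega>"
  shows "(\<lambda>n. measure M {x\<in>K. w n x \<le> T}) \<longlonglongrightarrow> 0"
proof -
  have ms: "{x\<in>B. w n x \<le> T} \<in> sets M" "{x\<in>B. w n x \<ge> T} \<in> sets M" if "B \<in> sets lebesgue" "B \<subseteq> \<Omega>" for n T B
    by (intro sets_M_Collect[OF sets_M_subset[OF that]]; measurable)+
  have step: "(\<lambda>n. measure M {x\<in>ball z r. w n x \<le> T}) \<longlonglongrightarrow> 0"
    if zr: "r > 0" "cball z r \<subseteq> \<Omega>" and c: "c > 0" "\<And>T. \<forall>\<^sub>F n in sequentially. c \<le> measure M {x\<in>ball z r. w n x \<ge> T}"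
    for z r c T
  proof (rule LIMSEQ_I)
    fix e :: real assume e: "e > 0"
    obtain C where C: "\<And>n. oscillation z r (w n) \<le> ennreal C" using osc[OF zr] by blast
    \<comment> \<open>Large enough for \<open>C/((L - T) c) < e\<close>.\<close>
    define L where "L = T + (\<bar>C\<bar> + 1) / (c * e)"
    have L: "L > T" using c e by (simp add: L_def)
    obtain N where N: "\<And>n. n \<ge> N \<Longrightarrow> c \<le> measure M {x\<in>ball z r. w n x \<ge> L}"
      using c(2)[of L] by (auto simp: eventually_sequentially)
    show "\<exists>N. \<forall>n\<ge>N. norm (measure M {x\<in>ball z r. w n x \<le> T} - 0) < e"
    proof (intro exI allI impI)
      fix n assume n: "n \<ge> N"
      let ?m = "measure M {x\<in>ball z r. w n x \<le> T}"
      have "(L - T) * c * ?m \<le> (L - T) * measure M {x\<in>ball z r. w n x \<ge> L} * ?m"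
        using N[OF n] L by (intro mult_right_mono mult_left_mono) auto
      also have "\<dots> \<le> \<bar>C\<bar>"
      proof (rule oscillation_level_sets[OF _ _ _ L])
        show "oscillation z r (w n) \<le> ennreal \<bar>C\<bar>"
          by (rule order_trans[OF C ennreal_leI]) simp
      qed (use zr ball_subset_cball in auto)
      finally have "(\<bar>C\<bar> + 1) / e * ?m \<le> \<bar>C\<bar>" using c e by (simp add: L_def)
      then have "(\<bar>C\<bar> + 1) * ?m \<le> \<bar>C\<bar> * e" using e by (simp add: field_simps)
      also have "\<dots> < (\<bar>C\<bar> + 1) * e" using e by simp
      finally have "?m < e" by (rule mult_left_less_imp_less) simp
      then show "norm (?m - 0) < e" by simp
    qed
  qed
  define good where "good z r \<longleftrightarrow> r > 0 \<and> ball z r \<subseteq> \<Omega> \<and> (\<forall>T. (\<lambda>n. measure M {x\<in>ball z r. w n x \<le> T}) \<longlonglongrightarrow> 0)" for z r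
  have good_sub: "good z' r'" if "good z r" "ball z' r' \<subseteq> ball z r" "r' > 0" for z r z' r'
    unfolding good_def
  proof (intro conjI allI)
    have br: "ball z r \<subseteq> \<Omega>" using that(1) by (simp add: good_def)
    show "ball z' r' \<subseteq> \<Omega>" "r' > 0" using that br by auto
    fix T
    show "(\<lambda>n. measure M {x\<in>ball z' r'. w n x \<le> T}) \<longlonglongrightarrow> 0"
    proof (rule tendsto_sandwich[OF _ _ tendsto_const])
      show "(\<lambda>n. measure M {x\<in>ball z r. w n x \<le> T}) \<longlonglongrightarrow> 0" using that(1) by (simp add: good_def)
      show "\<forall>\<^sub>F n in sequentially. measure M {x\<in>ball z' r'. w n x \<le> T} \<le> measure M {x\<in>ball z r. w n x \<le> T}"
        using that(2) br by (intro always_eventually allI finite_measure_mono ms) auto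
    qed simp
  qed
  \<comment> \<open>\<open>G\<close> is covered by good balls, \<open>H\<close> by the others; they are open, disjoint within \<open>\<Omega>\<close>, and cover it.\<close>
  define G where "G = (\<Union>(z, r)\<in>{(z, r). good z r}. ball z r)"
  define H where "H = (\<Union>(z, r)\<in>{(z, r). cball z r \<subseteq> \<Omega> \<and> r > 0 \<and> \<not> good z r}. ball z r)"
  have "open G" "open H" unfolding G_def H_def by (auto intro!: open_UN)
  have "\<Omega> \<subseteq> G \<union> H"
  proof
    fix x assume "x \<in> \<Omega>"
    then obtain s where s: "s > 0" "cball x s \<subseteq> \<Omega>" using open_domain open_contains_cball by metis
    then show "x \<in> G \<union> H" by (cases "good x s") (auto simp: G_def H_def intro!: exI[of _ x] exI[of _ s])
  qed
  moreover have "G \<inter> H \<inter> \<Omega> = {}"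
  proof (rule ccontr)
    assume "G \<inter> H \<inter> \<Omega> \<noteq> {}"
    then obtain x z r z' r' where 1: "x \<in> ball z r" "good z r" and 2: "x \<in> ball z' r'" "cball z' r' \<subseteq> \<Omega>" "r' > 0" "\<not> good z' r'"
      by (auto simp: G_def H_def)
    have "open (ball z r \<inter> ball z' r')" by auto
    then obtain \<rho> where \<rho>: "\<rho> > 0" "ball x \<rho> \<subseteq> ball z r \<inter> ball z' r'"
      using 1 2 openE by (metis IntI)
    have g: "good x \<rho>" using good_sub[OF 1(2)] \<rho> by auto
    have bx: "ball x \<rho> \<subseteq> \<Omega>" "ball x \<rho> \<subseteq> ball z' r'" "ball z' r' \<subseteq> \<Omega>" using g \<rho> 2 ball_subset_cball by (auto simp: good_def)
    define \<mu> where "\<mu> = measure M (ball x \<rho>)"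
    have \<mu>: "\<mu> > 0"
    proof -
      have "\<mu> = measure lebesgue (ball x \<rho>)" unfolding \<mu>_def using bx by (simp add: measure_restrict_space)
      also have "\<dots> = measure lborel (ball x \<rho>)" by (simp add: measure_completion)
      also have "\<dots> > 0" by (rule content_ball_pos[OF \<rho>(1)])
      finally show ?thesis .
    qed
    have "good z' r'" unfolding good_def
    proof (intro conjI allI)
      fix T
      show "(\<lambda>n. measure M {x\<in>ball z' r'. w n x \<le> T}) \<longlonglongrightarrow> 0"
      proof (rule step[OF 2(3,2)])
        show "\<mu> / 2 > 0" using \<mu> by simp
        fix T
        have "(\<lambda>n. measure M {y\<in>ball x \<rho>. w n y \<le> T}) \<longlonglongrightarrow> 0" using g by (simp add: good_def)
        then have "\<forall>\<^sub>F n in sequentially. measure M {y\<in>ball x \<rho>. w n y \<le> T} < \<mu> / 2"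
          using \<mu> by (intro order_tendstoD) auto
        then show "\<forall>\<^sub>F n in sequentially. \<mu> / 2 \<le> measure M {x\<in>ball z' r'. w n x \<ge> T}"
        proof eventually_elim
          case (elim n)
          have "\<mu> \<le> measure M ({y\<in>ball x \<rho>. w n y \<le> T} \<union> {x\<in>ball z' r'. w n x \<ge> T})"
            unfolding \<mu>_def using bx by (intro finite_measure_mono sets.Un ms) auto
          also have "\<dots> \<le> measure M {y\<in>ball x \<rho>. w n y \<le> T} + measure M {x\<in>ball z' r'. w n x \<ge> T}"
            using bx by (intro measure_Un_le ms) auto
          finally show ?case using elim by simp
        qed
      qed
    qed (use 2 bx in auto)
    with 2 show False by simp
  qed
  moreover have "G \<inter> \<Omega> \<noteq> {}"
  proof -
    have "good z0 r0" unfolding good_def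
      using step[OF start(2,1,3,4)] start(1,2) ball_subset_cball by blast
    then have "z0 \<in> G" using start(2) by (auto simp: G_def intro!: exI[of _ z0] exI[of _ r0])
    moreover have "z0 \<in> \<Omega>" using subsetD[OF start(1), of z0] start(2) by simp
    ultimately show ?thesis by auto
  qed
  ultimately have "H \<inter> \<Omega> = {}"
    using connectedD[OF conn \<open>open G\<close> \<open>open H\<close>] by blast
  then have cover: "\<Omega> \<subseteq> G" using \<open>\<Omega> \<subseteq> G \<union> H\<close> by blast
  then have "K \<subseteq> (\<Union>i\<in>{(z, r). good z r}. ball (fst i) (snd i))" using K by (auto simp: G_def split_beta)
  then obtain I where I: "I \<subseteq> {(z, r). good z r}" "finite I" "K \<subseteq> (\<Union>i\<in>I. ball (fst i) (snd i))"
    using compactE_image[OF K(1), of "{(z, r). good z r}" "\<lambda>i. ball (fst i) (snd i)"] by auto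
  show ?thesis
  proof (rule tendsto_sandwich[OF _ _ tendsto_const])
    have gi: "good (fst i) (snd i)" if "i \<in> I" for i using I(1) that by auto
    have "(\<lambda>n. \<Sum>i\<in>I. measure M {x\<in>ball (fst i) (snd i). w n x \<le> T}) \<longlonglongrightarrow> (\<Sum>i\<in>I. 0)"
      by (intro tendsto_sum) (use gi in \<open>auto simp: good_def\<close>)
    then show "(\<lambda>n. \<Sum>i\<in>I. measure M {x\<in>ball (fst i) (snd i). w n x \<le> T}) \<longlonglongrightarrow> 0" by simp
    show "\<forall>\<^sub>F n in sequentially. measure M {x\<in>K. w n x \<le> T} \<le> (\<Sum>i\<in>I. measure M {x\<in>ball (fst i) (snd i). w n x \<le> T})"
    proof (intro always_eventually allI)
      fix n
      have s: "{x\<in>ball (fst i) (snd i). w n x \<le> T} \<in> sets M" if "i \<in> I" for i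
        by (rule ms) (use gi[OF that] in \<open>auto simp: good_def\<close>)
      have "measure M {x\<in>K. w n x \<le> T} \<le> measure M (\<Union>i\<in>I. {x\<in>ball (fst i) (snd i). w n x \<le> T})"
        by (rule finite_measure_mono) (use I(3) in blast, intro sets.finite_UN I s)
      also have "\<dots> \<le> (\<Sum>i\<in>I. measure M {x\<in>ball (fst i) (snd i). w n x \<le> T})"
        by (intro measure_UNION_le I s)
      finally show "measure M {x\<in>K. w n x \<le> T} \<le> (\<Sum>i\<in>I. measure M {x\<in>ball (fst i) (snd i). w n x \<le> T})" .
    qed
  qed simp
qed

end

section \<open>Picone's inequality\<close>

lemma continuous_signed_powr:
  fixes r :: real
  assumes "r > 0"
  shows "continuous_on A (\<lambda>s. \<bar>s\<bar> powr r * sgn s)"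
proof -
  have eq: "(\<lambda>s::real. \<bar>s\<bar> powr r * sgn s) = (\<lambda>s. max s 0 powr r - max (-s) 0 powr r)"
    using assms by (auto simp: fun_eq_iff max_def sgn_real_def abs_real_def)
  have "continuous_on A (\<lambda>s::real. max s 0 powr r - max (-s) 0 powr r)"
    by (intro continuous_on_diff continuous_on_powr' continuous_on_max continuous_on_minus continuous_on_id continuous_on_const)
       (use assms in auto)
  then show ?thesis unfolding eq .
qed

lemma abs_powr_has_derivative:
  fixes s p :: real
  assumes p: "p > 1"
  shows "((\<lambda>s. \<bar>s\<bar> powr p) has_real_derivative p * (\<bar>s\<bar> powr (p - 1) * sgn s)) (at s)"
proof -
  consider "s > 0" | "s < 0" | "s = 0" by linarith
  then show ?thesis
  proof cases
    case 1
    have "((\<lambda>s. s powr p) has_real_derivative p * (\<bar>s\<bar> powr (p - 1) * sgn s)) (at s)"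
      using 1 by (auto intro!: derivative_eq_intros)
    then show ?thesis
      by (rule has_field_derivative_transform_within_open[where S="{0<..}"]) (use 1 in auto)
  next
    case 2
    have "((\<lambda>s. (-s) powr p) has_real_derivative p * (\<bar>s\<bar> powr (p - 1) * sgn s)) (at s)"
      using 2 by (auto intro!: derivative_eq_intros)
    then show ?thesis
      by (rule has_field_derivative_transform_within_open[where S="{..<0}"]) (use 2 in auto)
  next
    case 3
    have "((\<lambda>y. \<bar>y\<bar> powr (p - 1)) \<longlongrightarrow> 0 powr (p - 1)) (at (0::real))"
      using p by (intro tendsto_powr2 tendsto_const) (auto intro!: tendsto_eq_intros)
    then have "((\<lambda>y. \<bar>y\<bar> powr (p - 1)) \<longlongrightarrow> 0) (at (0::real))" using p by simp
    then have "((\<lambda>y. (\<bar>y\<bar> powr p - \<bar>0\<bar> powr p) / (y - 0)) \<longlongrightarrow> 0) (at (0::real))"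
    proof (rule Lim_null_comparison[rotated])
      show "\<forall>\<^sub>F y in at 0. norm ((\<bar>y\<bar> powr p - \<bar>0\<bar> powr p) / (y - 0)) \<le> \<bar>y\<bar> powr (p - 1)"
        using p by (auto simp: eventually_at_filter powr_diff)
    qed
    then show ?thesis using 3 p by (simp add: has_field_derivative_iff)
  qed
qed

lemma abs_powr_C1c:
  assumes "\<phi> \<in> C1c \<Omega>" "p > 1"
  shows "(\<lambda>x. \<bar>\<phi> x\<bar> powr p) \<in> C1c \<Omega>"
    "gradient (\<lambda>x. \<bar>\<phi> x\<bar> powr p) = (\<lambda>x. (p * (\<bar>\<phi> x\<bar> powr (p - 1) * sgn (\<phi> x))) *\<^sub>R gradient \<phi> x)"
proof -
  have c: "continuous_on (range \<phi>) (\<lambda>s. p * (\<bar>s\<bar> powr (p - 1) * sgn s))"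
    using assms by (intro continuous_intros continuous_signed_powr) auto
  show "(\<lambda>x. \<bar>\<phi> x\<bar> powr p) \<in> C1c \<Omega>"
    by (rule C1c_compose[OF assms(1) abs_powr_has_derivative[OF assms(2)] c]) (use assms in auto)
  show "gradient (\<lambda>x. \<bar>\<phi> x\<bar> powr p) = (\<lambda>x. (p * (\<bar>\<phi> x\<bar> powr (p - 1) * sgn (\<phi> x))) *\<^sub>R gradient \<phi> x)"
    by (rule C1_compose(2)[OF C1c_imp_C1[OF assms(1)] abs_powr_has_derivative[OF assms(2)] c])
qed

text \<open>
  Functions such as \<open>(s + \<epsilon>)\<^sup>1\<^sup>-\<^sup>p\<close> and \<open>ln (1 + s/\<epsilon>)\<close> behave well for \<open>s \<ge> 0\<close> only.  The tangent line at
  \<open>0\<close> extends them to \<open>C\<^sup>1\<close> functions with bounded derivative, to which the chain rule applies; a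
  nonnegative \<open>u\<close> does not see the extension.
\<close>

lemma DERIV_extend_linearly:
  fixes f f' :: "real \<Rightarrow> real"
  assumes "\<And>s. s \<ge> 0 \<Longrightarrow> (f has_real_derivative f' s) (at s)"
  shows "((\<lambda>s. if s \<ge> 0 then f s else f 0 + f' 0 * s) has_real_derivative f' (max s 0)) (at s)"
    (is "(?F has_real_derivative _) _")
proof -
  consider "s > 0" | "s < 0" | "s = 0" by linarith
  then show ?thesis
  proof cases
    case 1
    have "(f has_real_derivative f' (max s 0)) (at s)" using assms[of s] 1 by simp
    then show ?thesis
      by (rule has_field_derivative_transform_within_open[where S="{0<..}"]) (use 1 in auto)
  next
    case 2
    have "((\<lambda>s. f 0 + f' 0 * s) has_real_derivative f' (max s 0)) (at s)"
      using 2 by (auto intro!: derivative_eq_intros)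
    then show ?thesis
      by (rule has_field_derivative_transform_within_open[where S="{..<0}"]) (use 2 in auto)
  next
    case 3
    have "((\<lambda>y. (f y - f 0) / (y - 0)) \<longlongrightarrow> f' 0) (at 0)"
      using assms[of 0] by (simp add: has_field_derivative_iff)
    then have "((\<lambda>y. (f y - f 0) / (y - 0)) \<longlongrightarrow> f' 0) (at_right 0)"
      by (rule filterlim_mono) (auto simp: at_le)
    then have 1: "((\<lambda>y. (?F y - ?F 0) / (y - 0)) \<longlongrightarrow> f' 0) (at_right 0)"
      by (rule Lim_transform_eventually) (auto simp: eventually_at_right_field intro!: exI[of _ 1])
    have 2: "((\<lambda>y. (?F y - ?F 0) / (y - 0)) \<longlongrightarrow> f' 0) (at_left 0)"
      by (rule Lim_transform_eventually[OF tendsto_const]) (auto simp: eventually_at_left_field intro!: exI[of _ "-1"])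
    have "(?F has_real_derivative f' 0) (at 0)"
      using filterlim_split_at[OF 2 1] by (simp only: has_field_derivative_iff)
    then show ?thesis using 3 by simp
  qed
qed

lemma norm_powr_inner_self:
  assumes "p > 1"
  shows "norm X powr (p - 2) * (X \<bullet> X) = norm (X::'a::real_inner) powr p"
proof (cases "X = 0")
  case False
  then have "X \<bullet> X = norm X powr 2" by (simp add: dot_square_norm)
  then have "norm X powr (p - 2) * (X \<bullet> X) = norm X powr (p - 2) * norm X powr 2" by (simp only:)
  also have "\<dots> = norm X powr p" by (simp only: powr_add[symmetric]) simp
  finally show ?thesis .
qed (use assms in simp)

lemma norm_powr_inner_le:
  fixes X Y :: "'a::real_inner"
  assumes "p > 1"
  shows "norm X powr (p - 2) * \<bar>X \<bullet> Y\<bar> \<le> norm X powr (p - 1) * norm Y"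
proof (cases "X = 0")
  case False
  have "norm X powr (p - 2) * \<bar>X \<bullet> Y\<bar> \<le> norm X powr (p - 2) * (norm X * norm Y)"
    by (intro mult_left_mono Cauchy_Schwarz_ineq2) simp
  also have "\<dots> = (norm X powr (p - 2) * norm X powr 1) * norm Y" using False by simp
  also have "norm X powr (p - 2) * norm X powr 1 = norm X powr (p - 1)" by (simp only: powr_add[symmetric]) simp
  finally show ?thesis .
qed (use assms in simp)

lemma Young_powr:
  fixes s b p \<kappa> :: real
  assumes "s \<ge> 0" "b \<ge> 0" "p > 1" "\<kappa> > 0"
  shows "p * (s powr (p - 1) * b) \<le> (p - 1) * \<kappa> powr p * s powr p + \<kappa> powr (p * (1 - p)) * b powr p"
proof -
  define q where "q = p / (p - 1)"
  have q: "q > 1" "1/q + 1/p = 1" using assms by (auto simp: q_def field_simps)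
  have e: "(p - 1) * q = p" using assms by (simp add: q_def)
  have "((\<kappa> * s) powr (p - 1)) * (\<kappa> powr (1 - p) * b) \<le> ((\<kappa> * s) powr (p - 1)) powr q / q + (\<kappa> powr (1 - p) * b) powr p / p"
    by (rule Youngs_inequality) (use assms q in auto)
  also have "((\<kappa> * s) powr (p - 1)) powr q = \<kappa> powr p * s powr p"
    using assms by (simp add: powr_powr e powr_mult)
  also have "(\<kappa> powr (1 - p) * b) powr p = \<kappa> powr (p * (1 - p)) * b powr p"
    using assms by (simp add: powr_powr powr_mult mult.commute)
  also have "((\<kappa> * s) powr (p - 1)) * (\<kappa> powr (1 - p) * b) = s powr (p - 1) * b"
  proof -
    have "\<kappa> powr (p - 1) * \<kappa> powr (1 - p) = 1" using assms by (simp add: powr_add[symmetric])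
    then show ?thesis using assms by (simp add: powr_mult mult_ac)
  qed
  finally have "p * (s powr (p - 1) * b) \<le> p * (\<kappa> powr p * s powr p / q + \<kappa> powr (p * (1 - p)) * b powr p / p)"
    using assms by (intro mult_left_mono) auto
  also have "\<dots> = (p / q) * (\<kappa> powr p * s powr p) + \<kappa> powr (p * (1 - p)) * b powr p"
    using assms by (simp add: distrib_left)
  also have "p / q = p - 1" using assms by (simp add: q_def)
  finally show ?thesis by (simp add: mult.assoc)
qed

text \<open>
  Here \<open>X = \<nabla>u\<close>, \<open>Y = \<nabla>\<phi>\<close> and \<open>U = u + \<epsilon>\<close>, and the second factor of the inner product is
  \<open>\<nabla>(|\<phi>|\<^sup>p U\<^sup>1\<^sup>-\<^sup>p)\<close>.  For \<open>\<kappa> = 1\<close> this is Picone's inequality; taking \<open>\<kappa> < 1\<close> in Young's inequality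
  worsens the constant in front of \<open>|Y|\<^sup>p\<close> but retains a multiple of
  \<open>|\<phi>|\<^sup>p |\<nabla> log U|\<^sup>p\<close>.
\<close>

lemma Picone_pointwise:
  fixes X Y :: "'a::real_inner" and \<phi> U p \<kappa> :: real
  assumes p: "p > 1" and \<kappa>: "\<kappa> > 0" and U: "U > 0"
  shows "norm X powr (p - 2) * (X \<bullet> (U powr (1 - p) *\<^sub>R ((p * (\<bar>\<phi>\<bar> powr (p - 1) * sgn \<phi>)) *\<^sub>R Y) + (\<bar>\<phi>\<bar> powr p * (- ((p - 1) * U powr (- p)))) *\<^sub>R X))
    \<le> \<kappa> powr (p * (1 - p)) * norm Y powr p - (1 - \<kappa> powr p) * (p - 1) * (\<bar>\<phi>\<bar> powr p * norm X powr p / U powr p)"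
    (is "?L \<le> _")
proof -
  define s where "s = \<bar>\<phi>\<bar> * norm X / U"
  have s: "s \<ge> 0" using U by (simp add: s_def)
  have sp: "s powr r = \<bar>\<phi>\<bar> powr r * norm X powr r / U powr r" for r
    using U by (simp add: s_def powr_divide powr_mult)
  have "norm X powr (p - 2) * (X \<bullet> (U powr (1 - p) *\<^sub>R ((p * (\<bar>\<phi>\<bar> powr (p - 1) * sgn \<phi>)) *\<^sub>R Y) + (\<bar>\<phi>\<bar> powr p * (- ((p - 1) * U powr (- p)))) *\<^sub>R X))
    = U powr (1 - p) * p * \<bar>\<phi>\<bar> powr (p - 1) * (sgn \<phi> * (norm X powr (p - 2) * (X \<bullet> Y))) - (p - 1) * (U powr (- p) * \<bar>\<phi>\<bar> powr p * (norm X powr (p - 2) * (X \<bullet> X)))"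
    by (simp add: inner_add_right algebra_simps)
  also have "(U powr (- p) * \<bar>\<phi>\<bar> powr p * (norm X powr (p - 2) * (X \<bullet> X))) = s powr p"
    unfolding norm_powr_inner_self[OF p] sp by (simp add: powr_minus divide_inverse mult_ac)
  also have "sgn \<phi> * (norm X powr (p - 2) * (X \<bullet> Y)) \<le> norm X powr (p - 1) * norm Y"
  proof -
    have "sgn \<phi> * (norm X powr (p - 2) * (X \<bullet> Y)) \<le> \<bar>sgn \<phi>\<bar> * (norm X powr (p - 2) * \<bar>X \<bullet> Y\<bar>)"
      using abs_ge_self[of "sgn \<phi> * (norm X powr (p - 2) * (X \<bullet> Y))"] by (simp add: abs_mult)
    also have "\<dots> \<le> 1 * (norm X powr (p - 2) * \<bar>X \<bullet> Y\<bar>)"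
      by (intro mult_right_mono) (auto simp: sgn_real_def)
    finally show ?thesis using norm_powr_inner_le[OF p, of X Y] by simp
  qed
  finally have "norm X powr (p - 2) * (X \<bullet> (U powr (1 - p) *\<^sub>R ((p * (\<bar>\<phi>\<bar> powr (p - 1) * sgn \<phi>)) *\<^sub>R Y) + (\<bar>\<phi>\<bar> powr p * (- ((p - 1) * U powr (- p)))) *\<^sub>R X))
     \<le> U powr (1 - p) * p * \<bar>\<phi>\<bar> powr (p - 1) * (norm X powr (p - 1) * norm Y) - (p - 1) * s powr p"
    using p by (simp add: mult_left_mono)
  also have "U powr (1 - p) * p * \<bar>\<phi>\<bar> powr (p - 1) * (norm X powr (p - 1) * norm Y) = p * (s powr (p - 1) * norm Y)"
    unfolding sp using U powr_minus[of U "p - 1"] by (simp add: divide_inverse mult_ac)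
  also have "p * (s powr (p - 1) * norm Y) \<le> (p - 1) * \<kappa> powr p * s powr p + \<kappa> powr (p * (1 - p)) * norm Y powr p"
    by (rule Young_powr[OF s _ p \<kappa>]) simp
  finally have fin: "?L \<le> (p - 1) * \<kappa> powr p * s powr p + \<kappa> powr (p * (1 - p)) * norm Y powr p - (p - 1) * s powr p"
    by simp
  have "(p - 1) * \<kappa> powr p * S + Z - (p - 1) * S = Z - (1 - \<kappa> powr p) * (p - 1) * S" for Z S :: real
    by (simp add: algebra_simps)
  from fin[unfolded this] show ?thesis unfolding sp .
qed

context bounded_open_set begin

lemma integrable_weight_mult:
  fixes b :: "'a \<Rightarrow> real"
  assumes "integrable M h" "b \<in> borel_measurable M" "AE x in M. \<bar>b x\<bar> \<le> B"
  shows "integrable M (\<lambda>x. h x * b x :: real)"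
proof (rule Bochner_Integration.integrable_bound)
  show "integrable M (\<lambda>x. B * h x)" using assms(1) by simp
  show "AE x in M. norm (h x * b x) \<le> norm (B * h x)"
    using assms(3)
  proof eventually_elim
    case (elim x)
    then have "\<bar>b x\<bar> \<le> \<bar>B\<bar>" by simp
    then show ?case by (simp add: abs_mult mult.commute[of "\<bar>h x\<bar>"] mult_right_mono)
  qed
qed (use assms in measurable)

lemma C1c_abs_powr_bounded:
  assumes "\<phi> \<in> C1c \<Omega>"
  obtains B where "B > 0" "\<And>x. \<bar>\<phi> x\<bar> powr p \<le> B"
proof -
  obtain B where B: "B > 0" "\<And>x. \<bar>\<phi> x\<bar> \<le> B" using C1c_bounded[OF assms] by metis
  have "\<bar>\<phi> x\<bar> powr p \<le> B powr p" for x using B p_gt_1 by (intro powr_mono2) auto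
  moreover have "B powr p > 0" using B by simp
  ultimately show ?thesis using that by blast
qed

text \<open>
  The test function is \<open>|\<phi>|\<^sup>p (u + \<epsilon>)\<^sup>1\<^sup>-\<^sup>p\<close>.
\<close>

lemma Picone_integrated:
  assumes sol: "is_solution \<Omega> p q m a f lam \<eta> u" and u0: "AE x in M. u x \<ge> 0"
    and q: "1 < q" "q < p" and int: "integrable M m" "integrable M a" "integrable M f"
    and \<phi>: "\<phi> \<in> C1c \<Omega>" and \<epsilon>: "\<epsilon> > 0" and \<kappa>: "\<kappa> > 0" "\<kappa> \<le> 1"
  shows "(1 - \<kappa> powr p) * (p - 1) * (LINT x|M. \<bar>\<phi> x\<bar> powr p * norm (weak_gradient \<Omega> u x) powr p / (\<bar>u x\<bar> + \<epsilon>) powr p)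
     + lam * (LINT x|M. m x * ((\<bar>u x\<bar> / (\<bar>u x\<bar> + \<epsilon>)) powr (p - 1) * \<bar>\<phi> x\<bar> powr p))
     + \<eta> * (LINT x|M. a x * (\<bar>u x\<bar> powr (q - 1) * (\<bar>u x\<bar> + \<epsilon>) powr (1 - p) * \<bar>\<phi> x\<bar> powr p))
     + (LINT x|M. f x * ((\<bar>u x\<bar> + \<epsilon>) powr (1 - p) * \<bar>\<phi> x\<bar> powr p))
     \<le> \<kappa> powr (p * (1 - p)) * energy \<phi>"
    and "integrable M (\<lambda>x. \<bar>\<phi> x\<bar> powr p * norm (weak_gradient \<Omega> u x) powr p / (\<bar>u x\<bar> + \<epsilon>) powr p)"
proof -
  have uW: "u \<in> W01p \<Omega> p" using sol by (simp add: is_solution_def)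
  note [measurable] = LpD(1)[OF W01p_Lp(1)[OF uW]] LpD(1)[OF W01p_Lp(2)[OF uW]]
  define \<psi> where "\<psi> x = \<bar>\<phi> x\<bar> powr p" for x
  have \<psi>: "\<psi> \<in> C1c \<Omega>" and g\<psi>: "gradient \<psi> = (\<lambda>x. (p * (\<bar>\<phi> x\<bar> powr (p - 1) * sgn (\<phi> x))) *\<^sub>R gradient \<phi> x)"
    unfolding \<psi>_def using abs_powr_C1c[OF \<phi> p_gt_1] by auto
  have [measurable]: "\<psi> \<in> borel_measurable M" "\<phi> \<in> borel_measurable M" "gradient \<phi> \<in> borel_measurable M"
    by (intro continuous_measurable_M C1_continuous C1_continuous_gradient C1c_imp_C1[OF \<psi>] C1c_imp_C1[OF \<phi>])+
  have \<psi>0: "\<psi> x \<ge> 0" for x by (simp add: \<psi>_def)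
  obtain B where B: "B > 0" "\<And>x. \<bar>\<phi> x\<bar> powr p \<le> B" using C1c_abs_powr_bounded[OF \<phi>] by blast
  have B': "\<psi> x \<le> B" for x using B by (simp add: \<psi>_def)
  define g where "g s = (if s \<ge> 0 then (s + \<epsilon>) powr (1 - p) else (0 + \<epsilon>) powr (1 - p) + (- ((p - 1) * (0 + \<epsilon>) powr (- p))) * s)" for s
  define g' where "g' s = - ((p - 1) * (max s 0 + \<epsilon>) powr (- p))" for s
  have gd: "(g has_real_derivative g' s) (at s)" for s
    unfolding g_def g'_def
  proof (rule DERIV_extend_linearly[where f="\<lambda>s. (s + \<epsilon>) powr (1 - p)" and f'="\<lambda>s. - ((p - 1) * (s + \<epsilon>) powr (- p))"])
    fix s :: real assume "s \<ge> 0"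
    then show "((\<lambda>s. (s + \<epsilon>) powr (1 - p)) has_real_derivative - ((p - 1) * (s + \<epsilon>) powr (- p))) (at s)"
      using \<epsilon> by (auto intro!: derivative_eq_intros simp: algebra_simps)
  qed
  have gc: "continuous_on UNIV g'"
    unfolding g'_def by (intro continuous_intros continuous_on_powr) (use \<epsilon> in \<open>auto simp: max_def\<close>)
  have gb: "\<bar>g' s\<bar> \<le> (p - 1) * \<epsilon> powr (- p)" for s
  proof -
    have "(max s 0 + \<epsilon>) powr (- p) \<le> \<epsilon> powr (- p)" using \<epsilon> p_gt_1 by (intro powr_mono2') auto
    then show ?thesis using p_gt_1 by (simp add: g'_def abs_mult)
  qed
  define \<xi> where "\<xi> x = \<psi> x * g (u x)" for x
  have \<xi>: "\<xi> \<in> W01p \<Omega> p" and w\<xi>: "AE x in M. weak_gradient \<Omega> \<xi> x = g (u x) *\<^sub>R gradient \<psi> x + (\<psi> x * g' (u x)) *\<^sub>R weak_gradient \<Omega> u x"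
    unfolding \<xi>_def[abs_def] by (rule W01p_chain_rule[OF uW \<psi> gd gc gb])+
  note [measurable] = LpD(1)[OF W01p_Lp(2)[OF \<xi>]]
  have eq: "(LINT x|M. norm (weak_gradient \<Omega> u x) powr (p - 2) * (weak_gradient \<Omega> u x \<bullet> weak_gradient \<Omega> \<xi> x)) =
        lam * (LINT x|M. m x * \<bar>u x\<bar> powr (p - 2) * u x * \<xi> x)
        + \<eta> * (LINT x|M. a x * \<bar>u x\<bar> powr (q - 2) * u x * \<xi> x)
        + (LINT x|M. f x * \<xi> x)"
    using sol \<xi> by (simp add: is_solution_def)
  have pows: "\<bar>t\<bar> powr (r - 2) * t = \<bar>t\<bar> powr (r - 1)" if "t \<ge> 0" "r > 1" for t r :: real
  proof (cases "t = 0")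
    case False
    then have "\<bar>t\<bar> powr (r - 2) * t powr 1 = \<bar>t\<bar> powr (r - 1)" using that by (simp only: abs_of_nonneg powr_add[symmetric]) simp
    then show ?thesis using False that by simp
  qed (use that in simp)
  have im: "(LINT x|M. m x * \<bar>u x\<bar> powr (p - 2) * u x * \<xi> x) = (LINT x|M. m x * ((\<bar>u x\<bar> / (\<bar>u x\<bar> + \<epsilon>)) powr (p - 1) * \<bar>\<phi> x\<bar> powr p))"
  proof (rule integral_cong_AE)
    show "AE x in M. m x * \<bar>u x\<bar> powr (p - 2) * u x * \<xi> x = m x * ((\<bar>u x\<bar> / (\<bar>u x\<bar> + \<epsilon>)) powr (p - 1) * \<bar>\<phi> x\<bar> powr p)"
      using u0
    proof eventually_elim
      case (elim x)
      have "m x * \<bar>u x\<bar> powr (p - 2) * u x * \<xi> x = m x * (\<bar>u x\<bar> powr (p - 2) * u x) * \<xi> x" by simp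
      also have "\<dots> = m x * (\<bar>u x\<bar> powr (p - 1) * (u x + \<epsilon>) powr (1 - p) * \<psi> x)"
        unfolding pows[OF elim p_gt_1] using elim by (simp add: \<xi>_def g_def mult_ac)
      also have "\<bar>u x\<bar> powr (p - 1) * (u x + \<epsilon>) powr (1 - p) = (\<bar>u x\<bar> / (\<bar>u x\<bar> + \<epsilon>)) powr (p - 1)"
      proof -
        have "(\<bar>u x\<bar> / (\<bar>u x\<bar> + \<epsilon>)) powr (p - 1) = \<bar>u x\<bar> powr (p - 1) / (\<bar>u x\<bar> + \<epsilon>) powr (p - 1)"
          by (rule powr_divide)
        then show ?thesis using elim powr_minus[of "u x + \<epsilon>" "p - 1"] by (simp add: divide_inverse)
      qed
      finally show ?case by (simp add: \<psi>_def)
    qed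
  qed (use borel_measurable_integrable[OF int(1)] gd in \<open>auto simp: \<xi>_def g_def[abs_def]\<close>)
  have ia: "(LINT x|M. a x * \<bar>u x\<bar> powr (q - 2) * u x * \<xi> x) = (LINT x|M. a x * (\<bar>u x\<bar> powr (q - 1) * (\<bar>u x\<bar> + \<epsilon>) powr (1 - p) * \<bar>\<phi> x\<bar> powr p))"
  proof (rule integral_cong_AE)
    show "AE x in M. a x * \<bar>u x\<bar> powr (q - 2) * u x * \<xi> x = a x * (\<bar>u x\<bar> powr (q - 1) * (\<bar>u x\<bar> + \<epsilon>) powr (1 - p) * \<bar>\<phi> x\<bar> powr p)"
      using u0
    proof eventually_elim
      case (elim x)
      have "a x * \<bar>u x\<bar> powr (q - 2) * u x * \<xi> x = a x * (\<bar>u x\<bar> powr (q - 2) * u x) * \<xi> x" by simp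
      also have "\<dots> = a x * (\<bar>u x\<bar> powr (q - 1) * (\<bar>u x\<bar> + \<epsilon>) powr (1 - p) * \<bar>\<phi> x\<bar> powr p)"
        unfolding pows[OF elim q(1)] using elim by (simp add: \<xi>_def g_def \<psi>_def mult_ac)
      finally show ?case .
    qed
  qed (use borel_measurable_integrable[OF int(2)] gd in \<open>auto simp: \<xi>_def g_def[abs_def]\<close>)
  have if': "(LINT x|M. f x * \<xi> x) = (LINT x|M. f x * ((\<bar>u x\<bar> + \<epsilon>) powr (1 - p) * \<bar>\<phi> x\<bar> powr p))"
    by (rule integral_cong_AE)
       (use borel_measurable_integrable[OF int(3)] u0 in \<open>auto simp: \<xi>_def g_def[abs_def] \<psi>_def elim!: eventually_mono\<close>)
  note X = W01p_Lp(2)[OF uW]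
  show Di: "integrable M (\<lambda>x. \<bar>\<phi> x\<bar> powr p * norm (weak_gradient \<Omega> u x) powr p / (\<bar>u x\<bar> + \<epsilon>) powr p)"
  proof (rule Bochner_Integration.integrable_bound)
    show "integrable M (\<lambda>x. B * \<epsilon> powr (- p) * norm (weak_gradient \<Omega> u x) powr p)" using LpD(2)[OF X] by simp
    show "AE x in M. norm (\<bar>\<phi> x\<bar> powr p * norm (weak_gradient \<Omega> u x) powr p / (\<bar>u x\<bar> + \<epsilon>) powr p) \<le> norm (B * \<epsilon> powr (- p) * norm (weak_gradient \<Omega> u x) powr p)"
    proof (rule AE_I2)
      fix x
      have "\<bar>\<phi> x\<bar> powr p * (\<bar>u x\<bar> + \<epsilon>) powr (- p) \<le> B * \<epsilon> powr (- p)"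
        using B \<epsilon> p_gt_1 by (intro mult_mono powr_mono2') auto
      then have "\<bar>\<phi> x\<bar> powr p * (\<bar>u x\<bar> + \<epsilon>) powr (- p) * norm (weak_gradient \<Omega> u x) powr p \<le> B * \<epsilon> powr (- p) * norm (weak_gradient \<Omega> u x) powr p"
        by (rule mult_right_mono) simp
      then show "norm (\<bar>\<phi> x\<bar> powr p * norm (weak_gradient \<Omega> u x) powr p / (\<bar>u x\<bar> + \<epsilon>) powr p) \<le> norm (B * \<epsilon> powr (- p) * norm (weak_gradient \<Omega> u x) powr p)"
        using B by (simp add: powr_minus divide_inverse mult_ac)
    qed
  qed measurable
  have Li: "integrable M (\<lambda>x. norm (weak_gradient \<Omega> u x) powr (p - 2) * (weak_gradient \<Omega> u x \<bullet> weak_gradient \<Omega> \<xi> x))"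
  proof (rule Bochner_Integration.integrable_bound)
    show "integrable M (\<lambda>x. norm (weak_gradient \<Omega> u x) powr p + norm (weak_gradient \<Omega> \<xi> x) powr p)"
      using LpD(2)[OF X] LpD(2)[OF W01p_Lp(2)[OF \<xi>]] by simp
    show "AE x in M. norm (norm (weak_gradient \<Omega> u x) powr (p - 2) * (weak_gradient \<Omega> u x \<bullet> weak_gradient \<Omega> \<xi> x))
      \<le> norm (norm (weak_gradient \<Omega> u x) powr p + norm (weak_gradient \<Omega> \<xi> x) powr p)"
    proof (rule AE_I2)
      fix x
      let ?a = "norm (weak_gradient \<Omega> u x)" and ?b = "norm (weak_gradient \<Omega> \<xi> x)"
      have "p * (?a powr (p - 1) * ?b) \<le> (p - 1) * ?a powr p + ?b powr p"
        using Young_powr[of ?a ?b p 1] p_gt_1 by simp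
      also have "\<dots> \<le> p * (?a powr p + ?b powr p)"
        using p_gt_1 by (simp add: algebra_simps mult_left_le_one_le) (smt (verit) mult_right_mono powr_ge_zero mult_cancel_right1)
      finally have "?a powr (p - 1) * ?b \<le> ?a powr p + ?b powr p" using p_gt_1 by simp
      then show "norm (?a powr (p - 2) * (weak_gradient \<Omega> u x \<bullet> weak_gradient \<Omega> \<xi> x)) \<le> norm (?a powr p + ?b powr p)"
        using norm_powr_inner_le[OF p_gt_1, of "weak_gradient \<Omega> u x" "weak_gradient \<Omega> \<xi> x"] by (simp add: abs_mult)
    qed
  qed measurable
  have Gi: "integrable M (\<lambda>x. norm (gradient \<phi> x) powr p)" by (rule LpD(2)[OF C1c_Lp(2)[OF \<phi>]])
  let ?D = "\<lambda>x. \<bar>\<phi> x\<bar> powr p * norm (weak_gradient \<Omega> u x) powr p / (\<bar>u x\<bar> + \<epsilon>) powr p"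
  have "(LINT x|M. norm (weak_gradient \<Omega> u x) powr (p - 2) * (weak_gradient \<Omega> u x \<bullet> weak_gradient \<Omega> \<xi> x)) \<le>
    (LINT x|M. \<kappa> powr (p * (1 - p)) * norm (gradient \<phi> x) powr p - (1 - \<kappa> powr p) * (p - 1) * ?D x)"
  proof (rule integral_mono_AE[OF Li])
    show "integrable M (\<lambda>x. \<kappa> powr (p * (1 - p)) * norm (gradient \<phi> x) powr p - (1 - \<kappa> powr p) * (p - 1) * ?D x)"
      using Gi Di by (intro Bochner_Integration.integrable_diff integrable_mult_right) auto
    show "AE x in M. norm (weak_gradient \<Omega> u x) powr (p - 2) * (weak_gradient \<Omega> u x \<bullet> weak_gradient \<Omega> \<xi> x) \<le>
      \<kappa> powr (p * (1 - p)) * norm (gradient \<phi> x) powr p - (1 - \<kappa> powr p) * (p - 1) * ?D x"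
      using w\<xi> u0
    proof eventually_elim
      case (elim x)
      have gu: "g (u x) = (\<bar>u x\<bar> + \<epsilon>) powr (1 - p)" "g' (u x) = - ((p - 1) * (\<bar>u x\<bar> + \<epsilon>) powr (- p))"
        using elim by (auto simp: g_def g'_def)
      show ?case unfolding elim(1) gu g\<psi> \<psi>_def
        using \<epsilon> by (intro Picone_pointwise p_gt_1 \<kappa>) auto
    qed
  qed
  also have "\<dots> = \<kappa> powr (p * (1 - p)) * energy \<phi> - (1 - \<kappa> powr p) * (p - 1) * (LINT x|M. ?D x)"
    using Gi Di by (subst Bochner_Integration.integral_diff) (auto simp del: times_divide_eq_right)
  finally show "(1 - \<kappa> powr p) * (p - 1) * (LINT x|M. \<bar>\<phi> x\<bar> powr p * norm (weak_gradient \<Omega> u x) powr p / (\<bar>u x\<bar> + \<epsilon>) powr p)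
     + lam * (LINT x|M. m x * ((\<bar>u x\<bar> / (\<bar>u x\<bar> + \<epsilon>)) powr (p - 1) * \<bar>\<phi> x\<bar> powr p))
     + \<eta> * (LINT x|M. a x * (\<bar>u x\<bar> powr (q - 1) * (\<bar>u x\<bar> + \<epsilon>) powr (1 - p) * \<bar>\<phi> x\<bar> powr p))
     + (LINT x|M. f x * ((\<bar>u x\<bar> + \<epsilon>) powr (1 - p) * \<bar>\<phi> x\<bar> powr p))
     \<le> \<kappa> powr (p * (1 - p)) * energy \<phi>"
    unfolding eq im ia if' by linarith
qed

section \<open>Convergence in measure\<close>

text \<open>
  Absolute continuity of the integral: split \<open>|h|\<close> into a bounded truncation and a remainder with
  small integral.
\<close>

lemma integral_vanishing_sets:
  fixes h :: "'a \<Rightarrow> real"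
  assumes h: "integrable M h" and E: "\<And>n. E n \<in> sets M" "(\<lambda>n. measure M (E n)) \<longlonglongrightarrow> 0"
  shows "(\<lambda>n. LINT x|M. indicator (E n) x * \<bar>h x\<bar>) \<longlonglongrightarrow> 0"
proof (rule LIMSEQ_I)
  fix e :: real assume e: "e > 0"
  have [measurable]: "h \<in> borel_measurable M" using h by auto
  have mi: "integrable M (\<lambda>x. min \<bar>h x\<bar> c)" if "c \<ge> 0" for c
    by (rule Bochner_Integration.integrable_bound[OF h]) (use that in auto)
  have "(\<lambda>k. LINT x|M. min \<bar>h x\<bar> (real k)) \<longlonglongrightarrow> (LINT x|M. \<bar>h x\<bar>)"
  proof (rule integral_dominated_convergence)
    show "integrable M (\<lambda>x. \<bar>h x\<bar>)" using h by simp
    show "AE x in M. (\<lambda>k. min \<bar>h x\<bar> (real k)) \<longlonglongrightarrow> \<bar>h x\<bar>"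
    proof (rule AE_I2)
      fix x
      obtain N where "\<bar>h x\<bar> \<le> real N" using real_arch_simple by blast
      then have "\<forall>\<^sub>F k in sequentially. min \<bar>h x\<bar> (real k) = \<bar>h x\<bar>"
        unfolding eventually_sequentially by (intro exI[of _ N]) auto
      then show "(\<lambda>k. min \<bar>h x\<bar> (real k)) \<longlonglongrightarrow> \<bar>h x\<bar>" by (rule tendsto_eventually)
    qed
  qed auto
  then have "\<forall>\<^sub>F k in sequentially. (LINT x|M. \<bar>h x\<bar>) - e/2 < (LINT x|M. min \<bar>h x\<bar> (real k))"
    using e by (intro order_tendstoD) auto
  then obtain k where k: "(LINT x|M. \<bar>h x\<bar>) - e/2 < (LINT x|M. min \<bar>h x\<bar> (real k))"
    by (auto simp: eventually_sequentially)
  have "(\<lambda>n. real k * measure M (E n)) \<longlonglongrightarrow> 0" using tendsto_mult_right_zero[OF E(2)] .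
  then have "\<forall>\<^sub>F n in sequentially. real k * measure M (E n) < e/2" using e by (intro order_tendstoD) auto
  then obtain N where N: "\<And>n. n \<ge> N \<Longrightarrow> real k * measure M (E n) < e/2" by (auto simp: eventually_sequentially)
  show "\<exists>N. \<forall>n\<ge>N. norm ((LINT x|M. indicator (E n) x * \<bar>h x\<bar>) - 0) < e"
  proof (intro exI allI impI)
    fix n assume n: "n \<ge> N"
    note [measurable] = E(1)[of n]
    have Ei: "integrable M (\<lambda>x. indicator (E n) x :: real)" by (intro integrable_real_indicator E) (simp add: less_top[symmetric])
    have i1: "integrable M (\<lambda>x. indicator (E n) x * \<bar>h x\<bar>)"
      by (rule Bochner_Integration.integrable_bound[OF h]) (auto simp: indicator_def)
    have "(LINT x|M. indicator (E n) x * \<bar>h x\<bar>) \<le> (LINT x|M. real k * indicator (E n) x + (\<bar>h x\<bar> - min \<bar>h x\<bar> (real k)))"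
      using Ei h mi[of "real k"] i1
      by (intro integral_mono Bochner_Integration.integrable_add Bochner_Integration.integrable_diff integrable_mult_right) (auto simp: indicator_def)
    also have "\<dots> = real k * measure M (E n) + ((LINT x|M. \<bar>h x\<bar>) - (LINT x|M. min \<bar>h x\<bar> (real k)))"
      using Ei h mi[of "real k"] E(1)[of n] sets.sets_into_space[OF E(1)[of n]] by (simp add: Int_absorb2)
    finally have "(LINT x|M. indicator (E n) x * \<bar>h x\<bar>) < e" using N[OF n] k by linarith
    moreover have "(LINT x|M. indicator (E n) x * \<bar>h x\<bar>) \<ge> 0" by (intro Bochner_Integration.integral_nonneg) auto
    ultimately show "norm ((LINT x|M. indicator (E n) x * \<bar>h x\<bar>) - 0) < e" by simp
  qed
qed

lemma integral_mult_tendsto_in_measure: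
  fixes h :: "'a \<Rightarrow> real" and b :: "nat \<Rightarrow> 'a \<Rightarrow> real"
  assumes h: "integrable M h" and K: "compact K" "K \<subseteq> \<Omega>" "\<And>x. x \<notin> K \<Longrightarrow> h x = 0"
    and [measurable]: "\<And>n. b n \<in> borel_measurable M" and b: "\<And>n x. 0 \<le> b n x" "\<And>n x. b n x \<le> 1"
    and lim: "\<And>e. 0 < e \<Longrightarrow> e < 1 \<Longrightarrow> (\<lambda>n. measure M {x\<in>K. b n x \<le> 1 - e}) \<longlonglongrightarrow> 0"
  shows "(\<lambda>n. LINT x|M. h x * b n x) \<longlonglongrightarrow> (LINT x|M. h x)"
proof (rule LIMSEQ_I)
  fix \<epsilon> :: real assume \<epsilon>: "\<epsilon> > 0"
  define H where "H = (LINT x|M. \<bar>h x\<bar>)"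
  have H: "H \<ge> 0" by (simp add: H_def)
  define e where "e = min (1/2) (\<epsilon> / (2 * (H + 1)))"
  have e: "0 < e" "e < 1" using \<epsilon> H by (auto simp: e_def)
  have eH: "e * H < \<epsilon> / 2"
  proof -
    have "e * H \<le> \<epsilon> / (2 * (H + 1)) * H" using H by (intro mult_right_mono) (auto simp: e_def)
    also have "\<dots> < \<epsilon> / 2" using H \<epsilon> by (simp add: field_simps)
    finally show ?thesis .
  qed
  define E where "E n = {x\<in>K. b n x \<le> 1 - e}" for n
  have KM[measurable]: "K \<in> sets M" using K by (intro compact_sets_M)
  have Em[measurable]: "E n \<in> sets M" for n
    unfolding E_def by (rule sets_M_Collect[OF KM]) measurable
  have "(\<lambda>n. LINT x|M. indicator (E n) x * \<bar>h x\<bar>) \<longlonglongrightarrow> 0"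
    by (rule integral_vanishing_sets[OF h Em]) (use lim[OF e] in \<open>simp add: E_def\<close>)
  then have "\<forall>\<^sub>F n in sequentially. (LINT x|M. indicator (E n) x * \<bar>h x\<bar>) < \<epsilon> / 2" using \<epsilon> by (intro order_tendstoD) auto
  then obtain N where N: "\<And>n. n \<ge> N \<Longrightarrow> (LINT x|M. indicator (E n) x * \<bar>h x\<bar>) < \<epsilon> / 2" by (auto simp: eventually_sequentially)
  show "\<exists>N. \<forall>n\<ge>N. norm ((LINT x|M. h x * b n x) - (LINT x|M. h x)) < \<epsilon>"
  proof (intro exI allI impI)
    fix n assume n: "n \<ge> N"
    have hb: "integrable M (\<lambda>x. h x * b n x)"
      by (rule integrable_weight_mult[OF h, of _ 1]) (use b in \<open>auto simp: abs_le_iff intro: order_trans[of _ 0]\<close>)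
    have [measurable]: "h \<in> borel_measurable M" using h by auto
    have i1: "integrable M (\<lambda>x. indicator (E n) x * \<bar>h x\<bar>)"
      by (rule Bochner_Integration.integrable_bound[OF h]) (auto simp: indicator_def)
    have "norm ((LINT x|M. h x * b n x) - (LINT x|M. h x)) = norm (LINT x|M. h x * b n x - h x)"
      using h hb by simp
    also have "\<dots> \<le> (LINT x|M. e * \<bar>h x\<bar> + indicator (E n) x * \<bar>h x\<bar>)"
    proof (rule Bochner_Integration.integral_norm_bound_integral)
      show "norm (h x * b n x - h x) \<le> e * \<bar>h x\<bar> + indicator (E n) x * \<bar>h x\<bar>" for x
      proof (cases "x \<in> K")
        case True
        have "norm (h x * b n x - h x) = (1 - b n x) * \<bar>h x\<bar>"
        proof -
          have "h x * b n x - h x = - ((1 - b n x) * h x)" by (simp add: algebra_simps)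
          then show ?thesis using b(2)[of n x] by (simp add: abs_mult)
        qed
        also have "\<dots> \<le> (e + indicator (E n) x) * \<bar>h x\<bar>"
          using True b(1)[of n x] e by (intro mult_right_mono) (auto simp: E_def indicator_def)
        finally show ?thesis by (simp add: distrib_right)
      qed (use K in simp)
    qed (use h hb i1 in auto)
    also have "\<dots> = e * H + (LINT x|M. indicator (E n) x * \<bar>h x\<bar>)" using h i1 by (simp add: H_def)
    also have "\<dots> < \<epsilon>" using eH N[OF n] by linarith
    finally show "norm ((LINT x|M. h x * b n x) - (LINT x|M. h x)) < \<epsilon>" .
  qed
qed

text \<open>
  Otherwise \<open>h < \<delta>\<close> almost everywhere on each of countably many balls covering \<open>\<Omega>\<close>, for every
  \<open>\<delta> > 0\<close>.
\<close>

lemma positive_mass_ball: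
  fixes h :: "'a \<Rightarrow> real"
  assumes [measurable]: "h \<in> borel_measurable M" and h0: "AE x in M. h x \<ge> 0" and nz: "\<not> (AE x in M. h x = 0)"
  obtains z r \<delta> where "r > 0" "cball z r \<subseteq> \<Omega>" "\<delta> > 0" "measure M {x\<in>ball z r. h x \<ge> \<delta>} > 0"
proof (rule ccontr)
  assume "\<not> thesis"
  then have no: "measure M {x\<in>ball z r. h x \<ge> \<delta>} = 0" if "r > 0" "cball z r \<subseteq> \<Omega>" "\<delta> > 0" for z r \<delta>
    using that \<open>\<And>r z \<delta>. \<lbrakk>0 < r; cball z r \<subseteq> \<Omega>; 0 < \<delta>; 0 < measure M {x \<in> ball z r. \<delta> \<le> h x}\<rbrakk> \<Longrightarrow> thesis\<close>
    by (metis measure_nonneg order_le_less)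
  define \<F> where "\<F> = {ball z r |z r. r > 0 \<and> cball z r \<subseteq> \<Omega>}"
  obtain \<F>' where F': "\<F>' \<subseteq> \<F>" "countable \<F>'" "\<Union>\<F>' = \<Union>\<F>"
  proof (rule Lindelof)
    show "\<And>S. S \<in> \<F> \<Longrightarrow> open S" by (auto simp: \<F>_def)
  qed (rule that)
  have cover: "\<Omega> \<subseteq> \<Union>\<F>'"
  proof
    fix x assume "x \<in> \<Omega>"
    then obtain r where r: "r > 0" "cball x r \<subseteq> \<Omega>" using open_domain open_contains_cball by metis
    then have "ball x r \<in> \<F>" "x \<in> ball x r" by (auto simp: \<F>_def)
    then show "x \<in> \<Union>\<F>'" using F'(3) by blast
  qed
  have "AE x in M. x \<in> B \<longrightarrow> h x < \<delta>" if BF: "B \<in> \<F>'" and d: "\<delta> > 0" for B \<delta>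
  proof -
    obtain z r where B: "B = ball z r" "r > 0" "cball z r \<subseteq> \<Omega>" using subsetD[OF F'(1) BF] by (auto simp: \<F>_def)
    have BO: "B \<subseteq> \<Omega>" using B ball_subset_cball by blast
    have [measurable]: "B \<in> sets M" using BO B(1) by (simp add: ball_sets_M)
    have eq: "{x\<in>space M. \<not> (x \<in> B \<longrightarrow> h x < \<delta>)} = {x\<in>B. h x \<ge> \<delta>}" using BO by auto
    have "{x\<in>space M. \<not> (x \<in> B \<longrightarrow> h x < \<delta>)} \<in> sets M" by measurable
    moreover have "emeasure M {x\<in>B. h x \<ge> \<delta>} = 0" using no[OF B(2,3) d] by (simp add: emeasure_eq_measure B(1))
    ultimately show ?thesis by (intro AE_I[where N="{x\<in>B. h x \<ge> \<delta>}"]) (auto simp: eq)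
  qed
  then have "AE x in M. \<forall>k. \<forall>B\<in>\<F>'. x \<in> B \<longrightarrow> h x < inverse (real (Suc k))"
    by (subst AE_all_countable, intro allI, subst AE_ball_countable[OF F'(2)]) auto
  moreover have "AE x in M. x \<in> \<Omega>" by (simp add: AE_M_iff)
  ultimately have "AE x in M. h x = 0"
    using h0
  proof eventually_elim
    case (elim x)
    have lt: "h x < inverse (real (Suc k))" for k using elim(1,2) cover by blast
    have "h x \<le> 0"
    proof (rule ccontr)
      assume "\<not> h x \<le> 0"
      then obtain k where "inverse (real (Suc k)) < h x" using reals_Archimedean by (metis not_le)
      then show False using lt[of k] by simp
    qed
    then show ?case using elim(3) by simp
  qed
  then show False using nz by simp
qed

lemma oscillation_cong_AE:
  assumes "AE x in M. w x = w' x"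
  shows "oscillation z r w = oscillation z r w'"
proof -
  have 1: "(\<integral>\<^sup>+y. indicator (ball z r) y * ennreal \<bar>w x - w y\<bar> \<partial>M) = (\<integral>\<^sup>+y. indicator (ball z r) y * ennreal \<bar>w x - w' y\<bar> \<partial>M)" for x
    by (rule nn_integral_cong_AE) (use assms in \<open>auto elim: eventually_mono\<close>)
  show ?thesis unfolding oscillation_def 1
    by (rule nn_integral_cong_AE) (use assms in \<open>auto elim: eventually_mono\<close>)
qed

lemma nn_integral_ball_le_LINT:
  assumes i: "integrable M g" and g0: "\<And>x. g x \<ge> 0" and le: "AE x in M. x \<in> B \<longrightarrow> F x \<le> 1 + g x"
    and C: "(LINT x|M. g x) \<le> C"
  shows "(\<integral>\<^sup>+x. indicator B x * ennreal (F x) \<partial>M) \<le> ennreal (measure M (space M) + C)"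
proof -
  have "(\<integral>\<^sup>+x. indicator B x * ennreal (F x) \<partial>M) \<le> (\<integral>\<^sup>+x. ennreal (1 + g x) \<partial>M)"
    using le by (intro nn_integral_mono_AE) (auto elim!: eventually_mono simp: indicator_def intro!: ennreal_leI)
  also have "\<dots> = ennreal (LINT x|M. 1 + g x)"
    by (rule nn_integral_eq_integral) (use i g0 in auto)
  also have "(LINT x|M. 1 + g x) = measure M (space M) + (LINT x|M. g x)" using i by simp
  also have "ennreal \<dots> \<le> ennreal (measure M (space M) + C)" using C by (intro ennreal_leI) simp
  finally show ?thesis .
qed

end

section \<open>Sequences of nonnegative solutions\<close>

locale resonance_problem = bounded_open_set \<Omega> p for \<Omega> :: "'a::euclidean_space set" and p :: real +
  fixes q lam :: real and m a f :: "'a \<Rightarrow> real"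
  assumes connected_domain: "connected \<Omega>" and exponents: "1 < q" "q < p"
    and weights: "integrable M m" "integrable M a" "integrable M f"
    and a_nonneg: "AE x in M. a x \<ge> 0" and f_nonneg: "AE x in M. f x \<ge> 0"
    and f_nonzero: "\<not> (AE x in M. f x = 0)"
begin

definition eps :: "nat \<Rightarrow> real" where "eps n = 1 / real (Suc n)"

lemma eps: "eps n > 0" "eps n \<le> 1" "eps \<longlonglongrightarrow> 0"
proof -
  show "eps n > 0" "eps n \<le> 1" by (auto simp: eps_def)
  show "eps \<longlonglongrightarrow> 0" unfolding eps_def[abs_def] using LIMSEQ_Suc[OF lim_const_over_n[of 1]] by simp
qed

text \<open>
  The exponent in the lower bound is chosen so that \<open>\<epsilon>\<^sup>p\<^sup>-\<^sup>q\<^sup>+\<^sup>1\<close> times the bound \<open>\<epsilon>\<^sup>q\<^sup>-\<^sup>p\<close> for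
  \<open>u\<^sup>q\<^sup>-\<^sup>1 (u + \<epsilon>)\<^sup>1\<^sup>-\<^sup>p\<close> is \<open>\<epsilon>\<close>.
\<close>

definition nonneg_solutions :: "(nat \<Rightarrow> real) \<Rightarrow> (nat \<Rightarrow> 'a \<Rightarrow> real) \<Rightarrow> bool" where
  "nonneg_solutions \<eta> u \<longleftrightarrow> (\<forall>n. is_solution \<Omega> p q m a f lam (\<eta> n) (u n) \<and> (AE x in M. u n x \<ge> 0)
     \<and> \<eta> n \<ge> - (eps n powr (p - q + 1)))"

text \<open>
  Since \<open>u\<^sup>q\<^sup>-\<^sup>1 (u + \<epsilon>)\<^sup>1\<^sup>-\<^sup>p \<le> (u + \<epsilon>)\<^sup>q\<^sup>-\<^sup>p \<le> \<epsilon>\<^sup>q\<^sup>-\<^sup>p\<close>, the term with \<open>a\<close> costs at most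
  a multiple of \<open>\<epsilon>\<close>.
\<close>

lemma Picone_sequence:
  assumes s: "nonneg_solutions \<eta> u" and \<phi>: "\<phi> \<in> C1c \<Omega>" and \<kappa>: "\<kappa> > 0" "\<kappa> \<le> 1" and B: "\<And>x. \<bar>\<phi> x\<bar> powr p \<le> B"
  shows "(1 - \<kappa> powr p) * (p - 1) * (LINT x|M. \<bar>\<phi> x\<bar> powr p * norm (weak_gradient \<Omega> (u n) x) powr p / (\<bar>u n x\<bar> + eps n) powr p)
     + lam * (LINT x|M. m x * ((\<bar>u n x\<bar> / (\<bar>u n x\<bar> + eps n)) powr (p - 1) * \<bar>\<phi> x\<bar> powr p))
     + (LINT x|M. f x * ((\<bar>u n x\<bar> + eps n) powr (1 - p) * \<bar>\<phi> x\<bar> powr p))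
     \<le> \<kappa> powr (p * (1 - p)) * energy \<phi> + eps n * (B * (LINT x|M. a x))"
proof -
  let ?I = "LINT x|M. a x * (\<bar>u n x\<bar> powr (q - 1) * (\<bar>u n x\<bar> + eps n) powr (1 - p) * \<bar>\<phi> x\<bar> powr p)"
  have sol: "is_solution \<Omega> p q m a f lam (\<eta> n) (u n)" "AE x in M. u n x \<ge> 0" "\<eta> n \<ge> - (eps n powr (p - q + 1))"
    using s by (auto simp: nonneg_solutions_def)
  have uW: "u n \<in> W01p \<Omega> p" using sol(1) by (simp add: is_solution_def)
  note [measurable] = LpD(1)[OF W01p_Lp(1)[OF uW]] C1c_measurable(1)[OF \<phi>]
  have B0: "B \<ge> 0" using B[of undefined] by (meson order_trans powr_ge_zero)
  have bd: "\<bar>u n x\<bar> powr (q - 1) * (\<bar>u n x\<bar> + eps n) powr (1 - p) * \<bar>\<phi> x\<bar> powr p \<le> eps n powr (q - p) * B" for x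
  proof -
    have "\<bar>u n x\<bar> powr (q - 1) * (\<bar>u n x\<bar> + eps n) powr (1 - p) \<le> (\<bar>u n x\<bar> + eps n) powr (q - 1) * (\<bar>u n x\<bar> + eps n) powr (1 - p)"
      using exponents eps(1)[of n] by (intro mult_right_mono powr_mono2) auto
    also have "\<dots> = (\<bar>u n x\<bar> + eps n) powr (q - p)" by (simp only: powr_add[symmetric]) simp
    also have "\<dots> \<le> eps n powr (q - p)" using exponents eps(1)[of n] by (intro powr_mono2') auto
    finally show ?thesis using B by (intro mult_mono) auto
  qed
  have nn: "0 \<le> \<bar>u n x\<bar> powr (q - 1) * (\<bar>u n x\<bar> + eps n) powr (1 - p) * \<bar>\<phi> x\<bar> powr p" for x by simp
  have Ii: "integrable M (\<lambda>x. a x * (\<bar>u n x\<bar> powr (q - 1) * (\<bar>u n x\<bar> + eps n) powr (1 - p) * \<bar>\<phi> x\<bar> powr p))"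
    by (rule integrable_weight_mult[OF weights(2), of _ "eps n powr (q - p) * B"]) (use bd nn in auto)
  have I: "0 \<le> ?I" "?I \<le> eps n powr (q - p) * (B * (LINT x|M. a x))"
  proof -
    show "0 \<le> ?I" using a_nonneg by (intro integral_nonneg_AE) (auto elim!: eventually_mono)
    have "?I \<le> (LINT x|M. a x * (eps n powr (q - p) * B))"
      by (rule integral_mono_AE[OF Ii]) (use weights a_nonneg bd in \<open>auto elim!: eventually_mono intro!: mult_left_mono\<close>)
    then show "?I \<le> eps n powr (q - p) * (B * (LINT x|M. a x))" by (simp add: mult_ac)
  qed
  have "- (eps n * (B * (LINT x|M. a x))) \<le> \<eta> n * ?I"
  proof -
    have "eps n powr (p - q + 1) * ?I \<le> eps n powr (p - q + 1) * (eps n powr (q - p) * (B * (LINT x|M. a x)))"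
      by (intro mult_left_mono I) simp
    also have "\<dots> = (eps n powr (p - q + 1) * eps n powr (q - p)) * (B * (LINT x|M. a x))" by simp
    also have "eps n powr (p - q + 1) * eps n powr (q - p) = eps n"
      using eps(1)[of n] by (simp add: powr_add[symmetric])
    finally have "- (eps n * (B * (LINT x|M. a x))) \<le> - (eps n powr (p - q + 1)) * ?I" by simp
    also have "\<dots> \<le> \<eta> n * ?I" by (intro mult_right_mono sol(3) I)
    finally show ?thesis .
  qed
  with Picone_integrated(1)[OF sol(1,2) exponents weights \<phi> eps(1) \<kappa>, of n] show ?thesis by linarith
qed

lemma bounded_m_term:
  assumes \<phi>: "\<phi> \<in> C1c \<Omega>" and B: "\<And>x. \<bar>\<phi> x\<bar> powr p \<le> B" and v: "v \<in> borel_measurable M" "e > 0"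
  shows "\<bar>LINT x|M. m x * ((\<bar>v x\<bar> / (\<bar>v x\<bar> + e)) powr (p - 1) * \<bar>\<phi> x\<bar> powr p)\<bar> \<le> B * (LINT x|M. \<bar>m x\<bar>)"
proof -
  note [measurable] = v(1) C1c_measurable(1)[OF \<phi>]
  have bd: "(\<bar>v x\<bar> / (\<bar>v x\<bar> + e)) powr (p - 1) * \<bar>\<phi> x\<bar> powr p \<le> B" for x
  proof -
    have "(\<bar>v x\<bar> / (\<bar>v x\<bar> + e)) powr (p - 1) \<le> 1 powr (p - 1)"
      using v(2) p_gt_1 by (intro powr_mono2) auto
    then have "(\<bar>v x\<bar> / (\<bar>v x\<bar> + e)) powr (p - 1) * \<bar>\<phi> x\<bar> powr p \<le> 1 * B"
      using B by (intro mult_mono) auto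
    then show ?thesis by simp
  qed
  have "norm (LINT x|M. m x * ((\<bar>v x\<bar> / (\<bar>v x\<bar> + e)) powr (p - 1) * \<bar>\<phi> x\<bar> powr p)) \<le> (LINT x|M. \<bar>m x\<bar> * B)"
  proof (rule Bochner_Integration.integral_norm_bound_integral)
    show "integrable M (\<lambda>x. m x * ((\<bar>v x\<bar> / (\<bar>v x\<bar> + e)) powr (p - 1) * \<bar>\<phi> x\<bar> powr p))"
      by (rule integrable_weight_mult[OF weights(1), of _ B]) (use bd in auto)
    show "norm (m x * ((\<bar>v x\<bar> / (\<bar>v x\<bar> + e)) powr (p - 1) * \<bar>\<phi> x\<bar> powr p)) \<le> \<bar>m x\<bar> * B" for x
      using bd[of x] by (simp add: abs_mult mult_left_mono)
  qed (use weights in auto)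
  then show ?thesis by (simp add: mult.commute)
qed

text \<open>
  With \<open>\<kappa>\<^sup>p = 1/2\<close> half of the logarithmic term survives.  It and the source term are nonnegative,
  and all other terms are bounded independently of \<open>n\<close>.
\<close>

lemma log_estimate:
  assumes s: "nonneg_solutions \<eta> u" and \<phi>: "\<phi> \<in> C1c \<Omega>"
  obtains C where "\<And>n. (LINT x|M. \<bar>\<phi> x\<bar> powr p * norm (weak_gradient \<Omega> (u n) x) powr p / (\<bar>u n x\<bar> + eps n) powr p) \<le> C"
    "\<And>n. (LINT x|M. f x * ((\<bar>u n x\<bar> + eps n) powr (1 - p) * \<bar>\<phi> x\<bar> powr p)) \<le> C"
proof -
  obtain B where B: "B > 0" "\<And>x. \<bar>\<phi> x\<bar> powr p \<le> B" using C1c_abs_powr_bounded[OF \<phi>] by blast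
  define \<kappa> where "\<kappa> = (1/2) powr (1/p)"
  have \<kappa>: "\<kappa> > 0" "\<kappa> \<le> 1" "\<kappa> powr p = 1/2"
    using p_gt_1 powr_mono2[of "1/p" "1/2" 1] by (auto simp: \<kappa>_def powr_powr)
  define R where "R = \<kappa> powr (p * (1 - p)) * energy \<phi> + B * (LINT x|M. a x) + \<bar>lam\<bar> * (B * (LINT x|M. \<bar>m x\<bar>))"
  define D where "D n = (LINT x|M. \<bar>\<phi> x\<bar> powr p * norm (weak_gradient \<Omega> (u n) x) powr p / (\<bar>u n x\<bar> + eps n) powr p)" for n
  define F where "F n = (LINT x|M. f x * ((\<bar>u n x\<bar> + eps n) powr (1 - p) * \<bar>\<phi> x\<bar> powr p))" for n
  have D0: "D n \<ge> 0" for n unfolding D_def by (intro Bochner_Integration.integral_nonneg) auto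
  have F0: "F n \<ge> 0" for n unfolding F_def using f_nonneg by (intro integral_nonneg_AE) (auto elim!: eventually_mono)
  have a0: "(LINT x|M. a x) \<ge> 0" using a_nonneg by (intro integral_nonneg_AE)
  have main: "(p - 1) / 2 * D n + F n \<le> R" for n
  proof -
    have uW: "u n \<in> W01p \<Omega> p" using s by (simp add: nonneg_solutions_def is_solution_def)
    define T where "T = (LINT x|M. m x * ((\<bar>u n x\<bar> / (\<bar>u n x\<bar> + eps n)) powr (p - 1) * \<bar>\<phi> x\<bar> powr p))"
    have "\<bar>T\<bar> \<le> B * (LINT x|M. \<bar>m x\<bar>)" unfolding T_def
      by (rule bounded_m_term[OF \<phi> B(2) LpD(1)[OF W01p_Lp(1)[OF uW]] eps(1)])
    then have "\<bar>lam * T\<bar> \<le> \<bar>lam\<bar> * (B * (LINT x|M. \<bar>m x\<bar>))" by (simp add: abs_mult mult_left_mono)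
    moreover have "eps n * (B * (LINT x|M. a x)) \<le> B * (LINT x|M. a x)"
      using eps(1)[of n] eps(2)[of n] B a0 by (intro mult_left_le_one_le) auto
    moreover have "(1 - \<kappa> powr p) * (p - 1) * D n + lam * T + F n \<le> \<kappa> powr (p * (1 - p)) * energy \<phi> + eps n * (B * (LINT x|M. a x))"
      using Picone_sequence[OF s \<phi> \<kappa>(1,2) B(2), of n] by (simp only: D_def T_def F_def)
    moreover have "(1 - \<kappa> powr p) * (p - 1) * D n = (p - 1) / 2 * D n" by (simp add: \<kappa>(3))
    ultimately show ?thesis unfolding R_def by linarith
  qed
  have D1: "(p - 1) / 2 * D n \<ge> 0" for n using D0 p_gt_1 by simp
  have R0: "R \<ge> 0" using main[of 0] D1[of 0] F0[of 0] by linarith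
  show ?thesis
  proof (rule that[of "max R (R / ((p - 1) / 2))"])
    fix n
    have "(p - 1) / 2 * D n \<le> R" using main[of n] F0[of n] by linarith
    then have "D n \<le> R / ((p - 1) / 2)" using p_gt_1 by (simp add: field_simps)
    then show "(LINT x|M. \<bar>\<phi> x\<bar> powr p * norm (weak_gradient \<Omega> (u n) x) powr p / (\<bar>u n x\<bar> + eps n) powr p) \<le> max R (R / ((p - 1) / 2))"
      unfolding D_def by linarith
    show "(LINT x|M. f x * ((\<bar>u n x\<bar> + eps n) powr (1 - p) * \<bar>\<phi> x\<bar> powr p)) \<le> max R (R / ((p - 1) / 2))"
      using main[of n] D1[of n] unfolding F_def by linarith
  qed
qed

text \<open>
  This is \<open>ln (u\<^sub>n + \<epsilon>\<^sub>n)\<close> normalised to vanish where \<open>u\<^sub>n\<close> does; it is large exactly where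
  \<open>u\<^sub>n/(u\<^sub>n + \<epsilon>\<^sub>n)\<close> is close to \<open>1\<close>.
\<close>

definition log_ratio :: "(nat \<Rightarrow> 'a \<Rightarrow> real) \<Rightarrow> nat \<Rightarrow> 'a \<Rightarrow> real" where
  "log_ratio u n x = ln (1 + \<bar>u n x\<bar> / eps n)"

text \<open>
  The gradient of \<open>log_ratio\<close> is \<open>\<nabla>u\<^sub>n/(u\<^sub>n + \<epsilon>\<^sub>n)\<close>, which \<open>log_estimate\<close> controls once \<open>\<phi>\<close> is a
  cut-off function equal to \<open>1\<close> on the ball.
\<close>

lemma log_ratio_oscillation:
  assumes s: "nonneg_solutions \<eta> u" and zr: "r > 0" "cball z r \<subseteq> \<Omega>"
  shows "\<exists>C. \<forall>n. oscillation z r (log_ratio u n) \<le> ennreal C"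
proof -
  obtain \<psi> where \<psi>c: "\<psi> \<in> C1c \<Omega>" and \<psi>: "\<And>x. x \<in> cball z r \<Longrightarrow> \<psi> x = 1"
    by (rule C1c_cutoff[OF zr(2)]) (rule that)
  obtain C where C: "\<And>n. (LINT x|M. \<bar>\<psi> x\<bar> powr p * norm (weak_gradient \<Omega> (u n) x) powr p / (\<bar>u n x\<bar> + eps n) powr p) \<le> C"
    by (rule log_estimate[OF s \<psi>c]) (rule that)
  have "oscillation z r (log_ratio u n) \<le> ennreal (Poincare_const r * (measure M (space M) + C))" for n
  proof -
    have sol: "is_solution \<Omega> p q m a f lam (\<eta> n) (u n)" and u0: "AE x in M. u n x \<ge> 0"
      using s by (auto simp: nonneg_solutions_def)
    have uW: "u n \<in> W01p \<Omega> p" using sol(1) by (simp add: is_solution_def)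
    have e: "eps n > 0" by (rule eps)
    define G where "G t = (if t \<ge> 0 then ln (1 + t / eps n) else ln (1 + 0 / eps n) + (1 / (0 + eps n)) * t)" for t
    define G' where "G' t = 1 / (max t 0 + eps n)" for t
    have Gd: "(G has_real_derivative G' t) (at t)" for t
      unfolding G_def G'_def
    proof (rule DERIV_extend_linearly[where f="\<lambda>t. ln (1 + t / eps n)" and f'="\<lambda>t. 1 / (t + eps n)"])
      fix t :: real assume t: "t \<ge> 0"
      then have "1 + t / eps n > 0" using e by (intro add_pos_nonneg) auto
      then show "((\<lambda>t. ln (1 + t / eps n)) has_real_derivative 1 / (t + eps n)) (at t)"
        using e t by (auto intro!: derivative_eq_intros simp: field_simps)
    qed
    have Gc: "continuous_on UNIV G'" unfolding G'_def
      by (intro continuous_intros) (use e in \<open>auto simp: max_def\<close>)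
    have Gb: "\<bar>G' t\<bar> \<le> 1 / eps n" for t unfolding G'_def using e by (auto simp: frac_le)
    have "oscillation z r (log_ratio u n) = oscillation z r (\<lambda>x. G (u n x))"
      by (rule oscillation_cong_AE) (use u0 in \<open>auto simp: log_ratio_def G_def elim!: eventually_mono\<close>)
    also have "\<dots> \<le> ennreal (Poincare_const r) * (\<integral>\<^sup>+x. indicator (ball z r) x * ennreal (\<bar>G' (u n x)\<bar> * norm (weak_gradient \<Omega> (u n) x)) \<partial>M)"
      by (rule oscillation_W01p[OF uW zr(1) _ Gd Gc Gb]) (use zr ball_subset_cball in blast)
    also have "\<dots> \<le> ennreal (Poincare_const r) * ennreal (measure M (space M) + C)"
    proof (rule mult_left_mono[OF nn_integral_ball_le_LINT[OF _ _ _ C]])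
      show "integrable M (\<lambda>x. \<bar>\<psi> x\<bar> powr p * norm (weak_gradient \<Omega> (u n) x) powr p / (\<bar>u n x\<bar> + eps n) powr p)"
        by (rule Picone_integrated(2)[OF sol u0 exponents weights \<psi>c e zero_less_one order_refl])
      show "AE x in M. x \<in> ball z r \<longrightarrow> \<bar>G' (u n x)\<bar> * norm (weak_gradient \<Omega> (u n) x) \<le> 1 + \<bar>\<psi> x\<bar> powr p * norm (weak_gradient \<Omega> (u n) x) powr p / (\<bar>u n x\<bar> + eps n) powr p"
        using u0
      proof eventually_elim
        case (elim x)
        show ?case
        proof
          assume x: "x \<in> ball z r"
          define t where "t = norm (weak_gradient \<Omega> (u n) x) / (u n x + eps n)"
          have t: "t \<ge> 0" using elim e by (simp add: t_def)
          have "t \<le> 1 + t powr p" using le_delta_powr[OF t, of 1 p] p_gt_1 by simp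
          moreover have "\<psi> x = 1" using x by (intro \<psi>) auto
          moreover have "t powr p = norm (weak_gradient \<Omega> (u n) x) powr p / (u n x + eps n) powr p"
            unfolding t_def by (rule powr_divide)
          ultimately show "\<bar>G' (u n x)\<bar> * norm (weak_gradient \<Omega> (u n) x) \<le> 1 + \<bar>\<psi> x\<bar> powr p * norm (weak_gradient \<Omega> (u n) x) powr p / (\<bar>u n x\<bar> + eps n) powr p"
            using elim e by (simp add: G'_def t_def)
        qed
      qed
    qed auto
    also have "\<dots> = ennreal (Poincare_const r * (measure M (space M) + C))"
      using zr(1) by (simp add: ennreal_mult' Poincare_const_def)
    finally show ?thesis .
  qed
  then show ?thesis by blast
qed

lemma integrable_f_term:
  assumes \<phi>: "\<phi> \<in> C1c \<Omega>" and u: "u \<in> borel_measurable M" and e: "e > 0"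
  shows "integrable M (\<lambda>x. f x * ((\<bar>u x\<bar> + e) powr (1 - p) * \<bar>\<phi> x\<bar> powr p))"
proof -
  note [measurable] = u C1c_measurable(1)[OF \<phi>]
  obtain B where B: "B > 0" "\<And>x. \<bar>\<phi> x\<bar> powr p \<le> B" using C1c_abs_powr_bounded[OF \<phi>] by blast
  show ?thesis
  proof (rule integrable_weight_mult[OF weights(3), of _ "e powr (1 - p) * B"])
    show "AE x in M. \<bar>(\<bar>u x\<bar> + e) powr (1 - p) * \<bar>\<phi> x\<bar> powr p\<bar> \<le> e powr (1 - p) * B"
      using B e p_gt_1 by (intro AE_I2) (auto simp: abs_mult intro!: mult_mono powr_mono2')
  qed measurable
qed

lemma log_ratio_measurable: 
  assumes "nonneg_solutions \<eta> u"
  shows "u n \<in> borel_measurable M" "log_ratio u n \<in> borel_measurable M"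
proof -
  have "u n \<in> W01p \<Omega> p" using assms by (simp add: nonneg_solutions_def is_solution_def)
  then show [measurable]: "u n \<in> borel_measurable M" using LpD(1)[OF W01p_Lp(1)] by blast
  show "log_ratio u n \<in> borel_measurable M" unfolding log_ratio_def[abs_def] by measurable
qed

text \<open>
  Take a ball in which the set \<open>A\<close> where \<open>f \<ge> \<delta>\<close> has positive measure.  As \<open>\<integral> f (u\<^sub>n + \<epsilon>\<^sub>n)\<^sup>1\<^sup>-\<^sup>p |\<phi>|\<^sup>p\<close> is
  bounded, \<open>u\<^sub>n + \<epsilon>\<^sub>n\<close> can be below a small constant \<open>s\<^sub>0\<close> on at most half of \<open>A\<close>; on the other half
  \<open>log_ratio\<close> exceeds \<open>ln (s\<^sub>0/\<epsilon>\<^sub>n)\<close>, which tends to infinity.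
\<close>

lemma log_ratio_start:
  assumes s: "nonneg_solutions \<eta> u"
  obtains z r c where "cball z r \<subseteq> \<Omega>" "r > 0" "c > 0"
    "\<And>T. \<forall>\<^sub>F n in sequentially. c \<le> measure M {x\<in>ball z r. log_ratio u n x \<ge> T}"
proof -
  note fm[measurable] = borel_measurable_integrable[OF weights(3)]
  obtain z r \<delta> where zr: "r > 0" "cball z r \<subseteq> \<Omega>" "\<delta> > 0" and pos: "measure M {x\<in>ball z r. f x \<ge> \<delta>} > 0"
    using positive_mass_ball[OF fm f_nonneg f_nonzero] by metis
  define A where "A = {x\<in>ball z r. f x \<ge> \<delta>}"
  define c where "c = measure M A / 2"
  have c: "c > 0" using pos by (simp add: c_def A_def)
  have bO: "ball z r \<subseteq> \<Omega>" using zr ball_subset_cball by blast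
  have Bm[measurable]: "ball z r \<in> sets M" by (rule ball_sets_M[OF bO])
  have Am[measurable]: "A \<in> sets M"
    unfolding A_def by (rule sets_M_Collect[OF Bm]) measurable
  obtain \<psi> where \<psi>c: "\<psi> \<in> C1c \<Omega>" and \<psi>: "\<And>x. x \<in> cball z r \<Longrightarrow> \<psi> x = 1"
    by (rule C1c_cutoff[OF zr(2)]) (rule that)
  note [measurable] = C1c_measurable(1)[OF \<psi>c]
  obtain C0 where C0: "\<And>n. (LINT x|M. f x * ((\<bar>u n x\<bar> + eps n) powr (1 - p) * \<bar>\<psi> x\<bar> powr p)) \<le> C0"
    by (rule log_estimate[OF s \<psi>c]) (rule that)
  define C where "C = \<bar>C0\<bar> + 1"
  have C: "C > 0" by (simp add: C_def)
  \<comment> \<open>Chosen so that \<open>\<delta> s\<^sub>0\<^sup>1\<^sup>-\<^sup>p = C/c\<close>: Chebyshev's inequality then bounds the bad part of \<open>A\<close> by \<open>c\<close>, half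
    of its measure.\<close>
  define s0 where "s0 = (c * \<delta> / C) powr (1 / (p - 1))"
  have s0: "s0 > 0" "s0 powr (p - 1) = c * \<delta> / C" using c zr C p_gt_1 by (auto simp: s0_def powr_powr)
  have key: "c \<le> measure M {x\<in>A. \<bar>u n x\<bar> + eps n > s0}" for n
  proof -
    have e: "eps n > 0" by (rule eps)
    note [measurable] = log_ratio_measurable(1)[OF s, of n]
    define Z where "Z = {x\<in>A. \<bar>u n x\<bar> + eps n \<le> s0}"
    have Zm: "Z \<in> sets M" unfolding Z_def by (rule sets_M_Collect[OF Am]) measurable
    have Ym: "{x\<in>A. \<bar>u n x\<bar> + eps n > s0} \<in> sets M" by (rule sets_M_Collect[OF Am]) measurable
    note Fi = integrable_f_term[OF \<psi>c log_ratio_measurable(1)[OF s] e, of n]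
    have "(\<delta> * s0 powr (1 - p)) * measure M Z = (LINT x|M. (\<delta> * s0 powr (1 - p)) * indicator Z x)"
      using Zm sets.sets_into_space[OF Zm] by (simp add: Int_absorb2)
    also have "\<dots> \<le> (LINT x|M. f x * ((\<bar>u n x\<bar> + eps n) powr (1 - p) * \<bar>\<psi> x\<bar> powr p))"
    proof (rule integral_mono_AE[OF _ Fi])
      show "integrable M (\<lambda>x. (\<delta> * s0 powr (1 - p)) * indicator Z x :: real)"
        by (intro integrable_mult_right integrable_real_indicator Zm) (simp add: less_top[symmetric])
      show "AE x in M. \<delta> * s0 powr (1 - p) * indicator Z x \<le> f x * ((\<bar>u n x\<bar> + eps n) powr (1 - p) * \<bar>\<psi> x\<bar> powr p)"
        using f_nonneg
      proof eventually_elim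
        case (elim x)
        show ?case
        proof (cases "x \<in> Z")
          case True
          then have x: "x \<in> cball z r" "f x \<ge> \<delta>" "\<bar>u n x\<bar> + eps n \<le> s0" by (auto simp: Z_def A_def)
          have "s0 powr (1 - p) \<le> (\<bar>u n x\<bar> + eps n) powr (1 - p)"
            using x e p_gt_1 by (intro powr_mono2') auto
          then have "\<delta> * s0 powr (1 - p) \<le> f x * (\<bar>u n x\<bar> + eps n) powr (1 - p)"
            using x zr by (intro mult_mono) auto
          then show ?thesis using True \<psi>[OF x(1)] by simp
        qed (use elim in simp)
      qed
    qed
    also have "\<dots> \<le> C" using C0[of n] by (simp add: C_def)
    finally have "(\<delta> / s0 powr (p - 1)) * measure M Z \<le> C"
      using powr_minus[of s0 "p - 1"] by (simp add: divide_inverse)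
    then have "C / c * measure M Z \<le> C" using s0(2) c zr C by simp
    then have "measure M Z \<le> c" using c C by (simp add: field_simps)
    moreover have "measure M A \<le> measure M Z + measure M {x\<in>A. \<bar>u n x\<bar> + eps n > s0}"
    proof -
      have "measure M A \<le> measure M (Z \<union> {x\<in>A. \<bar>u n x\<bar> + eps n > s0})"
        by (intro finite_measure_mono sets.Un Zm Ym) (auto simp: Z_def)
      also have "\<dots> \<le> measure M Z + measure M {x\<in>A. \<bar>u n x\<bar> + eps n > s0}" by (rule measure_Un_le[OF Zm Ym])
      finally show ?thesis .
    qed
    ultimately show ?thesis unfolding c_def by linarith
  qed
  show ?thesis
  proof (rule that[OF zr(2,1) c])
    fix T
    have "filterlim (\<lambda>n. s0 / eps n) at_top sequentially"
    proof -
      have "filterlim (\<lambda>n. real (Suc n) * s0) at_top sequentially"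
        by (rule filterlim_at_top_mult_tendsto_pos[OF tendsto_const s0(1) filterlim_compose[OF filterlim_real_sequentially filterlim_Suc]])
      then show ?thesis by (simp add: eps_def mult.commute)
    qed
    then have "\<forall>\<^sub>F n in sequentially. s0 / eps n \<ge> exp T" by (simp add: filterlim_at_top)
    then show "\<forall>\<^sub>F n in sequentially. c \<le> measure M {x\<in>ball z r. log_ratio u n x \<ge> T}"
    proof eventually_elim
      case (elim n)
      have e: "eps n > 0" by (rule eps)
      note [measurable] = log_ratio_measurable(2)[OF s, of n]
      have "{x\<in>A. \<bar>u n x\<bar> + eps n > s0} \<subseteq> {x\<in>ball z r. log_ratio u n x \<ge> T}"
      proof
        fix x assume x: "x \<in> {x\<in>A. \<bar>u n x\<bar> + eps n > s0}"
        then have "exp T \<le> (\<bar>u n x\<bar> + eps n) / eps n"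
          using elim e by (smt (verit) divide_right_mono mem_Collect_eq)
        also have "\<dots> = 1 + \<bar>u n x\<bar> / eps n" using e by (simp add: field_simps)
        finally have "T \<le> log_ratio u n x" unfolding log_ratio_def
          by (subst ln_ge_iff) (use e in \<open>auto intro: add_pos_nonneg\<close>)
        then show "x \<in> {x\<in>ball z r. log_ratio u n x \<ge> T}" using x by (auto simp: A_def)
      qed
      moreover have "{x\<in>ball z r. log_ratio u n x \<ge> T} \<in> sets M"
        by (rule sets_M_Collect[OF Bm]) measurable
      ultimately show ?case using key[of n] by (meson finite_measure_mono order_trans)
    qed
  qed
qed

theorem log_ratio_tends_to_infinity:
  assumes s: "nonneg_solutions \<eta> u" and K: "compact K" "K \<subseteq> \<Omega>"
  shows "(\<lambda>n. measure M {x\<in>K. log_ratio u n x \<le> T}) \<longlonglongrightarrow> 0"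
proof -
  obtain z r c where st: "cball z r \<subseteq> \<Omega>" "r > 0" "c > 0"
    "\<And>T. \<forall>\<^sub>F n in sequentially. c \<le> measure M {x\<in>ball z r. log_ratio u n x \<ge> T}"
    by (rule log_ratio_start[OF s]) (rule that)
  show ?thesis
    by (rule mass_spreads[OF connected_domain log_ratio_measurable(2)[OF s] log_ratio_oscillation[OF s] st K])
qed

text \<open>
  Since \<open>u\<^sub>n/(u\<^sub>n + \<epsilon>\<^sub>n) \<rightarrow> 1\<close> in measure on the support of \<open>\<phi>\<close>, the term with \<open>m\<close> converges.  The
  constant \<open>c\<close> stands for what is known about the source term from below.
\<close>

theorem Picone_limit:
  assumes s: "nonneg_solutions \<eta> u" and \<phi>: "\<phi> \<in> C1c \<Omega>"
    and c: "\<And>n. c \<le> (LINT x|M. f x * ((\<bar>u n x\<bar> + eps n) powr (1 - p) * \<bar>\<phi> x\<bar> powr p))"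
  shows "lam * mass m \<phi> + c \<le> energy \<phi>"
proof -
  obtain B where B: "B > 0" "\<And>x. \<bar>\<phi> x\<bar> powr p \<le> B" using C1c_abs_powr_bounded[OF \<phi>] by blast
  obtain K where K: "compact K" "K \<subseteq> \<Omega>" "\<And>x. x \<notin> K \<Longrightarrow> \<phi> x = 0" using C1c_support[OF \<phi>] by metis
  note [measurable] = C1c_measurable(1)[OF \<phi>] log_ratio_measurable[OF s]
  define b where "b n x = (\<bar>u n x\<bar> / (\<bar>u n x\<bar> + eps n)) powr (p - 1)" for n x
  have hi: "integrable M (\<lambda>x. m x * \<bar>\<phi> x\<bar> powr p)"
    by (rule integrable_weight_mult[OF weights(1), of _ B]) (use B in auto)
  have lim: "(\<lambda>n. LINT x|M. (m x * \<bar>\<phi> x\<bar> powr p) * b n x) \<longlonglongrightarrow> mass m \<phi>"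
  proof (rule integral_mult_tendsto_in_measure[OF hi K(1,2)])
    show "m x * \<bar>\<phi> x\<bar> powr p = 0" if "x \<notin> K" for x using K(3)[OF that] by simp
    show "b n \<in> borel_measurable M" for n unfolding b_def by measurable
    show "0 \<le> b n x" for n x by (simp add: b_def)
    show "b n x \<le> 1" for n x
      using powr_mono2[of "p - 1" "\<bar>u n x\<bar> / (\<bar>u n x\<bar> + eps n)" 1] eps(1)[of n] p_gt_1 by (simp add: b_def)
    fix e :: real assume e: "0 < e" "e < 1"
    \<comment> \<open>\<open>b\<^sub>n \<le> 1 - e\<close> means \<open>u\<^sub>n/(u\<^sub>n + \<epsilon>\<^sub>n) \<le> d\<close>, which bounds \<open>log_ratio\<close> by \<open>ln (1/(1 - d))\<close>.\<close>
    define d where "d = (1 - e) powr (1 / (p - 1))"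
    have d: "0 < d" "d < 1" using e p_gt_1 powr_less_mono2[of "1 / (p - 1)" "1 - e" 1] by (auto simp: d_def)
    define T where "T = ln (1 / (1 - d))"
    have sub: "{x\<in>K. b n x \<le> 1 - e} \<subseteq> {x\<in>K. log_ratio u n x \<le> T}" for n
    proof
      fix x assume x: "x \<in> {x\<in>K. b n x \<le> 1 - e}"
      define t where "t = \<bar>u n x\<bar> / (\<bar>u n x\<bar> + eps n)"
      have ep: "eps n > 0" by (rule eps)
      have t: "0 \<le> t" "t < 1" using ep by (auto simp: t_def)
      have "(t powr (p - 1)) powr (1 / (p - 1)) \<le> (1 - e) powr (1 / (p - 1))"
        using x p_gt_1 by (intro powr_mono2) (auto simp: b_def t_def)
      then have "t \<le> d" using t p_gt_1 by (simp add: powr_powr d_def)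
      have "1 + \<bar>u n x\<bar> / eps n = 1 / (1 - t)"
        using ep by (simp add: t_def field_simps)
      also have "\<dots> \<le> 1 / (1 - d)" using \<open>t \<le> d\<close> d t by (intro divide_left_mono) auto
      finally have "log_ratio u n x \<le> T" unfolding log_ratio_def T_def
        using ep by (intro ln_mono) (auto intro: add_pos_nonneg)
      then show "x \<in> {x\<in>K. log_ratio u n x \<le> T}" using x by simp
    qed
    have KM[measurable]: "K \<in> sets M" using K by (intro compact_sets_M)
    have meas: "{x\<in>K. log_ratio u n x \<le> T} \<in> sets M" for n by (rule sets_M_Collect[OF KM]) measurable
    show "(\<lambda>n. measure M {x\<in>K. b n x \<le> 1 - e}) \<longlonglongrightarrow> 0"
      by (rule tendsto_sandwich[OF _ _ tendsto_const log_ratio_tends_to_infinity[OF s K(1,2), of T]])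
         (use finite_measure_mono[OF sub meas] in auto)
  qed
  have "lam * (LINT x|M. (m x * \<bar>\<phi> x\<bar> powr p) * b n x) + c \<le> energy \<phi> + eps n * (B * (LINT x|M. a x))" for n
  proof -
    have "(LINT x|M. (m x * \<bar>\<phi> x\<bar> powr p) * b n x) = (LINT x|M. m x * ((\<bar>u n x\<bar> / (\<bar>u n x\<bar> + eps n)) powr (p - 1) * \<bar>\<phi> x\<bar> powr p))"
      unfolding b_def by (simp add: mult_ac)
    then show ?thesis using Picone_sequence[OF s \<phi> zero_less_one order_refl B(2), of n] c[of n] by simp
  qed
  moreover have "(\<lambda>n. lam * (LINT x|M. (m x * \<bar>\<phi> x\<bar> powr p) * b n x) + c) \<longlonglongrightarrow> lam * mass m \<phi> + c"
    by (intro tendsto_intros lim)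
  moreover have "(\<lambda>n. energy \<phi> + eps n * (B * (LINT x|M. a x))) \<longlonglongrightarrow> energy \<phi> + 0 * (B * (LINT x|M. a x))"
    by (intro tendsto_intros eps(3))
  ultimately show ?thesis using LIMSEQ_le by fastforce
qed

end

section \<open>Approximation of the first eigenvalue\<close>

text \<open>
  Convexity of \<open>x\<^sup>p\<close>.  The first constant tends to \<open>1\<close> as \<open>\<theta> \<rightarrow> 0\<close>, so energies are upper
  semicontinuous under convergence in \<open>L\<^sup>p\<close> with no loss of a factor.
\<close>

lemma powr_add_le_weighted:
  fixes a b p \<theta> :: real
  assumes "a \<ge> 0" "b \<ge> 0" "p \<ge> 1" "0 < \<theta>" "\<theta> < 1"
  shows "(a + b) powr p \<le> (1 - \<theta>) powr (1 - p) * a powr p + \<theta> powr (1 - p) * b powr p"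
proof -
  have ge1: "1 \<le> t powr (1 - p)" if "0 < t" "t < 1" for t
    using powr_mono2'[of "1 - p" t 1] that assms(3) by simp
  consider "a = 0" | "b = 0" | "a > 0" "b > 0" using assms by linarith
  then show ?thesis
  proof cases
    case 1
    then show ?thesis using mult_right_mono[OF ge1[of \<theta>], of "b powr p"] assms by simp
  next
    case 2
    then show ?thesis using mult_right_mono[OF ge1[of "1 - \<theta>"], of "a powr p"] assms by simp
  next
    case 3
    have "convex_on {0<..} (\<lambda>x. x powr p)" using assms by (intro powr_convex)
    then have "((1 - \<theta>) *\<^sub>R (a / (1 - \<theta>)) + \<theta> *\<^sub>R (b / \<theta>)) powr p \<le> (1 - \<theta>) * (a / (1 - \<theta>)) powr p + \<theta> * (b / \<theta>) powr p"
      by (rule convex_onD) (use assms 3 in auto)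
    moreover have "(1 - \<theta>) *\<^sub>R (a / (1 - \<theta>)) + \<theta> *\<^sub>R (b / \<theta>) = a + b" using assms by simp
    moreover have "(1 - \<theta>) * (a / (1 - \<theta>)) powr p = (1 - \<theta>) powr (1 - p) * a powr p"
      using assms by (simp add: powr_divide powr_diff)
    moreover have "\<theta> * (b / \<theta>) powr p = \<theta> powr (1 - p) * b powr p"
      using assms by (simp add: powr_divide powr_diff)
    ultimately show ?thesis by simp
  qed
qed

text \<open>
  Hoelder's inequality for two points of weights \<open>1\<close> and \<open>\<tau>\<close>, obtained from Young's inequality
  with the parameter \<open>\<kappa>\<^sup>p = y/D\<close>, where \<open>y\<close> is the sum to be estimated.
\<close>

lemma discrete_Hoelder:
  fixes F A S B \<tau> D p :: real
  assumes "F \<ge> 0" "A \<ge> 0" "S \<ge> 0" "B \<ge> 0" "\<tau> \<ge> 0" "p > 1" "D > 0" "F powr p + \<tau> * S powr p \<le> D"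
  shows "(F powr (p - 1) * A + \<tau> * (S powr (p - 1) * B)) powr p \<le> D powr (p - 1) * (A powr p + \<tau> * B powr p)"
proof -
  define y where "y = F powr (p - 1) * A + \<tau> * (S powr (p - 1) * B)"
  define R where "R = A powr p + \<tau> * B powr p"
  have y0: "y \<ge> 0" "R \<ge> 0" using assms by (auto simp: y_def R_def)
  show ?thesis
  proof (cases "y = 0")
    case True
    then show ?thesis using assms y0 by (simp add: y_def[symmetric] R_def[symmetric])
  next
    case False
    then have y: "y > 0" using y0 by simp
    define \<kappa> where "\<kappa> = (y / D) powr (1 / p)"
    have \<kappa>: "\<kappa> > 0" "\<kappa> powr p = y / D" "\<kappa> powr (p * (1 - p)) = (y / D) powr (1 - p)"
      using y assms by (auto simp: \<kappa>_def powr_powr)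
    have "p * (F powr (p - 1) * A) \<le> (p - 1) * (y / D) * F powr p + (y / D) powr (1 - p) * A powr p"
      using Young_powr[OF assms(1,2,6) \<kappa>(1)] by (simp add: \<kappa>)
    moreover have "\<tau> * (p * (S powr (p - 1) * B)) \<le> \<tau> * ((p - 1) * (y / D) * S powr p + (y / D) powr (1 - p) * B powr p)"
      using Young_powr[OF assms(3,4,6) \<kappa>(1)] by (intro mult_left_mono assms) (simp add: \<kappa>)
    moreover have "p * y = p * (F powr (p - 1) * A) + \<tau> * (p * (S powr (p - 1) * B))"
      by (simp add: y_def distrib_left mult.left_commute)
    ultimately have "p * y \<le> (p - 1) * (y / D) * F powr p + (y / D) powr (1 - p) * A powr p
        + \<tau> * ((p - 1) * (y / D) * S powr p + (y / D) powr (1 - p) * B powr p)" by linarith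
    also have "\<dots> = (p - 1) * (y / D) * (F powr p + \<tau> * S powr p) + (y / D) powr (1 - p) * R"
      by (simp add: R_def algebra_simps)
    also have "(p - 1) * (y / D) * (F powr p + \<tau> * S powr p) \<le> (p - 1) * (y / D) * D"
      using assms y by (intro mult_left_mono) auto
    finally have "p * y \<le> (p - 1) * y + (y / D) powr (1 - p) * R" using assms by simp
    then have "y \<le> (y / D) powr (1 - p) * R" by (simp add: algebra_simps)
    then have "(y / D) powr (p - 1) * y \<le> (y / D) powr (p - 1) * ((y / D) powr (1 - p) * R)"
      by (rule mult_left_mono) simp
    also have "\<dots> = ((y / D) powr (p - 1) * (y / D) powr (1 - p)) * R" by simp
    also have "(y / D) powr (p - 1) * (y / D) powr (1 - p) = 1" using y assms by (simp add: powr_add[symmetric])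
    finally have "(y / D) powr (p - 1) * y \<le> R" by simp
    then have "D powr (p - 1) * ((y / D) powr (p - 1) * y) \<le> D powr (p - 1) * R" by (rule mult_left_mono) simp
    moreover have "D powr (p - 1) * ((y / D) powr (p - 1) * y) = y powr p"
    proof -
      have "D powr (p - 1) * (y / D) powr (p - 1) = y powr (p - 1)" using assms by (simp add: powr_divide)
      then have "D powr (p - 1) * ((y / D) powr (p - 1) * y) = y powr (p - 1) * y powr 1" using y by (simp add: mult.assoc[symmetric])
      also have "\<dots> = y powr p" by (simp only: powr_add[symmetric]) simp
      finally show ?thesis .
    qed
    ultimately show ?thesis by (simp add: y_def R_def)
  qed
qed

lemma one_minus_powr_le:
  fixes y r :: real
  assumes "0 \<le> y" "y \<le> 1" "r > 0"
  shows "(1 - y) powr r \<le> 1 - min 1 r * y"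
proof (cases "y = 1")
  case False
  then have y: "1 - y > 0" using assms by simp
  show ?thesis
  proof (cases "r \<ge> 1")
    case True
    have "(1 - y) powr r \<le> (1 - y) powr 1" using True y assms by (intro powr_mono') auto
    then show ?thesis using True y by simp
  next
    case r: False
    have "(1 - y) powr r * 1 powr (1 - r) \<le> r * (1 - y) + (1 - r) * 1"
      by (rule Youngs_inequality_0) (use assms r y in auto)
    then show ?thesis using r by (simp add: algebra_simps)
  qed
qed (use assms in auto)

lemma C1c_scale:
  assumes "\<phi> \<in> C1c \<Omega>"
  shows "(\<lambda>x. c * \<phi> x) \<in> C1c \<Omega>" "gradient (\<lambda>x. c * \<phi> x) = (\<lambda>x. c *\<^sub>R gradient \<phi> x)"
proof -
  have d: "((\<lambda>s. c * s) has_real_derivative (\<lambda>_. c) s) (at s)" for s by (auto intro!: derivative_eq_intros)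
  show "(\<lambda>x. c * \<phi> x) \<in> C1c \<Omega>" by (rule C1c_compose[OF assms d]) auto
  show "gradient (\<lambda>x. c * \<phi> x) = (\<lambda>x. c *\<^sub>R gradient \<phi> x)" by (rule C1_compose(2)[OF C1c_imp_C1[OF assms] d]) auto
qed

context bounded_open_set begin

lemma Lp_limit_norm_le:
  assumes "Lp_limit f g" "e > 0"
  shows "\<forall>\<^sub>F n in sequentially. (LINT x|M. norm (f n x) powr p) < (LINT x|M. norm (g x) powr p) + e"
proof -
  define G where "G = (LINT x|M. norm (g x) powr p)"
  have G0: "G \<ge> 0" by (simp add: G_def)
  have "((\<lambda>\<theta>. (1 - \<theta>) powr (1 - p) * G) \<longlongrightarrow> (1 - 0) powr (1 - p) * G) (at_right 0)"
    by (intro tendsto_intros) auto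
  then have "\<forall>\<^sub>F \<theta> in at_right 0. (1 - \<theta>) powr (1 - p) * G < G + e / 2"
    using assms(2) by (intro order_tendstoD) auto
  moreover have "\<forall>\<^sub>F \<theta> in at_right 0. (0::real) < \<theta> \<and> \<theta> < 1"
    by (auto simp: eventually_at_right_field intro!: exI[of _ 1])
  ultimately have "\<forall>\<^sub>F \<theta> in at_right 0. (0::real) < \<theta> \<and> \<theta> < 1 \<and> (1 - \<theta>) powr (1 - p) * G < G + e / 2"
    by eventually_elim auto
  then obtain \<theta> where \<theta>: "0 < \<theta>" "\<theta> < 1" "(1 - \<theta>) powr (1 - p) * G < G + e / 2"
    using eventually_happens'[OF trivial_limit_at_right_real] by blast
  have "(\<lambda>n. \<theta> powr (1 - p) * (LINT x|M. norm (f n x - g x) powr p)) \<longlonglongrightarrow> 0"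
    using tendsto_mult_right_zero[OF Lp_limitD(3)[OF assms(1)]] .
  then have "\<forall>\<^sub>F n in sequentially. \<theta> powr (1 - p) * (LINT x|M. norm (f n x - g x) powr p) < e / 2"
    using assms(2) by (intro order_tendstoD) auto
  then show ?thesis
  proof eventually_elim
    case (elim n)
    note i = LpD(2)[OF Lp_limitD(1)[OF assms(1), of n]] LpD(2)[OF Lp_limitD(2)[OF assms(1)]]
      LpD(2)[OF Lp_diff[OF Lp_limitD(1)[OF assms(1), of n] Lp_limitD(2)[OF assms(1)]]]
    have "(LINT x|M. norm (f n x) powr p) \<le> (LINT x|M. (1 - \<theta>) powr (1 - p) * norm (g x) powr p + \<theta> powr (1 - p) * norm (f n x - g x) powr p)"
    proof (rule integral_mono)
      fix x
      have "norm (f n x) powr p \<le> (norm (g x) + norm (f n x - g x)) powr p"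
        using p_gt_1 norm_triangle_sub[of "f n x" "g x"] by (intro powr_mono2) auto
      also have "\<dots> \<le> (1 - \<theta>) powr (1 - p) * norm (g x) powr p + \<theta> powr (1 - p) * norm (f n x - g x) powr p"
        using p_gt_1 \<theta> by (intro powr_add_le_weighted) auto
      finally show "norm (f n x) powr p \<le> (1 - \<theta>) powr (1 - p) * norm (g x) powr p + \<theta> powr (1 - p) * norm (f n x - g x) powr p" .
    qed (use i in auto)
    also have "\<dots> = (1 - \<theta>) powr (1 - p) * G + \<theta> powr (1 - p) * (LINT x|M. norm (f n x - g x) powr p)"
      using i by (simp add: G_def)
    finally show ?case using elim \<theta>(3) unfolding G_def by linarith
  qed
qed

text \<open>
  Inner regularity gives a compact set of positive measure on which \<open>m > 0\<close>; its indicator is a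
  bounded limit of test functions.
\<close>

lemma exists_positive_mass:
  assumes m: "integrable M m" and pos: "\<not> (AE x in M. max (m x) 0 = 0)"
  obtains \<phi> where "\<phi> \<in> C1c \<Omega>" "mass m \<phi> > 0"
proof -
  have mi: "integrable lebesgue (\<lambda>x. indicator \<Omega> x *\<^sub>R m x)"
    using m by (simp add: integrable_restrict_space)
  note [measurable] = borel_measurable_integrable[OF mi] borel_measurable_integrable[OF m]
  define E where "E = {x. indicator \<Omega> x *\<^sub>R m x > 0}"
  have "E = {x\<in>space lebesgue. indicator \<Omega> x *\<^sub>R m x > 0}" by (simp add: E_def)
  also have "\<dots> \<in> sets lebesgue" by measurable
  finally have E: "E \<in> sets lebesgue" .
  obtain N C where NC: "negligible N" "\<And>n::nat. compact (C n)" "E = (\<Union>n. C n) \<union> N"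
    using lebesgue_regular_inner[OF E] by metis
  have EO: "x \<in> \<Omega>" "m x > 0" if "x \<in> E" for x
    using that by (cases "x \<in> \<Omega>"; simp add: E_def)+
  have CE: "C n \<subseteq> E" for n using NC by auto
  have "\<exists>n. \<not> (AE x in lebesgue. x \<notin> C n)"
  proof (rule ccontr)
    assume "\<not> ?thesis"
    then have "AE x in lebesgue. \<forall>n. x \<notin> C n" by (simp add: AE_all_countable)
    moreover have "AE x in lebesgue. x \<notin> N"
      using NC(1) AE_not_in[of N lebesgue] by (simp add: negligible_iff_null_sets)
    ultimately have "AE x in lebesgue. x \<notin> E"
      by eventually_elim (use NC(3) in blast)
    then have "AE x in M. max (m x) 0 = 0" unfolding AE_M_iff
      by eventually_elim (auto simp: E_def indicator_def max_def split: if_splits)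
    then show False using pos by simp
  qed
  then obtain n where n: "\<not> (AE x in lebesgue. x \<notin> C n)" by blast
  define K where "K = C n"
  have K: "compact K" "K \<subseteq> \<Omega>" using NC(2) CE EO by (auto simp: K_def)
  have KM[measurable]: "K \<in> sets M" using K by (intro compact_sets_M)
  have mK: "integrable M (\<lambda>x. m x * indicator K x)"
    by (rule integrable_weight_mult[OF m, of _ 1]) (auto simp: indicator_def)
  have nn: "m x * indicator K x \<ge> 0" for x using CE[of n] EO[of x] by (auto simp: K_def indicator_def less_imp_le)
  have "(LINT x|M. m x * indicator K x) \<noteq> 0"
  proof
    assume "(LINT x|M. m x * indicator K x) = 0"
    then have "AE x in M. m x * indicator K x = 0" using integral_nonneg_eq_0_iff_AE[OF mK] nn by simp
    then have "AE x in lebesgue. x \<notin> C n" unfolding AE_M_iff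
    proof eventually_elim
      case (elim x)
      show ?case
      proof
        assume x: "x \<in> C n"
        then have "x \<in> E" using CE by blast
        then show False using elim EO[of x] x by (simp add: K_def)
      qed
    qed
    then show False using n by simp
  qed
  moreover have "(LINT x|M. m x * indicator K x) \<ge> 0" using nn by simp
  ultimately have p0: "(LINT x|M. m x * indicator K x) > 0" by simp
  obtain \<zeta> K' where \<zeta>: "\<And>n. \<zeta> n \<in> test_functions \<Omega>" "compact K'" "K' \<subseteq> \<Omega>"
      "\<And>n x. x \<notin> K' \<Longrightarrow> \<zeta> n x = 0" "\<And>n x. \<bar>\<zeta> n x\<bar> \<le> 1"
      "\<And>x. (\<lambda>n::nat. \<zeta> n x) \<longlonglongrightarrow> indicator K x"
    using indicator_approximation[OF K(1) open_domain K(2)] by blast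
  have c: "\<zeta> n \<in> C1c \<Omega>" for n using \<zeta>(1) test_functions_C1c by blast
  note [measurable] = C1c_measurable(1)[OF c]
  have "(\<lambda>n. LINT x|M. m x * \<bar>\<zeta> n x\<bar> powr p) \<longlonglongrightarrow> (LINT x|M. m x * indicator K x)"
  proof (rule integral_dominated_convergence)
    show "integrable M (\<lambda>x. \<bar>m x\<bar>)" using m by simp
    show "AE x in M. (\<lambda>n. m x * \<bar>\<zeta> n x\<bar> powr p) \<longlonglongrightarrow> m x * indicator K x"
    proof (rule AE_I2)
      fix x
      have "(\<lambda>n. \<bar>\<zeta> n x\<bar> powr p) \<longlonglongrightarrow> \<bar>indicator K x\<bar> powr p"
        using p_gt_1 by (intro tendsto_powr2 tendsto_const tendsto_rabs \<zeta>(6)) auto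
      then have "(\<lambda>n. m x * \<bar>\<zeta> n x\<bar> powr p) \<longlonglongrightarrow> m x * \<bar>indicator K x\<bar> powr p" by (rule tendsto_mult[OF tendsto_const])
      then show "(\<lambda>n. m x * \<bar>\<zeta> n x\<bar> powr p) \<longlonglongrightarrow> m x * indicator K x"
        using p_gt_1 by (cases "x \<in> K") auto
    qed
    show "AE x in M. norm (m x * \<bar>\<zeta> n x\<bar> powr p) \<le> \<bar>m x\<bar>" for n
    proof (rule AE_I2)
      fix x
      have "\<bar>\<zeta> n x\<bar> powr p \<le> 1" using powr_mono2[of p "\<bar>\<zeta> n x\<bar>" 1] \<zeta>(5)[of n x] p_gt_1 by simp
      then show "norm (m x * \<bar>\<zeta> n x\<bar> powr p) \<le> \<bar>m x\<bar>" by (simp add: abs_mult mult_right_le_one_le)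
    qed
  qed measurable
  then have "\<forall>\<^sub>F n in sequentially. mass m (\<zeta> n) > 0" using p0 by (intro order_tendstoD)
  then obtain k where "mass m (\<zeta> k) > 0" by (auto simp: eventually_sequentially)
  then show ?thesis using that[OF c[of k]] by blast
qed

text \<open>
  As \<open>m\<close> is merely integrable, convergence of \<open>\<zeta>\<^sub>n\<close> to \<open>u\<close> says nothing about \<open>\<integral> m |\<zeta>\<^sub>n|\<^sup>p\<close>.  The
  truncations \<open>T\<^sub>k(s) = (k + 1) arctan (s/(k + 1))\<close> cure this: they are bounded, they converge to
  \<open>s\<close> from below in modulus, and their slope is at most \<open>1\<close>, so they do not increase the energy.
\<close>

lemma C1c_quotient_approximation:
  assumes m: "integrable M m" and u: "u \<in> W01p \<Omega> p" and pos: "mass m u > 0" and e: "e > 0"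
  obtains \<phi> where "\<phi> \<in> C1c \<Omega>" "mass m \<phi> > mass m u - e"
    "energy \<phi> < (LINT x|M. norm (weak_gradient \<Omega> u x) powr p) + e"
proof -
  obtain \<zeta> where \<zeta>: "\<And>n. \<zeta> n \<in> C1c \<Omega>" "Lp_limit \<zeta> u" "Lp_limit (\<lambda>n. gradient (\<zeta> n)) (weak_gradient \<Omega> u)"
    "AE x in M. (\<lambda>n. \<zeta> n x) \<longlonglongrightarrow> u x"
    by (rule W01pE[OF u]) (rule that)
  note [measurable] = LpD(1)[OF W01p_Lp(1)[OF u]] borel_measurable_integrable[OF m]
    C1c_measurable(1)[OF \<zeta>(1)]
  define T where "T k s = real (Suc k) * arctan (s / real (Suc k))" for k s
  have Tc: "continuous_on UNIV (T k)" for k unfolding T_def by (intro continuous_intros) auto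
  have [measurable]: "T k \<in> borel_measurable borel" for k by (intro borel_measurable_continuous_onI Tc)
  have Td: "(T k has_real_derivative 1 / (1 + (s / real (Suc k))\<^sup>2)) (at s)" for k s
    unfolding T_def by (auto intro!: derivative_eq_intros simp: inverse_eq_divide)
  have Tle: "\<bar>T k s\<bar> \<le> \<bar>s\<bar>" for k s
  proof -
    have "\<bar>T k s\<bar> = real (Suc k) * \<bar>arctan (s / real (Suc k))\<bar>" by (simp add: T_def abs_mult)
    also have "\<dots> \<le> real (Suc k) * \<bar>s / real (Suc k)\<bar>" by (intro mult_left_mono abs_arctan_le) auto
    finally show ?thesis by (simp add: abs_divide)
  qed
  have Tb: "\<bar>T k s\<bar> \<le> real (Suc k) * 2" for k s
  proof -
    have "\<bar>arctan (s / real (Suc k))\<bar> \<le> 2" using arctan_bounded[of "s / real (Suc k)"] pi_half_less_two by linarith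
    then show ?thesis unfolding T_def abs_mult by (intro mult_mono) auto
  qed
  have Tlim: "(\<lambda>k. T k s) \<longlonglongrightarrow> s" for s
  proof -
    have "((\<lambda>h. (arctan (0 + h * s) - arctan 0) / h) \<longlongrightarrow> s) (at 0)"
    proof -
      have "((\<lambda>h. arctan (h * s)) has_real_derivative s) (at 0)"
        by (auto intro!: derivative_eq_intros)
      then show ?thesis by (simp add: has_field_derivative_iff)
    qed
    moreover have "filterlim (\<lambda>k. inverse (real (Suc k))) (at 0) sequentially"
      using LIMSEQ_inverse_real_of_nat by (auto simp: filterlim_at)
    ultimately have "(\<lambda>k. (arctan (0 + inverse (real (Suc k)) * s) - arctan 0) / inverse (real (Suc k))) \<longlonglongrightarrow> s"
      by (rule filterlim_compose)
    then show ?thesis by (simp add: T_def divide_inverse mult.commute)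
  qed
  \<comment> \<open>A positive integral is not the default value \<open>0\<close> of a function that is not integrable.\<close>
  have mu: "integrable M (\<lambda>x. m x * \<bar>u x\<bar> powr p)"
    using pos not_integrable_integral_eq by fastforce
  have "(\<lambda>k. LINT x|M. m x * \<bar>T k (u x)\<bar> powr p) \<longlonglongrightarrow> mass m u"
  proof (rule integral_dominated_convergence)
    show "integrable M (\<lambda>x. \<bar>m x * \<bar>u x\<bar> powr p\<bar>)" using mu by (rule integrable_abs)
    show "AE x in M. (\<lambda>k. m x * \<bar>T k (u x)\<bar> powr p) \<longlonglongrightarrow> m x * \<bar>u x\<bar> powr p"
      using p_gt_1 by (intro AE_I2 tendsto_mult tendsto_const tendsto_powr2 tendsto_rabs Tlim) auto
    show "AE x in M. norm (m x * \<bar>T k (u x)\<bar> powr p) \<le> \<bar>m x * \<bar>u x\<bar> powr p\<bar>" for k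
      using p_gt_1 Tle by (intro AE_I2) (auto simp: abs_mult intro!: mult_left_mono powr_mono2)
  qed measurable
  then have "\<forall>\<^sub>F k in sequentially. mass m u - e < (LINT x|M. m x * \<bar>T k (u x)\<bar> powr p)"
    using e by (intro order_tendstoD) auto
  then obtain k where k: "mass m u - e < (LINT x|M. m x * \<bar>T k (u x)\<bar> powr p)"
    by (auto simp: eventually_sequentially)
  have "(\<lambda>n. LINT x|M. m x * \<bar>T k (\<zeta> n x)\<bar> powr p) \<longlonglongrightarrow> (LINT x|M. m x * \<bar>T k (u x)\<bar> powr p)"
  proof (rule integral_dominated_convergence)
    show "integrable M (\<lambda>x. \<bar>m x\<bar> * (real (Suc k) * 2) powr p)" using m by simp
    show "AE x in M. (\<lambda>n. m x * \<bar>T k (\<zeta> n x)\<bar> powr p) \<longlonglongrightarrow> m x * \<bar>T k (u x)\<bar> powr p"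
      using \<zeta>(4)
    proof eventually_elim
      case (elim x)
      have "(\<lambda>n. T k (\<zeta> n x)) \<longlonglongrightarrow> T k (u x)" by (rule continuous_on_tendsto_compose[OF Tc elim]) auto
      then show ?case using p_gt_1 by (intro tendsto_mult tendsto_const tendsto_powr2 tendsto_rabs) auto
    qed
    show "AE x in M. norm (m x * \<bar>T k (\<zeta> n x)\<bar> powr p) \<le> \<bar>m x\<bar> * (real (Suc k) * 2) powr p" for n
      using p_gt_1 Tb by (intro AE_I2) (auto simp: abs_mult simp del: of_nat_Suc intro!: mult_left_mono powr_mono2)
  qed measurable
  then have "\<forall>\<^sub>F n in sequentially. mass m u - e < (LINT x|M. m x * \<bar>T k (\<zeta> n x)\<bar> powr p)"
    using k by (intro order_tendstoD)
  moreover have "\<forall>\<^sub>F n in sequentially. energy (\<zeta> n) < (LINT x|M. norm (weak_gradient \<Omega> u x) powr p) + e"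
    by (rule Lp_limit_norm_le[OF \<zeta>(3) e])
  ultimately have "\<forall>\<^sub>F n in sequentially. mass m u - e < (LINT x|M. m x * \<bar>T k (\<zeta> n x)\<bar> powr p)
      \<and> energy (\<zeta> n) < (LINT x|M. norm (weak_gradient \<Omega> u x) powr p) + e"
    by eventually_elim auto
  then obtain n where n: "mass m u - e < (LINT x|M. m x * \<bar>T k (\<zeta> n x)\<bar> powr p)"
      "energy (\<zeta> n) < (LINT x|M. norm (weak_gradient \<Omega> u x) powr p) + e"
    by (auto simp: eventually_sequentially)
  define \<phi> where "\<phi> x = T k (\<zeta> n x)" for x
  have cT: "continuous_on (range (\<zeta> n)) (\<lambda>s. 1 / (1 + (s / real (Suc k))\<^sup>2))"
    by (intro continuous_intros) (auto simp: add_nonneg_eq_0_iff)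
  have \<phi>: "\<phi> \<in> C1c \<Omega>" unfolding \<phi>_def by (rule C1c_compose[OF \<zeta>(1) Td cT]) (simp add: T_def)
  have g\<phi>: "gradient \<phi> = (\<lambda>x. (1 / (1 + (\<zeta> n x / real (Suc k))\<^sup>2)) *\<^sub>R gradient (\<zeta> n) x)"
    unfolding \<phi>_def[abs_def] by (rule C1_compose(2)[OF C1c_imp_C1[OF \<zeta>(1)] Td cT])
  have "energy \<phi> \<le> energy (\<zeta> n)"
  proof (rule integral_mono[OF LpD(2)[OF C1c_Lp(2)[OF \<phi>]] LpD(2)[OF C1c_Lp(2)[OF \<zeta>(1)]]])
    fix x
    have "1 / (1 + (\<zeta> n x / real (Suc k))\<^sup>2) \<le> 1" by (simp add: divide_le_eq_1 add_pos_nonneg)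
    then have "norm (gradient \<phi> x) \<le> 1 * norm (gradient (\<zeta> n) x)"
      unfolding g\<phi> norm_scaleR by (intro mult_right_mono) (auto simp: add_nonneg_nonneg)
    then show "norm (gradient \<phi> x) powr p \<le> norm (gradient (\<zeta> n) x) powr p"
      using p_gt_1 by (intro powr_mono2) auto
  qed
  then show ?thesis using that[OF \<phi>] n by (simp add: \<phi>_def)
qed

text \<open>
  Dividing by the \<open>p\<close>-th root of the mass normalises it to \<open>1\<close>, since mass and energy are homogeneous
  of degree \<open>p\<close>.
\<close>

lemma lambda1_approximation:
  assumes m: "integrable M m" and pos: "\<not> (AE x in M. max (m x) 0 = 0)" and \<tau>: "\<tau> > 0"
  obtains \<phi> where "\<phi> \<in> C1c \<Omega>" "mass m \<phi> = 1"
    "energy \<phi> < lambda1 \<Omega> p m + \<tau>"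
proof -
  define S where "S = {(LINT x|M. norm (weak_gradient \<Omega> u x) powr p) / mass m u | u.
          u \<in> W01p \<Omega> p \<and> mass m u > 0}"
  have l: "lambda1 \<Omega> p m = Inf S" by (simp add: lambda1_def S_def)
  obtain \<phi>0 where "\<phi>0 \<in> C1c \<Omega>" "mass m \<phi>0 > 0"
    using exists_positive_mass[OF m pos] by blast
  then have "S \<noteq> {}" using C1c_W01p(1) unfolding S_def by blast
  then obtain s where s: "s \<in> S" "s < lambda1 \<Omega> p m + \<tau>"
    using cInf_lessD[of S "lambda1 \<Omega> p m + \<tau>"] \<tau> l by auto
  then obtain u where u: "u \<in> W01p \<Omega> p" and D0: "mass m u > 0"
    and su: "s = (LINT x|M. norm (weak_gradient \<Omega> u x) powr p) / mass m u"
    unfolding S_def by blast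
  define D where "D = mass m u"
  define N where "N = (LINT x|M. norm (weak_gradient \<Omega> u x) powr p)"
  have D: "D > 0" and N: "N \<ge> 0" using D0 by (auto simp: D_def N_def)
  define L where "L = lambda1 \<Omega> p m + \<tau>"
  have sL: "N / D < L" using s(2) su by (simp add: N_def D_def L_def)
  have L: "L > 0" using sL D N by (meson divide_nonneg_pos le_less_trans)
  \<comment> \<open>Small enough for \<open>N + e < L (D - e)\<close>, so that the quotient stays below \<open>L\<close>.\<close>
  define e where "e = min (D / 2) ((L * D - N) / (2 * (1 + L)))"
  have LD: "L * D - N > 0" using sL D by (simp add: field_simps)
  have e: "e > 0" using D LD L by (simp add: e_def)
  obtain \<phi> where \<phi>: "\<phi> \<in> C1c \<Omega>" "mass m \<phi> > D - e" "energy \<phi> < N + e"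
    using C1c_quotient_approximation[OF m u D0 e] unfolding D_def N_def by blast
  define d where "d = mass m \<phi>"
  have eD: "e \<le> D / 2" "e * (1 + L) \<le> (L * D - N) / 2"
  proof -
    show "e \<le> D / 2" unfolding e_def by (rule min.cobounded1)
    have "e * (1 + L) \<le> ((L * D - N) / (2 * (1 + L))) * (1 + L)" using L by (intro mult_right_mono) (auto simp: e_def)
    also have "\<dots> = (L * D - N) / 2" using L by (simp add: field_simps)
    finally show "e * (1 + L) \<le> (L * D - N) / 2" .
  qed
  have d: "d > 0" "d > D - e" using \<phi>(2) eD(1) D by (auto simp: d_def)
  have "N + e < L * (D - e)" using eD(2) LD by (simp add: algebra_simps)
  also have "\<dots> < L * d" using d L by simp
  finally have lt: "energy \<phi> < L * d" using \<phi>(3) by linarith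
  define c where "c = d powr (- (1 / p))"
  have c: "c > 0" "c powr p = 1 / d"
  proof -
    show "c > 0" using d by (simp add: c_def)
    have "c powr p = d powr (- 1)" unfolding c_def powr_powr using p_gt_1 by simp
    also have "\<dots> = 1 / d" using d by (simp only: powr_minus_divide powr_one)
    finally show "c powr p = 1 / d" .
  qed
  show ?thesis
  proof (rule that[of "\<lambda>x. c * \<phi> x"])
    show "(\<lambda>x. c * \<phi> x) \<in> C1c \<Omega>" by (rule C1c_scale[OF \<phi>(1)])
    have "(LINT x|M. m x * \<bar>c * \<phi> x\<bar> powr p) = (LINT x|M. (1 / d) * (m x * \<bar>\<phi> x\<bar> powr p))"
      using c by (simp add: abs_mult powr_mult mult_ac)
    also have "\<dots> = (1 / d) * d" unfolding d_def by (rule integral_mult_right_zero)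
    finally show "(LINT x|M. m x * \<bar>c * \<phi> x\<bar> powr p) = 1" using d by simp
    have "(LINT x|M. norm (gradient (\<lambda>x. c * \<phi> x) x) powr p) = (LINT x|M. (1 / d) * norm (gradient \<phi> x) powr p)"
      using c by (simp add: C1c_scale(2)[OF \<phi>(1)] powr_mult)
    also have "\<dots> = (1 / d) * energy \<phi>" by (rule integral_mult_right_zero)
    also have "\<dots> < L" using lt d by (simp add: field_simps)
    finally show "(LINT x|M. norm (gradient (\<lambda>x. c * \<phi> x) x) powr p) < lambda1 \<Omega> p m + \<tau>" by (simp add: L_def)
  qed
qed

end

section \<open>Near-minimizers of the quotient\<close>

text \<open>
  The vector \<open>G\<close> is the gradient of \<open>D\<^sup>1\<^sup>/\<^sup>p\<close> when \<open>X\<close> and \<open>Y\<close> are the gradients of the functions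
  with values \<open>s\<close> and \<open>t\<close>.  The bound by the sum of the energies is Hoelder's inequality
  for two points; where \<open>t\<close> is constantly \<open>1\<close>, there is a gain of order
  \<open>\<tau> |X|\<^sup>p / (|s|\<^sup>p + \<tau>)\<close>.
\<close>

lemma hidden_convexity:
  fixes X Y :: "'a::real_inner" and s t p \<tau> \<delta> :: real
  assumes p: "p > 1" and \<tau>: "\<tau> \<ge> 0" and \<delta>: "\<delta> > 0"
  defines "D \<equiv> \<bar>s\<bar> powr p + \<tau> * \<bar>t\<bar> powr p + \<delta>"
  defines "G \<equiv> (1 / p * D powr (1 / p - 1)) *\<^sub>R ((p * (\<bar>s\<bar> powr (p - 1) * sgn s)) *\<^sub>R X + \<tau> *\<^sub>R ((p * (\<bar>t\<bar> powr (p - 1) * sgn t)) *\<^sub>R Y))"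
  shows "norm G powr p \<le> norm X powr p + \<tau> * norm Y powr p"
    and "\<tau> > 0 \<Longrightarrow> t = 1 \<Longrightarrow> Y = 0 \<Longrightarrow> norm G powr p \<le> norm X powr p - min 1 (p - 1) * \<tau> * (norm X powr p / (\<bar>s\<bar> powr p + \<tau>))"
proof -
  have D: "D > 0" using \<tau> \<delta> by (simp add: D_def add_nonneg_pos)
  define y where "y = \<bar>s\<bar> powr (p - 1) * norm X + \<tau> * (\<bar>t\<bar> powr (p - 1) * norm Y)"
  have y0: "y \<ge> 0" using \<tau> by (simp add: y_def)
  have sg: "\<bar>sgn z\<bar> \<le> 1" for z :: real by (simp add: sgn_real_def)
  have "norm ((p * (\<bar>s\<bar> powr (p - 1) * sgn s)) *\<^sub>R X + \<tau> *\<^sub>R ((p * (\<bar>t\<bar> powr (p - 1) * sgn t)) *\<^sub>R Y)) \<le> p * y"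
  proof -
    have 1: "norm ((p * (\<bar>z\<bar> powr (p - 1) * sgn z)) *\<^sub>R Z) \<le> p * (\<bar>z\<bar> powr (p - 1) * norm Z)" for z and Z :: 'a
    proof -
      have "norm ((p * (\<bar>z\<bar> powr (p - 1) * sgn z)) *\<^sub>R Z) = (p * (\<bar>z\<bar> powr (p - 1) * norm Z)) * \<bar>sgn z\<bar>"
        using p by (simp add: abs_mult)
      also have "\<dots> \<le> (p * (\<bar>z\<bar> powr (p - 1) * norm Z)) * 1"
        using p by (intro mult_left_mono sg) auto
      finally show ?thesis by simp
    qed
    have "norm ((p * (\<bar>s\<bar> powr (p - 1) * sgn s)) *\<^sub>R X + \<tau> *\<^sub>R ((p * (\<bar>t\<bar> powr (p - 1) * sgn t)) *\<^sub>R Y))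
       \<le> norm ((p * (\<bar>s\<bar> powr (p - 1) * sgn s)) *\<^sub>R X) + norm (\<tau> *\<^sub>R ((p * (\<bar>t\<bar> powr (p - 1) * sgn t)) *\<^sub>R Y))"
      by (rule norm_triangle_ineq)
    also have "norm (\<tau> *\<^sub>R ((p * (\<bar>t\<bar> powr (p - 1) * sgn t)) *\<^sub>R Y)) = \<tau> * norm ((p * (\<bar>t\<bar> powr (p - 1) * sgn t)) *\<^sub>R Y)"
      by (subst norm_scaleR) (simp only: abs_of_nonneg[OF \<tau>])
    also have "norm ((p * (\<bar>s\<bar> powr (p - 1) * sgn s)) *\<^sub>R X) + \<tau> * norm ((p * (\<bar>t\<bar> powr (p - 1) * sgn t)) *\<^sub>R Y)
       \<le> p * (\<bar>s\<bar> powr (p - 1) * norm X) + \<tau> * (p * (\<bar>t\<bar> powr (p - 1) * norm Y))"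
      by (intro add_mono mult_left_mono 1 \<tau>)
    also have "\<dots> = p * y" by (simp add: y_def algebra_simps)
    finally show ?thesis .
  qed
  moreover have c: "0 \<le> 1 / p * D powr (1 / p - 1)" using p by simp
  ultimately have "norm G \<le> (1 / p * D powr (1 / p - 1)) * (p * y)"
    unfolding G_def norm_scaleR abs_of_nonneg[OF c] by (intro mult_left_mono)
  also have "\<dots> = D powr (1 / p - 1) * y" using p by simp
  finally have "norm G powr p \<le> (D powr (1 / p - 1) * y) powr p" using p by (intro powr_mono2) auto
  also have "\<dots> = D powr (1 - p) * y powr p"
  proof -
    have "(1 / p - 1) * p = 1 - p" using p by (simp add: field_simps)
    then show ?thesis using y0 by (simp add: powr_mult powr_powr)
  qed
  finally have G: "norm G powr p \<le> D powr (1 - p) * y powr p" .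
  have D1: "D powr (1 - p) * D powr (p - 1) = 1" using D by (simp add: powr_add[symmetric])
  have "y powr p \<le> D powr (p - 1) * (norm X powr p + \<tau> * norm Y powr p)"
    unfolding y_def by (rule discrete_Hoelder) (use p \<tau> \<delta> D in \<open>auto simp: D_def\<close>)
  then have "D powr (1 - p) * y powr p \<le> D powr (1 - p) * (D powr (p - 1) * (norm X powr p + \<tau> * norm Y powr p))"
    by (rule mult_left_mono) simp
  also have "\<dots> = norm X powr p + \<tau> * norm Y powr p" using D1 by (simp add: mult.assoc[symmetric])
  finally show "norm G powr p \<le> norm X powr p + \<tau> * norm Y powr p" using G by linarith
  show "norm G powr p \<le> norm X powr p - min 1 (p - 1) * \<tau> * (norm X powr p / (\<bar>s\<bar> powr p + \<tau>))"
    if \<tau>0: "\<tau> > 0" and t: "t = 1" "Y = 0"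
  proof -
    define P where "P = \<bar>s\<bar> powr p"
    have P: "P \<ge> 0" "P + \<tau> > 0" "P + \<tau> \<le> D" using \<tau>0 \<delta> t by (auto simp: P_def D_def add_nonneg_pos)
    have "y powr p = (\<bar>s\<bar> powr (p - 1)) powr p * norm X powr p" using t by (simp add: y_def powr_mult)
    also have "(\<bar>s\<bar> powr (p - 1)) powr p = P powr (p - 1)" by (simp add: P_def powr_powr mult.commute)
    finally have yp: "y powr p = P powr (p - 1) * norm X powr p" .
    have "D powr (1 - p) * P powr (p - 1) = (P / D) powr (p - 1)"
      unfolding powr_divide using powr_minus[of D "p - 1"] by (simp add: divide_inverse mult.commute)
    also have "\<dots> \<le> (1 - \<tau> / (P + \<tau>)) powr (p - 1)"
    proof (rule powr_mono2)
      have "P / D \<le> P / (P + \<tau>)" using P by (intro divide_left_mono) auto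
      also have "\<dots> = 1 - \<tau> / (P + \<tau>)" using P by (simp add: field_simps)
      finally show "P / D \<le> 1 - \<tau> / (P + \<tau>)" .
    qed (use p P D in auto)
    also have "\<dots> \<le> 1 - min 1 (p - 1) * (\<tau> / (P + \<tau>))"
      by (rule one_minus_powr_le) (use P \<tau>0 p in auto)
    finally have "D powr (1 - p) * P powr (p - 1) * norm X powr p \<le> (1 - min 1 (p - 1) * (\<tau> / (P + \<tau>))) * norm X powr p"
      by (rule mult_right_mono) simp
    then show ?thesis using G unfolding yp P_def[symmetric] by (simp add: left_diff_distrib mult.assoc)
  qed
qed

context bounded_open_set begin

text \<open>
  The weight is replaced by a Borel function that agrees with it almost everywhere, extended by \<open>0\<close>.
\<close>

lemma trace_inequality_M:
  assumes \<gamma>: "\<gamma> \<ge> 1" "\<gamma> > DIM('a) / p"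
  obtains C where "C > 0"
    "\<And>\<phi> h \<kappa>. \<phi> \<in> C1c \<Omega> \<Longrightarrow> h \<in> borel_measurable M \<Longrightarrow> \<kappa> > 0 \<Longrightarrow> integrable M (\<lambda>x. \<bar>h x\<bar> powr \<gamma>) \<Longrightarrow>
      (LINT x|M. \<bar>h x\<bar> powr \<gamma>) \<le> \<kappa> powr \<gamma> \<Longrightarrow>
      (LINT x|M. \<bar>h x\<bar> * \<bar>\<phi> x\<bar> powr p) \<le> C * \<kappa> * energy \<phi>"
proof (rule trace_inequality[OF bounded_domain p_gt_1 \<gamma>])
  fix C :: real
  assume C: "C > 0"
    "\<And>\<phi> w \<kappa>. \<phi> \<in> C1c \<Omega> \<Longrightarrow> w \<in> borel_measurable borel \<Longrightarrow> (\<And>x. w x \<ge> 0) \<Longrightarrow> \<kappa> > 0 \<Longrightarrow>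
       (\<integral>\<^sup>+x. ennreal (w x powr \<gamma>) \<partial>lborel) \<le> ennreal (\<kappa> powr \<gamma>) \<Longrightarrow>
       (\<integral>\<^sup>+x. ennreal (w x * \<bar>\<phi> x\<bar> powr p) \<partial>lborel) \<le> ennreal (C * \<kappa>) * (\<integral>\<^sup>+x. ennreal (norm (gradient \<phi> x) powr p) \<partial>lborel)"
  show ?thesis
  proof (rule that[OF C(1)])
    fix \<phi> h and \<kappa> :: real
    assume \<phi>: "\<phi> \<in> C1c \<Omega>" and h[measurable]: "h \<in> borel_measurable M" and \<kappa>: "\<kappa> > 0"
      and hi: "integrable M (\<lambda>x. \<bar>h x\<bar> powr \<gamma>)" and le: "(LINT x|M. \<bar>h x\<bar> powr \<gamma>) \<le> \<kappa> powr \<gamma>"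
    obtain K where K: "K \<subseteq> \<Omega>" "\<And>x. x \<notin> K \<Longrightarrow> \<phi> x = 0" "\<And>x. x \<notin> K \<Longrightarrow> gradient \<phi> x = 0" using C1c_support[OF \<phi>] by metis
    note [measurable] = C1c_measurable(1)[OF \<phi>]
    have "(\<lambda>x. if x \<in> \<Omega> then h x else 0) \<in> borel_measurable lebesgue"
      by (rule borel_measurable_if_I[OF h]) simp
    then obtain w' where w'[measurable]: "w' \<in> borel_measurable borel" and ae: "AE x in lborel. (if x \<in> \<Omega> then h x else 0) = w' x"
      using completion_ex_borel_measurable_real[of "\<lambda>x. if x \<in> \<Omega> then h x else 0" lborel] by auto
    define w where "w x = \<bar>w' x\<bar>" for x
    have [measurable]: "w \<in> borel_measurable borel" unfolding w_def by measurable
    have "(\<integral>\<^sup>+x. ennreal (w x powr \<gamma>) \<partial>lborel) = (\<integral>\<^sup>+x. ennreal (\<bar>if x \<in> \<Omega> then h x else 0\<bar> powr \<gamma>) \<partial>lborel)"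
      by (rule nn_integral_cong_AE) (use ae in \<open>eventually_elim, auto simp: w_def\<close>)
    also have "\<dots> = (\<integral>\<^sup>+x. ennreal (\<bar>if x \<in> \<Omega> then h x else 0\<bar> powr \<gamma>) \<partial>M)"
      by (rule nn_integral_M_eq_lborel[symmetric]) (use \<gamma> in auto)
    also have "\<dots> = (\<integral>\<^sup>+x. ennreal (\<bar>h x\<bar> powr \<gamma>) \<partial>M)"
      by (rule nn_integral_cong) auto
    also have "\<dots> = ennreal (LINT x|M. \<bar>h x\<bar> powr \<gamma>)" by (rule nn_integral_eq_integral[OF hi]) simp
    finally have "(\<integral>\<^sup>+x. ennreal (w x powr \<gamma>) \<partial>lborel) \<le> ennreal (\<kappa> powr \<gamma>)" using le by (simp add: ennreal_leI)
    from C(2)[OF \<phi> _ _ \<kappa> this]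
    have "(\<integral>\<^sup>+x. ennreal (w x * \<bar>\<phi> x\<bar> powr p) \<partial>lborel) \<le> ennreal (C * \<kappa>) * (\<integral>\<^sup>+x. ennreal (norm (gradient \<phi> x) powr p) \<partial>lborel)"
      by (simp add: w_def)
    also have "(\<integral>\<^sup>+x. ennreal (norm (gradient \<phi> x) powr p) \<partial>lborel) = (\<integral>\<^sup>+x. ennreal (norm (gradient \<phi> x) powr p) \<partial>M)"
    proof (rule nn_integral_M_eq_lborel[symmetric])
      fix x assume "x \<notin> \<Omega>"
      then have "gradient \<phi> x = 0" using K by blast
      then show "ennreal (norm (gradient \<phi> x) powr p) = 0" by simp
    qed
    also have "\<dots> = ennreal (energy \<phi>)"
      by (rule nn_integral_eq_integral[OF LpD(2)[OF C1c_Lp(2)[OF \<phi>]]]) simp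
    also have "(\<integral>\<^sup>+x. ennreal (w x * \<bar>\<phi> x\<bar> powr p) \<partial>lborel) = (\<integral>\<^sup>+x. ennreal (\<bar>if x \<in> \<Omega> then h x else 0\<bar> * \<bar>\<phi> x\<bar> powr p) \<partial>lborel)"
      by (rule nn_integral_cong_AE) (use ae in \<open>eventually_elim, auto simp: w_def\<close>)
    also have "\<dots> = (\<integral>\<^sup>+x. ennreal (\<bar>if x \<in> \<Omega> then h x else 0\<bar> * \<bar>\<phi> x\<bar> powr p) \<partial>M)"
      by (rule nn_integral_M_eq_lborel[symmetric]) auto
    also have "\<dots> = (\<integral>\<^sup>+x. ennreal (\<bar>h x\<bar> * \<bar>\<phi> x\<bar> powr p) \<partial>M)"
      by (rule nn_integral_cong) auto
    finally have fin: "(\<integral>\<^sup>+x. ennreal (\<bar>h x\<bar> * \<bar>\<phi> x\<bar> powr p) \<partial>M) \<le> ennreal (C * \<kappa>) * ennreal (energy \<phi>)" .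
    have nn: "energy \<phi> \<ge> 0" "C * \<kappa> \<ge> 0" using C(1) \<kappa> by auto
    have "(LINT x|M. \<bar>h x\<bar> * \<bar>\<phi> x\<bar> powr p) = enn2real (\<integral>\<^sup>+x. ennreal (\<bar>h x\<bar> * \<bar>\<phi> x\<bar> powr p) \<partial>M)"
      by (rule integral_eq_nn_integral) auto
    also have "\<dots> \<le> C * \<kappa> * energy \<phi>"
    proof (rule enn2real_leI)
      show "0 \<le> C * \<kappa> * energy \<phi>" using nn by simp
      show "(\<integral>\<^sup>+x. ennreal (\<bar>h x\<bar> * \<bar>\<phi> x\<bar> powr p) \<partial>M) \<le> ennreal (C * \<kappa> * energy \<phi>)"
        using fin nn by (simp only: ennreal_mult)
    qed
    finally show "(LINT x|M. \<bar>h x\<bar> * \<bar>\<phi> x\<bar> powr p) \<le> C * \<kappa> * energy \<phi>" .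
  qed
qed

text \<open>
  Compare \<open>\<phi>\<close> with \<open>(|\<phi>|\<^sup>p + \<tau> |\<psi>|\<^sup>p)\<^sup>1\<^sup>/\<^sup>p\<close>.  The masses add up exactly, while the energy is at most
  \<open>energy \<phi> + \<tau> energy \<psi>\<close> minus \<open>\<tau>\<close> times a multiple of the integral in question.  As the
  difference of energy and \<open>lam\<close> times mass is nonnegative for the competitor and at most \<open>\<tau>\<close> for
  \<open>\<phi>\<close>, a factor \<open>\<tau>\<close> cancels.
\<close>

lemma near_minimizer_log_estimate:
  assumes m: "integrable M m" and Q0: "\<And>\<phi>. \<phi> \<in> C1c \<Omega> \<Longrightarrow> lam * mass m \<phi> \<le> energy \<phi>"
    and zr: "ball z r \<subseteq> \<Omega>" and \<psi>: "\<psi> \<in> C1c \<Omega>" "\<And>x. x \<in> ball z r \<Longrightarrow> \<psi> x = 1"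
    and \<phi>: "\<phi> \<in> C1c \<Omega>" and \<tau>: "\<tau> > 0"
    and near: "energy \<phi> - lam * mass m \<phi> \<le> \<tau>"
  shows "integrable M (\<lambda>x. indicator (ball z r) x * (norm (gradient \<phi> x) powr p / (\<bar>\<phi> x\<bar> powr p + \<tau>)))"
    and "(LINT x|M. indicator (ball z r) x * (norm (gradient \<phi> x) powr p / (\<bar>\<phi> x\<bar> powr p + \<tau>)))
      \<le> (1 + (energy \<psi> - lam * mass m \<psi>)) / min 1 (p - 1)"
proof -
  let ?B = "ball z r"
  note C = C1c_imp_C1[OF \<phi>] C1c_imp_C1[OF \<psi>(1)]
  note [measurable] = continuous_measurable_M[OF C1_continuous[OF C(1)]] continuous_measurable_M[OF C1_continuous[OF C(2)]]
    continuous_measurable_M[OF C1_continuous_gradient[OF C(1)]] borel_measurable_integrable[OF m]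
  have [measurable]: "?B \<in> sets M" using zr by (intro sets_M_subset) auto
  define I where "I x = indicator ?B x * (norm (gradient \<phi> x) powr p / (\<bar>\<phi> x\<bar> powr p + \<tau>))" for x
  note gi = LpD(2)[OF C1c_Lp(2)[OF \<phi>]] LpD(2)[OF C1c_Lp(2)[OF \<psi>(1)]]
  have Ii: "integrable M I"
  proof (rule Bochner_Integration.integrable_bound)
    show "integrable M (\<lambda>x. (1 / \<tau>) * norm (gradient \<phi> x) powr p)" using gi(1) by simp
    show "AE x in M. norm (I x) \<le> norm ((1 / \<tau>) * norm (gradient \<phi> x) powr p)"
    proof (rule AE_I2)
      fix x
      have "norm (gradient \<phi> x) powr p / (\<bar>\<phi> x\<bar> powr p + \<tau>) \<le> norm (gradient \<phi> x) powr p / \<tau>"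
        using \<tau> by (intro divide_left_mono mult_pos_pos add_nonneg_pos) auto
      then show "norm (I x) \<le> norm ((1 / \<tau>) * norm (gradient \<phi> x) powr p)"
        using \<tau> by (auto simp: I_def indicator_def abs_mult)
    qed
  qed (unfold I_def, measurable)
  then show "integrable M (\<lambda>x. indicator ?B x * (norm (gradient \<phi> x) powr p / (\<bar>\<phi> x\<bar> powr p + \<tau>)))"
    unfolding I_def .
  define P where "P x = \<bar>\<phi> x\<bar> powr p + \<tau> * \<bar>\<psi> x\<bar> powr p" for x
  have P0: "P x \<ge> 0" for x using \<tau> by (simp add: P_def)
  have Pc: "P \<in> C1c \<Omega>" and gP: "gradient P = (\<lambda>x. (p * (\<bar>\<phi> x\<bar> powr (p - 1) * sgn (\<phi> x))) *\<^sub>R gradient \<phi> x + \<tau> *\<^sub>R ((p * (\<bar>\<psi> x\<bar> powr (p - 1) * sgn (\<psi> x))) *\<^sub>R gradient \<psi> x))"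
  proof -
    note a = abs_powr_C1c[OF \<phi> p_gt_1] abs_powr_C1c[OF \<psi>(1) p_gt_1]
    note b = C1c_scale[OF a(3), of \<tau>]
    show "P \<in> C1c \<Omega>" unfolding P_def[abs_def] by (rule C1c_add[OF a(1) b(1)])
    show "gradient P = (\<lambda>x. (p * (\<bar>\<phi> x\<bar> powr (p - 1) * sgn (\<phi> x))) *\<^sub>R gradient \<phi> x + \<tau> *\<^sub>R ((p * (\<bar>\<psi> x\<bar> powr (p - 1) * sgn (\<psi> x))) *\<^sub>R gradient \<psi> x))"
      unfolding P_def[abs_def] C1_add(2)[OF C1c_imp_C1[OF a(1)] C1c_imp_C1[OF b(1)]] a(2) b(2) a(4) ..
  qed
  have g\<psi>0: "gradient \<psi> x = 0" if "x \<in> ?B" for x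
  proof (rule gradient_eqI)
    have "((\<lambda>x. 1) has_derivative (\<lambda>h. 0 \<bullet> h)) (at x)" by simp
    then show "(\<psi> has_derivative (\<lambda>h. 0 \<bullet> h)) (at x)"
      by (rule has_derivative_transform_within_open[where s="?B"]) (use \<psi>(2) that in auto)
  qed
  define d where "d n = 1 / real (Suc n)" for n
  have d: "d n > 0" "d n \<le> 1" for n by (auto simp: d_def)
  have dl: "d \<longlonglongrightarrow> 0" unfolding d_def[abs_def] using LIMSEQ_Suc[OF lim_const_over_n[of 1]] by simp
  define c where "c = min 1 (p - 1)"
  have c: "c > 0" using p_gt_1 by (simp add: c_def)
  \<comment> \<open>The shift by \<open>d\<^sub>n\<close> makes the \<open>p\<close>-th root differentiable, and the subtraction restores compact
    support.\<close>
  define \<Phi> where "\<Phi> n x = (P x + d n) powr (1 / p) - d n powr (1 / p)" for n x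
  define GQ where "GQ = energy \<phi> + \<tau> * energy \<psi> - c * \<tau> * (LINT x|M. I x)"
  have \<Phi>c: "\<Phi> n \<in> C1c \<Omega>" and step: "lam * mass m (\<Phi> n) \<le> GQ" for n
  proof -
    have der: "((\<lambda>t. (t + d n) powr (1 / p) - d n powr (1 / p)) has_real_derivative (1 / p * (P x + d n) powr (1 / p - 1))) (at (P x))" for x
      using P0[of x] d(1)[of n] by (auto intro!: derivative_eq_intros simp: add_nonneg_pos)
    have cont: "continuous_on (range P) (\<lambda>t. 1 / p * (t + d n) powr (1 / p - 1))"
    proof (intro continuous_intros)
      show "\<forall>t\<in>range P. t + d n \<noteq> 0" using P0 d(1)[of n] by (metis add_nonneg_pos less_irrefl rangeE)
    qed
    show \<Phi>c: "\<Phi> n \<in> C1c \<Omega>" unfolding \<Phi>_def by (rule C1c_compose[OF Pc der cont]) simp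
    have g\<Phi>: "gradient (\<Phi> n) = (\<lambda>x. (1 / p * (P x + d n) powr (1 / p - 1)) *\<^sub>R gradient P x)"
      unfolding \<Phi>_def[abs_def] by (rule C1_compose(2)[OF C1c_imp_C1[OF Pc] der cont])
    have pw: "norm (gradient (\<Phi> n) x) powr p \<le> norm (gradient \<phi> x) powr p + \<tau> * norm (gradient \<psi> x) powr p - c * \<tau> * I x" for x
    proof (cases "x \<in> ?B")
      case True
      have "norm (gradient (\<Phi> n) x) powr p \<le> norm (gradient \<phi> x) powr p - min 1 (p - 1) * \<tau> * (norm (gradient \<phi> x) powr p / (\<bar>\<phi> x\<bar> powr p + \<tau>))"
        unfolding g\<Phi> gP P_def
        by (rule hidden_convexity(2)) (use p_gt_1 \<tau> d \<psi>(2)[OF True] g\<psi>0[OF True] in auto)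
      then show ?thesis using True g\<psi>0[OF True] by (simp add: I_def c_def)
    next
      case False
      have "norm (gradient (\<Phi> n) x) powr p \<le> norm (gradient \<phi> x) powr p + \<tau> * norm (gradient \<psi> x) powr p"
        unfolding g\<Phi> gP P_def
        by (rule hidden_convexity(1)) (use p_gt_1 \<tau> d in auto)
      then show ?thesis using False by (simp add: I_def)
    qed
    have "lam * mass m (\<Phi> n) \<le> energy (\<Phi> n)" by (rule Q0[OF \<Phi>c])
    also have "\<dots> \<le> (LINT x|M. norm (gradient \<phi> x) powr p + \<tau> * norm (gradient \<psi> x) powr p - c * \<tau> * I x)"
      by (rule integral_mono[OF LpD(2)[OF C1c_Lp(2)[OF \<Phi>c]] _ pw]) (use gi Ii in auto)
    also have "\<dots> = GQ" unfolding GQ_def using gi Ii by simp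
    finally show "lam * mass m (\<Phi> n) \<le> GQ" .
  qed
  obtain B where B: "B > 0" "\<And>x. \<bar>P x\<bar> \<le> B" using C1c_bounded[OF Pc] by blast
  note [measurable] = C1c_measurable(1)[OF Pc] C1c_measurable(1)[OF \<Phi>c]
  have lim: "(\<lambda>n. LINT x|M. m x * \<bar>\<Phi> n x\<bar> powr p) \<longlonglongrightarrow> (LINT x|M. m x * P x)"
  proof (rule integral_dominated_convergence)
    show "integrable M (\<lambda>x. \<bar>m x\<bar> * (B + 1))" using m by simp
    show "AE x in M. (\<lambda>n. m x * \<bar>\<Phi> n x\<bar> powr p) \<longlonglongrightarrow> m x * P x"
    proof (rule AE_I2)
      fix x
      have "(\<lambda>n. \<Phi> n x) \<longlonglongrightarrow> (P x + 0) powr (1 / p) - 0 powr (1 / p)"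
        unfolding \<Phi>_def
        by (intro tendsto_diff tendsto_powr2 tendsto_add tendsto_const dl) (use P0 d p_gt_1 in \<open>auto intro!: always_eventually add_nonneg_nonneg less_imp_le[OF d(1)]\<close>)
      then have "(\<lambda>n. \<bar>\<Phi> n x\<bar> powr p) \<longlonglongrightarrow> \<bar>(P x + 0) powr (1 / p) - 0 powr (1 / p)\<bar> powr p"
        using p_gt_1 by (intro tendsto_powr2[OF tendsto_rabs tendsto_const]) auto
      then have "(\<lambda>n. \<bar>\<Phi> n x\<bar> powr p) \<longlonglongrightarrow> P x"
        using p_gt_1 P0[of x] by (simp add: powr_powr)
      then show "(\<lambda>n. m x * \<bar>\<Phi> n x\<bar> powr p) \<longlonglongrightarrow> m x * P x" by (rule tendsto_mult[OF tendsto_const])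
    qed
    show "AE x in M. norm (m x * \<bar>\<Phi> n x\<bar> powr p) \<le> \<bar>m x\<bar> * (B + 1)" for n
    proof (rule AE_I2)
      fix x
      have "0 \<le> \<Phi> n x" "\<Phi> n x \<le> (P x + d n) powr (1 / p)"
        unfolding \<Phi>_def using P0[of x] d(1)[of n] p_gt_1 powr_mono2[of "1 / p" "d n" "P x + d n"] by auto
      then have "\<bar>\<Phi> n x\<bar> powr p \<le> ((P x + d n) powr (1 / p)) powr p" using p_gt_1 by (intro powr_mono2) auto
      also have "\<dots> = P x + d n" using p_gt_1 P0[of x] d(1)[of n] by (simp add: powr_powr)
      also have "\<dots> \<le> B + 1" using B(2)[of x] d(2)[of n] by linarith
      finally show "norm (m x * \<bar>\<Phi> n x\<bar> powr p) \<le> \<bar>m x\<bar> * (B + 1)" by (simp add: abs_mult mult_left_mono)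
    qed
  qed measurable
  have "lam * (LINT x|M. m x * P x) \<le> GQ"
    by (rule LIMSEQ_le_const2[OF tendsto_mult[OF tendsto_const lim]]) (use step in auto)
  moreover have "(LINT x|M. m x * P x) = mass m \<phi> + \<tau> * mass m \<psi>"
  proof -
    have mi: "integrable M (\<lambda>x. m x * \<bar>\<zeta> x\<bar> powr p)" if \<zeta>: "\<zeta> \<in> C1c \<Omega>" for \<zeta>
    proof -
      note [measurable] = C1c_measurable(1)[OF \<zeta>]
      obtain b where "b > 0" "\<And>x. \<bar>\<zeta> x\<bar> powr p \<le> b" using C1c_abs_powr_bounded[OF \<zeta>] by blast
      then show ?thesis by (intro integrable_weight_mult[OF m, of _ b]) auto
    qed
    have "(LINT x|M. m x * P x) = (LINT x|M. m x * \<bar>\<phi> x\<bar> powr p + \<tau> * (m x * \<bar>\<psi> x\<bar> powr p))"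
      by (simp add: P_def algebra_simps)
    then show ?thesis using mi[OF \<phi>] mi[OF \<psi>(1)] by simp
  qed
  ultimately have "c * \<tau> * (LINT x|M. I x) \<le> (energy \<phi> - lam * mass m \<phi>)
      + \<tau> * (energy \<psi> - lam * mass m \<psi>)"
    unfolding GQ_def by (simp add: algebra_simps)
  also have "\<dots> \<le> \<tau> + \<tau> * (energy \<psi> - lam * mass m \<psi>)"
    using near by simp
  also have "\<dots> = \<tau> * (1 + (energy \<psi> - lam * mass m \<psi>))"
    by (simp add: distrib_left)
  finally have "\<tau> * (c * (LINT x|M. I x)) \<le> \<tau> * (1 + (energy \<psi> - lam * mass m \<psi>))"
    by (simp only: mult_ac)
  then have "c * (LINT x|M. I x) \<le> 1 + (energy \<psi> - lam * mass m \<psi>)"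
    using \<tau> by simp
  then show "(LINT x|M. indicator ?B x * (norm (gradient \<phi> x) powr p / (\<bar>\<phi> x\<bar> powr p + \<tau>)))
      \<le> (1 + (energy \<psi> - lam * mass m \<psi>)) / min 1 (p - 1)"
    using c unfolding I_def[symmetric] c_def[symmetric] by (simp add: pos_le_divide_eq mult.commute)
qed

end

section \<open>Nonexistence of nonnegative solutions\<close>

context resonance_problem begin

lemma constant_sequence_solutions:
  assumes "is_solution \<Omega> p q m a f lam \<eta> u" "AE x in M. u x \<ge> 0" "\<eta> \<ge> 0"
  shows "nonneg_solutions (\<lambda>_. \<eta>) (\<lambda>_. u)"
  using assms unfolding nonneg_solutions_def by (auto intro: order_trans[of _ 0])

text \<open>
  As \<open>\<epsilon>\<^sub>n \<le> 1\<close>, the source term is bounded below by its value at \<open>\<epsilon> = 1\<close>.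
\<close>

lemma Picone_with_source:
  assumes sol: "is_solution \<Omega> p q m a f lam \<eta> u" "AE x in M. u x \<ge> 0" "\<eta> \<ge> 0" and \<phi>: "\<phi> \<in> C1c \<Omega>"
  shows "lam * mass m \<phi> + (LINT x|M. f x * ((\<bar>u x\<bar> + 1) powr (1 - p) * \<bar>\<phi> x\<bar> powr p))
     \<le> energy \<phi>"
proof (rule Picone_limit[OF constant_sequence_solutions[OF sol] \<phi>])
  fix n
  note um = log_ratio_measurable(1)[OF constant_sequence_solutions[OF sol]]
  show "(LINT x|M. f x * ((\<bar>u x\<bar> + 1) powr (1 - p) * \<bar>\<phi> x\<bar> powr p)) \<le> (LINT x|M. f x * ((\<bar>u x\<bar> + eps n) powr (1 - p) * \<bar>\<phi> x\<bar> powr p))"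
  proof (rule integral_mono_AE[OF integrable_f_term[OF \<phi> um] integrable_f_term[OF \<phi> um eps(1)]])
    show "AE x in M. f x * ((\<bar>u x\<bar> + 1) powr (1 - p) * \<bar>\<phi> x\<bar> powr p) \<le> f x * ((\<bar>u x\<bar> + eps n) powr (1 - p) * \<bar>\<phi> x\<bar> powr p)"
      using f_nonneg
    proof eventually_elim
      case (elim x)
      have "(\<bar>u x\<bar> + 1) powr (1 - p) \<le> (\<bar>u x\<bar> + eps n) powr (1 - p)"
        using eps(1)[of n] eps(2)[of n] p_gt_1 by (intro powr_mono2') auto
      then show ?case using elim by (intro mult_left_mono mult_right_mono) auto
    qed
  qed simp
qed

text \<open>
  \<open>Picone_with_source\<close> gives \<open>\<integral> f (u + 1)\<^sup>1\<^sup>-\<^sup>p |\<phi>\<^sub>k|\<^sup>p \<le> \<epsilon>\<^sub>k\<close>, so \<open>\<phi>\<^sub>k\<close> is small on part of a ball.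
  The functions \<open>- (1/p) ln (|\<phi>\<^sub>k|\<^sup>p + \<epsilon>\<^sub>k)\<close> are large where \<open>\<phi>\<^sub>k\<close> is small and have bounded
  oscillation by \<open>near_minimizer_log_estimate\<close> with \<open>\<tau> = \<epsilon>\<^sub>k\<close>, so \<open>mass_spreads\<close> applies.
\<close>

theorem minimizing_sequence_vanishes:
  assumes sol: "is_solution \<Omega> p q m a f lam \<eta> u" "AE x in M. u x \<ge> 0" "\<eta> \<ge> 0"
    and \<phi>: "\<And>k. \<phi> k \<in> C1c \<Omega>"
    and near: "\<And>k. energy (\<phi> k) - lam * mass m (\<phi> k) \<le> eps k"
    and K: "compact K" "K \<subseteq> \<Omega>" and t: "t > 0"
  shows "(\<lambda>k. measure M {x\<in>K. \<bar>\<phi> k x\<bar> powr p > t}) \<longlonglongrightarrow> 0"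
proof -
  note um[measurable] = log_ratio_measurable(1)[OF constant_sequence_solutions[OF sol]]
  note C = C1c_imp_C1[OF \<phi>]
  note [measurable] = continuous_measurable_M[OF C1_continuous[OF C]] borel_measurable_integrable[OF weights(3)]
  define V where "V \<xi> = (LINT x|M. f x * ((\<bar>u x\<bar> + 1) powr (1 - p) * \<bar>\<xi> x\<bar> powr p))" for \<xi>
  have V0: "V \<xi> \<ge> 0" for \<xi> unfolding V_def using f_nonneg by (intro integral_nonneg_AE) (auto elim!: eventually_mono)
  have Q0: "lam * mass m \<xi> \<le> energy \<xi>" if "\<xi> \<in> C1c \<Omega>" for \<xi>
    using Picone_with_source[OF sol that] V0[of \<xi>] unfolding V_def by linarith
  have Vk: "V (\<phi> k) \<le> eps k" for k
    using Picone_with_source[OF sol \<phi>[of k]] near[of k] unfolding V_def by linarith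
  define w where "w k x = - (1 / p) * ln (\<bar>\<phi> k x\<bar> powr p + eps k)" for k x
  have wm: "w k \<in> borel_measurable M" for k unfolding w_def by measurable
  have wC: "C1 (w k)" "norm (gradient (w k) x) \<le> 1 + norm (gradient (\<phi> k) x) powr p / (\<bar>\<phi> k x\<bar> powr p + eps k)" for k x
  proof -
    define P where "P x = \<bar>\<phi> k x\<bar> powr p" for x
    have Pc: "P \<in> C1c \<Omega>" and gP: "gradient P = (\<lambda>x. (p * (\<bar>\<phi> k x\<bar> powr (p - 1) * sgn (\<phi> k x))) *\<^sub>R gradient (\<phi> k) x)"
      unfolding P_def[abs_def] using abs_powr_C1c[OF \<phi>[of k] p_gt_1] by auto
    have pos: "P x + eps k > 0" for x using eps(1)[of k] by (simp add: P_def add_nonneg_pos)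
    have der: "((\<lambda>t. - (1 / p) * ln (t + eps k)) has_real_derivative (- (1 / p) * (1 / (P x + eps k)))) (at (P x))" for x
      using pos[of x] p_gt_1 by (auto intro!: derivative_eq_intros)
    have cont: "continuous_on (range P) (\<lambda>t. - (1 / p) * (1 / (t + eps k)))"
      by (intro continuous_intros) (use pos in \<open>force simp: less_le\<close>)
    have wP: "w k = (\<lambda>x. - (1 / p) * ln (P x + eps k))" by (simp add: w_def P_def fun_eq_iff)
    show "C1 (w k)" unfolding wP by (rule C1_compose(1)[OF C1c_imp_C1[OF Pc] der cont])
    have gw: "gradient (w k) x = (- (1 / p) * (1 / (P x + eps k))) *\<^sub>R gradient P x"
      unfolding wP by (subst C1_compose(2)[OF C1c_imp_C1[OF Pc] der cont]) simp
    define A where "A = norm (gradient (\<phi> k) x)"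
    have "norm (gradient (w k) x) = (1 / p * (1 / (P x + eps k))) * (p * (\<bar>\<phi> k x\<bar> powr (p - 1) * \<bar>sgn (\<phi> k x)\<bar>) * A)"
      unfolding gw gP using p_gt_1 pos[of x] by (simp add: abs_mult A_def)
    also have "\<dots> = \<bar>\<phi> k x\<bar> powr (p - 1) * A * \<bar>sgn (\<phi> k x)\<bar> / (P x + eps k)" using p_gt_1 by simp
    also have "\<dots> \<le> \<bar>\<phi> k x\<bar> powr (p - 1) * A * 1 / (P x + eps k)"
      using pos[of x] by (intro divide_right_mono mult_left_mono) (auto simp: A_def sgn_real_def)
    also have "\<dots> \<le> ((P x + eps k) + A powr p) / (P x + eps k)"
    proof (rule divide_right_mono)
      have "p * (\<bar>\<phi> k x\<bar> powr (p - 1) * A) \<le> (p - 1) * P x + A powr p"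
        using Young_powr[of "\<bar>\<phi> k x\<bar>" A p 1] p_gt_1 by (simp add: A_def P_def)
      also have "\<dots> \<le> p * P x + p * A powr p"
        using p_gt_1 mult_right_mono[of 1 p "A powr p"] by (intro add_mono mult_right_mono) (auto simp: P_def)
      finally have "\<bar>\<phi> k x\<bar> powr (p - 1) * A \<le> P x + A powr p" using p_gt_1 by (simp add: distrib_left[symmetric])
      then show "\<bar>\<phi> k x\<bar> powr (p - 1) * A * 1 \<le> P x + eps k + A powr p" using eps(1)[of k] by simp
    qed (use pos[of x] in simp)
    also have "\<dots> = 1 + A powr p / (P x + eps k)" using pos[of x] by (simp add: add_divide_distrib)
    finally show "norm (gradient (w k) x) \<le> 1 + norm (gradient (\<phi> k) x) powr p / (\<bar>\<phi> k x\<bar> powr p + eps k)"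
      by (simp add: A_def P_def)
  qed
  have osc: "\<exists>D. \<forall>k. oscillation z r (w k) \<le> ennreal D" if zr: "r > 0" "cball z r \<subseteq> \<Omega>" for z r
  proof -
    obtain \<psi> where \<psi>c: "\<psi> \<in> C1c \<Omega>" and \<psi>: "\<And>x. x \<in> cball z r \<Longrightarrow> \<psi> x = 1"
      by (rule C1c_cutoff[OF zr(2)]) (rule that)
    have bO: "ball z r \<subseteq> \<Omega>" using zr ball_subset_cball by blast
    define D where "D = (1 + (energy \<psi> - lam * mass m \<psi>)) / min 1 (p - 1)"
    have "oscillation z r (w k) \<le> ennreal (Poincare_const r * (measure M (space M) + D))" for k
    proof -
      note est = near_minimizer_log_estimate[OF weights(1) Q0 bO \<psi>c _ \<phi> eps(1) near, of k]
      have "oscillation z r (w k) \<le> ennreal (Poincare_const r) * (\<integral>\<^sup>+x. indicator (ball z r) x * ennreal (norm (gradient (w k) x)) \<partial>M)"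
        by (rule oscillation_C1[OF wC(1) zr(1) bO])
      also have "\<dots> \<le> ennreal (Poincare_const r) * ennreal (measure M (space M) + D)"
      proof (intro mult_left_mono nn_integral_ball_le_LINT)
        show "integrable M (\<lambda>x. indicator (ball z r) x * (norm (gradient (\<phi> k) x) powr p / (\<bar>\<phi> k x\<bar> powr p + eps k)))"
          by (rule est(1)) (use \<psi> in auto)
        show "(LINT x|M. indicator (ball z r) x * (norm (gradient (\<phi> k) x) powr p / (\<bar>\<phi> k x\<bar> powr p + eps k))) \<le> D"
          unfolding D_def by (rule est(2)) (use \<psi> in auto)
        show "0 \<le> indicator (ball z r) x * (norm (gradient (\<phi> k) x) powr p / (\<bar>\<phi> k x\<bar> powr p + eps k))" for x
          using eps(1)[of k] by (simp add: add_nonneg_nonneg)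
        show "AE x in M. x \<in> ball z r \<longrightarrow> norm (gradient (w k) x) \<le> 1 + indicator (ball z r) x * (norm (gradient (\<phi> k) x) powr p / (\<bar>\<phi> k x\<bar> powr p + eps k))"
          using wC(2) by (intro AE_I2) auto
      qed simp
      also have "\<dots> = ennreal (Poincare_const r * (measure M (space M) + D))"
        using zr(1) by (simp add: ennreal_mult' Poincare_const_def)
      finally show ?thesis .
    qed
    then show ?thesis by blast
  qed
  \<comment> \<open>The weight of the source term vanishes exactly where \<open>f\<close> does.\<close>
  define h where "h x = f x * (\<bar>u x\<bar> + 1) powr (1 - p)" for x
  have hm[measurable]: "h \<in> borel_measurable M" unfolding h_def by measurable
  have h0: "AE x in M. h x \<ge> 0" using f_nonneg by eventually_elim (simp add: h_def)
  have hnz: "\<not> (AE x in M. h x = 0)"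
  proof
    assume "AE x in M. h x = 0"
    then have "AE x in M. f x = 0"
    proof eventually_elim
      case (elim x)
      have "\<bar>u x\<bar> + 1 \<noteq> 0" by linarith
      then show ?case using elim by (simp add: h_def)
    qed
    then show False using f_nonzero by simp
  qed
  obtain z r \<delta> where zr: "r > 0" "cball z r \<subseteq> \<Omega>" "\<delta> > 0" and pos: "measure M {x\<in>ball z r. h x \<ge> \<delta>} > 0"
    using positive_mass_ball[OF hm h0 hnz] by metis
  define A where "A = {x\<in>ball z r. h x \<ge> \<delta>}"
  define c where "c = measure M A / 2"
  have c: "c > 0" using pos by (simp add: c_def A_def)
  have bO: "ball z r \<subseteq> \<Omega>" using zr ball_subset_cball by blast
  have Bm[measurable]: "ball z r \<in> sets M" by (rule ball_sets_M[OF bO])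
  have Am[measurable]: "A \<in> sets M"
    unfolding A_def by (rule sets_M_Collect[OF Bm]) measurable
  have start: "\<forall>\<^sub>F k in sequentially. c \<le> measure M {x\<in>ball z r. w k x \<ge> T}" for T
  proof -
    \<comment> \<open>The threshold \<open>s\<^sub>k = \<surd>\<epsilon>\<^sub>k\<close> tends to \<open>0\<close>, and so does \<open>\<epsilon>\<^sub>k/s\<^sub>k\<close>, Chebyshev's bound for the set where it
      is exceeded.\<close>
    define s where "s k = sqrt (eps k)" for k
    have s: "s k > 0" "s k * s k = eps k" for k using eps(1)[of k] by (auto simp: s_def)
    have sl: "s \<longlonglongrightarrow> 0" using tendsto_real_sqrt[OF eps(3)] by (simp add: s_def[abs_def])
    have "(\<lambda>k. s k + eps k) \<longlonglongrightarrow> 0 + 0" by (intro tendsto_add sl eps(3))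
    then have e1: "\<forall>\<^sub>F k in sequentially. s k + eps k < exp (- p * T)" by (intro order_tendstoD) auto
    have "(\<lambda>k. s k / \<delta>) \<longlonglongrightarrow> 0 / \<delta>" by (intro tendsto_divide sl tendsto_const) (use zr in auto)
    then have e2: "\<forall>\<^sub>F k in sequentially. s k / \<delta> < c" using c by (intro order_tendstoD) auto
    from e1 e2 show ?thesis
    proof eventually_elim
      case (elim k)
      define Z where "Z = {x\<in>A. \<bar>\<phi> k x\<bar> powr p \<ge> s k}"
      define Y where "Y = {x\<in>A. \<bar>\<phi> k x\<bar> powr p < s k}"
      have Zm: "Z \<in> sets M" and Ym: "Y \<in> sets M"
        unfolding Z_def Y_def by (rule sets_M_Collect[OF Am]; measurable)+
      have "(\<delta> * s k) * measure M Z = (LINT x|M. (\<delta> * s k) * indicator Z x)"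
        using Zm sets.sets_into_space[OF Zm] by (simp add: Int_absorb2)
      also have "\<dots> \<le> V (\<phi> k)" unfolding V_def
      proof (rule integral_mono_AE[OF _ integrable_f_term[OF \<phi> um]])
        show "integrable M (\<lambda>x. (\<delta> * s k) * indicator Z x :: real)"
          by (intro integrable_mult_right integrable_real_indicator Zm) (simp add: less_top[symmetric])
        show "AE x in M. \<delta> * s k * indicator Z x \<le> f x * ((\<bar>u x\<bar> + 1) powr (1 - p) * \<bar>\<phi> k x\<bar> powr p)"
          using f_nonneg
        proof eventually_elim
          case (elim x)
          show ?case
          proof (cases "x \<in> Z")
            case True
            then have "\<delta> * s k \<le> h x * \<bar>\<phi> k x\<bar> powr p"
              using zr(3) s(1)[of k] by (intro mult_mono) (auto simp: Z_def A_def)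
            then show ?thesis using True by (simp add: h_def mult.assoc)
          qed (use elim in simp)
        qed
      qed simp
      also have "\<dots> \<le> s k * s k" using Vk[of k] s(2)[of k] by simp
      finally have "s k * (\<delta> * measure M Z) \<le> s k * s k" by (simp only: mult_ac)
      then have "\<delta> * measure M Z \<le> s k" using s(1)[of k] by simp
      then have "measure M Z \<le> s k / \<delta>" using zr(3) by (simp add: field_simps)
      then have "measure M Z \<le> c" using elim(2) by linarith
      moreover have "measure M A \<le> measure M Z + measure M Y"
      proof -
        have "measure M A \<le> measure M (Z \<union> Y)"
          by (intro finite_measure_mono sets.Un Zm Ym) (auto simp: Z_def Y_def)
        also have "\<dots> \<le> measure M Z + measure M Y" by (rule measure_Un_le[OF Zm Ym])
        finally show ?thesis .
      qed
      ultimately have cY: "c \<le> measure M Y" unfolding c_def by linarith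
      have sub: "Y \<subseteq> {x\<in>ball z r. w k x \<ge> T}"
      proof
        fix x assume x: "x \<in> Y"
        have pos: "\<bar>\<phi> k x\<bar> powr p + eps k > 0" using eps(1)[of k] by (simp add: add_nonneg_pos)
        have "\<bar>\<phi> k x\<bar> powr p + eps k \<le> exp (- p * T)" using x elim(1) by (simp add: Y_def)
        then have "ln (\<bar>\<phi> k x\<bar> powr p + eps k) \<le> - p * T" using pos by (metis exp_gt_zero ln_exp ln_mono)
        then have "w k x \<ge> T" unfolding w_def using p_gt_1 by (simp add: field_simps)
        then show "x \<in> {x\<in>ball z r. w k x \<ge> T}" using x by (auto simp: Y_def A_def)
      qed
      have "{x\<in>ball z r. w k x \<ge> T} \<in> sets M"
        by (rule sets_M_Collect[OF Bm]) (use wm in measurable)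
      then show ?case using cY finite_measure_mono[OF sub] by linarith
    qed
  qed
  define T where "T = - (1 / p) * ln t"
  have spread: "(\<lambda>k. measure M {x\<in>K. w k x \<le> T}) \<longlonglongrightarrow> 0"
    by (rule mass_spreads[OF connected_domain wm osc zr(2,1) c start K])
  have sub: "{x\<in>K. \<bar>\<phi> k x\<bar> powr p > t} \<subseteq> {x\<in>K. w k x \<le> T}" for k
  proof
    fix x assume x: "x \<in> {x\<in>K. \<bar>\<phi> k x\<bar> powr p > t}"
    then have "ln t \<le> ln (\<bar>\<phi> k x\<bar> powr p + eps k)" using t eps(1)[of k] by (intro ln_mono) auto
    then have "w k x \<le> T" unfolding w_def T_def using p_gt_1 by (simp add: divide_right_mono)
    then show "x \<in> {x\<in>K. w k x \<le> T}" using x by simp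
  qed
  have KM[measurable]: "K \<in> sets M" using K by (intro compact_sets_M)
  have "{x\<in>K. w k x \<le> T} \<in> sets M" for k
    by (rule sets_M_Collect[OF KM]) (use wm in measurable)
  from finite_measure_mono[OF sub this] show ?thesis
    by (intro tendsto_sandwich[OF _ _ tendsto_const spread]) auto
qed

text \<open>
  Along a minimizing sequence of mass \<open>1\<close> the sets \<open>E\<^sub>k\<close> where \<open>|\<phi>\<^sub>k|\<^sup>p > t\<close> shrink to measure \<open>0\<close>.  On
  \<open>E\<^sub>k\<close> the mass is controlled by the energy times the norm of \<open>m\<close> on \<open>E\<^sub>k\<close>, which tends to \<open>0\<close>; off
  \<open>E\<^sub>k\<close> it is at most \<open>t \<integral> |m| < 1/2\<close>.
\<close>

theorem no_nonneg_solution_at_lambda1: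
  assumes sol: "is_solution \<Omega> p q m a f lam \<eta> u" "AE x in M. u x \<ge> 0" "\<eta> \<ge> 0"
    and lam: "lam = lambda1 \<Omega> p m" and m_pos: "\<not> (AE x in M. max (m x) 0 = 0)"
    and \<gamma>: "\<gamma> \<ge> 1" "\<gamma> > DIM('a) / p" and mL: "m \<in> Lp \<Omega> \<gamma>"
  shows False
proof -
  note mm[measurable] = borel_measurable_integrable[OF weights(1)]
  have "\<exists>\<phi>. \<phi> \<in> C1c \<Omega> \<and> mass m \<phi> = 1 \<and> energy \<phi> < lam + eps k" for k
    unfolding lam by (rule lambda1_approximation[OF weights(1) m_pos eps(1)[of k]]) blast
  then obtain \<phi> where \<phi>: "\<And>k. \<phi> k \<in> C1c \<Omega>" "\<And>k. mass m (\<phi> k) = 1"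
    "\<And>k. energy (\<phi> k) < lam + eps k" by metis
  note [measurable] = C1c_measurable(1)[OF \<phi>(1)]
  have near: "energy (\<phi> k) - lam * mass m (\<phi> k) \<le> eps k" for k
    using \<phi>(3)[of k] by (simp add: \<phi>(2))
  define Mm where "Mm = (LINT x|M. \<bar>m x\<bar>)"
  have Mm: "Mm \<ge> 0" by (simp add: Mm_def)
  \<comment> \<open>Off \<open>E\<^sub>k\<close> the mass is then below \<open>1/2\<close>.\<close>
  define t where "t = 1 / (2 * (Mm + 1))"
  have t: "t > 0" "t * Mm < 1 / 2" using Mm by (auto simp: t_def field_simps)
  define E where "E k = {x\<in>\<Omega>. \<bar>\<phi> k x\<bar> powr p > t}" for k
  have Em[measurable]: "E k \<in> sets M" for k
  proof -
    have "E k = {x\<in>space M. \<bar>\<phi> k x\<bar> powr p > t}" by (simp add: E_def)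
    also have "\<dots> \<in> sets M" by measurable
    finally show ?thesis .
  qed
  have E0: "(\<lambda>k. measure M (E k)) \<longlonglongrightarrow> 0"
  proof (rule LIMSEQ_I)
    fix e :: real assume e: "e > 0"
    obtain K where K: "closed K" "K \<subseteq> \<Omega>" "emeasure lebesgue (\<Omega> - K) < ennreal (e / 2)"
      using sets_lebesgue_inner_closed[OF sets_domain, of "e / 2"] e by (metis half_gt_zero)
    have Kc: "compact K" using K bounded_domain by (meson bounded_subset compact_eq_bounded_closed)
    have KM: "K \<in> sets M" using K by (intro sets_M_subset) auto
    have OK: "\<Omega> - K \<in> sets M" using K by (intro sets_M_subset) auto
    have "emeasure M (\<Omega> - K) = emeasure lebesgue (\<Omega> - K)"
      by (rule emeasure_restrict_space) auto
    then have "ennreal (measure M (\<Omega> - K)) < ennreal (e / 2)"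
      using K(3) unfolding emeasure_eq_measure by (simp only:)
    then have mOK: "measure M (\<Omega> - K) < e / 2" by (simp add: ennreal_less_iff)
    have "\<forall>\<^sub>F k in sequentially. measure M {x\<in>K. \<bar>\<phi> k x\<bar> powr p > t} < e / 2"
      using e by (intro order_tendstoD[OF minimizing_sequence_vanishes[OF sol \<phi>(1) near Kc K(2) t(1)]]) auto
    then obtain N where N: "\<And>k. k \<ge> N \<Longrightarrow> measure M {x\<in>K. \<bar>\<phi> k x\<bar> powr p > t} < e / 2"
      by (auto simp: eventually_sequentially)
    show "\<exists>N. \<forall>k\<ge>N. norm (measure M (E k) - 0) < e"
    proof (intro exI allI impI)
      fix k assume k: "k \<ge> N"
      have eq: "{x\<in>K. \<bar>\<phi> k x\<bar> powr p > t} = K \<inter> E k" using K by (auto simp: E_def)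
      have "measure M (E k) \<le> measure M ((K \<inter> E k) \<union> (\<Omega> - K))"
        by (intro finite_measure_mono sets.Un sets.Int KM Em OK) (auto simp: E_def)
      also have "\<dots> \<le> measure M (K \<inter> E k) + measure M (\<Omega> - K)"
        by (intro measure_Un_le sets.Int KM Em OK)
      also have "\<dots> < e" using N[OF k] mOK unfolding eq by linarith
      finally show "norm (measure M (E k) - 0) < e" by simp
    qed
  qed
  show False
  proof (rule trace_inequality_M[OF \<gamma>])
    fix C :: real
    assume C: "C > 0"
      "\<And>\<phi> h \<kappa>. \<phi> \<in> C1c \<Omega> \<Longrightarrow> h \<in> borel_measurable M \<Longrightarrow> \<kappa> > 0 \<Longrightarrow> integrable M (\<lambda>x. \<bar>h x\<bar> powr \<gamma>) \<Longrightarrow>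
        (LINT x|M. \<bar>h x\<bar> powr \<gamma>) \<le> \<kappa> powr \<gamma> \<Longrightarrow>
        (LINT x|M. \<bar>h x\<bar> * \<bar>\<phi> x\<bar> powr p) \<le> C * \<kappa> * energy \<phi>"
    have mg: "integrable M (\<lambda>x. \<bar>m x\<bar> powr \<gamma>)" using LpD(2)[OF mL] by simp
    define S where "S k = (LINT x|M. indicator (E k) x * \<bar>m x\<bar> powr \<gamma>)" for k
    have S0: "S k \<ge> 0" for k unfolding S_def by (intro Bochner_Integration.integral_nonneg) auto
    have Sl: "S \<longlonglongrightarrow> 0"
      using integral_vanishing_sets[OF mg Em E0] by (simp add: S_def[abs_def])
    \<comment> \<open>The summand \<open>\<epsilon>\<^sub>k\<close> keeps \<open>\<kappa>\<^sub>k\<close> positive.\<close>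
    define \<kappa> where "\<kappa> k = (S k + eps k) powr (1 / \<gamma>)" for k
    have \<kappa>: "\<kappa> k > 0" "\<kappa> k powr \<gamma> = S k + eps k" for k
      using S0[of k] eps(1)[of k] \<gamma>(1) by (auto simp: \<kappa>_def powr_powr add_nonneg_pos)
    have "(\<lambda>k. (S k + eps k) powr (1 / \<gamma>)) \<longlonglongrightarrow> (0 + 0) powr (1 / \<gamma>)"
      by (intro tendsto_powr2 tendsto_add Sl eps(3) tendsto_const)
         (use S0 eps(1) \<gamma>(1) in \<open>auto intro!: always_eventually add_nonneg_nonneg less_imp_le[OF eps(1)]\<close>)
    then have \<kappa>l: "\<kappa> \<longlonglongrightarrow> 0" using \<gamma>(1) by (simp add: \<kappa>_def[abs_def])
    have bound: "1 \<le> C * \<kappa> k * (lam + 1) + t * Mm" for k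
    proof -
      obtain B where B: "B > 0" "\<And>x. \<bar>\<phi> k x\<bar> powr p \<le> B" using C1c_abs_powr_bounded[OF \<phi>(1)[of k]] by blast
      define h where "h x = m x * indicator (E k) x" for x
      have hm[measurable]: "h \<in> borel_measurable M" unfolding h_def by measurable
      have hp: "\<bar>h x\<bar> powr \<gamma> = indicator (E k) x * \<bar>m x\<bar> powr \<gamma>" for x
        using \<gamma>(1) by (auto simp: h_def indicator_def)
      have hi: "integrable M (\<lambda>x. \<bar>h x\<bar> powr \<gamma>)" unfolding hp
        by (rule Bochner_Integration.integrable_bound[OF mg]) (auto simp: indicator_def)
      have "(LINT x|M. \<bar>h x\<bar> powr \<gamma>) \<le> \<kappa> k powr \<gamma>"
        unfolding hp \<kappa>(2) S_def[symmetric] using eps(1)[of k] by simp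
      from C(2)[OF \<phi>(1) hm \<kappa>(1) hi this]
      have 1: "(LINT x|M. \<bar>h x\<bar> * \<bar>\<phi> k x\<bar> powr p) \<le> C * \<kappa> k * energy (\<phi> k)" .
      have "energy (\<phi> k) \<le> lam + 1" using \<phi>(3)[of k] eps(2)[of k] by linarith
      then have "C * \<kappa> k * energy (\<phi> k) \<le> C * \<kappa> k * (lam + 1)"
        using C(1) \<kappa>(1)[of k] by (intro mult_left_mono) auto
      with 1 have 2: "(LINT x|M. \<bar>h x\<bar> * \<bar>\<phi> k x\<bar> powr p) \<le> C * \<kappa> k * (lam + 1)" by linarith
      have hi': "integrable M h" unfolding h_def by (rule integrable_weight_mult[OF weights(1), of _ 1]) (auto simp: indicator_def)
      have i1: "integrable M (\<lambda>x. \<bar>h x\<bar> * \<bar>\<phi> k x\<bar> powr p)"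
        by (rule integrable_weight_mult[OF integrable_abs[OF hi'], of _ B]) (use B in auto)
      have i2: "integrable M (\<lambda>x. m x * \<bar>\<phi> k x\<bar> powr p)"
        by (rule integrable_weight_mult[OF weights(1), of _ B]) (use B in auto)
      have "1 = mass m (\<phi> k)" by (simp add: \<phi>(2))
      also have "\<dots> \<le> (LINT x|M. \<bar>h x\<bar> * \<bar>\<phi> k x\<bar> powr p + t * \<bar>m x\<bar>)"
      proof (rule integral_mono[OF i2])
        show "integrable M (\<lambda>x. \<bar>h x\<bar> * \<bar>\<phi> k x\<bar> powr p + t * \<bar>m x\<bar>)" using i1 weights(1) by simp
        fix x assume "x \<in> space M"
        show "m x * \<bar>\<phi> k x\<bar> powr p \<le> \<bar>h x\<bar> * \<bar>\<phi> k x\<bar> powr p + t * \<bar>m x\<bar>"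
        proof (cases "x \<in> E k")
          case True
          have "m x * \<bar>\<phi> k x\<bar> powr p \<le> \<bar>m x\<bar> * \<bar>\<phi> k x\<bar> powr p" by (intro mult_right_mono) auto
          moreover have "0 \<le> t * \<bar>m x\<bar>" using t(1) by simp
          moreover have "\<bar>h x\<bar> = \<bar>m x\<bar>" using True by (simp add: h_def)
          ultimately show ?thesis by simp
        next
          case False
          then have "\<bar>\<phi> k x\<bar> powr p \<le> t" using \<open>x \<in> space M\<close> by (auto simp: E_def)
          then have "\<bar>m x\<bar> * \<bar>\<phi> k x\<bar> powr p \<le> \<bar>m x\<bar> * t" by (intro mult_left_mono) auto
          moreover have "m x * \<bar>\<phi> k x\<bar> powr p \<le> \<bar>m x\<bar> * \<bar>\<phi> k x\<bar> powr p" by (intro mult_right_mono) auto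
          moreover have "0 \<le> \<bar>h x\<bar> * \<bar>\<phi> k x\<bar> powr p" by simp
          ultimately show ?thesis by (simp only: mult.commute[of t])
        qed
      qed
      also have "\<dots> = (LINT x|M. \<bar>h x\<bar> * \<bar>\<phi> k x\<bar> powr p) + t * Mm" using i1 weights(1) by (simp add: Mm_def)
      finally show ?thesis using 2 by linarith
    qed
    have "(\<lambda>k. C * \<kappa> k * (lam + 1) + t * Mm) \<longlonglongrightarrow> C * 0 * (lam + 1) + t * Mm"
      by (intro tendsto_intros \<kappa>l)
    then have "1 \<le> C * 0 * (lam + 1) + t * Mm"
      by (rule LIMSEQ_le_const) (use bound in auto)
    then show False using t(2) by simp
  qed
qed

theorem exists_negative_threshold:
  assumes lam: "lam > lambda1 \<Omega> p m" and m_pos: "\<not> (AE x in M. max (m x) 0 = 0)"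
  shows "\<exists>\<eta>hat<0. \<forall>\<eta>\<ge>\<eta>hat. \<not> (\<exists>u. is_solution \<Omega> p q m a f lam \<eta> u \<and> (AE x in M. u x \<ge> 0))"
proof (rule ccontr)
  assume "\<not> ?thesis"
  then have ex: "\<exists>\<eta>\<ge>\<eta>hat. \<exists>u. is_solution \<Omega> p q m a f lam \<eta> u \<and> (AE x in M. u x \<ge> 0)" if "\<eta>hat < 0" for \<eta>hat
    using that by blast
  have "\<exists>\<eta> u. \<eta> \<ge> - (eps n powr (p - q + 1)) \<and> is_solution \<Omega> p q m a f lam \<eta> u \<and> (AE x in M. u x \<ge> 0)" for n
    using ex[of "- (eps n powr (p - q + 1))"] eps(1)[of n] by auto
  then obtain \<eta> u where "\<And>n. \<eta> n \<ge> - (eps n powr (p - q + 1)) \<and> is_solution \<Omega> p q m a f lam (\<eta> n) (u n) \<and> (AE x in M. u n x \<ge> 0)"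
    by metis
  then have s: "nonneg_solutions \<eta> u" by (simp add: nonneg_solutions_def)
  have "lam - lambda1 \<Omega> p m > 0" using lam by simp
  then obtain \<phi> where \<phi>: "\<phi> \<in> C1c \<Omega>" "mass m \<phi> = 1"
    "energy \<phi> < lambda1 \<Omega> p m + (lam - lambda1 \<Omega> p m)"
    by (rule lambda1_approximation[OF weights(1) m_pos]) (rule that)
  have "lam * mass m \<phi> + 0 \<le> energy \<phi>"
  proof (rule Picone_limit[OF s \<phi>(1)])
    fix n
    show "0 \<le> (LINT x|M. f x * ((\<bar>u n x\<bar> + eps n) powr (1 - p) * \<bar>\<phi> x\<bar> powr p))"
      using f_nonneg by (intro integral_nonneg_AE) (auto elim!: eventually_mono)
  qed
  then show False using \<phi> by simp
qed

end

theorem proposition2p17: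
  fixes \<Omega> :: "'a::euclidean_space set" and p q \<gamma> :: real and m a f :: "'a \<Rightarrow> real"
  assumes domain: "open \<Omega>" "connected \<Omega>" "\<Omega> \<noteq> {}" "bounded \<Omega>"
    and exponents: "1 < q" "q < p"
    and gamma_large: "real DIM('a) \<ge> p \<Longrightarrow> \<gamma> > real DIM('a) / p"
    and gamma_one: "real DIM('a) < p \<Longrightarrow> \<gamma> = 1"
    and weights: "m \<in> Lp \<Omega> \<gamma>" "a \<in> Lp \<Omega> \<gamma>" "f \<in> Lp \<Omega> \<gamma>"
    and m_pos: "\<not> (AE x in lebesgue_on \<Omega>. max (m x) 0 = 0)"
    and a_nz: "\<not> (AE x in lebesgue_on \<Omega>. a x = 0)"
    and f_nz: "\<not> (AE x in lebesgue_on \<Omega>. f x = 0)"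
    and a_nonneg: "AE x in lebesgue_on \<Omega>. a x \<ge> 0"
    and f_nonneg: "AE x in lebesgue_on \<Omega>. f x \<ge> 0"
  shows "\<forall>lam\<ge>lambda1 \<Omega> p m. \<exists>\<eta>hat\<le>0.
           (\<forall>\<eta>\<ge>\<eta>hat. \<not> (\<exists>u. is_solution \<Omega> p q m a f lam \<eta> u \<and> (AE x in lebesgue_on \<Omega>. u x \<ge> 0))) \<and>
           (lam > lambda1 \<Omega> p m \<longrightarrow> \<eta>hat < 0)"
proof (intro allI impI)
  fix lam assume lam: "lam \<ge> lambda1 \<Omega> p m"
  have p: "p > 1" using exponents by simp
  have \<gamma>: "\<gamma> \<ge> 1 \<and> \<gamma> > real DIM('a) / p"
  proof (cases "real DIM('a) \<ge> p")
    case True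
    moreover have "real DIM('a) / p \<ge> 1" using True p by simp
    ultimately show ?thesis using gamma_large by linarith
  next
    case False
    then show ?thesis using gamma_one p by simp
  qed
  note mL = weights(1)
  interpret bounded_open_set \<Omega> p by unfold_locales (use domain p in auto)
  interpret resonance_problem \<Omega> p q lam m a f
    by unfold_locales
       (use domain exponents \<gamma> weights a_nonneg f_nonneg f_nz powr_integrable_imp_integrable in auto)
  show "\<exists>\<eta>hat\<le>0. (\<forall>\<eta>\<ge>\<eta>hat. \<not> (\<exists>u. is_solution \<Omega> p q m a f lam \<eta> u \<and> (AE x in lebesgue_on \<Omega>. u x \<ge> 0))) \<and>
           (lam > lambda1 \<Omega> p m \<longrightarrow> \<eta>hat < 0)"
  proof (cases "lam > lambda1 \<Omega> p m")
    case True
    then show ?thesis using exists_negative_threshold[OF True m_pos] by (auto intro: less_imp_le)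
  next
    case False
    then have "lam = lambda1 \<Omega> p m" using lam by simp
    then show ?thesis
      using no_nonneg_solution_at_lambda1[OF _ _ _ _ m_pos _ _ mL] \<gamma> by (intro exI[of _ 0]) auto
  qed
qed

end
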